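(* Let $\mathcal{A}$ be an algorithm for Subtour Partition Cover. For any instance $\mathcal{I}=(G,\mathcal{L},x,y)$ and subtour $B$ in $G$, if $\mathcal{A}$ is $(\alpha,\beta)$-light for $\mathcal{I}$ and $B$, then there exists a tour of $G$ of weight (w.r.t. $w_{\mathcal{I}}$) at most $5\alpha\,\mathrm{lb}_{\mathcal{I}}(\bar B)+\beta+w_{\mathcal{I}}(B)$. Moreover, for any $\varepsilon>0$, a tour of weight at most $9(1+\varepsilon)\alpha\,\mathrm{lb}_{\mathcal{I}}(\bar B)+\beta+w_{\mathcal{I}}(B)$ can be found in time polynomial in $n=|V|$, in $1/\varepsilon$, and in the running time of $\mathcal{A}$.
   Context: Edge sets are multisets. $\delta^+(S),\delta^-(S)$: edges leaving/entering $S$; $\delta(S)$ their union; $\delta^+_F(S)=\delta^+(S)\cap F$; $V(F)$: vertices incident to $F$. $F$ is Eulerian if in- and out-degrees in $F$ agree at each vertex; a subtour is an Eulerian $F$ with $(V(F),F)$ connected ($\emptyset$ allowed); a tour is a subtour with $V(F)=V$; subtours in an Eulerian $F$ are connected components of $(V(F),F)$; a collection of subtours is an Eulerian multiset. $T$ intersects $B$ if $V(T)\cap V(B)\ne\emptyset$. An instance $\mathcal{I}=(G,\mathcal{L},x,y)$: $G=(V,E)$ strongly connected digraph; $\mathcal{L}$ laminar family of subsets of $V$; $x\in\mathbb{R}^E$, $x_e>0$ all $e$, $x(\delta^+(v))=x(\delta^-(v))$ all $v$, $x(\delta(S))\ge2$ for $\emptyset\ne S\subsetneq V$; each $S\in\mathcal{L}$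 tight ($x(\delta^+(S))=x(\delta^-(S))=1$); $y:\mathcal{L}\to\mathbb{R}_{\ge0}$. $w_{\mathcal{I}}(e)=\sum_{S\in\mathcal{L}:e\in\delta(S)}y_S$. $y_v=y_{\{v\}}$ if $\{v\}\in\mathcal{L}$, else $0$; $\mathrm{lb}_{\mathcal{I}}(v)=2y_v$, $\mathrm{lb}(U)=\sum_{v\in U}\mathrm{lb}(v)$, $\mathrm{lb}(F)=\mathrm{lb}(V(F))$, $\mathrm{lb}_{\mathcal{I}}(\bar B)=\mathrm{lb}_{\mathcal{I}}(V\setminus V(B))$. Subtour Partition Cover: given $\mathcal{I}$, a subtour $B$, and a partition $(V_1,\dots,V_k)$ of $V\setminus V(B)$ with each $G[V_i]$ strongly connected, output a collection $F$ of subtours with $|\delta^+_F(V_i)|\ge1$ for all $i$. $\mathcal{A}$ is $(\alpha,\beta)$-light for $\mathcal{I}$ and $B$ if for every such partition its output $F$ satisfies $w_{\mathcal{I}}(T)\le\alpha\,\mathrm{lb}(T)$ for every subtour $T$ in $F$ with $V(T)\cap V(B)=\emptyset$, and $w_{\mathcal{I}}(F_B)\le\beta$ where $F_B$ is the collection of subtours in $F$ intersecting $B$.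
   Formalization: It is assumed that α ≥ 0 (the claim fails for negative α), and if G has parallel edges the running time is bounded by a polynomial in |V|+|E|, 1/ε and the running time of A; without parallel edges the bound is in n alone. *)

theory Defs
  imports Complex_Main "HOL-Library.Multiset" "HOL-Library.Disjoint_Sets"
    "Graph_Theory.Graph_Theory"
begin

section \<open>Cuts, subtours and tours\<close>

text \<open>
  Digraphs are those of the Graph-Theory library, so parallel edges and loops are possible.
  An edge set \<open>F\<close> of the digraph \<open>G\<close> is a multiset over \<^term>\<open>arcs G\<close>.
\<close>

definition cut_out :: "('v,'e) pre_digraph \<Rightarrow> 'v set \<Rightarrow> 'e set" where
  "cut_out G S = {e \<in> arcs G. tail G e \<in> S \<and> head G e \<notin> S}"

definition cut_in :: "('v,'e) pre_digraph \<Rightarrow> 'v set \<Rightarrow> 'e set" where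
  "cut_in G S = {e \<in> arcs G. tail G e \<notin> S \<and> head G e \<in> S}"

definition cut :: "('v,'e) pre_digraph \<Rightarrow> 'v set \<Rightarrow> 'e set" where
  "cut G S = cut_out G S \<union> cut_in G S"

definition mverts :: "('v,'e) pre_digraph \<Rightarrow> 'e multiset \<Rightarrow> 'v set" where
  "mverts G F = tail G ` set_mset F \<union> head G ` set_mset F"

definition eulerian :: "('v,'e) pre_digraph \<Rightarrow> 'e multiset \<Rightarrow> bool" where
  "eulerian G F \<longleftrightarrow> set_mset F \<subseteq> arcs G \<and>
     (\<forall>v \<in> verts G. size {#e \<in># F. head G e = v#} = size {#e \<in># F. tail G e = v#})"

text \<open>The graph \<open>(V(F), F)\<close>; multiplicities are irrelevant for its connectivity.\<close>

definition spanned :: "('v,'e) pre_digraph \<Rightarrow> 'e multiset \<Rightarrow> ('v,'e) pre_digraph" where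
  "spanned G F = \<lparr>verts = mverts G F, arcs = set_mset F, tail = tail G, head = head G\<rparr>"

text \<open>The library's \<open>connected\<close> demands a nonempty vertex set.\<close>

definition subtour :: "('v,'e) pre_digraph \<Rightarrow> 'e multiset \<Rightarrow> bool" where
  "subtour G F \<longleftrightarrow>
     eulerian G F \<and> (F = {#} \<or> Digraph_Component.connected (spanned G F))"

definition tour :: "('v,'e) pre_digraph \<Rightarrow> 'e multiset \<Rightarrow> bool" where
  "tour G F \<longleftrightarrow> subtour G F \<and> mverts G F = verts G"

text \<open>The subtours in \<open>F\<close>, i.e. the edge multisets of the connected components of \<open>(V(F), F)\<close>.\<close>

definition subtours_in :: "('v,'e) pre_digraph \<Rightarrow> 'e multiset \<Rightarrow> 'e multiset set" where
  "subtours_in G F =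
     {{#e \<in># F. u \<rightarrow>\<^sup>*\<^bsub>mk_symmetric (spanned G F)\<^esub> tail G e#} | u. u \<in> mverts G F}"

definition intersecting_part ::
    "('v,'e) pre_digraph \<Rightarrow> 'e multiset \<Rightarrow> 'e multiset \<Rightarrow> 'e multiset" where
  "intersecting_part G B F =
     (\<Sum>T \<in> {T \<in> subtours_in G F. mverts G T \<inter> mverts G B \<noteq> {}}. T)"

section \<open>Instances\<close>

record ('v,'e) inst =
  gr :: "('v,'e) pre_digraph"
  fam :: "'v set set"
  xval :: "'e \<Rightarrow> real"
  yval :: "'v set \<Rightarrow> real"

definition laminar :: "'v set set \<Rightarrow> bool" where
  "laminar L \<longleftrightarrow> (\<forall>S \<in> L. \<forall>S' \<in> L. S \<inter> S' = {} \<or> S \<subseteq> S' \<or> S' \<subseteq> S)"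

definition is_instance :: "('v,'e) inst \<Rightarrow> bool" where
  "is_instance I \<longleftrightarrow>
     fin_digraph (gr I) \<and> strongly_connected (gr I) \<and>
     laminar (fam I) \<and> (\<forall>S \<in> fam I. S \<subseteq> verts (gr I)) \<and>
     (\<forall>e \<in> arcs (gr I). xval I e > 0) \<and>
     (\<forall>v \<in> verts (gr I). sum (xval I) (cut_out (gr I) {v}) = sum (xval I) (cut_in (gr I) {v})) \<and>
     (\<forall>S. S \<noteq> {} \<and> S \<subset> verts (gr I) \<longrightarrow> sum (xval I) (cut (gr I) S) \<ge> 2) \<and>
     (\<forall>S \<in> fam I. sum (xval I) (cut_out (gr I) S) = 1 \<and> sum (xval I) (cut_in (gr I) S) = 1) \<and>
     (\<forall>S \<in> fam I. yval I S \<ge> 0)"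

definition weight_edge :: "('v,'e) inst \<Rightarrow> 'e \<Rightarrow> real" where
  "weight_edge I e = (\<Sum>S \<in> {S \<in> fam I. e \<in> cut (gr I) S}. yval I S)"

definition weight :: "('v,'e) inst \<Rightarrow> 'e multiset \<Rightarrow> real" where
  "weight I F = (\<Sum>e \<in># F. weight_edge I e)"

definition lb_vert :: "('v,'e) inst \<Rightarrow> 'v \<Rightarrow> real" where
  "lb_vert I v = 2 * (if {v} \<in> fam I then yval I {v} else 0)"

definition lb :: "('v,'e) inst \<Rightarrow> 'v set \<Rightarrow> real" where
  "lb I U = (\<Sum>v \<in> U. lb_vert I v)"

definition lb_compl :: "('v,'e) inst \<Rightarrow> 'e multiset \<Rightarrow> real" where
  "lb_compl I B = lb I (verts (gr I) - mverts (gr I) B)"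

section \<open>Subtour Partition Cover\<close>

definition valid_parts :: "('v,'e) inst \<Rightarrow> 'e multiset \<Rightarrow> 'v set list \<Rightarrow> bool" where
  "valid_parts I B Vs \<longleftrightarrow>
     distinct Vs \<and> partition_on (verts (gr I) - mverts (gr I) B) (set Vs) \<and>
     (\<forall>W \<in> set Vs. strongly_connected (gr I \<restriction> W))"

definition spc_solution :: "('v,'e) inst \<Rightarrow> 'v set list \<Rightarrow> 'e multiset \<Rightarrow> bool" where
  "spc_solution I Vs F \<longleftrightarrow>
     eulerian (gr I) F \<and>
     (\<forall>W \<in> set Vs. size {#e \<in># F. e \<in> cut_out (gr I) W#} \<ge> 1)"

text \<open>
  An algorithm maps an instance, a subtour \<open>B\<close> and a partition of \<open>V - V(B)\<close> to
  its output together with its running time.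
\<close>

type_synonym ('v,'e) alg =
  "('v,'e) inst \<Rightarrow> 'e multiset \<Rightarrow> 'v set list \<Rightarrow> 'e multiset \<times> nat"

text \<open>
  Correctness is stated for one pair \<open>(I, B)\<close>. No algorithm is correct for all pairs:
  for \<open>B = {#}\<close> the partition into the single part \<open>V\<close> has no solution.
\<close>

definition solves_spc :: "('v,'e) alg \<Rightarrow> ('v,'e) inst \<Rightarrow> 'e multiset \<Rightarrow> bool" where
  "solves_spc A I B \<longleftrightarrow> (\<forall>Vs. valid_parts I B Vs \<longrightarrow> spc_solution I Vs (fst (A I B Vs)))"

definition light ::
    "('v,'e) alg \<Rightarrow> real \<Rightarrow> real \<Rightarrow> ('v,'e) inst \<Rightarrow> 'e multiset \<Rightarrow> bool" where
  "light A \<alpha> \<beta> I B \<longleftrightarrow>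
     (\<forall>Vs. valid_parts I B Vs \<longrightarrow>
        (let F = fst (A I B Vs) in
           (\<forall>T \<in> subtours_in (gr I) F. mverts (gr I) T \<inter> mverts (gr I) B = {} \<longrightarrow>
              weight I T \<le> \<alpha> * lb I (mverts (gr I) T)) \<and>
           weight I (intersecting_part (gr I) B F) \<le> \<beta>))"

section \<open>A machine model with unit-cost real arithmetic\<close>

text \<open>
  Programs are systems of first-order recursive functions over binary trees. Vertices and
  edges are opaque atoms that can only be tested for equality; numbers are reals. Every
  evaluation step costs one time unit, so time is that of a real RAM up to polynomial
  factors. A program may query an oracle, and pays the running time of the oracle.
\<close>

datatype ('v,'e) data = Leaf | Vtx 'v | Edg 'e | Num real | Node "('v,'e) data" "('v,'e) data"

datatype op1 = Left | Right | IsNode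

datatype op2 = Pair | Same | Leq | Add | Sub | Mul | Div

datatype expr =
    Arg nat
  | EmptyTree
  | Literal int
  | Op1 op1 expr
  | Op2 op2 expr expr
  | Cond expr expr expr
  | LetIn expr expr
  | Call nat expr
  | Query expr

definition truth :: "bool \<Rightarrow> ('v,'e) data" where
  "truth b = (if b then Node Leaf Leaf else Leaf)"

fun apply1 :: "op1 \<Rightarrow> ('v,'e) data \<Rightarrow> ('v,'e) data" where
  "apply1 Left (Node a b) = a"
| "apply1 Right (Node a b) = b"
| "apply1 IsNode (Node a b) = truth True"
| "apply1 _ _ = Leaf"

text \<open>\<open>Same\<close> only compares atoms, since comparing whole trees is not a unit-cost operation.\<close>

fun apply2 :: "op2 \<Rightarrow> ('v,'e) data \<Rightarrow> ('v,'e) data \<Rightarrow> ('v,'e) data" where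
  "apply2 Pair a b = Node a b"
| "apply2 Same (Node a b) _ = truth False"
| "apply2 Same a b = truth (a = b)"
| "apply2 Leq (Num r) (Num s) = truth (r \<le> s)"
| "apply2 Add (Num r) (Num s) = Num (r + s)"
| "apply2 Sub (Num r) (Num s) = Num (r - s)"
| "apply2 Mul (Num r) (Num s) = Num (r * s)"
| "apply2 Div (Num r) (Num s) = Num (r / s)"
| "apply2 _ _ _ = Leaf"

text \<open>
  \<open>eval P orc \<sigma> e v t\<close>: in environment \<open>\<sigma>\<close>, expression \<open>e\<close> has value \<open>v\<close> and its evaluation
  takes time \<open>t\<close>. The list \<open>P\<close> holds the bodies of the functions; a body sees the argument
  of the call as \<open>Arg 0\<close>.
\<close>

inductive eval ::
    "expr list \<Rightarrow> (('v,'e) data \<Rightarrow> ('v,'e) data \<times> nat) \<Rightarrow>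
     ('v,'e) data list \<Rightarrow> expr \<Rightarrow> ('v,'e) data \<Rightarrow> nat \<Rightarrow> bool"
  for P :: "expr list" and orc :: "('v,'e) data \<Rightarrow> ('v,'e) data \<times> nat" where
  Arg: "i < length \<sigma> \<Longrightarrow> eval P orc \<sigma> (Arg i) (\<sigma> ! i) 1"
| EmptyTree: "eval P orc \<sigma> EmptyTree Leaf 1"
| Literal: "eval P orc \<sigma> (Literal z) (Num (of_int z)) 1"
| Op1: "eval P orc \<sigma> e v t \<Longrightarrow> eval P orc \<sigma> (Op1 f e) (apply1 f v) (t + 1)"
| Op2: "eval P orc \<sigma> e1 v1 t1 \<Longrightarrow> eval P orc \<sigma> e2 v2 t2 \<Longrightarrow>
    eval P orc \<sigma> (Op2 f e1 e2) (apply2 f v1 v2) (t1 + t2 + 1)"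
| CondT: "eval P orc \<sigma> c v t1 \<Longrightarrow> v \<noteq> Leaf \<Longrightarrow> eval P orc \<sigma> e1 w t2 \<Longrightarrow>
    eval P orc \<sigma> (Cond c e1 e2) w (t1 + t2 + 1)"
| CondF: "eval P orc \<sigma> c Leaf t1 \<Longrightarrow> eval P orc \<sigma> e2 w t2 \<Longrightarrow>
    eval P orc \<sigma> (Cond c e1 e2) w (t1 + t2 + 1)"
| LetIn: "eval P orc \<sigma> e1 v t1 \<Longrightarrow> eval P orc (v # \<sigma>) e2 w t2 \<Longrightarrow>
    eval P orc \<sigma> (LetIn e1 e2) w (t1 + t2 + 1)"
| Call: "eval P orc \<sigma> e v t1 \<Longrightarrow> f < length P \<Longrightarrow> eval P orc [v] (P ! f) w t2 \<Longrightarrow>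
    eval P orc \<sigma> (Call f e) w (t1 + t2 + 1)"
| Query: "eval P orc \<sigma> e v t \<Longrightarrow>
    eval P orc \<sigma> (Query e) (fst (orc v)) (t + snd (orc v) + 1)"

lemma eval_deterministic:
  "eval P orc \<sigma> e v t \<Longrightarrow> eval P orc \<sigma> e v' t' \<Longrightarrow> v' = v \<and> t' = t"
proof (induction arbitrary: v' t' rule: eval.induct)
  case (Arg i \<sigma>) from Arg.prems show ?case by cases auto
next
  case (EmptyTree \<sigma>) from EmptyTree.prems show ?case by cases auto
next
  case (Literal \<sigma> z) from Literal.prems show ?case by cases auto
next
  case (Op1 \<sigma> e v t f) from Op1.prems show ?case by cases (auto dest: Op1.IH)
next
  case (Op2 \<sigma> e1 v1 t1 e2 v2 t2 f)
  from Op2.prems show ?case by cases (auto dest: Op2.IH)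
next
  case (CondT \<sigma> c v t1 e1 w t2 e2)
  from CondT.prems show ?case using CondT.hyps(2) by cases (auto dest: CondT.IH)
next
  case (CondF \<sigma> c t1 e2 w t2 e1)
  from CondF.prems show ?case by cases (auto dest: CondF.IH)
next
  case (LetIn \<sigma> e1 v t1 e2 w t2)
  from LetIn.prems show ?case
  proof cases
    case (LetIn v2 s1 s2)
    with LetIn.IH(1) have "v2 = v" "s1 = t1" by blast+
    with LetIn LetIn.IH(2) show ?thesis by blast
  qed
next
  case (Call \<sigma> e v t1 f w t2)
  from Call.prems show ?case
  proof cases
    case (Call v2 s1 s2)
    with Call.IH(1) have "v2 = v" "s1 = t1" by blast+
    with Call Call.IH(2) show ?thesis by blast
  qed
next
  case (Query \<sigma> e v t) from Query.prems show ?case by cases (auto dest: Query.IH)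
qed

definition runs ::
    "expr list \<Rightarrow> (('v,'e) data \<Rightarrow> ('v,'e) data \<times> nat) \<Rightarrow>
     ('v,'e) data \<Rightarrow> ('v,'e) data \<Rightarrow> nat \<Rightarrow> bool" where
  "runs P orc inp out t \<longleftrightarrow> eval P orc [inp] (Call 0 (Arg 0)) out t"

section \<open>Encodings\<close>

text \<open>
  A set is represented by any list of its elements. A multiset of edges is represented by a
  list of its distinct elements with multiplicities, so its size is at most the number of edges
  of the graph.
\<close>

definition list_data :: "('v,'e) data list \<Rightarrow> ('v,'e) data" where
  "list_data ds = foldr Node ds Leaf"

definition enc_vset :: "('v,'e) data \<Rightarrow> 'v set \<Rightarrow> bool" where
  "enc_vset d S \<longleftrightarrow> (\<exists>us. distinct us \<and> set us = S \<and> d = list_data (map Vtx us))"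

definition enc_parts :: "('v,'e) data \<Rightarrow> 'v set list \<Rightarrow> bool" where
  "enc_parts d Vs \<longleftrightarrow> (\<exists>ds. list_all2 enc_vset ds Vs \<and> d = list_data ds)"

definition enc_edges :: "('v,'e) data \<Rightarrow> 'e multiset \<Rightarrow> bool" where
  "enc_edges d F \<longleftrightarrow> (\<exists>es. distinct es \<and> set es = set_mset F \<and>
     d = list_data (map (\<lambda>e. Node (Edg e) (Num (of_nat (count F e)))) es))"

definition enc_graph :: "('v,'e) data \<Rightarrow> ('v,'e) inst \<Rightarrow> bool" where
  "enc_graph d I \<longleftrightarrow> (\<exists>dV es. enc_vset dV (verts (gr I)) \<and> distinct es \<and> set es = arcs (gr I) \<and>
     d = Node dV (list_data (map (\<lambda>e.
           list_data [Edg e, Vtx (tail (gr I) e), Vtx (head (gr I) e), Num (xval I e)]) es)))"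

definition enc_fam :: "('v,'e) data \<Rightarrow> ('v,'e) inst \<Rightarrow> bool" where
  "enc_fam d I \<longleftrightarrow> (\<exists>Ss ds. distinct Ss \<and> set Ss = fam I \<and> list_all2 enc_vset ds Ss \<and>
     d = list_data (map2 (\<lambda>dS S. Node dS (Num (yval I S))) ds Ss))"

definition enc_input ::
    "('v,'e) data \<Rightarrow> ('v,'e) inst \<Rightarrow> 'e multiset \<Rightarrow> real \<Rightarrow> real \<Rightarrow> bool" where
  "enc_input d I B \<alpha> \<epsilon> \<longleftrightarrow> (\<exists>dG dL dB. enc_graph dG I \<and> enc_fam dL I \<and> enc_edges dB B \<and>
     d = list_data [dG, dL, dB, Num \<alpha>, Num \<epsilon>])"

text \<open>
  The oracle \<open>orc\<close> answers queries for partitions as \<open>A\<close> does on the fixed \<open>I\<close> and \<open>B\<close>, in the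
  running time of \<open>A\<close>; which of the encodings of the result it returns is left open.
\<close>

definition implements ::
    "(('v,'e) data \<Rightarrow> ('v,'e) data \<times> nat) \<Rightarrow> ('v,'e) alg \<Rightarrow>
     ('v,'e) inst \<Rightarrow> 'e multiset \<Rightarrow> bool" where
  "implements orc A I B \<longleftrightarrow>
     (\<forall>Vs q. valid_parts I B Vs \<and> enc_parts q Vs \<longrightarrow>
        enc_edges (fst (orc q)) (fst (A I B Vs)) \<and> snd (orc q) = snd (A I B Vs))"

definition time_bounded :: "('v,'e) alg \<Rightarrow> ('v,'e) inst \<Rightarrow> 'e multiset \<Rightarrow> nat \<Rightarrow> bool" where
  "time_bounded A I B \<tau> \<longleftrightarrow> (\<forall>Vs. valid_parts I B Vs \<longrightarrow> snd (A I B Vs) \<le> \<tau>)"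

end

theory Submission
  imports Defs
begin

text \<open>Partition \<open>V - V(B)\<close> into pieces \<open>H\<close>, each an Eulerian connected multiset that is cheap
  compared with the vertex costs of the piece; initially all pieces are single vertices. Starting
  from the partition \<open>E = B # H\<close>, query the algorithm for the parts of \<open>E\<close> other than \<open>B\<close> and
  merge the components of its answer into \<open>E\<close>. Among the merged pieces take the one with the
  smallest label (the largest cost of a piece of \<open>H\<close> inside), keep and seal it and undo the other
  merges. Repeating this ends with a single piece, a tour, and the labels pay for all connections
  unless one of two things happens. If the new components meeting a piece of \<open>H\<close>, and no piece of
  larger label, are too expensive, then \<open>H\<close> can be improved by joining them to that piece. If a
  cheap subtour that leaves a sealed piece appears, it is remembered and used to extend pieces
  before they are sealed. In both cases the construction restarts. For the existence statement \<open>H\<close>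
  is optimal with respect to a lexicographic potential; the algorithm uses the sum of squared
  labels, which grows by a fixed amount in each improvement once every vertex has a positive cost.

  The algorithm is a program in a language whose only loop is \<open>foldr\<close>, compiled to the machine
  model, inside one outer loop. Apart from the oracle it handles only costs of vertices, never
  weights of edges.\<close>

subsection \<open>Connectivity of edge multisets\<close>

text \<open>Every answer to a query may weigh \<alpha> times the total cost, so keeping all merges
  would charge each vertex once per round. The account used instead: a piece \<open>Y\<close> weighs
  at most \<alpha> times \<open>(h + K) * cX Y - K * pl Y\<close>, plus \<alpha> times
  \<open>f * cX Y\<close> once sealed. The \<open>f\<close> term pays for new components. They are
  charged to the touched pieces of \<open>H\<close> of largest label, and only while these are
  unsealed; as merges outside the kept piece are undone, a vertex pays in one round only. The term
  \<open>K * pl Y\<close> is a credit: a joined piece keeps the largest label alone, so the credits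
  of the others are set free. Hence the piece of smallest label can spend its whole credit on a
  remembered subtour, which is why that piece is chosen. The piece of \<open>B\<close> gets a label
  above all costs; it is chosen only when nothing else remains, so \<beta> is paid once.

  The lexicographic potential gives no polynomial bound on the number of improvements. Squares do,
  but then an improvement must not give up too many labels, which raises \<open>h\<close>,
  \<open>K\<close>, \<open>f\<close> from 2, 1, 2 to 3, 3, 3.\<close>

definition und :: "('v,'e) pre_digraph \<Rightarrow> 'e multiset \<Rightarrow> ('v \<times> 'v) set" where
  "und G M = (\<Union>e\<in>set_mset M. {(tail G e, head G e), (head G e, tail G e)})"

abbreviation linked :: "('v,'e) pre_digraph \<Rightarrow> 'e multiset \<Rightarrow> 'v \<Rightarrow> 'v \<Rightarrow> bool" where
  "linked G M u v \<equiv> (u, v) \<in> (und G M)\<^sup>*"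

text \<open>The vertex set is given separately from the edges, so that a single vertex without edges
  counts as connected.\<close>

definition lconn :: "('v,'e) pre_digraph \<Rightarrow> 'v set \<Rightarrow> 'e multiset \<Rightarrow> bool" where
  "lconn G X M \<longleftrightarrow> X \<noteq> {} \<and> mverts G M \<subseteq> X \<and> (\<forall>u\<in>X. \<forall>v\<in>X. linked G M u v)"

lemma linked_mono: "linked G M u v \<Longrightarrow> M \<subseteq># M' \<Longrightarrow> linked G M' u v"
  by (rule rtrancl_mono[THEN subsetD, rotated]) (auto simp: und_def dest: mset_subset_eqD)

lemma linked_sym: "linked G M u v \<Longrightarrow> linked G M v u"
proof -
  have "sym (und G M)" by (auto simp: sym_def und_def)
  then show "linked G M u v \<Longrightarrow> linked G M v u" by (metis sym_rtrancl symD)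
qed

lemma linked_trans: "linked G M u v \<Longrightarrow> linked G M v w \<Longrightarrow> linked G M u w"
  by (rule rtrancl_trans)

lemma linked_closed:
  assumes "linked G M u v" "u \<in> X"
    and "\<And>e. e \<in># M \<Longrightarrow> tail G e \<in> X \<longleftrightarrow> head G e \<in> X"
  shows "v \<in> X"
  using assms by (induction rule: rtrancl_induct) (auto simp: und_def)

lemma mverts_plus [simp]: "mverts G (A + B) = mverts G A \<union> mverts G B"
  by (auto simp: mverts_def)

lemma mverts_empty [simp]: "mverts G {#} = {}"
  by (simp add: mverts_def)

lemma mverts_sum_list: "mverts G (sum_list Ms) = (\<Union>M\<in>set Ms. mverts G M)"
  by (induction Ms) auto

text \<open>A walk from \<open>u\<close> to an end of some edge is either empty or begins with an
  edge at \<open>u\<close>; in both cases \<open>u\<close> is incident to \<open>M\<close>.\<close>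

lemma lconn_mverts:
  assumes "lconn G X M" "M \<noteq> {#}"
  shows "mverts G M = X"
proof
  show "mverts G M \<subseteq> X" using assms by (simp add: lconn_def)
  show "X \<subseteq> mverts G M"
  proof
    fix u assume u: "u \<in> X"
    obtain e where e: "e \<in># M" using assms(2) by blast
    then have "tail G e \<in> X" using assms(1) by (auto simp: lconn_def mverts_def)
    then have "linked G M u (tail G e)" using u assms(1) by (simp add: lconn_def)
    then show "u \<in> mverts G M"
    proof (cases rule: converse_rtranclE)
      case base then show ?thesis using e by (auto simp: mverts_def)
    next
      case (step y) then show ?thesis by (auto simp: und_def mverts_def)
    qed
  qed
qed

text \<open>The library's reachability lives on a fixed vertex set. Every pair in
  \<open>und G M\<close> ends in \<open>mverts G M\<close>, so only membership of the start vertex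
  has to be added to \<open>linked\<close>.\<close>

lemma reachable_spanned_iff:
  "u \<rightarrow>\<^sup>*\<^bsub>mk_symmetric (spanned G M)\<^esub> v \<longleftrightarrow> u \<in> mverts G M \<and> linked G M u v"
proof -
  have p: "parcs (mk_symmetric (spanned G M)) = und G M"
    by (simp add: parcs_mk_symmetric und_def spanned_def)
  have V: "verts (spanned G M) = mverts G M"
    by (simp add: spanned_def)
  have sub: "y \<in> mverts G M" if "(x, y) \<in> und G M" for x y
    using that by (auto simp: und_def mverts_def)
  show ?thesis
  proof
    assume "u \<rightarrow>\<^sup>*\<^bsub>mk_symmetric (spanned G M)\<^esub> v"
    then have *: "(u, v) \<in> rtrancl_on (mverts G M) (und G M)"
      by (simp add: reachable_def p V)
    then show "u \<in> mverts G M \<and> linked G M u v"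
      by (auto dest: in_rtrancl_on_in_F rtrancl_on_rtranclI)
  next
    assume "u \<in> mverts G M \<and> linked G M u v"
    then have u: "u \<in> mverts G M" and "linked G M u v" by auto
    from this(2) have "(u, v) \<in> rtrancl_on (mverts G M) (und G M)"
    proof (induction rule: rtrancl_induct)
      case base then show ?case using u by simp
    next
      case (step y z) then show ?case by (meson rtrancl_on_into_rtrancl_on sub)
    qed
    then show "u \<rightarrow>\<^sup>*\<^bsub>mk_symmetric (spanned G M)\<^esub> v"
      by (simp add: reachable_def p V)
  qed
qed

lemma connected_spanned_iff:
  "Digraph_Component.connected (spanned G M) \<longleftrightarrow> M \<noteq> {#} \<and> lconn G (mverts G M) M"
proof -
  have "verts (with_proj (mk_symmetric (spanned G M))) = mverts G M"
    by (simp add: spanned_def)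
  moreover have "mverts G M \<noteq> {} \<longleftrightarrow> M \<noteq> {#}" by (auto simp: mverts_def)
  ultimately show ?thesis
    by (auto simp: connected_def strongly_connected_def reachable_spanned_iff lconn_def)
qed

subsection \<open>Eulerian multisets\<close>

lemma eulerian_empty [simp]: "eulerian G {#}"
  by (simp add: eulerian_def)

lemma eulerian_plus: "eulerian G A \<Longrightarrow> eulerian G B \<Longrightarrow> eulerian G (A + B)"
  by (auto simp: eulerian_def)

lemma eulerian_sum_list: "(\<And>M. M \<in> set Ms \<Longrightarrow> eulerian G M) \<Longrightarrow> eulerian G (sum_list Ms)"
  by (induction Ms) (auto intro: eulerian_plus)

text \<open>Counting edges by their end in \<open>S\<close> turns the degree condition at single
  vertices into a balance for sets of vertices.\<close>

lemma size_filter_by_vertex: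
  assumes "finite S"
  shows "size {#e \<in># M. f e \<in> S#} = (\<Sum>v\<in>S. size {#e \<in># M. f e = v#})"
proof (induction M)
  case (add x M)
  have "(\<Sum>v\<in>S. size (filter_mset (\<lambda>e. f e = v) (add_mset x M)))
      = (\<Sum>v\<in>S. size (filter_mset (\<lambda>e. f e = v) M) + (if f x = v then 1 else 0))"
    by (rule sum.cong) auto
  also have "\<dots> = size {#e \<in># M. f e \<in> S#} + (if f x \<in> S then 1 else 0)"
    using assms add by (simp add: sum.distrib)
  finally show ?case by simp
qed simp

text \<open>If an edge entered \<open>S\<close> although none leaves it, the edges with tail in
  \<open>S\<close> would form a proper submultiset of those with head in \<open>S\<close>, while the
  degree condition summed over \<open>S\<close> makes both equally large.\<close>

lemma eulerian_closed_backwards: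
  assumes "fin_digraph G" and eu: "eulerian G M"
    and closed: "\<And>e. e \<in># M \<Longrightarrow> tail G e \<in> S \<Longrightarrow> head G e \<in> S"
    and e: "e \<in># M" "head G e \<in> S" and S: "S \<subseteq> verts G"
  shows "tail G e \<in> S"
proof (rule ccontr)
  interpret fin_digraph G by fact
  assume ne: "tail G e \<notin> S"
  have fS: "finite S" using S finite_verts finite_subset by blast
  have "{#e \<in># M. tail G e \<in> S#} \<subset># {#e \<in># M. head G e \<in> S#}"
  proof (rule subset_mset.le_neq_trans)
    show "{#e \<in># M. tail G e \<in> S#} \<subseteq># {#e \<in># M. head G e \<in> S#}"
      by (rule filter_mset_mono_strong) (use closed in auto)
    show "{#e \<in># M. tail G e \<in> S#} \<noteq> {#e \<in># M. head G e \<in> S#}"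
    proof
      assume "{#e \<in># M. tail G e \<in> S#} = {#e \<in># M. head G e \<in> S#}"
      then have "e \<in># {#e \<in># M. tail G e \<in> S#}" using e by (metis (mono_tags) set_mset_filter mem_Collect_eq)
      then show False using ne by simp
    qed
  qed
  then have "size {#e \<in># M. tail G e \<in> S#} < size {#e \<in># M. head G e \<in> S#}"
    by (rule mset_subset_size)
  moreover have "size {#e \<in># M. tail G e \<in> S#} = size {#e \<in># M. head G e \<in> S#}"
    using eu S unfolding size_filter_by_vertex[OF fS]
    by (intro sum.cong) (auto simp: eulerian_def)
  ultimately show False by simp
qed

text \<open>The vertices reachable along directed edges of \<open>M\<close> have no leaving edge, hence by the
  degree condition no entering edge.\<close>

lemma eulerian_linked_directed:
  assumes G: "fin_digraph G" and eu: "eulerian G M" and "linked G M u v"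
    and u: "u \<in> verts G"
  shows "(u, v) \<in> {(tail G e, head G e) |e. e \<in># M}\<^sup>*"
proof -
  interpret fin_digraph G by fact
  let ?R = "{(tail G e, head G e) |e. e \<in># M}"
  let ?S = "{x \<in> verts G. (u, x) \<in> ?R\<^sup>*}"
  have arcs: "e \<in> arcs G" if "e \<in># M" for e using eu that by (auto simp: eulerian_def)
  have closed: "head G e \<in> ?S" if e: "e \<in># M" "tail G e \<in> ?S" for e
  proof -
    have "(tail G e, head G e) \<in> ?R" using e by blast
    with e(2) have "(u, head G e) \<in> ?R\<^sup>*" by (auto intro: rtrancl_into_rtrancl)
    with arcs[OF e(1)] show ?thesis by simp
  qed
  have "v \<in> ?S"
  proof (rule linked_closed[OF assms(3)])
    show "u \<in> ?S" using u by simp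
    fix e assume e: "e \<in># M"
    show "tail G e \<in> ?S \<longleftrightarrow> head G e \<in> ?S"
      using closed[OF e] eulerian_closed_backwards[OF G eu closed e] by blast
  qed
  then show ?thesis by simp
qed

text \<open>This is what makes pieces legal parts of a query. The directed walk given by
  \<open>eulerian_linked_directed\<close> uses edges of \<open>M\<close> only, and all their ends
  lie in \<open>X\<close>.\<close>

lemma strongly_connected_induce:
  assumes G: "fin_digraph G" and eu: "eulerian G M" and l: "lconn G X M" and X: "X \<subseteq> verts G"
  shows "strongly_connected (G \<restriction> X)"
proof -
  let ?R = "{(tail G e, head G e) |e. e \<in># M}"
  have "u \<rightarrow>\<^sup>*\<^bsub>G \<restriction> X\<^esub> v" if uv: "u \<in> X" "v \<in> X" for u v
  proof -
    have "(u, v) \<in> ?R\<^sup>*" using uv l X by (intro eulerian_linked_directed[OF G eu]) (auto simp: lconn_def)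
    then have "(u, v) \<in> rtrancl_on X (arcs_ends (G \<restriction> X))"
    proof (induction rule: rtrancl_induct)
      case base then show ?case using uv by simp
    next
      case (step y z)
      then obtain e where e: "e \<in># M" "y = tail G e" "z = head G e" by auto
      moreover have "e \<in> arcs G" using e eu by (auto simp: eulerian_def)
      moreover have "y \<in> X" "z \<in> X" using l e by (auto simp: lconn_def mverts_def)
      ultimately have "(y, z) \<in> arcs_ends (G \<restriction> X)"
        by (auto simp: arcs_ends_def arc_to_ends_def induce_subgraph_def)
      then show ?case using step.IH \<open>z \<in> X\<close> by (meson rtrancl_on_into_rtrancl_on)
    qed
    then show ?thesis by (simp add: reachable_def)
  qed
  then show ?thesis using l by (auto simp: strongly_connected_def lconn_def)
qed

lemma tourI:
  assumes "eulerian G M" "lconn G (verts G) M" "M \<noteq> {#}"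
  shows "tour G M"
  using assms lconn_mverts[OF assms(2,3)]
  by (auto simp: tour_def subtour_def connected_spanned_iff)

lemma subtour_lconn:
  assumes "subtour G B" "B \<noteq> {#}"
  shows "lconn G (mverts G B) B"
  using assms by (auto simp: subtour_def connected_spanned_iff)

subsection \<open>Pieces\<close>

text \<open>Vertex set, edges, label, and whether the piece is sealed.\<close>

datatype ('v,'e) piece = Piece (pX: "'v set") (pM: "'e multiset") (pl: real) (ps: bool)

definition touch :: "('v,'e) piece \<Rightarrow> ('v,'e) piece \<Rightarrow> bool" where
  "touch p q \<longleftrightarrow> pX p \<inter> pX q \<noteq> {}"

definition crossP :: "('v,'e) piece \<Rightarrow> ('v,'e) piece \<Rightarrow> bool" where
  "crossP p q \<longleftrightarrow> touch p q \<and> \<not> pX p \<subseteq> pX q"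

text \<open>The piece \<open>p\<close> contributes only its edges. In a partition of a superset of
  \<open>pX p\<close> the touched pieces already cover \<open>pX p\<close>, and the label is
  inherited from them.\<close>

definition joined :: "('v,'e) piece \<Rightarrow> ('v,'e) piece list \<Rightarrow> ('v,'e) piece" where
  "joined p S = Piece (\<Union>q\<in>set S. pX q) (pM p + sum_list (map pM S)) (foldr max (map pl S) 0) False"

definition absorb :: "('v,'e) piece \<Rightarrow> ('v,'e) piece list \<Rightarrow> ('v,'e) piece list" where
  "absorb p D = joined p (filter (touch p) D) # filter (\<lambda>q. \<not> touch p q) D"

text \<open>Stated for positions of the list, so that together with nonemptiness it also excludes
  repetitions.\<close>

definition djl :: "('v,'e) piece list \<Rightarrow> bool" where
  "djl D \<longleftrightarrow> sorted_wrt (\<lambda>p q. pX p \<inter> pX q = {}) D"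

definition part :: "'v set \<Rightarrow> ('v,'e) piece list \<Rightarrow> bool" where
  "part V D \<longleftrightarrow> (\<Union>p\<in>set D. pX p) = V \<and> (\<forall>p\<in>set D. pX p \<noteq> {}) \<and> djl D"

lemma djl_Nil [simp]: "djl []" by (simp add: djl_def)
lemma djl_Cons [simp]: "djl (p # D) \<longleftrightarrow> (\<forall>q\<in>set D. pX p \<inter> pX q = {}) \<and> djl D"
  by (simp add: djl_def)
lemma djl_append: "djl (A @ D) \<longleftrightarrow> djl A \<and> djl D \<and> (\<forall>p\<in>set A. \<forall>q\<in>set D. pX p \<inter> pX q = {})"
  by (auto simp: djl_def sorted_wrt_append)
lemma djl_filter: "djl D \<Longrightarrow> djl (filter P D)"
  by (simp add: djl_def sorted_wrt_filter)

lemma djl_unique: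
  assumes "djl D" "p \<in> set D" "q \<in> set D" "v \<in> pX p" "v \<in> pX q"
  shows "p = q"
  using assms by (induction D) auto

lemma part_unique:
  "part V D \<Longrightarrow> p \<in> set D \<Longrightarrow> q \<in> set D \<Longrightarrow> v \<in> pX p \<Longrightarrow> v \<in> pX q \<Longrightarrow> p = q"
  by (auto simp: part_def intro: djl_unique)

lemma part_cover: "part V D \<Longrightarrow> v \<in> V \<Longrightarrow> \<exists>p\<in>set D. v \<in> pX p"
  by (auto simp: part_def)

lemma part_subset: "part V D \<Longrightarrow> p \<in> set D \<Longrightarrow> pX p \<subseteq> V"
  by (auto simp: part_def)

lemma part_nonempty: "part V D \<Longrightarrow> p \<in> set D \<Longrightarrow> pX p \<noteq> {}"
  by (auto simp: part_def)

lemma part_distinct: "part V D \<Longrightarrow> distinct D"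
proof -
  have "djl D \<Longrightarrow> \<forall>p\<in>set D. pX p \<noteq> {} \<Longrightarrow> distinct D" by (induction D) auto
  then show "part V D \<Longrightarrow> distinct D" by (simp add: part_def)
qed

lemma part_length:
  assumes "part V D" "finite V"
  shows "length D \<le> card V"
proof -
  have "length D = card (set D)" using part_distinct[OF assms(1)] by (simp add: distinct_card)
  also have "\<dots> \<le> card V"
  proof (rule card_inj_on_le[where f = "\<lambda>p. SOME v. v \<in> pX p"])
    have *: "(SOME v. v \<in> pX p) \<in> pX p" if "p \<in> set D" for p
      using part_nonempty[OF assms(1) that] by (simp add: some_in_eq)
    show "inj_on (\<lambda>p. SOME v. v \<in> pX p) (set D)"
    proof (rule inj_onI)
      fix p q assume pq: "p \<in> set D" "q \<in> set D" "(SOME v. v \<in> pX p) = (SOME v. v \<in> pX q)"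
      show "p = q" using part_unique[OF assms(1) pq(1,2) *[OF pq(1)]] *[OF pq(2)] pq(3) by simp
    qed
    show "(\<lambda>p. SOME v. v \<in> pX p) ` set D \<subseteq> V" using * part_subset[OF assms(1)] by blast
    show "finite V" by fact
  qed
  finally show ?thesis .
qed

lemma sum_djl:
  assumes "djl S" "\<And>p. p \<in> set S \<Longrightarrow> finite (pX p)"
  shows "sum c (\<Union>p\<in>set S. pX p) = (\<Sum>p\<leftarrow>S. sum c (pX p) :: real)"
  using assms
proof (induction S)
  case (Cons p S)
  have "sum c (\<Union>p\<in>set (p # S). pX p) = sum c (pX p \<union> (\<Union>p\<in>set S. pX p))" by simp
  also have "\<dots> = sum c (pX p) + sum c (\<Union>p\<in>set S. pX p)"
    using Cons.prems by (intro sum.union_disjoint) auto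
  finally show ?case using Cons by simp
qed simp

lemma pX_joined [simp]: "pX (joined p S) = (\<Union>q\<in>set S. pX q)"
  and pM_joined [simp]: "pM (joined p S) = pM p + sum_list (map pM S)"
  and pl_joined [simp]: "pl (joined p S) = foldr max (map pl S) 0"
  by (simp_all add: joined_def)

lemma foldr_max_ge: "x \<in> set xs \<Longrightarrow> x \<le> foldr max xs (0::real)"
  by (induction xs) (auto simp: max_def)

lemma foldr_max_nonneg: "0 \<le> foldr max xs (0::real)"
  by (induction xs) (auto simp: max_def)

lemma foldr_max_in: "xs \<noteq> [] \<Longrightarrow> \<forall>x\<in>set xs. 0 \<le> x \<Longrightarrow> foldr max xs (0::real) \<in> set xs"
proof (induction xs)
  case (Cons a xs) then show ?case by (cases "xs = []") (auto simp: max_def)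
qed simp

lemma foldr_max_split: "foldr max (as @ x # bs) (0::real) = max x (foldr max (as @ bs) 0)"
  by (induction as) (auto simp: max.left_commute)

lemma absorb_touched:
  assumes "part V D" "pX p \<subseteq> V" "pX p \<noteq> {}"
  shows "filter (touch p) D \<noteq> []" "pX p \<subseteq> pX (joined p (filter (touch p) D))"
proof -
  show *: "pX p \<subseteq> pX (joined p (filter (touch p) D))"
  proof
    fix v assume v: "v \<in> pX p"
    with assms obtain q where "q \<in> set D" "v \<in> pX q" using part_cover[of V D v] by blast
    with v show "v \<in> pX (joined p (filter (touch p) D))" by (auto simp: touch_def)
  qed
  show "filter (touch p) D \<noteq> []"
  proof
    assume "filter (touch p) D = []"
    with * assms(3) show False by simp
  qed
qed

lemma part_absorb:
  assumes "part V D" "pX p \<subseteq> V" "pX p \<noteq> {}"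
  shows "part V (absorb p D)"
proof -
  have d: "djl D" using assms(1) by (simp add: part_def)
  have "pX q \<inter> pX r = {}" if "q \<in> set D" "touch p q" "r \<in> set D" "\<not> touch p r" for q r
    using that djl_unique[OF d, of q r] by blast
  then have "djl (absorb p D)" using d by (auto simp: absorb_def djl_filter)
  moreover have "(\<Union>q\<in>set (absorb p D). pX q) = V" using assms(1) by (auto simp: absorb_def part_def)
  moreover have "\<forall>q\<in>set (absorb p D). pX q \<noteq> {}"
    using absorb_touched[OF assms] assms(1,3) by (auto simp: absorb_def part_def)
  ultimately show ?thesis by (simp add: part_def)
qed

lemma length_absorb:
  assumes "part V D" "pX p \<subseteq> V" "pX p \<noteq> {}"
  shows "length (absorb p D) \<le> length D"
  using absorb_touched(1)[OF assms] sum_length_filter_compl[of "touch p" D]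
  by (cases "filter (touch p) D") (auto simp: absorb_def)

text \<open>The source of all progress: a vertex of \<open>p\<close> outside \<open>g\<close> lies
  in some other piece, so absorbing \<open>p\<close> joins at least two pieces.\<close>

lemma crossP_other:
  assumes "part V D" "pX p \<subseteq> V" "g \<in> set D" "crossP p g"
  obtains g2 where "g2 \<in> set D" "g2 \<noteq> g" "touch p g2"
proof -
  obtain v where v: "v \<in> pX p" "v \<notin> pX g" using assms(4) by (auto simp: crossP_def)
  then obtain g2 where "g2 \<in> set D" "v \<in> pX g2" using part_cover[OF assms(1), of v] assms(2) by blast
  with v that show ?thesis by (auto simp: touch_def)
qed

lemma length_filter_two:
  assumes "a \<in> set D" "b \<in> set D" "a \<noteq> b" "P a" "P b"
  shows "length (filter (\<lambda>x. \<not> P x) D) + 2 \<le> length D"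
proof -
  have "card {a, b} \<le> card (set (filter P D))" using assms by (intro card_mono) auto
  also have "\<dots> \<le> length (filter P D)" by (rule card_length)
  finally show ?thesis using assms(3) sum_length_filter_compl[of P D] by simp
qed

lemma length_absorb_less:
  assumes "part V D" "pX p \<subseteq> V" "g \<in> set D" "crossP p g"
  shows "length (absorb p D) < length D"
proof -
  obtain g2 where "g2 \<in> set D" "g2 \<noteq> g" "touch p g2" using crossP_other[OF assms] .
  then show ?thesis using length_filter_two[of g D g2 "touch p"] assms by (auto simp: absorb_def crossP_def)
qed

lemma absorb_cover:
  assumes "part V D" "pX p \<subseteq> V" "pX p \<noteq> {}"
  shows "\<exists>g\<in>set (absorb p D). pX p \<subseteq> pX g"
    and "q \<in> set D \<Longrightarrow> \<exists>g\<in>set (absorb p D). pX q \<subseteq> pX g \<and> pl q \<le> pl g"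
proof -
  show "\<exists>g\<in>set (absorb p D). pX p \<subseteq> pX g"
    using absorb_touched(2)[OF assms] by (auto simp: absorb_def)
  assume q: "q \<in> set D"
  show "\<exists>g\<in>set (absorb p D). pX q \<subseteq> pX g \<and> pl q \<le> pl g"
  proof (cases "touch p q")
    case True
    with q have "pX q \<subseteq> pX (joined p (filter (touch p) D))" "pl q \<le> pl (joined p (filter (touch p) D))"
      by (auto intro: foldr_max_ge)
    then show ?thesis by (auto simp: absorb_def)
  qed (use q in \<open>auto simp: absorb_def\<close>)
qed

lemma mset_sub_sum_list: "M \<in> set Ms \<Longrightarrow> M \<subseteq># sum_list (Ms :: 'a multiset list)"
  by (induction Ms) (auto intro: subset_mset.order_trans)

text \<open>Connectivity of a joined piece: every vertex reaches one fixed vertex \<open>r\<close>, either through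
  the absorbed multiset alone or first inside the touched piece it comes from.\<close>

lemma lconn_joined:
  assumes D: "part V D" and p: "pX p \<subseteq> V" "pX p \<noteq> {}" "mverts G (pM p) \<subseteq> pX p"
    and conn: "\<And>q. q \<in> set D \<Longrightarrow> touch p q \<Longrightarrow> lconn G (pX q) (pM q)"
    and r: "\<And>x. x \<in> pX p \<Longrightarrow> linked G (pM (joined p (filter (touch p) D))) x r"
  shows "lconn G (pX (joined p (filter (touch p) D))) (pM (joined p (filter (touch p) D)))"
proof -
  let ?S = "filter (touch p) D" let ?M = "pM (joined p ?S)"
  have sub: "pM q \<subseteq># ?M" if "q \<in> set ?S" for q
  proof -
    have "pM q \<subseteq># sum_list (map pM ?S)" using that by (intro mset_sub_sum_list) simp
    then show ?thesis unfolding pM_joined by (rule subset_mset.order_trans) simp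
  qed
  have ne: "pX (joined p ?S) \<noteq> {}" using absorb_touched[OF D p(1,2)] p(2) by auto
  have vM: "mverts G ?M \<subseteq> pX (joined p ?S)"
  proof -
    have "mverts G (pM p) \<subseteq> pX (joined p ?S)" using absorb_touched(2)[OF D p(1,2)] p(3) by blast
    moreover have "mverts G (pM q) \<subseteq> pX q" if "q \<in> set ?S" for q
      using conn that by (simp add: lconn_def)
    ultimately show ?thesis by (auto simp: mverts_sum_list)
  qed
  have *: "linked G ?M u r" if u: "u \<in> pX (joined p ?S)" for u
  proof -
    obtain q where q: "q \<in> set D" "touch p q" "u \<in> pX q" using u by auto
    then obtain x where x: "x \<in> pX p" "x \<in> pX q" by (auto simp: touch_def)
    have "linked G (pM q) u x" using conn[OF q(1,2)] q(3) x(2) by (simp add: lconn_def)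
    then have "linked G ?M u x" by (rule linked_mono[OF _ sub]) (use q in simp)
    with r[OF x(1)] show ?thesis by (rule rtrancl_trans[rotated])
  qed
  have "linked G ?M u v" if "u \<in> pX (joined p ?S)" "v \<in> pX (joined p ?S)" for u v
    by (rule linked_trans[OF *[OF that(1)] linked_sym[OF *[OF that(2)]]])
  with ne vM show ?thesis unfolding lconn_def by blast
qed

lemma lconn_absorb:
  assumes "part V D" "pX p \<subseteq> V" "lconn G (pX p) (pM p)"
    and "\<And>q. q \<in> set D \<Longrightarrow> lconn G (pX q) (pM q)" and g: "g \<in> set (absorb p D)"
  shows "lconn G (pX g) (pM g)"
proof -
  have ne: "pX p \<noteq> {}" using assms(3) by (simp add: lconn_def)
  then obtain r where r: "r \<in> pX p" by blast
  have "lconn G (pX (joined p (filter (touch p) D))) (pM (joined p (filter (touch p) D)))"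
  proof (rule lconn_joined[OF assms(1,2) ne, where r = r])
    fix x assume "x \<in> pX p"
    then have "linked G (pM p) x r" using r assms(3) by (simp add: lconn_def)
    then show "linked G (pM (joined p (filter (touch p) D))) x r" by (rule linked_mono) simp
  qed (use assms(3,4) in \<open>auto simp: lconn_def\<close>)
  then show ?thesis using g assms(4) unfolding absorb_def by auto
qed

lemma eulerian_absorb:
  assumes "eulerian G (pM p)" "\<And>q. q \<in> set D \<Longrightarrow> eulerian G (pM q)" "g \<in> set (absorb p D)"
  shows "eulerian G (pM g)"
proof (cases "g = joined p (filter (touch p) D)")
  case True
  have "eulerian G (sum_list (map pM (filter (touch p) D)))"
    using assms(2) by (intro eulerian_sum_list) auto
  then show ?thesis using True assms(1) by (simp add: eulerian_plus)
qed (use assms in \<open>auto simp: absorb_def\<close>)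

subsection \<open>The merging procedure\<close>

text \<open>\<open>h\<close> bounds the weight of a piece of \<open>H\<close> relative to \<open>\<alpha>\<close> times its cost; a remembered subtour
  may be attached to a piece if it costs at most \<open>K\<close> times the label; the components charged to a
  piece of \<open>H\<close> cost at most \<open>f\<close> times its label. The tour costs \<open>(h + K + f) \<alpha>\<close>: \<open>2 + 1 + 2\<close> for
  existence and \<open>3 + 3 + 3\<close> for the algorithm.\<close>

locale subtour_setting =
  fixes G :: "('v,'e) pre_digraph" and w :: "'e \<Rightarrow> real" and B :: "'e multiset"
    and c :: "'v \<Rightarrow> real" and \<alpha> \<beta> h K f :: real
  assumes G: "fin_digraph G" and B: "subtour G B" "B \<noteq> {#}"
    and w_nonneg: "\<And>e. 0 \<le> w e" and c_nonneg: "\<And>v. 0 \<le> c v"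
    and c_B: "\<And>v. v \<in> mverts G B \<Longrightarrow> c v = 0"
    and params: "0 \<le> \<alpha>" "0 \<le> h" "0 \<le> K" "0 \<le> f"
begin

abbreviation V :: "'v set" where "V \<equiv> verts G"
abbreviation VB :: "'v set" where "VB \<equiv> mverts G B"

definition wt :: "'e multiset \<Rightarrow> real" where "wt M = (\<Sum>e\<in>#M. w e)"
abbreviation cX :: "('v,'e) piece \<Rightarrow> real" where "cX p \<equiv> sum c (pX p)"
text \<open>Exceeds the cost of every set of vertices, so the piece of \<open>B\<close> never has
  the smallest label while another piece exists.\<close>

definition big :: real where "big = sum c V + 1"
definition Bp :: "('v,'e) piece" where "Bp = Piece VB B big False"
text \<open>A marker: a piece of an intermediate partition is the one that has swallowed
  \<open>B\<close> if and only if it contains this vertex.\<close>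

definition b0 :: 'v where "b0 = (SOME v. v \<in> VB)"

definition free :: "('v,'e) piece \<Rightarrow> bool" where "free T \<longleftrightarrow> \<not> touch T Bp"

definition cyc :: "('v,'e) piece \<Rightarrow> bool" where
  "cyc C \<longleftrightarrow> lconn G (pX C) (pM C) \<and> eulerian G (pM C) \<and> pX C \<subseteq> V - VB \<and> wt (pM C) \<le> \<alpha> * cX C"

definition Hinv :: "('v,'e) piece list \<Rightarrow> bool" where
  "Hinv H \<longleftrightarrow> part (V - VB) H \<and> (\<forall>p\<in>set H. lconn G (pX p) (pM p) \<and> eulerian G (pM p) \<and>
     \<not> ps p \<and> pl p = cX p \<and> wt (pM p) \<le> h * \<alpha> * cX p)"

text \<open>Besides the account, three clauses carry the argument. Labels are labels of pieces of
  \<open>H\<close>, hence smaller than \<open>big\<close> and usable in \<open>bits\<close>. An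
  unsealed piece other than \<open>Bp\<close> is still a member of \<open>H\<close>. No remembered
  subtour crossing a sealed piece is cheap relative to its label, so a cheap one found later is
  new.\<close>

definition Einv :: "('v,'e) piece list \<Rightarrow> ('v,'e) piece list \<Rightarrow> ('v,'e) piece list \<Rightarrow> bool" where
  "Einv H Q E \<longleftrightarrow> part V E \<and> Bp \<in> set E \<and> (\<forall>Y\<in>set E. lconn G (pX Y) (pM Y) \<and> eulerian G (pM Y) \<and>
     (Y \<noteq> Bp \<longrightarrow> 0 \<le> pl Y \<and> pl Y \<in> pl ` set H \<and>
        wt (pM Y) \<le> \<alpha> * ((h + K + (if ps Y then f else 0)) * cX Y - K * pl Y) \<and>
        (\<not> ps Y \<longrightarrow> Y \<in> set H) \<and>
        (\<forall>p\<in>set H. touch p Y \<longrightarrow> pX p \<subseteq> pX Y \<and> pl p \<le> pl Y) \<and>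
        (ps Y \<longrightarrow> (\<forall>C\<in>set Q. crossP C Y \<longrightarrow> K * pl Y < cX C))))"

definition spc_out :: "('v,'e) piece list \<Rightarrow> ('v,'e) piece list \<Rightarrow> bool" where
  "spc_out E Ts \<longleftrightarrow> part V Ts \<and> (\<forall>T\<in>set Ts. lconn G (pX T) (pM T) \<and> eulerian G (pM T) \<and>
      (free T \<longrightarrow> wt (pM T) \<le> \<alpha> * cX T)) \<and>
     (\<Sum>T\<leftarrow>filter (\<lambda>T. \<not> free T) Ts. wt (pM T)) \<le> \<beta> \<and>
     (\<forall>Y\<in>set E. Y \<noteq> Bp \<longrightarrow> (\<exists>T\<in>set Ts. crossP T Y))"

definition crossing :: "('v,'e) piece list \<Rightarrow> ('v,'e) piece list \<Rightarrow> ('v,'e) piece list" where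
  "crossing E Ts = filter (\<lambda>T. \<exists>Y\<in>set E. crossP T Y) Ts"

text \<open>Ties between labels are possible, so one subtour can lie in several groups.\<close>

definition grp :: "('v,'e) piece list \<Rightarrow> ('v,'e) piece \<Rightarrow> ('v,'e) piece \<Rightarrow> bool" where
  "grp H p T \<longleftrightarrow> touch T p \<and> (\<forall>q\<in>set H. touch T q \<longrightarrow> pl q \<le> pl p)"

text \<open>The conditions under which the labels pay for a round. A violation of one of the first
  two clauses allows an improvement of \<open>H\<close>; a violation of the third supplies a subtour
  worth remembering.\<close>

definition quiet :: "('v,'e) piece list \<Rightarrow> ('v,'e) piece list \<Rightarrow> ('v,'e) piece list \<Rightarrow> bool" where
  "quiet H E Tf \<longleftrightarrow>
     (\<forall>p\<in>set H. (\<Sum>T\<leftarrow>filter (grp H p) Tf. cX T) \<le> f * pl p) \<and>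
     (\<forall>p\<in>set H. \<forall>T\<in>set Tf. grp H p T \<longrightarrow> cX T \<le> K * pl p) \<and>
     (\<forall>T\<in>set Tf. \<forall>Y\<in>set E. ps Y \<and> crossP T Y \<longrightarrow> K * pl Y < cX T)"

text \<open>A definite choice among ties, so that the program can be shown to compute the same
  piece.\<close>

definition minp :: "('v,'e) piece list \<Rightarrow> ('v,'e) piece" where
  "minp D = hd (filter (\<lambda>g. \<forall>q\<in>set D. pl g \<le> pl q) D)"

definition cheap :: "('v,'e) piece list \<Rightarrow> ('v,'e) piece list \<Rightarrow> ('v,'e) piece list" where
  "cheap Q D = filter (\<lambda>C. crossP C (minp D) \<and> cX C \<le> K * pl (minp D)) Q"

definition xstep :: "('v,'e) piece list \<Rightarrow> ('v,'e) piece list \<Rightarrow> ('v,'e) piece list" where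
  "xstep Q D = (if cheap Q D = [] then D else absorb (hd (cheap Q D)) D)"

definition seal :: "('v,'e) piece \<Rightarrow> ('v,'e) piece" where
  "seal g = Piece (pX g) (pM g) (pl g) True"

lemma finite_V [simp]: "finite V"
  using G by (simp add: fin_digraph.finite_verts)

lemma VB_sub: "VB \<subseteq> V"
proof -
  interpret fin_digraph G by (rule G)
  show ?thesis using B(1) by (auto simp: subtour_def eulerian_def mverts_def)
qed

lemma b0: "b0 \<in> VB"
proof -
  have "VB \<noteq> {}" using B(2) by (auto simp: mverts_def)
  then show ?thesis unfolding b0_def by (simp add: some_in_eq)
qed

lemma wt_plus [simp]: "wt (M + N) = wt M + wt N"
  by (simp add: wt_def)
lemma wt_empty [simp]: "wt {#} = 0"
  by (simp add: wt_def)
lemma wt_nonneg: "0 \<le> wt M"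
  unfolding wt_def by (induction M) (auto simp: w_nonneg)
lemma wt_sum_list: "wt (sum_list Ms) = (\<Sum>M\<leftarrow>Ms. wt M)"
  by (induction Ms) auto

lemma c_sum_nonneg: "0 \<le> sum c X"
  by (rule sum_nonneg) (rule c_nonneg)

lemma c_sum_mono: "X \<subseteq> Y \<Longrightarrow> finite Y \<Longrightarrow> sum c X \<le> sum c Y"
  by (rule sum_mono2) (auto simp: c_nonneg)

lemma c_less_big: "X \<subseteq> V \<Longrightarrow> sum c X < big"
  using c_sum_mono[of X V] by (simp add: big_def)

lemma big_pos: "0 < big"
  using c_sum_nonneg[of V] by (simp add: big_def)

lemma Bp_simps [simp]: "pX Bp = VB" "pM Bp = B" "pl Bp = big" "ps Bp = False"
  by (simp_all add: Bp_def)

lemma c_VB: "sum c VB = 0"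
  by (simp add: c_B)

lemma Einv_b0:
  assumes "Einv H Q E" "Y \<in> set E"
  shows "b0 \<in> pX Y \<longleftrightarrow> Y = Bp"
  using part_unique[of V E Y Bp b0] assms b0 by (auto simp: Einv_def)

lemma Einv_disjoint_B:
  assumes "Einv H Q E" "Y \<in> set E" "Y \<noteq> Bp"
  shows "pX Y \<inter> VB = {}"
  using part_unique[of V E Y Bp] assms by (auto simp: Einv_def)

lemma Einv_init:
  assumes "Hinv H"
  shows "Einv H Q (Bp # H)"
proof -
  have p: "part (V - VB) H" using assms by (simp add: Hinv_def)
  have "Bp \<notin> set H" using part_subset[OF p] b0 by force
  have "part V (Bp # H)" using p VB_sub b0 by (auto simp: part_def)
  moreover have "lconn G VB B" "eulerian G B"
    using subtour_lconn[OF B] B(1) by (auto simp: subtour_def)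
  moreover have "pX p \<subseteq> pX Y \<and> pl p \<le> pl Y" if "p \<in> set H" "Y \<in> set H" "touch p Y" for p Y
    using that part_unique[OF p that(1,2)] by (auto simp: touch_def)
  \<comment> \<open>Initially the label equals the cost, so the right-hand side is just
    \<open>h * \<alpha> * cX Y\<close>: the credit is present from the start and costs
    nothing.\<close>
  moreover have "wt (pM Y) \<le> \<alpha> * ((h + K) * cX Y - K * pl Y)" if "Y \<in> set H" for Y
    using that assms by (auto simp: Hinv_def algebra_simps)
  ultimately show ?thesis using assms by (auto simp: Einv_def Hinv_def c_sum_nonneg)
qed

text \<open>The weight of a piece of an intermediate partition is bounded by its cost, minus a credit
  proportional to its label, plus charges \<open>qf\<close> distributed over its vertices. The credit of a
  piece is released when the piece is merged into one with a larger label.\<close>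

definition bd :: "real \<Rightarrow> real \<Rightarrow> ('v \<Rightarrow> real) \<Rightarrow> 'v set \<Rightarrow> real \<Rightarrow> real" where
  "bd A C qf X l = \<alpha> * (A * sum c X - (if b0 \<in> X then 0 else K * l)) + (if b0 \<in> X then C else 0) + sum qf X"

definition bounded :: "real \<Rightarrow> real \<Rightarrow> ('v \<Rightarrow> real) \<Rightarrow> ('v,'e) piece list \<Rightarrow> bool" where
  "bounded A C qf D \<longleftrightarrow> (\<forall>g\<in>set D. wt (pM g) \<le> bd A C qf (pX g) (pl g))"

text \<open>The joined piece keeps the larger label, so the credit for the smaller one is no longer
  held back. The second inequality hands this credit out. As \<open>b0\<close> lies in at most one
  of the two sets, \<open>C\<close> is counted at most once.\<close>

lemma bd_add:
  assumes "finite X1" "finite X2" "X1 \<inter> X2 = {}" "0 \<le> l1" "0 \<le> l2"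
  shows "bd A C qf X1 l1 + bd A C qf X2 l2 \<le> bd A C qf (X1 \<union> X2) (max l1 l2)"
    and "b0 \<notin> X1 \<Longrightarrow> l1 \<le> l2 \<Longrightarrow>
      bd A C qf X1 l1 + \<alpha> * (K * l1) + bd A C qf X2 l2 \<le> bd A C qf (X1 \<union> X2) (max l1 l2)"
proof -
  have s: "sum g (X1 \<union> X2) = sum g X1 + sum g X2" for g :: "'v \<Rightarrow> real"
    using assms by (simp add: sum.union_disjoint)
  have k: "0 \<le> \<alpha> * (K * l1)" "0 \<le> \<alpha> * (K * l2)" using params assms by simp_all
  have "\<not> (b0 \<in> X1 \<and> b0 \<in> X2)" using assms by blast
  then show "bd A C qf X1 l1 + bd A C qf X2 l2 \<le> bd A C qf (X1 \<union> X2) (max l1 l2)"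
    using k by (auto simp: bd_def s algebra_simps max_def)
  show "bd A C qf X1 l1 + \<alpha> * (K * l1) + bd A C qf X2 l2 \<le> bd A C qf (X1 \<union> X2) (max l1 l2)"
    if "b0 \<notin> X1" "l1 \<le> l2"
    using k that by (auto simp: bd_def s algebra_simps max_def)
qed

lemma bd_join:
  assumes "djl S" "\<And>q. q \<in> set S \<Longrightarrow> finite (pX q) \<and> 0 \<le> pl q"
  shows "(\<Sum>q\<leftarrow>S. bd A C qf (pX q) (pl q)) \<le> bd A C qf (\<Union>q\<in>set S. pX q) (foldr max (map pl S) 0)"
  using assms
proof (induction S)
  case (Cons p S)
  have "bd A C qf (pX p) (pl p) + bd A C qf (\<Union>q\<in>set S. pX q) (foldr max (map pl S) 0)
      \<le> bd A C qf (pX p \<union> (\<Union>q\<in>set S. pX q)) (max (pl p) (foldr max (map pl S) 0))"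
    using Cons.prems by (intro bd_add(1)) (auto simp: foldr_max_nonneg)
  with Cons show ?case by simp
qed (simp add: bd_def)

lemma bounded_touched:
  assumes "bounded A C qf D"
  shows "(\<Sum>q\<leftarrow>filter P D. wt (pM q)) \<le> (\<Sum>q\<leftarrow>filter P D. bd A C qf (pX q) (pl q))"
  using assms by (intro sum_list_mono) (auto simp: bounded_def)

lemma part_finite: "part V D \<Longrightarrow> q \<in> set D \<Longrightarrow> finite (pX q)"
  using part_subset[of V D q] finite_subset[OF _ finite_V] by blast

text \<open>The weight of \<open>T\<close> is booked on one of its vertices \<open>v\<close>. After
  absorption \<open>v\<close> lies in the joined piece only, so the bounds of all other pieces are
  unchanged.\<close>

lemma bounded_absorb_charge:
  assumes D: "part V D" "\<And>q. q \<in> set D \<Longrightarrow> 0 \<le> pl q" and bnd: "bounded A C qf D"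
    and T: "pX T \<subseteq> V" "v \<in> pX T"
  shows "bounded A C (qf(v := qf v + wt (pM T))) (absorb T D)"
proof -
  let ?S = "filter (touch T) D" and ?q = "qf(v := qf v + wt (pM T))"
  have ne: "pX T \<noteq> {}" using T by blast
  have vJ: "v \<in> pX (joined T ?S)" using absorb_touched(2)[OF D(1) T(1) ne] T(2) by blast
  have fin: "finite (pX (joined T ?S))" using part_finite[OF D(1)] by simp
  have q: "sum ?q X = sum qf X + (if v \<in> X then wt (pM T) else 0)" if "finite X" for X
  proof -
    have "?q = (\<lambda>u. qf u + (if u = v then wt (pM T) else 0))" by auto
    then show ?thesis using that by (simp add: sum.distrib)
  qed
  have "wt (pM (joined T ?S)) = wt (pM T) + (\<Sum>q\<leftarrow>?S. wt (pM q))"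
    by (simp add: wt_sum_list comp_def)
  also have "(\<Sum>q\<leftarrow>?S. wt (pM q)) \<le> (\<Sum>q\<leftarrow>?S. bd A C qf (pX q) (pl q))"
    by (rule bounded_touched[OF bnd])
  also have "\<dots> \<le> bd A C qf (pX (joined T ?S)) (pl (joined T ?S))"
    using D part_finite[OF D(1)] unfolding pX_joined pl_joined by (intro bd_join) (auto simp: part_def djl_filter)
  also have "wt (pM T) + \<dots> = bd A C ?q (pX (joined T ?S)) (pl (joined T ?S))"
    using vJ q[OF fin] by (simp add: bd_def)
  finally have 1: "wt (pM (joined T ?S)) \<le> bd A C ?q (pX (joined T ?S)) (pl (joined T ?S))" by simp
  have 2: "wt (pM g) \<le> bd A C ?q (pX g) (pl g)" if g: "g \<in> set D" "\<not> touch T g" for g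
  proof -
    have "v \<notin> pX g" using g T(2) by (auto simp: touch_def)
    then have "bd A C ?q (pX g) (pl g) = bd A C qf (pX g) (pl g)"
      using q part_finite[OF D(1) g(1)] by (simp add: bd_def)
    then show ?thesis using bnd g by (simp add: bounded_def)
  qed
  show ?thesis using 1 2 by (auto simp: bounded_def absorb_def)
qed

text \<open>Here \<open>T\<close> is not booked on a vertex but paid by the credit of the piece
  \<open>g\<close> of smallest label, which is released because \<open>T\<close> also touches
  another piece.\<close>

lemma bounded_absorb_credit:
  assumes D: "part V D" "\<And>q. q \<in> set D \<Longrightarrow> 0 \<le> pl q" and bnd: "bounded A C qf D"
    and T: "pX T \<subseteq> V" and g: "g \<in> set D" "b0 \<notin> pX g" "\<And>q. q \<in> set D \<Longrightarrow> pl g \<le> pl q"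
    and cr: "crossP T g" "wt (pM T) \<le> \<alpha> * (K * pl g)"
  shows "bounded A C qf (absorb T D)"
proof -
  let ?S = "filter (touch T) D"
  obtain g2 where g2: "g2 \<in> set D" "g2 \<noteq> g" "touch T g2" using crossP_other[OF D(1) T g(1) cr(1)] .
  have gS: "g \<in> set ?S" using g cr by (simp add: crossP_def)
  then obtain as bs where S: "?S = as @ g # bs" using split_list[OF gS] by blast
  have dj: "djl (as @ g # bs)" unfolding S[symmetric] using D(1) by (simp add: part_def djl_filter)
  have in_S: "x \<in> set D" if "x \<in> set (as @ g # bs)" for x using that unfolding S[symmetric] by simp
  let ?R = "as @ bs"
  have R: "djl ?R" "pX g \<inter> (\<Union>q\<in>set ?R. pX q) = {}" using dj by (auto simp: djl_append)
  have Rq: "finite (pX q) \<and> 0 \<le> pl q" if "q \<in> set ?R" for q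
    using that in_S part_finite[OF D(1)] D(2) by simp
  have "g2 \<in> set (as @ g # bs)" unfolding S[symmetric] using g2 by simp
  then have "g2 \<in> set ?R" using g2(2) by simp
  then have "pl g2 \<le> foldr max (map pl ?R) 0" by (intro foldr_max_ge) auto
  \<comment> \<open>Leaving out \<open>g\<close> does not change the largest label among the joined
    pieces, so the whole credit of \<open>g\<close> is free for \<open>T\<close>.\<close>
  then have le: "pl g \<le> foldr max (map pl ?R) 0" using g(3)[OF g2(1)] by simp
  have "wt (pM (joined T ?S)) = wt (pM T) + (\<Sum>q\<leftarrow>?S. wt (pM q))"
    by (simp add: wt_sum_list comp_def)
  also have "\<dots> \<le> \<alpha> * (K * pl g) + (\<Sum>q\<leftarrow>?S. bd A C qf (pX q) (pl q))"
    using cr(2) bounded_touched[OF bnd, of "touch T"] by simp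
  also have "\<dots> = bd A C qf (pX g) (pl g) + \<alpha> * (K * pl g) + (\<Sum>q\<leftarrow>?R. bd A C qf (pX q) (pl q))"
    unfolding S by simp
  also have "\<dots> \<le> bd A C qf (pX g) (pl g) + \<alpha> * (K * pl g)
      + bd A C qf (\<Union>q\<in>set ?R. pX q) (foldr max (map pl ?R) 0)"
    using bd_join[OF R(1) Rq, of A C qf] by simp
  also have "\<dots> \<le> bd A C qf (pX g \<union> (\<Union>q\<in>set ?R. pX q)) (max (pl g) (foldr max (map pl ?R) 0))"
    using R(2) Rq le g D(2)[OF g(1)] part_finite[OF D(1) g(1)]
    by (intro bd_add(2)) (auto simp: foldr_max_nonneg)
  also have "pX g \<union> (\<Union>q\<in>set ?R. pX q) = pX (joined T ?S)" unfolding S by auto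
  also have "max (pl g) (foldr max (map pl ?R) 0) = pl (joined T ?S)"
    unfolding S pl_joined by (simp only: map_append list.map foldr_max_split)
  finally have 1: "wt (pM (joined T ?S)) \<le> bd A C qf (pX (joined T ?S)) (pl (joined T ?S))" .
  show ?thesis using 1 bnd by (auto simp: bounded_def absorb_def)
qed

end

section \<open>Charging the components of a solution to the pieces of a partition\<close>

context subtour_setting begin

text \<open>What all partitions coarser than \<open>E\<close> that occur during a merge have in
  common. Joining creates no new labels, and \<open>B \<subseteq># pM g\<close> later ensures that
  the final multiset is nonempty.\<close>

definition Dinv :: "('v,'e) piece list \<Rightarrow> ('v,'e) piece list \<Rightarrow> ('v,'e) piece list \<Rightarrow> bool" where
  "Dinv E L D \<longleftrightarrow> part V D \<and> (\<forall>g\<in>set D. lconn G (pX g) (pM g) \<and> eulerian G (pM g) \<and> 0 \<le> pl g \<and>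
      (b0 \<in> pX g \<longrightarrow> big \<le> pl g \<and> B \<subseteq># pM g) \<and> (b0 \<notin> pX g \<longrightarrow> pl g \<in> pl ` (set E - {Bp}))) \<and>
     (\<forall>Y\<in>set E. \<exists>g\<in>set D. pX Y \<subseteq> pX g \<and> pl Y \<le> pl g) \<and> (\<forall>T\<in>set L. \<exists>g\<in>set D. pX T \<subseteq> pX g)"

lemma EinvD:
  assumes "Einv H Q E" "Y \<in> set E" "Y \<noteq> Bp"
  shows "0 \<le> pl Y" "pl Y \<in> pl ` set H"
    "wt (pM Y) \<le> \<alpha> * ((h + K + (if ps Y then f else 0)) * cX Y - K * pl Y)"
    "\<not> ps Y \<Longrightarrow> Y \<in> set H"
    "p \<in> set H \<Longrightarrow> touch p Y \<Longrightarrow> pX p \<subseteq> pX Y \<and> pl p \<le> pl Y"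
    "ps Y \<Longrightarrow> C \<in> set Q \<Longrightarrow> crossP C Y \<Longrightarrow> K * pl Y < cX C"
  using assms by (simp_all add: Einv_def)

lemma Dinv_init: "Einv H Q E \<Longrightarrow> Dinv E [] E"
  using Einv_b0[of H Q E] big_pos unfolding Dinv_def
  by (force simp: Einv_def)

lemma Dinv_absorb:
  assumes D: "Dinv E L D" and T: "pX T \<subseteq> V" "lconn G (pX T) (pM T)" "eulerian G (pM T)"
  shows "Dinv E (T # L) (absorb T D)"
proof -
  have ne: "pX T \<noteq> {}" using T(2) by (simp add: lconn_def)
  have P: "part V D" using D by (simp add: Dinv_def)
  have "\<forall>g\<in>set D. lconn G (pX g) (pM g) \<and> eulerian G (pM g) \<and> 0 \<le> pl g \<and>
      (b0 \<in> pX g \<longrightarrow> big \<le> pl g \<and> B \<subseteq># pM g) \<and> (b0 \<notin> pX g \<longrightarrow> pl g \<in> pl ` (set E - {Bp}))"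
    using D by (simp add: Dinv_def)
  then have Dg: "lconn G (pX g) (pM g)" "eulerian G (pM g)" "0 \<le> pl g"
    "b0 \<in> pX g \<Longrightarrow> big \<le> pl g" "b0 \<in> pX g \<Longrightarrow> B \<subseteq># pM g"
    "b0 \<notin> pX g \<Longrightarrow> pl g \<in> pl ` (set E - {Bp})" if "g \<in> set D" for g
    using that by simp_all
  let ?S = "filter (touch T) D" let ?J = "joined T ?S"
  have J1: "big \<le> pl ?J \<and> B \<subseteq># pM ?J" if b: "b0 \<in> pX ?J"
  proof -
    obtain q where q: "q \<in> set D" "touch T q" "b0 \<in> pX q" using b by auto
    have "pl q \<le> pl ?J" unfolding pl_joined using q by (intro foldr_max_ge) auto
    moreover have "pM q \<subseteq># sum_list (map pM ?S)" using q by (intro mset_sub_sum_list) auto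
    then have "pM q \<subseteq># pM ?J" unfolding pM_joined by (rule subset_mset.order_trans) simp
    ultimately show ?thesis using Dg(4,5)[OF q(1,3)] by (meson order_trans subset_mset.order_trans)
  qed
  have J2: "pl ?J \<in> pl ` (set E - {Bp})" if b: "b0 \<notin> pX ?J"
  proof -
    have "pl ?J \<in> set (map pl ?S)" unfolding pl_joined
      using absorb_touched(1)[OF P T(1) ne] Dg(3) by (intro foldr_max_in) auto
    then obtain q where q: "q \<in> set D" "touch T q" "pl ?J = pl q" by auto
    then have "b0 \<notin> pX q" using b by auto
    then show ?thesis using Dg(6)[OF q(1)] q(3) by simp
  qed
  have J3: "0 \<le> pl ?J" by (simp add: foldr_max_nonneg)
  have g: "0 \<le> pl g \<and> (b0 \<in> pX g \<longrightarrow> big \<le> pl g \<and> B \<subseteq># pM g) \<and> (b0 \<notin> pX g \<longrightarrow> pl g \<in> pl ` (set E - {Bp}))"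
    if "g \<in> set (absorb T D)" for g
  proof (cases "g = ?J")
    case True then show ?thesis using J1 J2 J3 by blast
  next
    case False
    then have "g \<in> set D" using that by (auto simp: absorb_def)
    then show ?thesis using Dg by blast
  qed
  have DE: "\<forall>Y\<in>set E. \<exists>g\<in>set D. pX Y \<subseteq> pX g \<and> pl Y \<le> pl g"
    and DL: "\<forall>Y\<in>set L. \<exists>g\<in>set D. pX Y \<subseteq> pX g"
    using D by (simp_all add: Dinv_def)
  have "\<exists>g\<in>set (absorb T D). pX Y \<subseteq> pX g \<and> pl Y \<le> pl g" if Y: "Y \<in> set E" for Y
  proof -
    obtain g where g: "g \<in> set D" "pX Y \<subseteq> pX g" "pl Y \<le> pl g" using DE Y by blast
    obtain g' where "g' \<in> set (absorb T D)" "pX g \<subseteq> pX g'" "pl g \<le> pl g'"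
      using absorb_cover(2)[OF P T(1) ne g(1)] by blast
    with g show ?thesis by (intro bexI[of _ g']) auto
  qed
  moreover have "\<exists>g\<in>set (absorb T D). pX Y \<subseteq> pX g" if Y: "Y \<in> set L" for Y
  proof -
    obtain g where g: "g \<in> set D" "pX Y \<subseteq> pX g" using DL Y by blast
    obtain g' where "g' \<in> set (absorb T D)" "pX g \<subseteq> pX g'"
      using absorb_cover(2)[OF P T(1) ne g(1)] by blast
    with g show ?thesis by (intro bexI[of _ g']) auto
  qed
  moreover note absorb_cover(1)[OF P T(1) ne] part_absorb[OF P T(1) ne]
  moreover have "lconn G (pX g) (pM g) \<and> eulerian G (pM g)" if "g \<in> set (absorb T D)" for g
    using lconn_absorb[OF P T(1,2) Dg(1) that] eulerian_absorb[OF T(3) Dg(2) that] by simp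
  ultimately show ?thesis using g unfolding Dinv_def by simp
qed

text \<open>The map \<open>\<tau>\<close> names for each subtour the vertex charged with its weight;
  \<open>q0\<close> holds the charges present beforehand.\<close>

lemma foldr_absorb:
  assumes E: "Einv H Q E" and bnd: "bounded A C q0 E"
    and Ts: "\<And>T. T \<in> set Ts \<Longrightarrow> pX T \<subseteq> V \<and> lconn G (pX T) (pM T) \<and> eulerian G (pM T) \<and> \<tau> T \<in> pX T"
  shows "Dinv E Ts (foldr absorb Ts E)"
    and "bounded A C (\<lambda>v. q0 v + (\<Sum>T\<leftarrow>Ts. if \<tau> T = v then wt (pM T) else 0)) (foldr absorb Ts E)"
    and "length (foldr absorb Ts E) \<le> length E"
proof -
  let ?q = "\<lambda>Ts v. q0 v + (\<Sum>T\<leftarrow>Ts. if \<tau> T = v then wt (pM T) else 0)"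
  have "Dinv E Ts (foldr absorb Ts E) \<and> bounded A C (?q Ts) (foldr absorb Ts E)
    \<and> length (foldr absorb Ts E) \<le> length E"
    using Ts
  proof (induction Ts)
    case Nil then show ?case using Dinv_init[OF E] bnd by simp
  next
    case (Cons T Ts)
    let ?D = "foldr absorb Ts E"
    have T: "pX T \<subseteq> V" "lconn G (pX T) (pM T)" "eulerian G (pM T)" "\<tau> T \<in> pX T"
      using Cons.prems by auto
    have IH: "Dinv E Ts ?D" "bounded A C (?q Ts) ?D" "length ?D \<le> length E" using Cons by auto
    have P: "part V ?D" "\<And>q. q \<in> set ?D \<Longrightarrow> 0 \<le> pl q" using IH(1) by (auto simp: Dinv_def)
    have "(?q Ts)(\<tau> T := ?q Ts (\<tau> T) + wt (pM T)) = ?q (T # Ts)" by auto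
    then have "bounded A C (?q (T # Ts)) (absorb T ?D)"
      using bounded_absorb_charge[OF P IH(2) T(1,4)] by simp
    moreover have "length (absorb T ?D) \<le> length E"
      using length_absorb[OF P(1) T(1)] T(4) IH(3) by (metis empty_iff order_trans)
    ultimately show ?case using Dinv_absorb[OF IH(1) T(1,2,3)] by simp
  qed
  then show "Dinv E Ts (foldr absorb Ts E)" "bounded A C (?q Ts) (foldr absorb Ts E)"
    "length (foldr absorb Ts E) \<le> length E" by auto
qed

lemma sum_charges:
  assumes "finite X"
  shows "(\<Sum>v\<in>X. \<Sum>T\<leftarrow>Ts. if \<tau> T = v then d T else (0::real)) = (\<Sum>T\<leftarrow>filter (\<lambda>T. \<tau> T \<in> X) Ts. d T)"
  using assms by (induction Ts) (auto simp: sum.distrib)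

lemma sum_list_filter_mono:
  "(\<And>x. x \<in> set xs \<Longrightarrow> 0 \<le> d x) \<Longrightarrow> (\<Sum>x\<leftarrow>filter P xs. d x) \<le> (\<Sum>x\<leftarrow>xs. d x :: real)"
  by (induction xs) (auto intro: add_increasing)

text \<open>A crossing subtour that avoids \<open>B\<close> is charged to the touched piece of \<open>H\<close> with the largest
  label. That piece is not yet part of a sealed piece: otherwise the subtour would be a cheap
  connection of a sealed piece.\<close>

lemma charge_target:
  assumes H: "Hinv H" and E: "Einv H Q E" and q: "quiet H E Tf" and T: "T \<in> set Tf"
    and cr: "Y0 \<in> set E" "crossP T Y0" and fr: "free T" "pX T \<subseteq> V"
  obtains p where "p \<in> set H" "p \<in> set E" "p \<noteq> Bp" "grp H p T"
proof -
  have P: "part (V - VB) H" using H by (simp add: Hinv_def)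
  have PE: "part V E" using E by (simp add: Einv_def)
  let ?L = "filter (touch T) H"
  have ne: "pX T \<noteq> {}" using cr by (auto simp: crossP_def touch_def)
  have sub: "pX T \<subseteq> V - VB" using fr by (auto simp: free_def touch_def)
  have "?L \<noteq> []" using absorb_touched(1)[OF P sub ne] .
  then have "Max (pl ` set ?L) \<in> pl ` set ?L" by (intro Max_in) (auto simp: filter_empty_conv)
  then obtain p where p: "p \<in> set H" "touch T p" "pl p = Max (pl ` set ?L)" by auto
  have "pl r \<le> pl p" if "r \<in> set H" "touch T r" for r
    unfolding p(3) using that by (intro Max_ge) auto
  then have gr: "grp H p T" using p by (simp add: grp_def)
  obtain v where v: "v \<in> pX T" "v \<in> pX p" using p(2) by (auto simp: touch_def)
  then obtain Y where Y: "Y \<in> set E" "v \<in> pX Y" using part_cover[OF PE, of v] fr(2) by blast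
  have YB: "Y \<noteq> Bp" using v Y(2) sub by auto
  have pY: "pX p \<subseteq> pX Y" "pl p \<le> pl Y"
    using EinvD(5)[OF E Y(1) YB p(1)] v Y by (auto simp: touch_def)
  have "\<not> ps Y"
  proof
    assume s: "ps Y"
    have "crossP T Y"
    proof -
      have "\<not> pX T \<subseteq> pX Y"
      proof
        assume *: "pX T \<subseteq> pX Y"
        obtain u where "u \<in> pX T" "u \<in> pX Y0" using cr by (auto simp: crossP_def touch_def)
        then have "Y0 = Y" using part_unique[OF PE cr(1) Y(1)] * by blast
        then show False using cr(2) * by (simp add: crossP_def)
      qed
      then show ?thesis using v Y by (auto simp: crossP_def touch_def)
    qed
    moreover have "\<forall>T\<in>set Tf. \<forall>Y\<in>set E. ps Y \<and> crossP T Y \<longrightarrow> K * pl Y < cX T"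
      "\<forall>p\<in>set H. \<forall>T\<in>set Tf. grp H p T \<longrightarrow> cX T \<le> K * pl p"
      using q by (simp_all add: quiet_def)
    ultimately have "K * pl Y < cX T" "cX T \<le> K * pl p" using T gr p(1) Y(1) s by blast+
    moreover have "K * pl p \<le> K * pl Y" using pY params by (simp add: mult_left_mono)
    ultimately show False by simp
  qed
  then have "Y \<in> set H" using E Y YB by (auto simp: Einv_def)
  then have "Y = p" using part_unique[OF P _ p(1) Y(2) v(2)] by simp
  then show ?thesis using that p(1) Y YB gr by blast
qed

text \<open>The pieces of \<open>E\<close> account in three ways. A sealed piece brings its
  allowance \<open>f * cX Y\<close> along and receives no new charge. The piece of \<open>B\<close>
  receives the components meeting \<open>B\<close>, of weight at most \<open>\<beta>\<close>. An
  unsealed piece of \<open>H\<close> receives part of its group, paid by \<open>f * pl Y\<close>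
  with \<open>pl Y = cX Y\<close>. Afterwards all merged pieces obey one bound with factor
  \<open>h + K + f\<close>.\<close>

lemma bounded_merged:
  assumes H: "Hinv H" and E: "Einv H Q E" and out: "spc_out E Ts"
    and q: "quiet H E (filter free (crossing E Ts))"
  defines "D \<equiv> foldr absorb (crossing E Ts) E"
  shows "Dinv E (crossing E Ts) D" "bounded (h + K + f) (wt B + \<beta>) (\<lambda>_. 0) D" "length D \<le> length E"
proof -
  let ?L = "crossing E Ts"
  have PE: "part V E" and BE: "Bp \<in> set E" using E by (auto simp: Einv_def)
  have Ts: "T \<in> set Ts" "pX T \<subseteq> V" "lconn G (pX T) (pM T)" "eulerian G (pM T)"
    "free T \<Longrightarrow> wt (pM T) \<le> \<alpha> * cX T" "\<exists>Y\<in>set E. crossP T Y" if "T \<in> set ?L" for T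
    using that out part_subset[of V Ts T] by (auto simp: spc_out_def crossing_def)
  \<comment> \<open>The piece to be charged with \<open>T\<close>: that of \<open>B\<close> if
    \<open>T\<close> meets \<open>B\<close>, otherwise a piece of \<open>H\<close> of largest label.
    The latter is still present in \<open>E\<close> by \<open>charge_target\<close>, and pieces of
    \<open>H\<close> carry no seal.\<close>
  define good where "good T p \<longleftrightarrow> p \<in> set E \<and> \<not> ps p \<and> touch T p \<and>
      (if free T then p \<in> set H \<and> p \<noteq> Bp \<and> grp H p T else p = Bp)" for T p
  have ex: "\<exists>p. good T p" if T: "T \<in> set ?L" for T
  proof (cases "free T")
    case True
    obtain Y where Y: "Y \<in> set E" "crossP T Y" using Ts(6)[OF T] by blast
    have "T \<in> set (filter free ?L)" using T True by simp
    from charge_target[OF H E q this Y True Ts(2)[OF T]]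
    obtain p where "p \<in> set H" "p \<in> set E" "p \<noteq> Bp" "grp H p T" .
    moreover have "\<not> ps p" using H \<open>p \<in> set H\<close> by (auto simp: Hinv_def)
    ultimately show ?thesis using True unfolding good_def by (auto simp: grp_def intro!: exI[of _ p])
  next
    case False
    then show ?thesis using BE unfolding good_def by (auto simp: free_def intro!: exI[of _ Bp])
  qed
  define tgt where "tgt T = (SOME p. good T p)" for T
  have tgt: "good T (tgt T)" if "T \<in> set ?L" for T
    unfolding tgt_def using ex[OF that] by (rule someI_ex)
  define \<tau> where "\<tau> T = (SOME v. v \<in> pX T \<inter> pX (tgt T))" for T
  have \<tau>: "\<tau> T \<in> pX T" "\<tau> T \<in> pX (tgt T)" if "T \<in> set ?L" for T
  proof -
    have "pX T \<inter> pX (tgt T) \<noteq> {}" using tgt[OF that] by (simp add: good_def touch_def)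
    then have "\<tau> T \<in> pX T \<inter> pX (tgt T)" unfolding \<tau>_def some_in_eq .
    then show "\<tau> T \<in> pX T" "\<tau> T \<in> pX (tgt T)" by auto
  qed
  have tgt_eq: "tgt T = Y" if "T \<in> set ?L" "Y \<in> set E" "\<tau> T \<in> pX Y" for T Y
    using part_unique[OF PE _ that(2) \<tau>(2)[OF that(1)] that(3)] tgt[OF that(1)] by (simp add: good_def)
  \<comment> \<open>Moves the allowance of sealed pieces into vertex charges, so that all pieces of
    \<open>E\<close> obey one bound with factor \<open>h + K\<close>.\<close>
  define q0 where "q0 v = (if \<exists>Y\<in>set E. ps Y \<and> v \<in> pX Y then \<alpha> * f * c v else 0)" for v
  have q0: "sum q0 (pX Y) = (if ps Y then \<alpha> * f * cX Y else 0)" if Y: "Y \<in> set E" for Y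
  proof -
    have "q0 v = (if ps Y then \<alpha> * f * c v else 0)" if v: "v \<in> pX Y" for v
    proof -
      have "(\<exists>Z\<in>set E. ps Z \<and> v \<in> pX Z) \<longleftrightarrow> ps Y"
      proof
        assume "\<exists>Z\<in>set E. ps Z \<and> v \<in> pX Z"
        then obtain Z where Z: "Z \<in> set E" "ps Z" "v \<in> pX Z" by blast
        show "ps Y" using part_unique[OF PE Y Z(1) v Z(3)] Z(2) by simp
      qed (use Y v in blast)
      then show ?thesis by (simp add: q0_def)
    qed
    then have *: "sum q0 (pX Y) = (\<Sum>v\<in>pX Y. if ps Y then \<alpha> * f * c v else 0)" by (intro sum.cong) auto
    show ?thesis unfolding * by (cases "ps Y") (simp_all add: sum_distrib_left)
  qed
  have b1: "bounded (h + K) (wt B) q0 E"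
    unfolding bounded_def
  proof
    fix Y assume Y: "Y \<in> set E"
    show "wt (pM Y) \<le> bd (h + K) (wt B) q0 (pX Y) (pl Y)"
    proof (cases "Y = Bp")
      case True
      then show ?thesis using b0 q0[OF Y] by (simp add: bd_def c_VB)
    next
      case False
      then have "b0 \<notin> pX Y" using Einv_b0[OF E Y] by simp
      moreover have "wt (pM Y) \<le> \<alpha> * ((h + K + (if ps Y then f else 0)) * cX Y - K * pl Y)"
        using E Y False by (auto simp: Einv_def)
      ultimately show ?thesis using q0[OF Y] by (simp add: bd_def algebra_simps split: if_splits)
    qed
  qed
  have Ts': "pX T \<subseteq> V \<and> lconn G (pX T) (pM T) \<and> eulerian G (pM T) \<and> \<tau> T \<in> pX T" if "T \<in> set ?L" for T
    using Ts[OF that] \<tau>[OF that] by simp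
  note fa = foldr_absorb[OF E b1 Ts']
  show Di: "Dinv E ?L D" unfolding D_def by (rule fa(1))
  show "length D \<le> length E" unfolding D_def by (rule fa(3))
  define qf where "qf v = q0 v + (\<Sum>T\<leftarrow>?L. if \<tau> T = v then wt (pM T) else 0)" for v
  have b2: "bounded (h + K) (wt B) qf D" unfolding D_def qf_def by (rule fa(2))
  have PD: "part V D" and DiE: "\<forall>Y\<in>set E. \<exists>g\<in>set D. pX Y \<subseteq> pX g \<and> pl Y \<le> pl g"
    using Di by (simp_all add: Dinv_def)
  have qY: "sum qf (pX Y) \<le> \<alpha> * f * cX Y + (if Y = Bp then \<beta> else 0)" if Y: "Y \<in> set E" for Y
  proof -
    let ?F = "filter (\<lambda>T. \<tau> T \<in> pX Y) ?L"
    have s: "sum qf (pX Y) = sum q0 (pX Y) + (\<Sum>T\<leftarrow>?F. wt (pM T))"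
      using part_finite[OF PE Y] by (simp add: qf_def sum.distrib sum_charges)
    have F: "good T Y" if "T \<in> set ?F" for T using that tgt_eq[OF _ Y, of T] tgt[of T] by auto
    consider "ps Y" | "Y = Bp" | "\<not> ps Y" "Y \<noteq> Bp" by blast
    then show ?thesis
    proof cases
      case 1
      have "?F = []"
      proof (rule ccontr)
        assume "?F \<noteq> []"
        then have "hd ?F \<in> set ?F" by (rule hd_in_set)
        from F[OF this] 1 show False by (simp add: good_def)
      qed
      moreover have "Y \<noteq> Bp" using 1 by auto
      ultimately show ?thesis using s q0[OF Y] 1 by simp
    next
      case 2
      have "?F = filter (\<lambda>T. \<tau> T \<in> pX Y) (filter (\<lambda>T. \<not> free T) ?L)"
      proof -
        have "\<not> free T" if "T \<in> set ?F" for T using F[OF that] 2 by (auto simp: good_def split: if_splits)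
        then show ?thesis unfolding filter_filter by (intro filter_cong) auto
      qed
      also have "\<dots> = filter (\<lambda>T. \<tau> T \<in> pX Y \<and> (\<exists>Y\<in>set E. crossP T Y)) (filter (\<lambda>T. \<not> free T) Ts)"
        unfolding crossing_def by (auto intro: filter_cong)
      finally have "(\<Sum>T\<leftarrow>?F. wt (pM T)) \<le> (\<Sum>T\<leftarrow>filter (\<lambda>T. \<not> free T) Ts. wt (pM T))"
        by (simp only:) (rule sum_list_filter_mono, rule wt_nonneg)
      also have "\<dots> \<le> \<beta>" using out by (simp add: spc_out_def)
      finally show ?thesis using s q0[OF Y] 2 by (simp add: c_VB)
    next
      case 3
      have YH: "Y \<in> set H" using 3 E Y by (auto simp: Einv_def)
      have gT: "free T \<and> grp H Y T" if "T \<in> set ?F" for T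
        using F[OF that] 3 by (auto simp: good_def split: if_splits)
      have "(\<Sum>T\<leftarrow>?F. wt (pM T)) \<le> (\<Sum>T\<leftarrow>?F. \<alpha> * cX T)"
        using gT Ts(5) by (intro sum_list_mono) auto
      also have "\<dots> = \<alpha> * (\<Sum>T\<leftarrow>?F. cX T)" by (simp add: sum_list_const_mult)
      also have "(\<Sum>T\<leftarrow>?F. cX T) \<le> (\<Sum>T\<leftarrow>filter (grp H Y) (filter free ?L). cX T)"
      proof -
        have "?F = filter (\<lambda>T. \<tau> T \<in> pX Y) (filter (grp H Y) (filter free ?L))"
          unfolding filter_filter using gT by (intro filter_cong) auto
        then show ?thesis by (simp only:) (rule sum_list_filter_mono, rule c_sum_nonneg)
      qed
      also have "\<dots> \<le> f * pl Y" using q YH by (simp add: quiet_def)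
      also have "pl Y = cX Y" using H YH by (simp add: Hinv_def)
      finally show ?thesis using s q0[OF Y] 3 params by (simp add: mult_left_mono mult.assoc)
    qed
  qed
  show "bounded (h + K + f) (wt B + \<beta>) (\<lambda>_. 0) D"
    unfolding bounded_def
  proof
    fix g assume g: "g \<in> set D"
    \<comment> \<open>The pieces of \<open>E\<close> inside \<open>g\<close> cover it exactly, so
      the charges of \<open>g\<close> are the sum of theirs.\<close>
    let ?S = "filter (\<lambda>Y. pX Y \<subseteq> pX g) E"
    have "pX g \<subseteq> (\<Union>Y\<in>set ?S. pX Y)"
    proof (rule subsetI)
      fix v assume v: "v \<in> pX g"
      from part_subset[OF PD g] v have "v \<in> V" by (rule subsetD)
      from part_cover[OF PE this] obtain Y where Y: "Y \<in> set E" "v \<in> pX Y" by blast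
      from DiE Y(1) obtain g' where g': "g' \<in> set D" "pX Y \<subseteq> pX g'" by blast
      from g'(2) Y(2) have "v \<in> pX g'" by (rule subsetD)
      then have "g' = g" by (rule part_unique[OF PD g'(1) g _ v])
      then show "v \<in> (\<Union>Y\<in>set ?S. pX Y)" using Y g' by auto
    qed
    moreover have "(\<Union>Y\<in>set ?S. pX Y) \<subseteq> pX g" by auto
    ultimately have U: "pX g = (\<Union>Y\<in>set ?S. pX Y)" by (rule equalityI)
    have dj: "djl ?S" using PE by (simp add: part_def djl_filter)
    have fin: "finite (pX Y)" if "Y \<in> set ?S" for Y using that part_finite[OF PE] by simp
    have sums: "sum d (pX g) = (\<Sum>Y\<leftarrow>?S. sum d (pX Y))" for d :: "'v \<Rightarrow> real"
      using arg_cong[OF U, of "sum d"] sum_djl[OF dj fin, of d] by (rule trans)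
    have "sum qf (pX g) = (\<Sum>Y\<leftarrow>?S. sum qf (pX Y))" by (rule sums)
    also have "\<dots> \<le> (\<Sum>Y\<leftarrow>?S. \<alpha> * f * cX Y + (if Y = Bp then \<beta> else 0))"
      using qY by (intro sum_list_mono) auto
    also have "\<dots> = \<alpha> * f * (\<Sum>Y\<leftarrow>?S. cX Y) + (\<Sum>Y\<leftarrow>?S. if Y = Bp then \<beta> else 0)"
      by (simp add: sum_list_addf sum_list_const_mult)
    finally have sq: "sum qf (pX g) \<le> \<alpha> * f * (\<Sum>Y\<leftarrow>?S. cX Y) + (\<Sum>Y\<leftarrow>?S. if Y = Bp then \<beta> else 0)" .
    have sB: "(\<Sum>Y\<leftarrow>?S. if Y = Bp then \<beta> else 0) = (if b0 \<in> pX g then \<beta> else 0)"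
    proof -
      have "distinct ?S" using part_distinct[OF PE] by simp
      then have "(\<Sum>Y\<leftarrow>?S. if Y = Bp then \<beta> else 0) = (\<Sum>Y\<in>set ?S. if Y = Bp then \<beta> else 0)"
        by (rule sum_list_distinct_conv_sum_set)
      then have "(\<Sum>Y\<leftarrow>?S. if Y = Bp then \<beta> else 0) = (if Bp \<in> set ?S then \<beta> else 0)"
        by (simp only: sum.delta finite_set)
      moreover have "Bp \<in> set ?S \<longleftrightarrow> b0 \<in> pX g"
      proof
        show "Bp \<in> set ?S \<Longrightarrow> b0 \<in> pX g" using b0 by auto
        assume "b0 \<in> pX g"
        with equalityD1[OF U] have "b0 \<in> (\<Union>Y\<in>set ?S. pX Y)" by (rule subsetD)
        then obtain Y where "Y \<in> set ?S" "b0 \<in> pX Y" by (rule UN_E)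
        then show "Bp \<in> set ?S" using Einv_b0[OF E, of Y] by auto
      qed
      ultimately show ?thesis by (simp only:)
    qed
    have "sum qf (pX g) \<le> \<alpha> * f * cX g + (if b0 \<in> pX g then \<beta> else 0)"
      using sq unfolding sB sums[of c, symmetric] .
    moreover have "wt (pM g) \<le> bd (h + K) (wt B) qf (pX g) (pl g)" using b2 g by (simp add: bounded_def)
    ultimately show "wt (pM g) \<le> bd (h + K + f) (wt B + \<beta>) (\<lambda>_. 0) (pX g) (pl g)"
      by (simp add: bd_def algebra_simps split: if_splits)
  qed
qed

end

section \<open>Attaching remembered subtours and sealing the piece of smallest label\<close>

context subtour_setting begin

lemma minp:
  assumes "D \<noteq> []"
  shows "minp D \<in> set D" "q \<in> set D \<Longrightarrow> pl (minp D) \<le> pl q"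
proof -
  let ?F = "filter (\<lambda>g. \<forall>q\<in>set D. pl g \<le> pl q) D"
  have "Min (pl ` set D) \<in> pl ` set D" using assms by (intro Min_in) auto
  then obtain g where g: "g \<in> set D" "pl g = Min (pl ` set D)" by auto
  have "g \<in> set ?F" using g by simp
  then have "?F \<noteq> []" by (metis empty_iff list.set(1))
  then have "minp D \<in> set ?F" unfolding minp_def by (rule hd_in_set)
  then show "minp D \<in> set D" "q \<in> set D \<Longrightarrow> pl (minp D) \<le> pl q" by auto
qed

text \<open>A second piece carries the label of a piece of \<open>H\<close>. That label is a cost,
  hence below \<open>big\<close>, while a piece containing \<open>b0\<close> has at least the label
  \<open>big\<close>.\<close>

lemma Dinv_single:
  assumes D: "Dinv E L D" and H: "Hinv H" and E: "Einv H Q E"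
    and g: "g \<in> set D" "g2 \<in> set D" "g2 \<noteq> g" and min: "\<And>q. q \<in> set D \<Longrightarrow> pl g \<le> pl q"
  shows "b0 \<notin> pX g"
proof
  assume b: "b0 \<in> pX g"
  have PD: "part V D" using D by (simp add: Dinv_def)
  have "b0 \<notin> pX g2" using part_unique[OF PD g(1,2) b] g(3) by blast
  then have "pl g2 \<in> pl ` (set E - {Bp})" using D g(2) by (simp add: Dinv_def)
  then obtain Y where Y: "Y \<in> set E" "Y \<noteq> Bp" "pl g2 = pl Y" by auto
  obtain p where p: "p \<in> set H" "pl Y = pl p" using EinvD(2)[OF E Y(1,2)] by auto
  have "pl p = cX p" using H p(1) by (simp add: Hinv_def)
  moreover have "pX p \<subseteq> V" using H p(1) part_subset[of "V - VB" H p] by (auto simp: Hinv_def)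
  ultimately have "pl g2 < big" using Y(3) p(2) c_less_big by simp
  moreover have "big \<le> pl g" using D g(1) b by (simp add: Dinv_def)
  ultimately show False using min[OF g(2)] by simp
qed

lemma cycD: assumes "cyc C"
  shows "pX C \<subseteq> V" "lconn G (pX C) (pM C)" "eulerian G (pM C)" "wt (pM C) \<le> \<alpha> * cX C"
  using assms by (auto simp: cyc_def)

lemma xstep_inv:
  assumes D: "Dinv E L D" and H: "Hinv H" and E: "Einv H Q E" and Q: "\<And>C. C \<in> set Q \<Longrightarrow> cyc C"
    and bnd: "bounded A C0 qf D" and ne: "cheap Q D \<noteq> []"
  shows "Dinv E L (xstep Q D)" "bounded A C0 qf (xstep Q D)" "length (xstep Q D) < length D"
proof -
  have PD: "part V D" and nn: "\<And>q. q \<in> set D \<Longrightarrow> 0 \<le> pl q" using D by (simp_all add: Dinv_def)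
  let ?C = "hd (cheap Q D)" let ?g = "minp D"
  have "?C \<in> set (cheap Q D)" using ne by (rule hd_in_set)
  then have C: "cyc ?C" "crossP ?C ?g" "cX ?C \<le> K * pl ?g" using Q by (auto simp: cheap_def)
  have Dne: "D \<noteq> []"
    using PD b0 VB_sub by (auto simp: part_def)
  note g = minp[OF Dne]
  obtain g2 where g2: "g2 \<in> set D" "g2 \<noteq> ?g" using crossP_other[OF PD cycD(1)[OF C(1)] g(1) C(2)] by blast
  have nb: "b0 \<notin> pX ?g" by (rule Dinv_single[OF D H E g(1) g2 g(2)])
  have x: "xstep Q D = absorb ?C D" using ne by (simp add: xstep_def)
  have "Dinv E (?C # L) (xstep Q D)" unfolding x using cycD[OF C(1)] by (intro Dinv_absorb[OF D])
  then show "Dinv E L (xstep Q D)" by (simp add: Dinv_def)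
  have "wt (pM ?C) \<le> \<alpha> * (K * pl ?g)"
    using cycD(4)[OF C(1)] mult_left_mono[OF C(3) params(1)] by simp
  then show "bounded A C0 qf (xstep Q D)" unfolding x
    by (intro bounded_absorb_credit[OF PD nn bnd cycD(1)[OF C(1)] g(1) nb g(2) C(2)])
  show "length (xstep Q D) < length D" unfolding x
    by (rule length_absorb_less[OF PD cycD(1)[OF C(1)] g(1) C(2)])
qed

lemma xloop_inv:
  assumes D: "Dinv E L D" and H: "Hinv H" and E: "Einv H Q E" and Q: "\<And>C. C \<in> set Q \<Longrightarrow> cyc C"
    and bnd: "bounded A C0 qf D" and n: "length D \<le> n"
  shows "Dinv E L ((xstep Q ^^ n) D)" "bounded A C0 qf ((xstep Q ^^ n) D)"
    "cheap Q ((xstep Q ^^ n) D) = []"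
proof -
  \<comment> \<open>Either the process has become stationary, or each of the \<open>n\<close> steps
    has shortened the partition. The second is impossible once \<open>n\<close> reaches the length
    of \<open>D\<close>, since a partition of \<open>V\<close> is never empty.\<close>
  have *: "Dinv E L ((xstep Q ^^ n) D) \<and> bounded A C0 qf ((xstep Q ^^ n) D) \<and>
    (cheap Q ((xstep Q ^^ n) D) = [] \<or> length ((xstep Q ^^ n) D) + n \<le> length D)" for n
  proof (induction n)
    case 0 then show ?case using D bnd by simp
  next
    case (Suc n)
    let ?D = "(xstep Q ^^ n) D"
    show ?case
    proof (cases "cheap Q ?D = []")
      case True
      then have "xstep Q ?D = ?D" by (simp add: xstep_def)
      then show ?thesis using Suc True by simp
    next
      case False
      then show ?thesis using xstep_inv[OF _ H E Q _ False, of L A C0 qf] Suc by force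
    qed
  qed
  then show "Dinv E L ((xstep Q ^^ n) D)" "bounded A C0 qf ((xstep Q ^^ n) D)" by blast+
  have "part V ((xstep Q ^^ n) D)" using *[of n] by (simp add: Dinv_def)
  then have "(xstep Q ^^ n) D \<noteq> []" using b0 VB_sub by (auto simp: part_def)
  then have "0 < length ((xstep Q ^^ n) D)" by simp
  then show "cheap Q ((xstep Q ^^ n) D) = []" using *[of n] n by linarith
qed

text \<open>If one piece remains it contains \<open>B\<close>, and its bound is the one claimed for
  the tour. Otherwise the piece of smallest label avoids \<open>B\<close>, and its bound in
  \<open>D\<close> is literally the one demanded of a sealed piece. As every piece of
  \<open>E\<close> lies inside a piece of \<open>D\<close>, those not touching \<open>g\<close> can
  be restored unchanged.\<close>

theorem merge_step:
  assumes H: "Hinv H" and E: "Einv H Q E" and Q: "\<And>C. C \<in> set Q \<Longrightarrow> cyc C"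
    and out: "spc_out E Ts" and q: "quiet H E (filter free (crossing E Ts))" and n: "length E \<le> n"
  defines "D \<equiv> (xstep Q ^^ n) (foldr absorb (crossing E Ts) E)"
  defines "g \<equiv> minp D"
  shows "length D = 1 \<Longrightarrow> tour G (pM g) \<and> wt (pM g) \<le> (h + K + f) * \<alpha> * sum c V + \<beta> + wt B"
    and "length D \<noteq> 1 \<Longrightarrow> Einv H Q (seal g # filter (\<lambda>Y. \<not> touch g Y) E) \<and>
      length (seal g # filter (\<lambda>Y. \<not> touch g Y) E) < length E"
proof -
  let ?L = "crossing E Ts"
  note m = bounded_merged[OF H E out q]
  have "length (foldr absorb ?L E) \<le> n" using m(3) n by simp
  note x = xloop_inv[OF m(1) H E Q m(2) this, folded D_def]
  have PD: "part V D" using x(1) by (simp add: Dinv_def)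
  have PE: "part V E" using E by (simp add: Einv_def)
  have Dne: "D \<noteq> []" using PD b0 VB_sub by (auto simp: part_def)
  note g = minp[OF Dne, folded g_def]
  have gD: "lconn G (pX g) (pM g)" "eulerian G (pM g)" "0 \<le> pl g"
    "b0 \<in> pX g \<Longrightarrow> B \<subseteq># pM g" "b0 \<notin> pX g \<Longrightarrow> pl g \<in> pl ` (set E - {Bp})"
    using x(1) g(1) by (simp_all add: Dinv_def)
  have bg: "wt (pM g) \<le> bd (h + K + f) (wt B + \<beta>) (\<lambda>_. 0) (pX g) (pl g)"
    using x(2) g(1) by (simp add: bounded_def)
  show "tour G (pM g) \<and> wt (pM g) \<le> (h + K + f) * \<alpha> * sum c V + \<beta> + wt B" if 1: "length D = 1"
  proof -
    have "D = [g]" using 1 g(1) by (cases D) auto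
    then have X: "pX g = V" using PD by (simp add: part_def)
    then have b: "b0 \<in> pX g" using b0 VB_sub by blast
    have "pM g \<noteq> {#}" using gD(4)[OF b] B(2) by auto
    then have "tour G (pM g)" using gD(1,2) X by (intro tourI) simp_all
    then show ?thesis using bg b X by (simp add: bd_def algebra_simps)
  qed
  assume len: "length D \<noteq> 1"
  obtain g2 where g2: "g2 \<in> set D" "g2 \<noteq> g"
  proof (rule ccontr)
    assume "\<not> thesis"
    then have "set D \<subseteq> {g}" using that by blast
    then have "card (set D) \<le> 1" using card_mono[of "{g}" "set D"] by simp
    then show False using len Dne part_distinct[OF PD] by (simp add: distinct_card) (cases D; simp)
  qed
  have nb: "b0 \<notin> pX g" by (rule Dinv_single[OF x(1) H E g(1) g2 g(2)])
  have DE: "\<forall>Y\<in>set E. \<exists>g\<in>set D. pX Y \<subseteq> pX g \<and> pl Y \<le> pl g"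
    and DL: "\<forall>T\<in>set ?L. \<exists>g\<in>set D. pX T \<subseteq> pX g"
    using x(1) by (simp_all add: Dinv_def)
  have inside: "pX Y \<subseteq> pX g \<and> pl Y \<le> pl g" if Y: "Y \<in> set E" "touch g Y" for Y
  proof -
    obtain v where v: "v \<in> pX g" "v \<in> pX Y" using Y(2) by (auto simp: touch_def)
    obtain g' where g': "g' \<in> set D" "pX Y \<subseteq> pX g'" "pl Y \<le> pl g'" using DE Y(1) by blast
    have "v \<in> pX g'" using g'(2) v(2) by (rule subsetD)
    then have "g' = g" by (rule part_unique[OF PD g'(1) g(1) _ v(1)])
    then show ?thesis using g' by simp
  qed
  have BE: "Bp \<in> set E" using E by (simp add: Einv_def)
  have nB: "\<not> touch g Bp" using inside[OF BE] b0 nb by auto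
  let ?E = "seal g # filter (\<lambda>Y. \<not> touch g Y) E"
  have sealg [simp]: "pX (seal g) = pX g" "pM (seal g) = pM g" "pl (seal g) = pl g" "ps (seal g)"
    by (simp_all add: seal_def)
  have "part V ?E"
  proof -
    have "djl ?E" using PE by (auto simp: part_def djl_filter touch_def)
    moreover have "(\<Union>Y\<in>set ?E. pX Y) = V"
    proof
      show "(\<Union>Y\<in>set ?E. pX Y) \<subseteq> V" using part_subset[OF PD g(1)] part_subset[OF PE] by auto
      show "V \<subseteq> (\<Union>Y\<in>set ?E. pX Y)"
      proof (rule subsetI)
        fix v assume "v \<in> V"
        from part_cover[OF PE this] obtain Y where Y: "Y \<in> set E" "v \<in> pX Y" by blast
        then show "v \<in> (\<Union>Y\<in>set ?E. pX Y)" using inside[OF Y(1)] by (cases "touch g Y") auto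
      qed
    qed
    ultimately show ?thesis using part_nonempty[OF PD g(1)] PE by (simp add: part_def)
  qed
  moreover have "seal g \<noteq> Bp" by (metis Bp_simps(4) sealg(4))
  moreover have "pl g \<in> pl ` set H"
  proof -
    obtain Y where Y: "Y \<in> set E" "Y \<noteq> Bp" "pl g = pl Y" using gD(5)[OF nb] by auto
    then show ?thesis using EinvD(2)[OF E Y(1,2)] by simp
  qed
  moreover have "wt (pM g) \<le> \<alpha> * ((h + K + f) * cX g - K * pl g)"
    using bg nb by (simp add: bd_def)
  moreover have "pX p \<subseteq> pX g \<and> pl p \<le> pl g" if p: "p \<in> set H" "touch p g" for p
  proof -
    obtain v where v: "v \<in> pX p" "v \<in> pX g" using p(2) by (auto simp: touch_def)
    have "v \<in> V" using part_subset[OF PD g(1)] v(2) by (rule subsetD)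
    from part_cover[OF PE this] obtain Y where Y: "Y \<in> set E" "v \<in> pX Y" by blast
    then have t: "touch g Y" "touch p Y" using v by (auto simp: touch_def)
    then have "Y \<noteq> Bp" using nB by blast
    from EinvD(5)[OF E Y(1) this p(1) t(2)] inside[OF Y(1) t(1)] show ?thesis by auto
  qed
  \<comment> \<open>The piece \<open>g\<close> has the smallest label in \<open>D\<close> and the
    attaching loop is stationary, so no remembered subtour crosses \<open>g\<close> cheaply.\<close>
  moreover have "K * pl g < cX C" if C: "C \<in> set Q" "crossP C g" for C
  proof -
    have "C \<notin> set (cheap Q D)" using x(3) by simp
    then show ?thesis using C by (simp add: cheap_def g_def)
  qed
  ultimately have "Einv H Q ?E"
    using E gD nB BE unfolding Einv_def by (auto simp: touch_def crossP_def)
  \<comment> \<open>The solution crosses each piece of \<open>E\<close> inside \<open>g\<close>, and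
    the crossing component lies in \<open>g\<close> too; so \<open>g\<close> contains at least two
    pieces of \<open>E\<close>.\<close>
  moreover have "length ?E < length E"
  proof -
    obtain v where v: "v \<in> pX g" using part_nonempty[OF PD g(1)] by blast
    have "v \<in> V" using part_subset[OF PD g(1)] v by (rule subsetD)
    from part_cover[OF PE this] obtain Y where Y: "Y \<in> set E" "v \<in> pX Y" by blast
    then have tY: "touch g Y" using v by (auto simp: touch_def)
    then have YB: "Y \<noteq> Bp" using nB by blast
    obtain T where T: "T \<in> set Ts" "crossP T Y" using out Y(1) YB by (auto simp: spc_out_def)
    have TL: "T \<in> set ?L" using T Y(1) by (auto simp: crossing_def)
    have TV: "pX T \<subseteq> V" using out T(1) part_subset[of V Ts T] by (simp add: spc_out_def)
    obtain g' where g': "g' \<in> set D" "pX T \<subseteq> pX g'" using DL TL by blast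
    obtain u where u: "u \<in> pX T" "u \<in> pX Y" using T(2) by (auto simp: crossP_def touch_def)
    have "u \<in> pX g'" "u \<in> pX g" using g'(2) u inside[OF Y(1) tY] by auto
    then have "g' = g" by (rule part_unique[OF PD g'(1) g(1)])
    then have Tg: "pX T \<subseteq> pX g" using g'(2) by simp
    obtain Y2 where Y2: "Y2 \<in> set E" "Y2 \<noteq> Y" "touch T Y2" using crossP_other[OF PE TV Y(1) T(2)] .
    have "touch g Y2" using Y2(3) Tg by (auto simp: touch_def)
    then show ?thesis using length_filter_two[of Y E Y2 "touch g"] Y(1) Y2(1,2) tY by simp
  qed
  ultimately show "Einv H Q ?E \<and> length ?E < length E" ..
qed

end

subsection \<open>Components of a solution of Subtour Partition Cover\<close>

text \<open>Components of the spanning graph \<open>(V, F)\<close>: vertices not incident to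
  \<open>F\<close> form pieces without edges, so that the result is a partition of
  \<open>V\<close>.\<close>

definition comps_of :: "('v,'e) pre_digraph \<Rightarrow> 'e multiset \<Rightarrow> ('v,'e) piece list \<Rightarrow> bool" where
  "comps_of G F Ts \<longleftrightarrow> part (verts G) Ts \<and> (\<forall>T\<in>set Ts. lconn G (pX T) (pM T)) \<and> sum_list (map pM Ts) = F"

lemma filter_mset_empty: "filter_mset P M = {#} \<longleftrightarrow> (\<forall>x\<in>#M. \<not> P x)"
  by (induction M) auto

lemma sum_list_filter_compl:
  "sum_list (map f (filter P xs)) + sum_list (map f (filter (\<lambda>x. \<not> P x) xs)) =
   (sum_list (map f xs) :: 'a multiset)"
  by (induction xs) (auto simp: ac_simps)

lemma sum_pM_absorb: "sum_list (map pM (absorb p D)) = pM p + sum_list (map pM D)"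
  by (simp add: absorb_def union_assoc sum_list_filter_compl)

lemma foldr_absorb_lconn:
  assumes "part V D" "\<And>q. q \<in> set D \<Longrightarrow> lconn G (pX q) (pM q)"
    and "\<And>p. p \<in> set L \<Longrightarrow> pX p \<subseteq> V \<and> lconn G (pX p) (pM p)"
  shows "part V (foldr absorb L D) \<and> (\<forall>q\<in>set (foldr absorb L D). lconn G (pX q) (pM q)) \<and>
    sum_list (map pM (foldr absorb L D)) = sum_list (map pM L) + sum_list (map pM D)"
  using assms(3)
proof (induction L)
  case Nil then show ?case using assms by simp
next
  case (Cons p L)
  then have IH: "part V (foldr absorb L D)" "\<And>q. q \<in> set (foldr absorb L D) \<Longrightarrow> lconn G (pX q) (pM q)"
    "sum_list (map pM (foldr absorb L D)) = sum_list (map pM L) + sum_list (map pM D)" by simp_all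
  have p: "pX p \<subseteq> V" "lconn G (pX p) (pM p)" "pX p \<noteq> {}" using Cons.prems by (auto simp: lconn_def)
  show ?case using part_absorb[OF IH(1) p(1,3)] lconn_absorb[OF IH(1) p(1,2) IH(2)] IH(3)
    by (simp add: sum_pM_absorb union_assoc)
qed

definition edge_piece :: "('v,'e) pre_digraph \<Rightarrow> 'e multiset \<Rightarrow> 'e \<Rightarrow> ('v,'e) piece" where
  "edge_piece G F e = Piece {tail G e, head G e} (replicate_mset (count F e) e) 0 False"

definition singles :: "('v \<Rightarrow> real) \<Rightarrow> 'v list \<Rightarrow> ('v,'e) piece list" where
  "singles l vs = map (\<lambda>v. Piece {v} {#} (l v) False) vs"

lemma lconn_single: "lconn G {v} {#}" by (simp add: lconn_def)

lemma part_singles: "distinct vs \<Longrightarrow> part (set vs) (singles l vs)"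
  by (induction vs) (auto simp: part_def singles_def)

lemma sum_pM_singles: "sum_list (map pM (singles l vs)) = {#}"
  by (induction vs) (auto simp: singles_def)

text \<open>Components arise by absorbing one edge after another, each with its full multiplicity,
  into single vertices. The same fold serves the existence proof and the program, hence the
  arbitrary initial labels \<open>l\<close>.\<close>

lemma comps_of_fold:
  assumes "fin_digraph G" "set_mset F \<subseteq> arcs G" "distinct vs" "set vs = verts G"
    and "distinct es" "set es = set_mset F"
  shows "comps_of G F (foldr (\<lambda>e. absorb (edge_piece G F e)) es (singles l vs))"
proof -
  interpret fin_digraph G by fact
  have "lconn G {tail G e, head G e} (replicate_mset (count F e) e)" if "e \<in># F" for e
  proof -
    have "e \<in># replicate_mset (count F e) e" using that by simp
    then have "(tail G e, head G e) \<in> und G (replicate_mset (count F e) e)"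
      "(head G e, tail G e) \<in> und G (replicate_mset (count F e) e)" unfolding und_def by blast+
    then show ?thesis by (auto simp: lconn_def mverts_def)
  qed
  then have L: "pX p \<subseteq> verts G \<and> lconn G (pX p) (pM p)" if p: "p \<in> set (map (edge_piece G F) es)" for p
  proof -
    obtain e where e: "e \<in># F" "p = edge_piece G F e" using p assms(6) by auto
    then have "tail G e \<in> verts G" "head G e \<in> verts G" using assms(2) by auto
    with e show ?thesis using \<open>\<And>e. e \<in># F \<Longrightarrow> lconn G {tail G e, head G e} (replicate_mset (count F e) e)\<close>[OF e(1)]
      by (simp add: edge_piece_def)
  qed
  have S: "lconn G (pX q) (pM q)" if "q \<in> set (singles l vs)" for q
    using that by (auto simp: singles_def lconn_single)
  have "part (verts G) (singles l vs)" using part_singles[OF assms(3), of l] assms(4) by simp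
  have f: "part (verts G) (foldr absorb (map (edge_piece G F) es) (singles l vs)) \<and>
      (\<forall>q\<in>set (foldr absorb (map (edge_piece G F) es) (singles l vs)). lconn G (pX q) (pM q)) \<and>
      sum_list (map pM (foldr absorb (map (edge_piece G F) es) (singles l vs))) =
      sum_list (map pM (map (edge_piece G F) es)) + sum_list (map pM (singles l vs))"
    by (rule foldr_absorb_lconn[OF \<open>part (verts G) (singles l vs)\<close> S L])
  have "sum_list (map pM (map (edge_piece G F) es)) = (\<Sum>e\<in>set_mset F. replicate_mset (count F e) e)"
    using sum_list_distinct_conv_sum_set[OF assms(5), of "\<lambda>e. replicate_mset (count F e) e"] assms(6)
    by (simp add: edge_piece_def comp_def)
  also have "\<dots> = F"
    by (rule multiset_eqI) (simp add: count_sum count_eq_zero_iff if_distrib sum.delta)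
  finally show ?thesis using f unfolding comps_of_def foldr_map comp_def by (simp add: sum_pM_singles)
qed

text \<open>No edge of \<open>F\<close> joins two pieces, so any test lying between "both ends in
  \<open>pX T\<close>" and "some end in \<open>pX T\<close>" selects the same edges.\<close>

lemma comps_of_filter:
  assumes c: "comps_of G F Ts" and T: "T \<in> set Ts"
    and P: "\<And>e. tail G e \<in> pX T \<Longrightarrow> head G e \<in> pX T \<Longrightarrow> P e"
      "\<And>e. P e \<Longrightarrow> tail G e \<in> pX T \<or> head G e \<in> pX T"
  shows "filter_mset P F = pM T"
proof -
  obtain as bs where s: "Ts = as @ T # bs" using split_list[OF T] by blast
  have mv: "mverts G (pM q) \<subseteq> pX q" if "q \<in> set Ts" for q using c that by (auto simp: comps_of_def lconn_def)
  have dj: "pX q \<inter> pX T = {}" if "q \<in> set (as @ bs)" for q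
    using c that unfolding comps_of_def part_def s by (auto simp: djl_append)
  have "filter_mset P (pM q) = {#}" if "q \<in> set (as @ bs)" for q
  proof -
    have "\<not> P e" if e: "e \<in># pM q" for e
    proof
      assume "P e"
      then have "tail G e \<in> pX T \<or> head G e \<in> pX T" by (rule P(2))
      moreover have "q \<in> set Ts" using \<open>q \<in> set (as @ bs)\<close> unfolding s by auto
      then have "tail G e \<in> pX q" "head G e \<in> pX q" using mv[of q] e by (auto simp: mverts_def)
      ultimately show False using dj[OF \<open>q \<in> set (as @ bs)\<close>] by blast
    qed
    then show ?thesis by (simp add: filter_mset_empty)
  qed
  then have z: "filter_mset P (sum_list (map pM L)) = {#}" if "set L \<subseteq> set (as @ bs)" for L
    using that by (induction L) auto
  have "filter_mset P (pM T) = pM T"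
    unfolding filter_mset_eq_conv
  proof (safe; (simp; fail)?)
    fix e assume "e \<in># pM T"
    then show "P e" using mv[OF T] P(1)[of e] by (auto simp: mverts_def)
  qed
  moreover have "F = sum_list (map pM as) + (pM T + sum_list (map pM bs))"
    using c unfolding comps_of_def s by simp
  ultimately show ?thesis using z[of as] z[of bs] by simp
qed

lemma comps_of_edge:
  assumes c: "comps_of G F Ts" and e: "e \<in># F"
  obtains T where "T \<in> set Ts" "e \<in># pM T" "tail G e \<in> pX T" "head G e \<in> pX T"
proof -
  have *: "e \<in># sum_list (map pM L) \<Longrightarrow> \<exists>T\<in>set L. e \<in># pM T" for L by (induction L) auto
  obtain T where T: "T \<in> set Ts" "e \<in># pM T" using *[of Ts] c e by (auto simp: comps_of_def)
  then have "mverts G (pM T) \<subseteq> pX T" using c by (auto simp: comps_of_def lconn_def)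
  with T that show ?thesis by (auto simp: mverts_def)
qed

lemma comps_of_eulerian:
  assumes c: "comps_of G F Ts" and T: "T \<in> set Ts" and F: "eulerian G F"
  shows "eulerian G (pM T)"
  unfolding eulerian_def
proof (intro conjI ballI)
  have "pM T \<subseteq># F" using c T mset_sub_sum_list[of "pM T" "map pM Ts"] by (auto simp: comps_of_def)
  then show "set_mset (pM T) \<subseteq> arcs G" using F set_mset_mono[of "pM T" F] by (auto simp: eulerian_def)
  have mv: "mverts G (pM T) \<subseteq> pX T" using c T by (auto simp: comps_of_def lconn_def)
  fix v assume v: "v \<in> verts G"
  \<comment> \<open>Selecting by tail keeps all edges of \<open>F\<close> leaving a vertex of
    \<open>T\<close>, selecting by head all those entering one; so the degrees in \<open>F\<close>
    and in \<open>pM T\<close> agree there.\<close>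
  have t: "pM T = {#e \<in># F. tail G e \<in> pX T#}" "pM T = {#e \<in># F. head G e \<in> pX T#}"
    using comps_of_filter[OF c T, of "\<lambda>e. tail G e \<in> pX T"] comps_of_filter[OF c T, of "\<lambda>e. head G e \<in> pX T"]
    by auto
  show "size {#e \<in># pM T. head G e = v#} = size {#e \<in># pM T. tail G e = v#}"
  proof (cases "v \<in> pX T")
    case True
    have "{#e \<in># pM T. head G e = v#} = {#e \<in># F. head G e = v#}"
      unfolding t(2) filter_filter_mset using True by (intro filter_mset_cong) auto
    moreover have "{#e \<in># pM T. tail G e = v#} = {#e \<in># F. tail G e = v#}"
      unfolding t(1) filter_filter_mset using True by (intro filter_mset_cong) auto
    ultimately show ?thesis using F v by (simp add: eulerian_def)
  next
    case False
    then have "{#e \<in># pM T. head G e = v#} = {#}" "{#e \<in># pM T. tail G e = v#} = {#}"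
      unfolding filter_mset_empty using mv by (auto simp: mverts_def)
    then show ?thesis by (simp only:)
  qed
qed

lemma comps_of_component:
  assumes c: "comps_of G F Ts" and T: "T \<in> set Ts" and u: "u \<in> pX T" "u \<in> mverts G F"
  shows "{#e \<in># F. u \<rightarrow>\<^sup>*\<^bsub>mk_symmetric (spanned G F)\<^esub> tail G e#} = pM T"
proof (rule trans)
  have P: "part (verts G) Ts" using c by (simp add: comps_of_def)
  have closed: "tail G e \<in> pX T \<longleftrightarrow> head G e \<in> pX T" if e: "e \<in># F" for e
  proof -
    obtain T' where T': "T' \<in> set Ts" "tail G e \<in> pX T'" "head G e \<in> pX T'" using comps_of_edge[OF c e] .
    then show ?thesis using part_unique[OF P T T'(1) _ T'(2)] part_unique[OF P T T'(1) _ T'(3)] by blast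
  qed
  have "linked G F u (tail G e) \<longleftrightarrow> tail G e \<in> pX T" if e: "e \<in># F" for e
  proof
    assume "linked G F u (tail G e)"
    then show "tail G e \<in> pX T" using u(1) closed by (rule linked_closed)
  next
    assume "tail G e \<in> pX T"
    then have "linked G (pM T) u (tail G e)" using c T u(1) by (auto simp: comps_of_def lconn_def)
    moreover have "pM T \<subseteq># F" using c T mset_sub_sum_list[of "pM T" "map pM Ts"] by (auto simp: comps_of_def)
    ultimately show "linked G F u (tail G e)" by (rule linked_mono)
  qed
  then show "{#e \<in># F. u \<rightarrow>\<^sup>*\<^bsub>mk_symmetric (spanned G F)\<^esub> tail G e#} = {#e \<in># F. tail G e \<in> pX T#}"
    using u(2) by (intro filter_mset_cong refl) (simp add: reachable_spanned_iff)
  show "{#e \<in># F. tail G e \<in> pX T#} = pM T" by (rule comps_of_filter[OF c T]) auto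
qed

lemma subtours_in_comps:
  assumes G: "fin_digraph G" and c: "comps_of G F Ts" and F: "eulerian G F"
  shows "subtours_in G F = pM ` {T \<in> set Ts. pM T \<noteq> {#}}"
proof -
  interpret fin_digraph G by fact
  have P: "part (verts G) Ts" using c by (simp add: comps_of_def)
  have mv: "mverts G (pM T) \<subseteq> pX T" "mverts G (pM T) \<subseteq> mverts G F" if "T \<in> set Ts" for T
    using c that by (auto simp: comps_of_def lconn_def mverts_sum_list)
  show ?thesis
  proof (intro equalityI subsetI)
    fix M assume "M \<in> subtours_in G F"
    then obtain u where u: "u \<in> mverts G F" "M = {#e \<in># F. u \<rightarrow>\<^sup>*\<^bsub>mk_symmetric (spanned G F)\<^esub> tail G e#}"
      by (auto simp: subtours_in_def)
    obtain e where e: "e \<in># F" "u = tail G e \<or> u = head G e" using u(1) by (auto simp: mverts_def)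
    obtain T where T: "T \<in> set Ts" "e \<in># pM T" "tail G e \<in> pX T" "head G e \<in> pX T" using comps_of_edge[OF c e(1)] .
    then have "M = pM T" using comps_of_component[OF c T(1) _ u(1)] e(2) u(2) by auto
    then show "M \<in> pM ` {T \<in> set Ts. pM T \<noteq> {#}}" using T(1,2) by auto
  next
    fix M assume "M \<in> pM ` {T \<in> set Ts. pM T \<noteq> {#}}"
    then obtain T where T: "T \<in> set Ts" "pM T \<noteq> {#}" "M = pM T" by auto
    then obtain e where "e \<in># pM T" by blast
    then have u: "tail G e \<in> mverts G (pM T)" by (auto simp: mverts_def)
    have "tail G e \<in> pX T" "tail G e \<in> mverts G F" using u mv[OF T(1)] by auto
    from comps_of_component[OF c T(1) this] T(3)
    have "M = {#e' \<in># F. tail G e \<rightarrow>\<^sup>*\<^bsub>mk_symmetric (spanned G F)\<^esub> tail G e'#}" by (simp only:)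
    then show "M \<in> subtours_in G F" using u mv[OF T(1)] unfolding subtours_in_def by blast
  qed
qed

lemma weight_sum: "finite S \<Longrightarrow> weight I (\<Sum>T\<in>S. g T) = (\<Sum>T\<in>S. weight I (g T))"
  by (induction S rule: finite_induct) (auto simp: weight_def)

lemma weight_intersecting_part:
  assumes G: "fin_digraph G" and c: "comps_of G F Ts" and F: "eulerian G F"
  shows "weight I (intersecting_part G B F) =
    (\<Sum>T\<leftarrow>filter (\<lambda>T. pX T \<inter> mverts G B \<noteq> {}) Ts. weight I (pM T))"
proof -
  have P: "part (verts G) Ts" using c by (simp add: comps_of_def)
  let ?S = "{T \<in> set Ts. pM T \<noteq> {#} \<and> pX T \<inter> mverts G B \<noteq> {}}"
  have mv: "mverts G (pM T) = pX T" if "T \<in> set Ts" "pM T \<noteq> {#}" for T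
    using c that lconn_mverts[of G "pX T" "pM T"] by (auto simp: comps_of_def)
  have "{T \<in> subtours_in G F. mverts G T \<inter> mverts G B \<noteq> {}} = pM ` ?S"
    unfolding subtours_in_comps[OF assms] using mv by auto
  \<comment> \<open>\<open>subtours_in\<close> is a set of multisets; injectivity ensures that no
    weight is lost by identifying equal components.\<close>
  moreover have inj: "inj_on pM ?S"
  proof (rule inj_onI)
    fix T T' assume T: "T \<in> ?S" "T' \<in> ?S" "pM T = pM T'"
    then have eq: "pX T = pX T'" using mv[of T] mv[of T'] by simp
    obtain v where "v \<in> pX T" using part_nonempty[OF P] T(1) by blast
    then show "T = T'" using part_unique[OF P, of T T' v] T(1,2) eq by auto
  qed
  ultimately have "weight I (intersecting_part G B F) = (\<Sum>T\<in>?S. weight I (pM T))"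
    by (simp add: intersecting_part_def sum.reindex[OF inj] weight_sum)
  also have "\<dots> = (\<Sum>T\<in>{T \<in> set Ts. pX T \<inter> mverts G B \<noteq> {}}. weight I (pM T))"
    by (rule sum.mono_neutral_left) (auto simp: weight_def)
  also have "\<dots> = (\<Sum>T\<leftarrow>filter (\<lambda>T. pX T \<inter> mverts G B \<noteq> {}) Ts. weight I (pM T))"
    using sum_list_distinct_conv_sum_set[of "filter (\<lambda>T. pX T \<inter> mverts G B \<noteq> {}) Ts" "\<lambda>T. weight I (pM T)"]
      part_distinct[OF P] by simp
  finally show ?thesis .
qed

lemma weight_edge_nonneg:
  assumes "is_instance I"
  shows "0 \<le> weight_edge I e"
  using assms by (auto simp: weight_edge_def is_instance_def intro!: sum_nonneg)

text \<open>For empty \<open>B\<close> the single part \<open>V\<close> is a valid partition, as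
  \<open>G\<close> is strongly connected, but no edge leaves \<open>V\<close>, so no output solves
  it.\<close>

lemma subtour_nonempty:
  assumes I: "is_instance I" and A: "solves_spc A I B"
  shows "B \<noteq> {#}"
proof
  assume B: "B = {#}"
  interpret fin_digraph "gr I" using I by (simp add: is_instance_def)
  have sc: "strongly_connected (gr I)" using I by (simp add: is_instance_def)
  have "arcs_ends (gr I \<restriction> verts (gr I)) = arcs_ends (gr I)"
    by (auto simp: arcs_ends_def arc_to_ends_def induce_subgraph_def)
  then have r: "strongly_connected (gr I \<restriction> verts (gr I))" using sc
    by (simp add: strongly_connected_def reachable_def)
  have "valid_parts I B [verts (gr I)]"
    using sc B r by (auto simp: valid_parts_def strongly_connected_def[of "gr I"] partition_on_def disjoint_def)
  then have "spc_solution I [verts (gr I)] (fst (A I B [verts (gr I)]))" using A by (simp add: solves_spc_def)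
  then have "{#e \<in># fst (A I B [verts (gr I)]). e \<in> cut_out (gr I) (verts (gr I))#} \<noteq> {#}"
    unfolding spc_solution_def by force
  moreover have "cut_out (gr I) (verts (gr I)) = {}" by (auto simp: cut_out_def)
  ultimately show False by simp
qed

section \<open>Partitions as queries to the algorithm\<close>

lemma djl_distinct_map:
  assumes "djl L" "\<forall>Y\<in>set L. pX Y \<noteq> {}"
  shows "distinct (map pX L)" "disjoint (set (map pX L))"
proof -
  show "distinct (map pX L)" using assms by (induction L) (simp, force)
  show "disjoint (set (map pX L))" using djl_unique[OF assms(1)]
    by (auto simp: disjoint_def)
qed

text \<open>The costs \<open>c\<close> with factor \<open>\<alpha>\<close> are kept apart from
  \<open>lb\<close> with the factor \<open>\<alpha>'\<close> of the algorithm. They are compared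
  only through \<open>lb_le\<close>, which leaves room for perturbed costs.\<close>

locale light_setting = subtour_setting "gr I" "weight_edge I" B c \<alpha> \<beta> h K f
  for I :: "('v,'e) inst" and B c \<alpha> \<beta> h K f +
  fixes A :: "('v,'e) alg" and \<alpha>' :: real
  assumes inst: "is_instance I" and solves: "solves_spc A I B" and lt: "light A \<alpha>' \<beta> I B"
    and lb_le: "\<And>X. X \<subseteq> verts (gr I) - mverts (gr I) B \<Longrightarrow> \<alpha>' * lb I X \<le> \<alpha> * sum c X"
begin

lemma wt_weight: "wt M = weight I M"
  by (simp add: wt_def weight_def)

abbreviation query_of :: "('v,'e) piece list \<Rightarrow> 'v set list" where
  "query_of E \<equiv> map pX (filter free E)"

lemma free_iff:
  assumes "Einv H Q E" "Y \<in> set E"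
  shows "free Y \<longleftrightarrow> Y \<noteq> Bp"
  using Einv_disjoint_B[OF assms] b0 by (auto simp: free_def touch_def)

lemma valid_query:
  assumes E: "Einv H Q E"
  shows "valid_parts I B (query_of E)"
proof -
  let ?L = "filter free E"
  have P: "part V E" using E by (simp add: Einv_def)
  have BE: "Bp \<in> set E" using E by (simp add: Einv_def)
  have L: "Y \<in> set ?L \<longleftrightarrow> Y \<in> set E \<and> Y \<noteq> Bp" for Y using free_iff[OF E, of Y] by auto
  have dj: "djl ?L" using P by (simp add: part_def djl_filter)
  have ne: "\<forall>Y\<in>set ?L. pX Y \<noteq> {}" using P by (auto simp: part_def)
  have "(\<Union>Y\<in>set ?L. pX Y) = V - VB"
  proof (intro equalityI subsetI)
    fix v assume "v \<in> (\<Union>Y\<in>set ?L. pX Y)"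
    then obtain Y where Y: "Y \<in> set E" "Y \<noteq> Bp" "v \<in> pX Y" using L by auto
    then show "v \<in> V - VB" using Einv_disjoint_B[OF E Y(1,2)] part_subset[OF P Y(1)] by auto
  next
    fix v assume v: "v \<in> V - VB"
    then obtain Y where Y: "Y \<in> set E" "v \<in> pX Y" using part_cover[OF P, of v] by blast
    moreover have "Y \<noteq> Bp" using v Y by auto
    ultimately show "v \<in> (\<Union>Y\<in>set ?L. pX Y)" using L by blast
  qed
  moreover have "strongly_connected (gr I \<restriction> pX Y)" if "Y \<in> set ?L" for Y
    using that E part_subset[OF P, of Y] by (intro strongly_connected_induce[OF G, of "pM Y"]) (auto simp: Einv_def)
  ultimately show ?thesis
    using djl_distinct_map[OF dj] ne by (auto simp: valid_parts_def partition_on_def)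
qed

lemma spc_out_query:
  assumes E: "Einv H Q E" and c: "comps_of (gr I) (fst (A I B (query_of E))) Ts"
  shows "spc_out E Ts"
proof -
  let ?F = "fst (A I B (query_of E))"
  note vq = valid_query[OF E]
  have sol: "spc_solution I (query_of E) ?F" using solves vq by (simp add: solves_spc_def)
  then have eu: "eulerian (gr I) ?F" by (simp add: spc_solution_def)
  have P: "part V Ts" using c by (simp add: comps_of_def)
  have lc: "lconn (gr I) (pX T) (pM T)" if "T \<in> set Ts" for T using c that by (simp add: comps_of_def)
  have lt1: "\<forall>T\<in>subtours_in (gr I) ?F. mverts (gr I) T \<inter> VB = {} \<longrightarrow> weight I T \<le> \<alpha>' * lb I (mverts (gr I) T)"
    and lt2: "weight I (intersecting_part (gr I) B ?F) \<le> \<beta>"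
    using lt vq by (simp_all add: light_def Let_def)
  have "wt (pM T) \<le> \<alpha> * cX T" if T: "T \<in> set Ts" "free T" for T
  proof (cases "pM T = {#}")
    case True then show ?thesis using params c_sum_nonneg by simp
  next
    case False
    then have s: "pM T \<in> subtours_in (gr I) ?F" using T by (auto simp: subtours_in_comps[OF G c eu])
    have X: "mverts (gr I) (pM T) = pX T" by (rule lconn_mverts[OF lc[OF T(1)] False])
    have d: "pX T \<inter> VB = {}" using T(2) by (simp add: free_def touch_def)
    have "weight I (pM T) \<le> \<alpha>' * lb I (pX T)" using bspec[OF lt1 s] unfolding X using d by blast
    also have "\<dots> \<le> \<alpha> * cX T" using d part_subset[OF P T(1)] by (intro lb_le) auto
    finally show ?thesis by (simp add: wt_weight)
  qed
  moreover have "(\<Sum>T\<leftarrow>filter (\<lambda>T. \<not> free T) Ts. wt (pM T)) \<le> \<beta>"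
    using lt2 by (simp add: weight_intersecting_part[OF G c eu] wt_weight free_def touch_def)
  \<comment> \<open>An edge of the solution that leaves \<open>Y\<close> has both ends in one
    component, which therefore touches \<open>Y\<close> and is not contained in it.\<close>
  moreover have "\<exists>T\<in>set Ts. crossP T Y" if Y: "Y \<in> set E" "Y \<noteq> Bp" for Y
  proof -
    have "pX Y \<in> set (query_of E)" using Y free_iff[OF E Y(1)] by auto
    then have "1 \<le> size {#e \<in># ?F. e \<in> cut_out (gr I) (pX Y)#}" using sol unfolding spc_solution_def by blast
    then have "{#e \<in># ?F. e \<in> cut_out (gr I) (pX Y)#} \<noteq> {#}" by force
    then obtain e where e: "e \<in># ?F" "e \<in> cut_out (gr I) (pX Y)" by (auto simp: filter_mset_empty)
    obtain T where T: "T \<in> set Ts" "tail (gr I) e \<in> pX T" "head (gr I) e \<in> pX T"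
      using comps_of_edge[OF c e(1)] .
    then have "crossP T Y" using e(2) by (auto simp: crossP_def touch_def cut_out_def)
    then show ?thesis using T(1) by blast
  qed
  ultimately show ?thesis using P lc comps_of_eulerian[OF c _ eu] by (auto simp: spc_out_def)
qed

end

subsection \<open>Improving the initial pieces\<close>

definition unionP :: "('v,'e) piece list \<Rightarrow> ('v,'e) piece" where
  "unionP Ts = Piece (\<Union>T\<in>set Ts. pX T) (sum_list (map pM Ts)) 0 False"

lemma unionP_simps [simp]: "pX (unionP Ts) = (\<Union>T\<in>set Ts. pX T)" "pM (unionP Ts) = sum_list (map pM Ts)"
  by (simp_all add: unionP_def)

definition dissolve :: "('v \<Rightarrow> real) \<Rightarrow> 'v list \<Rightarrow> ('v,'e) piece list \<Rightarrow> ('v,'e) piece list \<Rightarrow> ('v,'e) piece list" where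
  "dissolve c vs drp H = singles c vs @ filter (\<lambda>q. \<forall>r\<in>set drp. \<not> touch r q) H"

text \<open>\<open>absorb\<close> labels the new piece with the largest label it swallows, whereas a
  piece of \<open>H\<close> must be labelled with its cost.\<close>

definition reset_hd :: "('v \<Rightarrow> real) \<Rightarrow> ('v,'e) piece list \<Rightarrow> ('v,'e) piece list" where
  "reset_hd c L = Piece (pX (hd L)) (pM (hd L)) (sum c (pX (hd L))) False # tl L"

definition improve :: "('v \<Rightarrow> real) \<Rightarrow> 'v list \<Rightarrow> ('v,'e) piece list \<Rightarrow> ('v,'e) piece list \<Rightarrow> ('v,'e) piece list \<Rightarrow> ('v,'e) piece list" where
  "improve c vs drp Ts H = reset_hd c (absorb (unionP Ts) (dissolve c vs drp H))"

lemma sum_list_filter_compl_real: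
  "(\<Sum>x\<leftarrow>filter P xs. g x) + (\<Sum>x\<leftarrow>filter (\<lambda>x. \<not> P x) xs. g x) = (\<Sum>x\<leftarrow>xs. g x :: 'b::comm_monoid_add)"
  by (induction xs) (auto simp: ac_simps)

lemma mem_kept_iff:
  assumes P: "part U H" and drp: "set drp \<subseteq> set H"
  shows "q \<in> set (filter (\<lambda>q. \<forall>r\<in>set drp. \<not> touch r q) H) \<longleftrightarrow> q \<in> set H \<and> q \<notin> set drp"
    (is "q \<in> set ?kept \<longleftrightarrow> _")
  proof
    assume q: "q \<in> set ?kept"
    have "q \<notin> set drp"
    proof
      assume "q \<in> set drp"
      then have "\<not> touch q q" using q by auto
      then show False using part_nonempty[OF P, of q] q by (simp add: touch_def)
    qed
    then show "q \<in> set H \<and> q \<notin> set drp" using q by simp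
  next
    assume q: "q \<in> set H \<and> q \<notin> set drp"
    have "\<not> touch r q" if "r \<in> set drp" for r
    proof
      assume "touch r q"
      then obtain v where "v \<in> pX r" "v \<in> pX q" by (auto simp: touch_def)
      then have "r = q" using part_unique[OF P, of r q v] drp that q by blast
      then show False using that q by simp
    qed
    then show "q \<in> set ?kept" using q by simp
  qed

lemma part_dissolve:
  assumes P: "part U H" and drp: "set drp \<subseteq> set H" and vs: "distinct vs" "set vs = (\<Union>q\<in>set drp. pX q)"
  shows "part U (dissolve c vs drp H)"
proof -
  let ?kept = "filter (\<lambda>q. \<forall>r\<in>set drp. \<not> touch r q) H"
  note kept = mem_kept_iff[OF P drp]
  have U_drp: "(\<Union>q\<in>set drp. pX q) \<subseteq> U" using part_subset[OF P] drp by blast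
  have disj: "pX q \<inter> (\<Union>q\<in>set drp. pX q) = {}" if "q \<in> set ?kept" for q
    using that by (auto simp: touch_def)
  have "djl (singles c vs @ ?kept)" unfolding djl_append
  proof (intro conjI ballI)
    show "djl (singles c vs)" using part_singles[OF vs(1), of c] unfolding part_def by blast
    show "djl ?kept" using P by (simp add: part_def djl_filter)
    fix p q assume "p \<in> set (singles c vs)" and q: "q \<in> set ?kept"
    then obtain v where "v \<in> set vs" "pX p = {v}" by (auto simp: singles_def)
    then show "pX p \<inter> pX q = {}" using disj[OF q] vs(2) by auto
  qed
  moreover have "(\<Union>p\<in>set (singles c vs @ ?kept). pX p) = U"
  proof
    show "(\<Union>p\<in>set (singles c vs @ ?kept). pX p) \<subseteq> U"
      using U_drp part_subset[OF P] vs(2) by (auto simp: singles_def)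
    show "U \<subseteq> (\<Union>p\<in>set (singles c vs @ ?kept). pX p)"
    proof
      fix v assume v: "v \<in> U"
      obtain q where q: "q \<in> set H" "v \<in> pX q" using part_cover[OF P v] by blast
      show "v \<in> (\<Union>p\<in>set (singles c vs @ ?kept). pX p)"
      proof (cases "q \<in> set drp")
        case True
        then have "v \<in> set vs" using q vs(2) by auto
        then show ?thesis by (auto simp: singles_def)
      next
        case False
        then have "q \<in> set ?kept" using q kept[of q] by blast
        then show ?thesis using q by (intro UN_I[of q]) auto
      qed
    qed
  qed
  moreover have "\<forall>p\<in>set (singles c vs @ ?kept). pX p \<noteq> {}"
    using part_nonempty[OF P] by (auto simp: singles_def)
  ultimately show ?thesis by (simp add: part_def dissolve_def)
  qed

section \<open>Effect of an improvement, and progress by remembering subtours\<close>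

context subtour_setting begin

text \<open>\<open>Kt\<close> are the touched pieces that stay whole, \<open>N\<close> is the cost
  of the new piece, and \<open>W\<close> is its weight bound without the factor
  \<open>\<alpha>\<close>. The condition \<open>star\<close> gives connectivity: several subtours
  need not meet each other, so they must share a touched piece that is kept. The function
  \<open>g\<close> is left open to serve both potentials.\<close>

lemma improve_spec:
  fixes g :: "real \<Rightarrow> 'b::linordered_semidom"
  assumes H: "Hinv H" and drp: "set drp \<subseteq> set H" "\<And>q. q \<in> set drp \<Longrightarrow> touch (unionP Ts) q"
    and vs: "distinct vs" "set vs = (\<Union>q\<in>set drp. pX q)"
    and Ts: "Ts \<noteq> []" "\<And>T. T \<in> set Ts \<Longrightarrow> cyc T"
    and star: "length Ts = 1 \<or> (\<exists>j\<in>set H. j \<notin> set drp \<and> (\<forall>T\<in>set Ts. touch T j))"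
    and g: "\<And>x. 0 \<le> g x"
  defines "Kt \<equiv> filter (\<lambda>q. touch (unionP Ts) q \<and> q \<notin> set drp) H"
  defines "N \<equiv> (\<Sum>q\<leftarrow>Kt. cX q) + sum c (pX (unionP Ts) \<inter> (\<Union>q\<in>set drp. pX q))"
  assumes W: "h * (\<Sum>q\<leftarrow>Kt. cX q) + (\<Sum>T\<leftarrow>Ts. cX T) \<le> h * N"
  shows "Hinv (improve c vs drp Ts H)"
    and "g N + (\<Sum>q\<leftarrow>filter (\<lambda>q. \<not> touch (unionP Ts) q) H. g (pl q)) \<le> (\<Sum>q\<leftarrow>improve c vs drp Ts H. g (pl q))"
    and "cX (unionP Ts) \<le> N"
proof -
  let ?T = "unionP Ts" and ?U = "V - VB"
  have P: "part ?U H" using H by (simp add: Hinv_def)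
  let ?kept = "filter (\<lambda>q. \<forall>r\<in>set drp. \<not> touch r q) H"
  let ?D = "dissolve c vs drp H"
  let ?S = "filter (touch ?T) ?D"
  let ?J = "joined ?T ?S"
  note kept = mem_kept_iff[OF P drp(1)]
  have H_fin: "finite (pX q)" if "q \<in> set H" for q
    using part_subset[OF P that] finite_subset[OF _ finite_V] by blast
  have disj: "pX q \<inter> (\<Union>q\<in>set drp. pX q) = {}" if "q \<in> set ?kept" for q
    using that by (auto simp: touch_def)
  have PD: "part ?U ?D" by (rule part_dissolve[OF P drp(1) vs])
  have TU: "pX ?T \<subseteq> ?U" using Ts(2) by (auto simp: cyc_def)
  have Tne: "pX ?T \<noteq> {}" using Ts by (auto simp: cyc_def lconn_def neq_Nil_conv)
  have Dp: "lconn G (pX q) (pM q) \<and> eulerian G (pM q) \<and> \<not> ps q \<and> pl q = cX q \<and> wt (pM q) \<le> h * \<alpha> * cX q"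
    if "q \<in> set ?D" for q
  proof (cases "q \<in> set (singles c vs)")
    case True
    then show ?thesis using params by (auto simp: singles_def lconn_single c_nonneg)
  next
    case False
    then have "q \<in> set H" using that by (simp add: dissolve_def)
    then show ?thesis using H by (simp add: Hinv_def)
  qed
  have PA: "part ?U (absorb ?T ?D)" by (rule part_absorb[OF PD TU Tne])
  have SK: "?S = filter (touch ?T) (singles c vs) @ Kt"
  proof -
    have "filter (touch ?T) ?kept = filter (\<lambda>q. touch ?T q \<and> q \<notin> set drp) H"
      using kept unfolding filter_filter by (intro filter_cong) auto
    then show ?thesis by (simp add: dissolve_def Kt_def)
  qed
  have XJ: "pX ?J = (\<Union>q\<in>set Kt. pX q) \<union> (pX ?T \<inter> (\<Union>q\<in>set drp. pX q))"
    unfolding pX_joined SK by (auto simp: singles_def touch_def vs(2)[symmetric])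
  have MJ: "pM ?J = sum_list (map pM Ts) + sum_list (map pM Kt)"
  proof -
    have "sum_list (map pM (filter P (singles c vs))) = {#}" for P :: "('v,'e) piece \<Rightarrow> bool"
      by (induction vs) (auto simp: singles_def)
    then show ?thesis unfolding pM_joined SK by simp
  qed
  have KtH: "q \<in> set Kt \<Longrightarrow> q \<in> set H \<and> q \<in> set ?kept" for q using kept[of q] by (auto simp: Kt_def)
  have cJ: "cX ?J = N"
  proof -
    have "sum c (\<Union>q\<in>set Kt. pX q) = (\<Sum>q\<leftarrow>Kt. cX q)"
    proof (rule sum_djl)
      show "djl Kt" using P by (simp add: Kt_def part_def djl_filter)
    qed (use KtH H_fin in blast)
    moreover have "sum c (pX ?J) = sum c (\<Union>q\<in>set Kt. pX q) + sum c (pX ?T \<inter> (\<Union>q\<in>set drp. pX q))"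
      unfolding XJ
    proof (rule sum.union_disjoint)
      show "finite (\<Union>q\<in>set Kt. pX q)" using KtH H_fin by auto
      show "finite (pX ?T \<inter> (\<Union>q\<in>set drp. pX q))" using H_fin drp(1) by auto
      show "(\<Union>q\<in>set Kt. pX q) \<inter> (pX ?T \<inter> (\<Union>q\<in>set drp. pX q)) = {}" using disj KtH by blast
    qed
    ultimately show ?thesis by (simp add: N_def)
  qed
  have TJ: "pX ?T \<subseteq> pX ?J" by (rule absorb_touched(2)[OF PD TU Tne])
  have JU: "pX ?J \<subseteq> ?U" by (rule part_subset[OF PA]) (simp add: absorb_def)
  have fJ: "finite (pX ?J)" by (rule finite_subset[OF JU]) simp
  show "cX ?T \<le> N" using c_sum_mono[OF TJ fJ] unfolding cJ .
  have Tmv: "mverts G (pM ?T) \<subseteq> pX ?T"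
  proof -
    have "mverts G (pM T) \<subseteq> pX T" if "T \<in> set Ts" for T using Ts(2)[OF that] by (simp add: cyc_def lconn_def)
    then show ?thesis by (auto simp: mverts_sum_list)
  qed
  have sub1: "pM T \<subseteq># pM ?J" if "T \<in> set Ts" for T
  proof -
    have "pM T \<subseteq># sum_list (map pM Ts)" using that by (intro mset_sub_sum_list) simp
    then show ?thesis unfolding MJ by (rule subset_mset.order_trans) simp
  qed
  have sub2: "pM q \<subseteq># pM ?J" if "q \<in> set Kt" for q
  proof -
    have "pM q \<subseteq># sum_list (map pM Kt)" using that by (intro mset_sub_sum_list) simp
    then show ?thesis unfolding MJ by (rule subset_mset.order_trans) simp
  qed
  have Tl: "linked G (pM ?J) x y" if "T \<in> set Ts" "x \<in> pX T" "y \<in> pX T" for T x y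
  proof -
    have "linked G (pM T) x y" using Ts(2)[OF that(1)] that(2,3) by (simp add: cyc_def lconn_def)
    then show ?thesis by (rule linked_mono[OF _ sub1[OF that(1)]])
  qed
  have "\<exists>r. \<forall>x\<in>pX ?T. linked G (pM ?J) x r"
    using star
  proof
    assume "length Ts = 1"
    then obtain T where T: "Ts = [T]" by (cases Ts) auto
    obtain r where r: "r \<in> pX T" using Tne T by auto
    have "\<forall>x\<in>pX ?T. linked G (pM ?J) x r" using Tl[of T] T r by simp
    then show ?thesis ..
  next
    assume "\<exists>j\<in>set H. j \<notin> set drp \<and> (\<forall>T\<in>set Ts. touch T j)"
    then obtain j where j: "j \<in> set H" "j \<notin> set drp" "\<forall>T\<in>set Ts. touch T j" by blast
    obtain T0 where T0: "T0 \<in> set Ts" using Ts(1) by (cases Ts) auto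
    have "touch ?T j" using j(3) T0 by (auto simp: touch_def)
    then have jK: "j \<in> set Kt" using j by (simp add: Kt_def)
    obtain r where r: "r \<in> pX j" using part_nonempty[OF P j(1)] by blast
    have "linked G (pM ?J) x r" if x: "x \<in> pX ?T" for x
    proof -
      obtain T where T: "T \<in> set Ts" "x \<in> pX T" using x by auto
      obtain y where y: "y \<in> pX T" "y \<in> pX j" using j(3) T(1) by (auto simp: touch_def)
      have "linked G (pM j) y r" using H j(1) y(2) r by (simp add: Hinv_def lconn_def)
      then have "linked G (pM ?J) y r" by (rule linked_mono[OF _ sub2[OF jK]])
      with Tl[OF T y(1)] show ?thesis by (rule linked_trans)
    qed
    then show ?thesis by blast
  qed
  then obtain r where r: "\<And>x. x \<in> pX ?T \<Longrightarrow> linked G (pM ?J) x r" by blast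
  have lJ: "lconn G (pX ?J) (pM ?J)"
    by (rule lconn_joined[OF PD TU Tne Tmv _ r]) (use Dp in auto)
  have eJ: "eulerian G (pM ?J)"
    unfolding MJ using Ts(2) KtH H by (intro eulerian_plus eulerian_sum_list) (auto simp: cyc_def Hinv_def)
  have wJ: "wt (pM ?J) \<le> h * \<alpha> * cX ?J"
  proof -
    have "wt (pM ?J) = (\<Sum>T\<leftarrow>Ts. wt (pM T)) + (\<Sum>q\<leftarrow>Kt. wt (pM q))"
      unfolding MJ by (simp add: wt_sum_list comp_def)
    also have "\<dots> \<le> (\<Sum>T\<leftarrow>Ts. \<alpha> * cX T) + (\<Sum>q\<leftarrow>Kt. h * \<alpha> * cX q)"
      using Ts(2) KtH H by (intro add_mono sum_list_mono) (auto simp: cyc_def Hinv_def)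
    also have "\<dots> = \<alpha> * (h * (\<Sum>q\<leftarrow>Kt. cX q) + (\<Sum>T\<leftarrow>Ts. cX T))"
      by (simp add: sum_list_const_mult algebra_simps)
    also have "\<dots> \<le> \<alpha> * (h * N)" using W params(1) by (rule mult_left_mono)
    finally show ?thesis unfolding cJ by (simp only: mult.assoc mult.left_commute)
  qed
  let ?J' = "Piece (pX ?J) (pM ?J) (cX ?J) False"
  have imp: "improve c vs drp Ts H = ?J' # filter (\<lambda>q. \<not> touch ?T q) ?D"
    by (simp add: improve_def reset_hd_def absorb_def)
  have "part ?U (?J' # filter (\<lambda>q. \<not> touch ?T q) ?D)"
    using PA by (simp add: part_def absorb_def)
  then show "Hinv (improve c vs drp Ts H)"
    unfolding Hinv_def imp using lJ eJ wJ Dp by auto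
  have "filter (\<lambda>q. \<not> touch ?T q) ?kept = filter (\<lambda>q. \<not> touch ?T q) H"
    using kept drp(2) unfolding filter_filter by (intro filter_cong) auto
  then have fD: "filter (\<lambda>q. \<not> touch ?T q) ?D =
      filter (\<lambda>q. \<not> touch ?T q) (singles c vs) @ filter (\<lambda>q. \<not> touch ?T q) H"
    by (simp only: dissolve_def filter_append)
  have plJ: "pl ?J' = N" using cJ by (simp only: piece.sel)
  have "(\<Sum>q\<leftarrow>improve c vs drp Ts H. g (pl q)) = g N +
      ((\<Sum>q\<leftarrow>filter (\<lambda>q. \<not> touch ?T q) (singles c vs). g (pl q)) +
       (\<Sum>q\<leftarrow>filter (\<lambda>q. \<not> touch ?T q) H. g (pl q)))"
    unfolding imp list.map sum_list.Cons plJ fD map_append sum_list_append by (rule refl)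
  \<comment> \<open>Vertices of dissolved pieces that are not rejoined remain as single pieces; they
    can only add to the potential.\<close>
  moreover have "0 \<le> (\<Sum>q\<leftarrow>filter (\<lambda>q. \<not> touch ?T q) (singles c vs). g (pl q))"
    using g by (intro sum_list_nonneg) auto
  ultimately show "g N + (\<Sum>q\<leftarrow>filter (\<lambda>q. \<not> touch (unionP Ts) q) H. g (pl q)) \<le> (\<Sum>q\<leftarrow>improve c vs drp Ts H. g (pl q))"
    by (simp add: add_left_mono)
qed

text \<open>A triple records that a remembered subtour joins \<open>u\<close> and \<open>v\<close>
  cheaply relative to the label of \<open>p\<close>. The number of triples is the measure of what
  has been remembered.\<close>

definition bits :: "('v,'e) piece list \<Rightarrow> ('v,'e) piece list \<Rightarrow> ('v \<times> 'v \<times> ('v,'e) piece) set" where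
  "bits H Q = {(u, v, p). u \<in> V \<and> v \<in> V \<and> p \<in> set H \<and> (\<exists>C\<in>set Q. u \<in> pX C \<and> v \<in> pX C \<and> cX C \<le> K * pl p)}"

lemma bits_sub: "bits H Q \<subseteq> V \<times> V \<times> set H"
  by (auto simp: bits_def)

lemma finite_bits: "finite (bits H Q)"
  by (rule finite_subset[OF bits_sub]) simp

lemma card_bits: "part (V - VB) H \<Longrightarrow> card (bits H Q) \<le> card V ^ 3"
proof -
  assume P: "part (V - VB) H"
  have "card (bits H Q) \<le> card (V \<times> V \<times> set H)" by (rule card_mono[OF _ bits_sub]) simp
  also have "\<dots> = card V * (card V * card (set H))" by (simp add: card_cartesian_product)
  also have "\<dots> \<le> card V * (card V * card V)"
    using card_length[of H] part_length[OF P] card_mono[of V "V - VB"] by simp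
  finally show ?thesis by (simp add: power3_eq_cube mult.assoc)
qed

text \<open>Take \<open>u\<close> in both \<open>T\<close> and \<open>Y\<close>, \<open>v\<close> in
  \<open>T\<close> outside \<open>Y\<close>, and \<open>p\<close> in \<open>H\<close> with the label
  of \<open>Y\<close>. Had this triple been present, a remembered subtour would cross the sealed
  piece \<open>Y\<close> cheaply.\<close>

lemma bits_grow:
  assumes E: "Einv H Q E" and T: "pX T \<subseteq> V" and Y: "Y \<in> set E" "ps Y" "crossP T Y" "cX T \<le> K * pl Y"
  shows "card (bits H Q) < card (bits H (T # Q))"
proof (rule psubset_card_mono[OF finite_bits])
  have YB: "Y \<noteq> Bp" using Y(2) by auto
  obtain p where p: "p \<in> set H" "pl Y = pl p" using EinvD(2)[OF E Y(1) YB] by auto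
  obtain u where u: "u \<in> pX T" "u \<in> pX Y" using Y(3) by (auto simp: crossP_def touch_def)
  obtain v where v: "v \<in> pX T" "v \<notin> pX Y" using Y(3) by (auto simp: crossP_def)
  have "(u, v, p) \<in> bits H (T # Q)" using u v T p Y(4) by (auto simp: bits_def)
  moreover have "(u, v, p) \<notin> bits H Q"
  proof
    assume "(u, v, p) \<in> bits H Q"
    then obtain C where C: "C \<in> set Q" "u \<in> pX C" "v \<in> pX C" "cX C \<le> K * pl p" by (auto simp: bits_def)
    then have "crossP C Y" using u v by (auto simp: crossP_def touch_def)
    from EinvD(6)[OF E Y(1) YB Y(2) C(1) this] C(4) p(2) show False by simp
  qed
  moreover have "bits H Q \<subseteq> bits H (T # Q)" by (auto simp: bits_def)
  ultimately show "bits H Q \<subset> bits H (T # Q)" by blast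
qed

lemma crossing_cyc:
  assumes "spc_out E Ts" "T \<in> set (filter free (crossing E Ts))"
  shows "cyc T"
proof -
  have T: "T \<in> set Ts" "free T" using assms(2) by (auto simp: crossing_def)
  moreover have "pX T \<subseteq> V" using assms(1) T(1) part_subset[of V Ts T] by (simp add: spc_out_def)
  ultimately show ?thesis using assms(1) by (auto simp: spc_out_def cyc_def free_def touch_def)
qed

lemma crossing_djl:
  assumes "spc_out E Ts"
  shows "djl (filter P (filter free (crossing E Ts)))"
  using assms by (simp add: spc_out_def part_def crossing_def djl_filter)

lemma grp_touched:
  assumes "\<And>T. T \<in> set Ts \<Longrightarrow> grp H p T" "q \<in> set H" "touch (unionP Ts) q"
  shows "pl q \<le> pl p"
proof -
  obtain T where "T \<in> set Ts" "touch T q" using assms(3) by (auto simp: touch_def)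
  then show ?thesis using assms(1,2) by (auto simp: grp_def)
qed

end

subsection \<open>Existence of a light tour\<close>

lemma finite_grows_max:
  fixes \<phi> :: "'a \<Rightarrow> nat"
  assumes "P x0" "\<And>x. P x \<Longrightarrow> \<phi> x \<le> N"
  obtains x where "P x" "\<And>y. P y \<Longrightarrow> \<phi> y \<le> \<phi> x"
proof -
  have "\<forall>y. P y \<longrightarrow> \<phi> y < Suc N" using assms(2) by (simp add: less_Suc_eq_le)
  from ex_has_greatest_nat[of P x0 \<phi>, OF assms(1) this] that show ?thesis by blast
qed

context subtour_setting begin

lemma Hinv_singles: "distinct vs \<Longrightarrow> set vs = V - VB \<Longrightarrow> Hinv (singles c vs)"
  using part_singles[of vs c] params c_nonneg
  by (auto simp: Hinv_def singles_def lconn_single)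

text \<open>Larger labels dominate: \<open>rk\<close> is the position of a label among all possible ones, and one
  piece of larger rank outweighs any partition into pieces of smaller rank.\<close>

definition rk :: "real \<Rightarrow> nat" where "rk r = card {x \<in> sum c ` Pow V. x < r}"
definition gex :: "real \<Rightarrow> nat" where "gex r = (card V + 1) ^ rk r"

lemma rk_mono: "r \<le> s \<Longrightarrow> rk r \<le> rk s"
  unfolding rk_def by (intro card_mono) auto

lemma rk_less: "X \<subseteq> V \<Longrightarrow> sum c X < s \<Longrightarrow> rk (sum c X) < rk s"
  unfolding rk_def by (intro psubset_card_mono) (auto simp: psubset_eq)

lemma gex_mono: "r \<le> s \<Longrightarrow> gex r \<le> gex s"
  unfolding gex_def by (intro power_increasing rk_mono) auto

lemma gex_dominates:
  assumes L: "length L \<le> card V" "\<And>q. q \<in> set L \<Longrightarrow> pl q \<le> sum c X" and X: "X \<subseteq> V" "sum c X < N"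
  shows "(\<Sum>q\<leftarrow>L. gex (pl q)) < gex N"
proof -
  have "(\<Sum>q\<leftarrow>L. gex (pl q)) \<le> (\<Sum>q\<leftarrow>L. gex (sum c X))"
    using L(2) by (intro sum_list_mono gex_mono) auto
  also have "\<dots> \<le> card V * gex (sum c X)" using L(1) by (simp add: sum_list_triv)
  also have "\<dots> < (card V + 1) * gex (sum c X)" by (simp add: gex_def)
  also have "\<dots> = (card V + 1) ^ Suc (rk (sum c X))" by (simp add: gex_def)
  also have "\<dots> \<le> gex N" unfolding gex_def using rk_less[OF X] by (intro power_increasing) auto
  finally show ?thesis .
qed

definition \<Phi> :: "('v,'e) piece list \<Rightarrow> nat" where "\<Phi> H = (\<Sum>q\<leftarrow>H. gex (pl q))"

lemma \<Phi>_bound: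
  assumes "Hinv H" shows "\<Phi> H \<le> card V * (card V + 1) ^ card (sum c ` Pow V)"
proof -
  have "gex r \<le> (card V + 1) ^ card (sum c ` Pow V)" for r
    unfolding gex_def rk_def by (intro power_increasing card_mono) auto
  then have "\<Phi> H \<le> (\<Sum>q\<leftarrow>H. (card V + 1) ^ card (sum c ` Pow V))"
    unfolding \<Phi>_def by (intro sum_list_mono)
  also have "\<dots> = length H * (card V + 1) ^ card (sum c ` Pow V)" by (simp add: sum_list_triv)
  also have "length H \<le> card V"
    using assms part_length[of "V - VB" H] card_mono[of V "V - VB"] by (simp add: Hinv_def)
  finally show ?thesis by simp
qed

lemma length_Hinv: "Hinv H \<Longrightarrow> length H \<le> card V"
  using part_length[of "V - VB" H] card_mono[of V "V - VB"] by (simp add: Hinv_def)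

text \<open>A single subtour that costs more than \<open>j\<close> becomes a piece of its own, with
  everything it touches dissolved; this gives \<open>K = 1\<close>. A larger group needs
  \<open>j\<close> to be connected. If it costs more than twice \<open>pl j\<close>, its overlap
  with the dissolved pieces exceeds half of its cost, and then \<open>h = 2\<close> pays for the
  group; this gives \<open>f = 2\<close>.\<close>

lemma improve_exists:
  assumes H: "Hinv H" and j: "j \<in> set H" and Ts: "Ts \<noteq> []" "\<And>T. T \<in> set Ts \<Longrightarrow> cyc T \<and> grp H j T"
    and dj: "djl Ts" and h2: "h = 2"
    and big: "length Ts = 1 \<and> pl j < (\<Sum>T\<leftarrow>Ts. cX T) \<or> 2 * pl j < (\<Sum>T\<leftarrow>Ts. cX T)"
  obtains H' where "Hinv H'" "\<Phi> H < \<Phi> H'"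
proof -
  let ?T = "unionP Ts"
  have P: "part (V - VB) H" using H by (simp add: Hinv_def)
  have fin: "finite (pX T)" if "T \<in> set Ts" for T
    using Ts(2)[OF that] by (intro finite_subset[of "pX T" V]) (auto simp: cyc_def)
  have L: "(\<Sum>T\<leftarrow>Ts. cX T) = cX ?T" using sum_djl[OF dj fin, of c] by simp
  have plj: "pl j = cX j" using H j by (simp add: Hinv_def)
  have plj0: "0 \<le> pl j" using plj c_sum_nonneg by simp
  define single where "single \<longleftrightarrow> length Ts = 1 \<and> pl j < (\<Sum>T\<leftarrow>Ts. cX T)"
  define drp where "drp = filter (\<lambda>q. touch ?T q \<and> (single \<or> q \<noteq> j)) H"
  define Kt where "Kt = filter (\<lambda>q. touch ?T q \<and> q \<notin> set drp) H"
  let ?N = "(\<Sum>q\<leftarrow>Kt. cX q) + sum c (pX ?T \<inter> (\<Union>q\<in>set drp. pX q))"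
  have drp: "set drp \<subseteq> set H" "\<And>q. q \<in> set drp \<Longrightarrow> touch ?T q" by (auto simp: drp_def)
  have Hf: "finite (pX q)" if "q \<in> set H" for q
    using part_subset[OF P that] by (rule finite_subset) simp
  have "finite (\<Union>q\<in>set drp. pX q)" using Hf drp(1) by (intro finite_UN_I) auto
  from finite_distinct_list[OF this] obtain vs where vs: "set vs = (\<Union>q\<in>set drp. pX q)" "distinct vs"
    by (elim exE conjE)
  obtain T0 where T0: "T0 \<in> set Ts" using Ts(1) by (cases Ts) auto
  have tj: "touch ?T j" using Ts(2)[OF T0] T0 by (auto simp: grp_def touch_def)
  have star: "length Ts = 1 \<or> (\<exists>j\<in>set H. j \<notin> set drp \<and> (\<forall>T\<in>set Ts. touch T j))"
  proof (cases single)
    case False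
    then show ?thesis using j Ts(2) by (auto simp: drp_def grp_def intro!: bexI[of _ j])
  qed (simp add: single_def)
  have Kt: "Kt = (if single then [] else [j])"
  proof (cases single)
    case True then show ?thesis by (simp add: Kt_def drp_def)
  next
    case False
    have "Kt = filter (\<lambda>q. q = j) H" unfolding Kt_def drp_def using False tj by (auto intro: filter_cong)
    also have "\<dots> = [j]" using part_distinct[OF P] j by (induction H) (auto simp: filter_empty_conv)
    finally show ?thesis using False by simp
  qed
  have cov: "pX ?T \<subseteq> (\<Union>q\<in>set drp. pX q) \<union> (\<Union>q\<in>set Kt. pX q)"
  proof
    fix v assume v: "v \<in> pX ?T"
    then have "v \<in> V - VB" using Ts(2) by (auto simp: cyc_def)
    from part_cover[OF P this] obtain q where q: "q \<in> set H" "v \<in> pX q" by blast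
    with v have "touch ?T q" by (auto simp: touch_def)
    with q show "v \<in> (\<Union>q\<in>set drp. pX q) \<union> (\<Union>q\<in>set Kt. pX q)" by (auto simp: Kt_def)
  qed
  have W: "h * (\<Sum>q\<leftarrow>Kt. cX q) + (\<Sum>T\<leftarrow>Ts. cX T) \<le> h * ?N" and big': "pl j < ?N"
  proof -
    have 1: "cX ?T \<le> sum c (pX ?T \<inter> (\<Union>q\<in>set drp. pX q)) + (\<Sum>q\<leftarrow>Kt. cX q)"
    proof -
      have "pX ?T \<subseteq> (pX ?T \<inter> (\<Union>q\<in>set drp. pX q)) \<union> (\<Union>q\<in>set Kt. pX q)" using cov by blast
      then have "cX ?T \<le> sum c ((pX ?T \<inter> (\<Union>q\<in>set drp. pX q)) \<union> (\<Union>q\<in>set Kt. pX q))"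
        using fin Hf[OF j] by (intro c_sum_mono) (auto simp: Kt)
      also have "\<dots> \<le> sum c (pX ?T \<inter> (\<Union>q\<in>set drp. pX q)) + sum c (\<Union>q\<in>set Kt. pX q)"
        using fin Hf[OF j]
        by (subst sum.union_inter[symmetric]) (auto simp: Kt c_sum_nonneg)
      also have "sum c (\<Union>q\<in>set Kt. pX q) = (\<Sum>q\<leftarrow>Kt. cX q)" by (simp add: Kt)
      finally show ?thesis by simp
    qed
    have m: "2 * pl j < cX ?T" if "\<not> single" using big that by (auto simp: single_def L)
    show "pl j < ?N"
    proof (cases single)
      case True then show ?thesis using 1 by (simp add: single_def L)
    next
      case False then show ?thesis using 1 m plj0 by simp
    qed
    show "h * (\<Sum>q\<leftarrow>Kt. cX q) + (\<Sum>T\<leftarrow>Ts. cX T) \<le> h * ?N"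
    proof (cases single)
      case True
      then have "cX ?T \<le> ?N" "0 \<le> ?N" using 1 c_sum_nonneg[of "pX ?T"] by (simp_all add: Kt)
      then show ?thesis using True by (simp add: h2 L Kt)
    next
      case False
      then have "2 * pl j < cX ?T" "cX ?T \<le> ?N" using 1 m by simp_all
      moreover have "(\<Sum>q\<leftarrow>Kt. cX q) = pl j" using False by (simp add: Kt plj)
      \<comment> \<open>With \<open>x\<close> the overlap with the dissolved pieces,
        \<open>x \<ge> t - p\<close> and \<open>t > 2 * p\<close> give
        \<open>t \<le> 2 * x\<close>.\<close>
      moreover have "2 * p < t \<Longrightarrow> t \<le> k + x \<Longrightarrow> k = p \<Longrightarrow> 2 * k + t \<le> 2 * (k + x)" for p t k x :: real
        by (simp add: algebra_simps)
      ultimately show ?thesis unfolding h2 L by blast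
    qed
  qed
  have H': "Hinv (improve c vs drp Ts H)"
    by (rule improve_spec(1)[OF H drp vs(2,1) Ts(1) _ star, of gex])
      (use Ts(2) W[unfolded Kt_def] in blast)+
  have g: "gex ?N + (\<Sum>q\<leftarrow>filter (\<lambda>q. \<not> touch ?T q) H. gex (pl q)) \<le> \<Phi> (improve c vs drp Ts H)"
    unfolding \<Phi>_def Kt_def
    by (rule improve_spec(2)[OF H drp vs(2,1) Ts(1) _ star, of gex])
      (use Ts(2) W[unfolded Kt_def] in \<open>blast | simp\<close>)+
  \<comment> \<open>All touched pieces have labels at most \<open>pl j\<close>, which is below
    \<open>?N\<close>, so the new piece outweighs even the loss of all of them.\<close>
  have "(\<Sum>q\<leftarrow>filter (touch ?T) H. gex (pl q)) < gex ?N"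
  proof (rule gex_dominates)
    show "length (filter (touch ?T) H) \<le> card V"
      using length_Hinv[OF H] length_filter_le[of "touch ?T" H] by linarith
    show "pX j \<subseteq> V" using part_subset[OF P j] by blast
    show "cX j < ?N" using big' plj by simp
    fix q assume "q \<in> set (filter (touch ?T) H)"
    then show "pl q \<le> cX j" unfolding plj[symmetric] using Ts(2) by (intro grp_touched[of Ts]) auto
  qed
  then have "\<Phi> H < \<Phi> (improve c vs drp Ts H)"
    using g sum_list_filter_compl_real[of "\<lambda>q. gex (pl q)" "touch ?T" H] unfolding \<Phi>_def by linarith
  then show ?thesis using that H' by blast
qed

end

section \<open>Existence by an optimal choice of pieces and remembered subtours\<close>

context light_setting begin

lemma components_exist:
  assumes F: "eulerian (gr I) F"
  obtains Ts where "comps_of (gr I) F Ts"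
proof -
  from finite_distinct_list[OF finite_V] obtain vs where vs: "set vs = V" "distinct vs" by (elim exE conjE)
  from finite_distinct_list[OF finite_set_mset[of F]] obtain es where es: "set es = set_mset F" "distinct es"
    by (elim exE conjE)
  have "set_mset F \<subseteq> arcs (gr I)" using F by (simp add: eulerian_def)
  from comps_of_fold[OF G this vs(2,1) es(2,1)] show ?thesis by (rule that)
qed

text \<open>Optimality of \<open>H\<close> for \<open>\<Phi>\<close>, and then of \<open>Q\<close>
  for \<open>bits H\<close>, replaces the restarts: a violation of \<open>quiet\<close> would yield
  a better \<open>H\<close> or more triples. Hence every round either ends with a tour or shortens
  the partition.\<close>

lemma light_tour_exists:
  assumes hKf: "h = 2" "K = 1" "f = 2"
  shows "\<exists>F. tour (gr I) F \<and> weight I F \<le> 5 * \<alpha> * sum c V + \<beta> + weight I B"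
proof -
  have "finite (V - VB)" by simp
  from finite_distinct_list[OF this] obtain vs where vs: "set vs = V - VB" "distinct vs" by (elim exE conjE)
  obtain H where H: "Hinv H" and Hmax: "\<And>H'. Hinv H' \<Longrightarrow> \<Phi> H' \<le> \<Phi> H"
    using finite_grows_max[of Hinv "singles c vs" \<Phi>, OF Hinv_singles[OF vs(2,1)] \<Phi>_bound] by blast
  have P: "part (V - VB) H" using H by (simp add: Hinv_def)
  obtain Q where Q: "\<forall>C\<in>set Q. cyc C" and Qmax: "\<And>Q'. \<forall>C\<in>set Q'. cyc C \<Longrightarrow> card (bits H Q') \<le> card (bits H Q)"
    using finite_grows_max[of "\<lambda>Q. \<forall>C\<in>set Q. cyc C" "[]" "\<lambda>Q. card (bits H Q)" "card V ^ 3"]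
      card_bits[OF P] by auto
  have "\<exists>F. tour (gr I) F \<and> weight I F \<le> 5 * \<alpha> * sum c V + \<beta> + weight I B" if "Einv H Q E" for E
    using that
  proof (induction "length E" arbitrary: E rule: less_induct)
    case less
    note E = less.prems
    have eu: "eulerian (gr I) (fst (A I B (query_of E)))"
      using solves valid_query[OF E] by (simp add: solves_spc_def spc_solution_def)
    then obtain Ts where c: "comps_of (gr I) (fst (A I B (query_of E))) Ts" by (rule components_exist)
    have out: "spc_out E Ts" by (rule spc_out_query[OF E c])
    let ?L = "filter free (crossing E Ts)"
    have qt: "quiet H E ?L"
      unfolding quiet_def
    proof (intro conjI ballI impI)
      fix p assume p: "p \<in> set H"
      let ?G = "filter (grp H p) ?L"
      show "(\<Sum>T\<leftarrow>?G. cX T) \<le> f * pl p"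
      proof (rule ccontr)
        assume "\<not> (\<Sum>T\<leftarrow>?G. cX T) \<le> f * pl p"
        then have big: "2 * pl p < (\<Sum>T\<leftarrow>?G. cX T)" using hKf by simp
        moreover have "0 \<le> pl p" using H p c_sum_nonneg by (simp add: Hinv_def)
        ultimately have "?G \<noteq> []" by (intro notI) (simp only: list.map sum_list.Nil)
        moreover have "\<And>T. T \<in> set ?G \<Longrightarrow> cyc T \<and> grp H p T" using crossing_cyc[OF out] by auto
        ultimately obtain H' where "Hinv H'" "\<Phi> H < \<Phi> H'"
          using improve_exists[OF H p _ _ crossing_djl[OF out] hKf(1)] big by metis
        then show False using Hmax[of H'] by simp
      qed
      fix T assume T: "T \<in> set ?L" "grp H p T"
      show "cX T \<le> K * pl p"
      proof (rule ccontr)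
        assume "\<not> cX T \<le> K * pl p"
        then have "length [T] = 1 \<and> pl p < (\<Sum>T\<leftarrow>[T]. cX T)" using hKf by simp
        moreover have "cyc T" by (rule crossing_cyc[OF out T(1)])
        ultimately obtain H' where "Hinv H'" "\<Phi> H < \<Phi> H'"
          using improve_exists[OF H p _ _ _ hKf(1), of "[T]"] T(2) by auto
        then show False using Hmax[of H'] by simp
      qed
    next
      fix T Y assume T: "T \<in> set ?L" and Y: "Y \<in> set E" "ps Y \<and> crossP T Y"
      show "K * pl Y < cX T"
      proof (rule ccontr)
        assume *: "\<not> K * pl Y < cX T"
        have cT: "cyc T" by (rule crossing_cyc[OF out T])
        then have "pX T \<subseteq> V" by (rule cycD)
        then have "card (bits H Q) < card (bits H (T # Q))"
          using Y * by (intro bits_grow[OF E _ Y(1)]) auto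
        then show False using Qmax[of "T # Q"] Q cT by simp
      qed
    qed
    note m = merge_step[OF H E _ out qt order_refl]
    let ?D = "(xstep Q ^^ length E) (foldr absorb (crossing E Ts) E)"
    show ?case
    proof (cases "length ?D = 1")
      case True
      have "tour (gr I) (pM (minp ?D)) \<and> wt (pM (minp ?D)) \<le> (h + K + f) * \<alpha> * sum c V + \<beta> + wt B"
        using m(1)[OF _ True] Q by blast
      moreover have "h + K + f = 5" using hKf by simp
      ultimately show ?thesis unfolding wt_weight by (intro exI[of _ "pM (minp ?D)"]) (simp only:)
    next
      case False
      let ?E = "seal (minp ?D) # filter (\<lambda>Y. \<not> touch (minp ?D) Y) E"
      have "Einv H Q ?E \<and> length ?E < length E" using m(2)[OF _ False] Q by blast
      then show ?thesis using less.hyps[of ?E] by blast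
    qed
  qed
  from this[OF Einv_init[OF H]] show ?thesis .
qed

end

lemma is_instance_fin: "is_instance I \<Longrightarrow> fin_digraph (gr I)"
  by (simp add: is_instance_def)

lemma lb_vert_nonneg: "is_instance I \<Longrightarrow> 0 \<le> lb_vert I v"
  by (simp add: lb_vert_def is_instance_def)

theorem tour_existence:
  fixes A :: "('v,'e) alg"
  assumes I: "is_instance I" and B: "subtour (gr I) B" and \<alpha>: "0 \<le> \<alpha>"
    and A: "solves_spc A I B" "light A \<alpha> \<beta> I B"
  shows "\<exists>F. tour (gr I) F \<and> weight I F \<le> 5 * \<alpha> * lb_compl I B + \<beta> + weight I B"
proof -
  define c where "c v = (if v \<in> mverts (gr I) B then 0 else lb_vert I v)" for v
  interpret fin_digraph "gr I" by (rule is_instance_fin[OF I])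
  have cs: "sum c X = lb I X" if "X \<inter> mverts (gr I) B = {}" for X
    unfolding lb_def c_def using that by (intro sum.cong) auto
  interpret light_setting I B c \<alpha> \<beta> 2 1 2 A \<alpha>
  proof
    show "B \<noteq> {#}" by (rule subtour_nonempty[OF I A(1)])
    show "0 \<le> weight_edge I e" for e by (rule weight_edge_nonneg[OF I])
    show "0 \<le> c v" for v using lb_vert_nonneg[OF I] by (simp add: c_def)
    show "\<alpha> * lb I X \<le> \<alpha> * sum c X" if "X \<subseteq> verts (gr I) - mverts (gr I) B" for X
    proof -
      have "X \<inter> mverts (gr I) B = {}" using that by blast
      then show ?thesis by (simp add: cs)
    qed
  qed (use I B \<alpha> A in \<open>auto simp: c_def is_instance_fin\<close>)
  have "sum c (verts (gr I)) = sum c (verts (gr I) - mverts (gr I) B)"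
    by (rule sum.mono_neutral_right) (auto simp: c_def)
  also have "\<dots> = lb_compl I B" unfolding lb_compl_def by (rule cs) auto
  finally show ?thesis using light_tour_exists by simp
qed

subsection \<open>Local search with polynomially many improvements\<close>

text \<open>Greedy filling of one bin. The offset \<open>t0\<close> is the share of the piece that
  is kept in any case and counts in every bin.\<close>

definition pack :: "('a \<Rightarrow> real) \<Rightarrow> real \<Rightarrow> real \<Rightarrow> 'a list \<Rightarrow> real \<times> 'a list \<times> 'a list" where
  "pack tq L t0 qs = foldr (\<lambda>q (t, A, R).
     if 3 * (t + tq q) \<le> 2 * L then (t + tq q, q # A, R) else (t, A, q # R)) qs (t0, [], [])"

lemma pack_spec:
  assumes "pack tq L t0 qs = (t, A, R)" "3 * t0 \<le> 2 * L" "\<And>q. q \<in> set qs \<Longrightarrow> 0 \<le> tq q"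
  shows "t = t0 + sum_list (map tq A)" "3 * t \<le> 2 * L" "mset A + mset R = mset qs"
    "\<And>q. q \<in> set R \<Longrightarrow> 2 * L < 3 * (t + tq q)"
proof -
  have "t = t0 + sum_list (map tq A) \<and> 3 * t \<le> 2 * L \<and> mset A + mset R = mset qs \<and>
      (\<forall>q\<in>set R. 2 * L < 3 * (t + tq q))"
    using assms
  proof (induction qs arbitrary: t A R)
    case (Cons a qs)
    obtain t' A' R' where p: "pack tq L t0 qs = (t', A', R')" by (cases "pack tq L t0 qs") auto
    have nn: "0 \<le> tq a" using Cons.prems(3) by simp
    have IH: "t' = t0 + sum_list (map tq A')" "3 * t' \<le> 2 * L" "mset A' + mset R' = mset qs"
      "\<forall>q\<in>set R'. 2 * L < 3 * (t' + tq q)"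
      using Cons.IH[OF p Cons.prems(2)] Cons.prems(3) by auto
    have st: "pack tq L t0 (a # qs) =
      (if 3 * (t' + tq a) \<le> 2 * L then (t' + tq a, a # A', R') else (t', A', a # R'))"
      using p by (simp add: pack_def)
    show ?case
    proof (cases "3 * (t' + tq a) \<le> 2 * L")
      case True
      then have *: "t = t' + tq a" "A = a # A'" "R = R'" using st Cons.prems(1) by simp_all
      have "2 * L < 3 * (t' + tq a + tq q)" if "q \<in> set R'" for q using IH(4) that nn by fastforce
      then show ?thesis using IH True unfolding * by simp
    next
      case False
      then have *: "t = t'" "A = A'" "R = a # R'" using st Cons.prems(1) by simp_all
      show ?thesis using IH False unfolding * by auto
    qed
  qed (auto simp: pack_def)
  then show "t = t0 + sum_list (map tq A)" "3 * t \<le> 2 * L" "mset A + mset R = mset qs"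
    "\<And>q. q \<in> set R \<Longrightarrow> 2 * L < 3 * (t + tq q)" by auto
qed

text \<open>The result is what is dropped, that is, everything outside the bin of largest label sum.
  The third bin is the remainder \<open>R2\<close>.\<close>

definition bins :: "('a \<Rightarrow> real) \<Rightarrow> real \<Rightarrow> real \<Rightarrow> ('a \<Rightarrow> real) \<Rightarrow> 'a list \<Rightarrow> 'a list" where
  "bins tq L t0 l qs = (let (t1, A1, R1) = pack tq L t0 qs; (t2, A2, R2) = pack tq L t0 R1;
     s = (\<lambda>A. sum_list (map l A)) in
     if s A2 \<le> s A1 \<and> s R2 \<le> s A1 then A2 @ R2 else if s R2 \<le> s A2 then A1 @ R2 else A1 @ A2)"

text \<open>Items of size at most \<open>m\<close> and total size at most \<open>L - t0\<close> fit into three bins, each of which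
  has size at most \<open>2 L / 3 - t0\<close>: an item rejected by the first two bins shows that those are
  filled to more than \<open>2 L / 3 - t0\<close> in total. Keeping the bin of largest label sum drops at most
  twice the label sum that is kept.\<close>

lemma bins_spec:
  assumes nn: "\<And>q. q \<in> set qs \<Longrightarrow> 0 \<le> tq q \<and> tq q \<le> m" and t0: "0 \<le> t0" "t0 \<le> m" "3 * m < L"
    and tot: "t0 + sum_list (map tq qs) = L"
  obtains A where "mset A + mset (bins tq L t0 l qs) = mset qs"
    "3 * (t0 + sum_list (map tq A)) \<le> 2 * L"
    "sum_list (map l (bins tq L t0 l qs)) \<le> 2 * sum_list (map l A)"
proof -
  obtain t1 A1 R1 where p1: "pack tq L t0 qs = (t1, A1, R1)" by (cases "pack tq L t0 qs") auto
  obtain t2 A2 R2 where p2: "pack tq L t0 R1 = (t2, A2, R2)" by (cases "pack tq L t0 R1") auto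
  have b: "3 * t0 \<le> 2 * L" using t0 by simp
  note s1 = pack_spec[OF p1 b] note s2 = pack_spec[OF p2 b]
  have m1: "mset A1 + mset R1 = mset qs" using s1(3) nn by blast
  have R1: "set R1 \<subseteq> set qs" by (metis m1 set_mset_mset set_mset_union sup_ge2)
  have nn1: "0 \<le> tq q" if "q \<in> set R1" for q using nn R1 that by blast
  have m2: "mset A2 + mset R2 = mset R1" using s2(3) nn1 by blast
  have sub2: "set A2 \<subseteq> set R1" "set R2 \<subseteq> set R1"
    by (metis m2 set_mset_mset set_mset_union sup_ge1, metis m2 set_mset_mset set_mset_union sup_ge2)
  have sums: "sum_list (map tq A1) + sum_list (map tq A2) + sum_list (map tq R2) = sum_list (map tq qs)"
  proof -
    have "sum_list (map tq xs) = sum_mset (image_mset tq (mset xs))" for xs by (simp add: sum_mset_sum_list flip: mset_map)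
    then show ?thesis using m1 m2 by (metis image_mset_union sum_mset.union add.assoc)
  qed
  have f1: "3 * (t0 + sum_list (map tq A1)) \<le> 2 * L" using s1(1,2) nn by force
  have f2: "3 * (t0 + sum_list (map tq A2)) \<le> 2 * L" using s2(1,2) nn1 by force
  have f3: "3 * (t0 + sum_list (map tq R2)) \<le> 2 * L"
  proof (cases "R2 = []")
    case True then show ?thesis using b by simp
  next
    case False
    then obtain q where q: "q \<in> set R2" by (cases R2) auto
    have q1: "q \<in> set R1" using q sub2(2) by blast
    \<comment> \<open>Every item fits into an empty bin, since together with \<open>t0\<close> it
      has size at most \<open>2 * m\<close>, which is less than \<open>2 * L / 3\<close>.\<close>
    have "A2 \<noteq> []"
    proof
      assume "A2 = []"
      then have "2 * L < 3 * (t0 + tq q)" using s2(1,4)[OF nn1] q by fastforce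
      moreover have "tq q \<le> m" using nn q1 R1 by blast
      ultimately show False using t0 by argo
    qed
    \<comment> \<open>The item \<open>k\<close> was rejected by the first bin, so less than
      \<open>L / 3\<close> is left for the third, and \<open>t0 \<le> m < L / 3\<close>.\<close>
    then obtain k A2' where k: "A2 = k # A2'" by (cases A2) auto
    have k1: "k \<in> set R1" using k sub2(1) by auto
    have t1: "t1 = t0 + sum_list (map tq A1)" using s1(1) nn by blast
    have "2 * L < 3 * (t1 + tq k)" by (rule s1(4)) (use nn k1 in auto)
    moreover have "0 \<le> sum_list (map tq A2')" using nn1 sub2(1) k by (intro sum_list_nonneg) auto
    then have "tq k \<le> sum_list (map tq A2)" using k by simp
    ultimately show ?thesis using sums tot t1 t0 by argo
  qed
  let ?s = "\<lambda>A. sum_list (map l A)"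
  have B: "bins tq L t0 l qs = (if ?s A2 \<le> ?s A1 \<and> ?s R2 \<le> ?s A1 then A2 @ R2 else if ?s R2 \<le> ?s A2 then A1 @ R2 else A1 @ A2)"
    by (simp add: bins_def p1 p2 Let_def)
  have mm: "mset A1 + (mset A2 + mset R2) = mset qs" using m1 m2 by simp
  show ?thesis
  proof (cases "?s A2 \<le> ?s A1 \<and> ?s R2 \<le> ?s A1")
    case True
    then show ?thesis using that[of A1] B mm f1 by simp
  next
    case F1: False
    show ?thesis
    proof (cases "?s R2 \<le> ?s A2")
      case True
      then have "?s A1 \<le> ?s A2" using F1 by linarith
      then show ?thesis using that[of A2] B mm f2 F1 True by (simp add: ac_simps)
    next
      case False
      then have "?s A1 \<le> ?s R2" using F1 by linarith
      then show ?thesis using that[of R2] B mm f3 F1 False by (simp add: ac_simps)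
    qed
  qed
qed

lemma sum_djl_Int:
  assumes "djl S" "\<And>p. p \<in> set S \<Longrightarrow> finite (pX p)"
  shows "sum c (X \<inter> (\<Union>p\<in>set S. pX p)) = (\<Sum>p\<leftarrow>S. sum c (pX p \<inter> X) :: real)"
  using assms
proof (induction S)
  case (Cons p S)
  have "X \<inter> (\<Union>p\<in>set (p # S). pX p) = (pX p \<inter> X) \<union> (X \<inter> (\<Union>p\<in>set S. pX p))" by auto
  also have "sum c \<dots> = sum c (pX p \<inter> X) + sum c (X \<inter> (\<Union>p\<in>set S. pX p))"
    using Cons.prems by (intro sum.union_disjoint) auto
  finally show ?case using Cons by simp
qed simp

section \<open>An improvement that increases the sum of squared labels\<close>

context subtour_setting begin

definition drops :: "('v,'e) piece list \<Rightarrow> ('v,'e) piece \<Rightarrow> ('v,'e) piece list \<Rightarrow> ('v,'e) piece list" where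
  "drops H j Ts = bins (\<lambda>q. sum c (pX q \<inter> pX (unionP Ts))) (\<Sum>T\<leftarrow>Ts. cX T)
     (sum c (pX j \<inter> pX (unionP Ts))) pl (filter (\<lambda>q. touch (unionP Ts) q \<and> \<not> touch q j) H)"

text \<open>Write \<open>l\<close> for the label of \<open>j\<close>, \<open>a\<close> for the label
  sum of the kept bin and \<open>d\<close> for the overlap with the dropped pieces; the new cost is
  \<open>N = l + a + d\<close>. As \<open>j\<close> and the kept bin hold at most two thirds of the
  overlap, \<open>d\<close> is at least a third of the cost of the group, which is what the weight
  bound with \<open>h = 3\<close> needs. No label exceeds \<open>l\<close> and the dropped labels
  sum to at most \<open>2 * a\<close>, so the squares lost are at most
  \<open>l^2 + 3 * l * a\<close>.\<close>

lemma improve_local: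
  assumes H: "Hinv H" and j: "j \<in> set H" and Ts: "Ts \<noteq> []" "\<And>T. T \<in> set Ts \<Longrightarrow> cyc T \<and> grp H j T"
    and dj: "djl Ts" and h3: "h = 3" and big: "3 * pl j < (\<Sum>T\<leftarrow>Ts. cX T)"
    and vs: "distinct vs" "set vs = (\<Union>q\<in>set (drops H j Ts). pX q)"
  shows "Hinv (improve c vs (drops H j Ts) Ts H)"
    and "(\<Sum>q\<leftarrow>H. (pl q)\<^sup>2) + 5 * (pl j)\<^sup>2 \<le> (\<Sum>q\<leftarrow>improve c vs (drops H j Ts) Ts H. (pl q)\<^sup>2)"
proof -
  let ?T = "unionP Ts" let ?L = "\<Sum>T\<leftarrow>Ts. cX T"
  let ?t = "\<lambda>q. sum c (pX q \<inter> pX ?T)"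
  let ?it = "filter (\<lambda>q. touch ?T q \<and> \<not> touch q j) H"
  let ?drp = "drops H j Ts"
  have P: "part (V - VB) H" using H by (simp add: Hinv_def)
  have Hf: "finite (pX q)" if "q \<in> set H" for q
    using part_subset[OF P that] by (rule finite_subset) simp
  have Hl: "pl q = cX q" if "q \<in> set H" for q using H that by (simp add: Hinv_def)
  have fin: "finite (pX T)" if "T \<in> set Ts" for T
    using Ts(2)[OF that] by (intro finite_subset[of "pX T" V]) (auto simp: cyc_def)
  have L: "?L = cX ?T" using sum_djl[OF dj fin, of c] by simp
  obtain T0 where T0: "T0 \<in> set Ts" using Ts(1) by (cases Ts) auto
  have tj: "touch ?T j" using Ts(2)[OF T0] T0 by (auto simp: grp_def touch_def)
  have same: "touch q j \<longleftrightarrow> q = j" if q: "q \<in> set H" for q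
  proof
    assume "touch q j"
    then obtain v where "v \<in> pX q" "v \<in> pX j" by (auto simp: touch_def)
    then show "q = j" by (rule part_unique[OF P q j])
  next
    assume "q = j" then show "touch q j" using part_nonempty[OF P j] by (simp add: touch_def)
  qed
  have it: "set ?it = {q \<in> set H. touch ?T q \<and> q \<noteq> j}" using same by auto
  have dit: "distinct ?it" using part_distinct[OF P] by simp
  have lt: "?t q \<le> pl q" if "q \<in> set H" for q
    unfolding Hl[OF that] by (intro c_sum_mono Hf[OF that]) auto
  have le_j: "pl q \<le> pl j" if "q \<in> set H" "touch ?T q" for q
    using Ts(2) that by (intro grp_touched[of Ts H j q]) auto
  have sums: "(\<Sum>q\<leftarrow>filter (touch ?T) H. g q) = g j + (\<Sum>q\<leftarrow>?it. g q)" for g :: "_ \<Rightarrow> real"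
  proof -
    have "(\<Sum>q\<leftarrow>filter (touch ?T) H. g q) = sum g (set (filter (touch ?T) H))"
      using part_distinct[OF P] by (intro sum_list_distinct_conv_sum_set) simp
    also have "set (filter (touch ?T) H) = insert j (set ?it)" unfolding it using j tj by auto
    also have "sum g (insert j (set ?it)) = g j + sum g (set ?it)" using it by (intro sum.insert) auto
    also have "sum g (set ?it) = (\<Sum>q\<leftarrow>?it. g q)" using sum_list_distinct_conv_sum_set[OF dit, of g] by simp
    finally show ?thesis .
  qed
  have tot: "?t j + (\<Sum>q\<leftarrow>?it. ?t q) = ?L"
  proof -
    let ?S = "filter (touch ?T) H"
    have "pX ?T = pX ?T \<inter> (\<Union>q\<in>set ?S. pX q)"
    proof (intro equalityI subsetI)
      fix v assume v: "v \<in> pX ?T"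
      then have "v \<in> V - VB" using Ts(2) by (auto simp: cyc_def)
      from part_cover[OF P this] obtain q where q: "q \<in> set H" "v \<in> pX q" by blast
      with v have "q \<in> set ?S" by (auto simp: touch_def)
      with v q show "v \<in> pX ?T \<inter> (\<Union>q\<in>set ?S. pX q)" by blast
    qed auto
    then have "cX ?T = sum c (pX ?T \<inter> (\<Union>q\<in>set ?S. pX q))" by (rule arg_cong)
    also have "\<dots> = (\<Sum>q\<leftarrow>?S. ?t q)"
    proof (rule sum_djl_Int)
      show "djl ?S" using P by (simp add: part_def djl_filter)
    qed (use Hf in auto)
    finally show ?thesis unfolding L sums[of ?t] by (rule sym)
  qed
  have nnit: "0 \<le> ?t q \<and> ?t q \<le> pl j" if "q \<in> set ?it" for q
    using that lt[of q] le_j[of q] c_sum_nonneg[of "pX q \<inter> pX ?T"] by auto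
  obtain A where A: "mset A + mset ?drp = mset ?it" "3 * (?t j + (\<Sum>q\<leftarrow>A. ?t q)) \<le> 2 * ?L"
    "(\<Sum>q\<leftarrow>?drp. pl q) \<le> 2 * (\<Sum>q\<leftarrow>A. pl q)"
    using bins_spec[of ?it ?t "pl j" "?t j" ?L pl, OF nnit _ lt[OF j] big tot, folded drops_def]
      c_sum_nonneg by auto
  have split: "(\<Sum>q\<leftarrow>A. g q) + (\<Sum>q\<leftarrow>?drp. g q) = (\<Sum>q\<leftarrow>?it. g q)" for g :: "_ \<Rightarrow> real"
  proof -
    have "sum_mset (image_mset g (mset A + mset ?drp)) = sum_mset (image_mset g (mset ?it))" by (simp only: A(1))
    moreover have "sum_mset (image_mset g (mset xs)) = (\<Sum>q\<leftarrow>xs. g q)" for xs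
      by (simp add: sum_mset_sum_list flip: mset_map)
    ultimately show ?thesis by (simp only: image_mset_union sum_mset.union)
  qed
  have sA: "set A \<union> set ?drp = set ?it" by (metis A(1) set_mset_mset set_mset_union)
  have dA: "distinct (A @ ?drp)" using dit A(1) by (metis mset_append mset_eq_imp_distinct_iff)
  have drp: "set ?drp \<subseteq> set H" "\<And>q. q \<in> set ?drp \<Longrightarrow> touch ?T q" using sA it by auto
  have jd: "j \<notin> set ?drp" using sA it by auto
  define Kt where "Kt = filter (\<lambda>q. touch ?T q \<and> q \<notin> set ?drp) H"
  have Kt: "(\<Sum>q\<leftarrow>Kt. g q) = g j + (\<Sum>q\<leftarrow>A. g q)" for g :: "_ \<Rightarrow> real"
  proof -
    have "(\<Sum>q\<leftarrow>Kt. g q) = sum g (set Kt)"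
      unfolding Kt_def using part_distinct[OF P] by (intro sum_list_distinct_conv_sum_set) simp
    also have "set Kt = insert j (set A)"
    proof
      show "set Kt \<subseteq> insert j (set A)" unfolding Kt_def using sA it by auto
      show "insert j (set A) \<subseteq> set Kt" unfolding Kt_def using sA it jd j tj dA by auto
    qed
    also have "sum g (insert j (set A)) = g j + sum g (set A)" using sA it by (intro sum.insert) auto
    also have "sum g (set A) = (\<Sum>q\<leftarrow>A. g q)" using sum_list_distinct_conv_sum_set[of A g] dA by simp
    finally show ?thesis .
  qed
  have td: "sum c (pX ?T \<inter> (\<Union>q\<in>set ?drp. pX q)) = (\<Sum>q\<leftarrow>?drp. ?t q)"
  proof (rule sum_djl_Int)
    have "djl L" if "distinct L" "set L \<subseteq> set H" for L
      using that
    proof (induction L)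
      case (Cons a L)
      have "pX a \<inter> pX q = {}" if q: "q \<in> set L" for q
      proof (rule ccontr)
        assume "pX a \<inter> pX q \<noteq> {}"
        then obtain v where "v \<in> pX a" "v \<in> pX q" by blast
        from part_unique[OF P _ _ this] q Cons.prems show False by auto
      qed
      then show ?case using Cons by simp
    qed simp
    then show "djl ?drp" using dA drp(1) by simp
  qed (use Hf drp(1) in auto)
  let ?l = "pl j" let ?a = "\<Sum>q\<leftarrow>A. pl q" let ?d = "\<Sum>q\<leftarrow>?drp. ?t q"
  let ?N = "(\<Sum>q\<leftarrow>Kt. cX q) + sum c (pX ?T \<inter> (\<Union>q\<in>set ?drp. pX q))"
  have AH: "q \<in> set H \<and> touch ?T q" if "q \<in> set A \<or> q \<in> set ?drp" for q using that sA it by auto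
  have aA: "(\<Sum>q\<leftarrow>A. cX q) = ?a"
    using AH Hl by (intro arg_cong[of _ _ sum_list] map_cong) auto
  have N: "?N = ?l + ?a + ?d" unfolding td Kt aA Hl[OF j] ..
  have d: "?L \<le> 3 * ?d" using A(2) split[of ?t] tot by argo
  have l0: "0 \<le> ?l" using Hl[OF j] c_sum_nonneg by simp
  have a0: "0 \<le> ?a" using AH Hl c_sum_nonneg by (intro sum_list_nonneg) auto
  have W: "h * (\<Sum>q\<leftarrow>Kt. cX q) + ?L \<le> h * ?N"
    unfolding h3 td using d by (simp add: algebra_simps)
  have star: "length Ts = 1 \<or> (\<exists>j\<in>set H. j \<notin> set ?drp \<and> (\<forall>T\<in>set Ts. touch T j))"
    using j jd Ts(2) by (auto simp: grp_def)
  have sq: "0 \<le> (x::real)\<^sup>2" for x by simp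
  show "Hinv (improve c vs ?drp Ts H)"
    by (rule improve_spec(1)[OF H drp vs Ts(1) _ star, of "\<lambda>x. x\<^sup>2"])
      (use Ts(2) W[unfolded Kt_def] sq in blast)+
  have g: "?N\<^sup>2 + (\<Sum>q\<leftarrow>filter (\<lambda>q. \<not> touch ?T q) H. (pl q)\<^sup>2) \<le> (\<Sum>q\<leftarrow>improve c vs ?drp Ts H. (pl q)\<^sup>2)"
    unfolding Kt_def
    by (rule improve_spec(2)[OF H drp vs Ts(1) _ star, of "\<lambda>x. x\<^sup>2"])
      (use Ts(2) W[unfolded Kt_def] sq in blast)+
  have TN: "cX ?T \<le> ?N" unfolding Kt_def
    by (rule improve_spec(3)[OF H drp vs Ts(1) _ star, of "\<lambda>x. x\<^sup>2"])
      (use Ts(2) W[unfolded Kt_def] sq in blast)+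
  have sqs: "(\<Sum>q\<leftarrow>B. (pl q)\<^sup>2) \<le> ?l * (\<Sum>q\<leftarrow>B. pl q)" if "set B \<subseteq> set A \<union> set ?drp" for B
  proof -
    have "(\<Sum>q\<leftarrow>B. (pl q)\<^sup>2) \<le> (\<Sum>q\<leftarrow>B. ?l * pl q)"
    proof (rule sum_list_mono)
      fix q assume "q \<in> set B"
      then have "q \<in> set H \<and> touch ?T q" using that AH by blast
      then have "pl q \<le> ?l" "0 \<le> pl q" using le_j Hl c_sum_nonneg by auto
      then show "(pl q)\<^sup>2 \<le> ?l * pl q" by (simp add: power2_eq_square mult_right_mono)
    qed
    then show ?thesis by (simp add: sum_list_const_mult)
  qed
  have "(\<Sum>q\<leftarrow>filter (touch ?T) H. (pl q)\<^sup>2) \<le> ?l\<^sup>2 + ?l * ?a + ?l * (2 * ?a)"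
  proof -
    have "(\<Sum>q\<leftarrow>?drp. (pl q)\<^sup>2) \<le> ?l * (\<Sum>q\<leftarrow>?drp. pl q)" by (rule sqs) auto
    also have "\<dots> \<le> ?l * (2 * ?a)" using A(3) l0 by (rule mult_left_mono)
    finally have "(\<Sum>q\<leftarrow>?drp. (pl q)\<^sup>2) \<le> ?l * (2 * ?a)" .
    moreover have "(\<Sum>q\<leftarrow>A. (pl q)\<^sup>2) \<le> ?l * ?a" by (rule sqs) auto
    ultimately show ?thesis using sums[of "\<lambda>q. (pl q)\<^sup>2"] split[of "\<lambda>q. (pl q)\<^sup>2"] by linarith
  qed
  \<comment> \<open>From \<open>N \<ge> 3 * l\<close> and \<open>d \<ge> l\<close>:
    \<open>N^2 \<ge> 3 * l * N \<ge> 3 * l * (2 * l + a)\<close>, which is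
    \<open>6 * l^2 + 3 * l * a\<close>. The surplus over the lost squares is the gain of
    \<open>5 * l^2\<close>.\<close>
  moreover have "?l\<^sup>2 + ?l * ?a + ?l * (2 * ?a) + 5 * ?l\<^sup>2 \<le> ?N\<^sup>2"
  proof -
    have N3: "3 * ?l \<le> ?N" using TN L big by linarith
    have dl: "?l \<le> ?d" using d big by linarith
    have "?l * (?l + ?a + ?l) \<le> ?l * ?N" unfolding N using l0 dl by (intro mult_left_mono) auto
    moreover have "3 * ?l * ?N \<le> ?N * ?N" using N3 l0 by (intro mult_right_mono) linarith+
    ultimately show ?thesis by (simp add: power2_eq_square algebra_simps)
  qed
  ultimately show "(\<Sum>q\<leftarrow>H. (pl q)\<^sup>2) + 5 * ?l\<^sup>2 \<le> (\<Sum>q\<leftarrow>improve c vs ?drp Ts H. (pl q)\<^sup>2)"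
    using g sum_list_filter_compl_real[of "\<lambda>q. (pl q)\<^sup>2" "touch ?T" H] by linarith
qed

end

subsection \<open>Loop programs\<close>

text \<open>Programs whose only recursion is \<open>foldr\<close> over a list. The body of a fold \<open>VF c xs a b\<close> and
  the body of a subroutine call \<open>VS a b\<close> are closed: they see only \<open>[element, accumulator, c]\<close>
  and \<open>[argument]\<close>, so no variable has to be shifted when programs are composed.\<close>

datatype lx = VA nat | VE | VL int | V1 op1 lx | V2 op2 lx lx | VC lx lx lx | VLet lx lx
  | VS lx lx | VQ lx | VF lx lx lx lx

text \<open>Any datum is read as a list, ended by whatever is not a node, so that folds are
  total.\<close>

fun dl :: "('v,'e) data \<Rightarrow> ('v,'e) data list" where
  "dl (Node a b) = a # dl b"
| "dl _ = []"

lemma dl_list_data [simp]: "dl (list_data ds) = ds"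
  by (induction ds) (auto simp: list_data_def)

lemma list_data_simps [simp]: "list_data [] = Leaf" "list_data (d # ds) = Node d (list_data ds)"
  by (simp_all add: list_data_def)

type_synonym ('v,'e) orc = "('v,'e) data \<Rightarrow> ('v,'e) data \<times> nat"

primrec den :: "('v,'e) orc \<Rightarrow> lx \<Rightarrow> ('v,'e) data list \<Rightarrow> ('v,'e) data" where
  "den orc (VA i) = (\<lambda>\<sigma>. \<sigma> ! i)"
| "den orc VE = (\<lambda>\<sigma>. Leaf)"
| "den orc (VL z) = (\<lambda>\<sigma>. Num (of_int z))"
| "den orc (V1 f a) = (\<lambda>\<sigma>. apply1 f (den orc a \<sigma>))"
| "den orc (V2 f a b) = (\<lambda>\<sigma>. apply2 f (den orc a \<sigma>) (den orc b \<sigma>))"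
| "den orc (VC c a b) = (\<lambda>\<sigma>. if den orc c \<sigma> \<noteq> Leaf then den orc a \<sigma> else den orc b \<sigma>)"
| "den orc (VLet a b) = (\<lambda>\<sigma>. den orc b (den orc a \<sigma> # \<sigma>))"
| "den orc (VS a b) = (\<lambda>\<sigma>. den orc b [den orc a \<sigma>])"
| "den orc (VQ a) = (\<lambda>\<sigma>. fst (orc (den orc a \<sigma>)))"
| "den orc (VF c xs a b) = (\<lambda>\<sigma>. foldr (\<lambda>x acc. den orc b [x, acc, den orc c \<sigma>])
      (dl (den orc xs \<sigma>)) (den orc a \<sigma>))"

primrec wfx :: "nat \<Rightarrow> lx \<Rightarrow> bool" where
  "wfx k (VA i) \<longleftrightarrow> i < k"
| "wfx k VE \<longleftrightarrow> True"
| "wfx k (VL z) \<longleftrightarrow> True"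
| "wfx k (V1 f a) \<longleftrightarrow> wfx k a"
| "wfx k (V2 f a b) \<longleftrightarrow> wfx k a \<and> wfx k b"
| "wfx k (VC c a b) \<longleftrightarrow> wfx k c \<and> wfx k a \<and> wfx k b"
| "wfx k (VLet a b) \<longleftrightarrow> wfx k a \<and> wfx (Suc k) b"
| "wfx k (VS a b) \<longleftrightarrow> wfx k a \<and> wfx 1 b"
| "wfx k (VQ a) \<longleftrightarrow> wfx k a"
| "wfx k (VF c xs a b) \<longleftrightarrow> wfx k c \<and> wfx k xs \<and> wfx k a \<and> wfx 3 b"

text \<open>\<open>bnd orc N e \<sigma>\<close>: every list that is folded over has at most \<open>N\<close> elements and every oracle
  call takes time at most \<open>N\<close>. This makes the running time polynomial in \<open>N\<close>.\<close>

primrec bnd :: "('v,'e) orc \<Rightarrow> nat \<Rightarrow> lx \<Rightarrow> ('v,'e) data list \<Rightarrow> bool" where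
  "bnd orc N (VA i) = (\<lambda>\<sigma>. True)"
| "bnd orc N VE = (\<lambda>\<sigma>. True)"
| "bnd orc N (VL z) = (\<lambda>\<sigma>. True)"
| "bnd orc N (V1 f a) = (\<lambda>\<sigma>. bnd orc N a \<sigma>)"
| "bnd orc N (V2 f a b) = (\<lambda>\<sigma>. bnd orc N a \<sigma> \<and> bnd orc N b \<sigma>)"
| "bnd orc N (VC c a b) = (\<lambda>\<sigma>. bnd orc N c \<sigma> \<and>
      (if den orc c \<sigma> \<noteq> Leaf then bnd orc N a \<sigma> else bnd orc N b \<sigma>))"
| "bnd orc N (VLet a b) = (\<lambda>\<sigma>. bnd orc N a \<sigma> \<and> bnd orc N b (den orc a \<sigma> # \<sigma>))"
| "bnd orc N (VS a b) = (\<lambda>\<sigma>. bnd orc N a \<sigma> \<and> bnd orc N b [den orc a \<sigma>])"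
| "bnd orc N (VQ a) = (\<lambda>\<sigma>. bnd orc N a \<sigma> \<and> snd (orc (den orc a \<sigma>)) \<le> N)"
| "bnd orc N (VF c xs a b) = (\<lambda>\<sigma>. bnd orc N c \<sigma> \<and> bnd orc N xs \<sigma> \<and> bnd orc N a \<sigma> \<and>
      length (dl (den orc xs \<sigma>)) \<le> N \<and>
      (\<forall>ys x zs. dl (den orc xs \<sigma>) = ys @ x # zs \<longrightarrow>
         bnd orc N b [x, foldr (\<lambda>x acc. den orc b [x, acc, den orc c \<sigma>]) zs (den orc a \<sigma>), den orc c \<sigma>]))"

text \<open>In the clause for folds, the factor \<open>N + 1\<close> includes the final call on the
  exhausted list, and 40 is a generous allowance for the bookkeeping of one iteration.\<close>

primrec tb :: "nat \<Rightarrow> lx \<Rightarrow> nat" where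
  "tb N (VA i) = 1"
| "tb N VE = 1"
| "tb N (VL z) = 1"
| "tb N (V1 f a) = tb N a + 1"
| "tb N (V2 f a b) = tb N a + tb N b + 1"
| "tb N (VC c a b) = tb N c + (tb N a + tb N b) + 1"
| "tb N (VLet a b) = tb N a + tb N b + 1"
| "tb N (VS a b) = tb N a + tb N b + 1"
| "tb N (VQ a) = tb N a + N + 1"
| "tb N (VF c xs a b) = tb N c + tb N xs + tb N a + 4 + (N + 1) * (tb N b + 40)"

lemma tb_poly: "\<exists>C k. \<forall>N. tb N e \<le> C * (N + 1) ^ k"
proof -
  have add: "\<exists>C k. \<forall>N. f N + g N \<le> C * (N + 1) ^ k"
    if fg: "\<exists>C k. \<forall>N. f N \<le> C * (N + 1) ^ k" "\<exists>C k. \<forall>N. g N \<le> C * (N + 1) ^ k" for f g :: "nat \<Rightarrow> nat"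
  proof -
    obtain C k where 1: "\<And>N. f N \<le> C * (N + 1) ^ k" using fg(1) by blast
    obtain C' k' where 2: "\<And>N. g N \<le> C' * (N + 1) ^ k'" using fg(2) by blast
    have "f N + g N \<le> (C + C') * (N + 1) ^ (k + k')" for N
    proof -
      have "f N \<le> C * (N + 1) ^ (k + k')"
        by (rule order_trans[OF 1]) (intro mult_left_mono power_increasing, auto)
      moreover have "g N \<le> C' * (N + 1) ^ (k + k')"
        by (rule order_trans[OF 2]) (intro mult_left_mono power_increasing, auto)
      ultimately show ?thesis by (simp add: add_mult_distrib)
    qed
    then show ?thesis by blast
  qed
  have mult: "\<exists>C k. \<forall>N. (N + 1) * f N \<le> C * (N + 1) ^ k"
    if f: "\<exists>C k. \<forall>N. f N \<le> C * (N + 1) ^ k" for f :: "nat \<Rightarrow> nat"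
  proof -
    obtain C k where 1: "\<And>N. f N \<le> C * (N + 1) ^ k" using f by blast
    have "(N + 1) * f N \<le> C * (N + 1) ^ Suc k" for N
      using mult_le_mono2[OF 1[of N], of "N + 1"] by (simp add: mult.left_commute mult.assoc)
    then show ?thesis by blast
  qed
  have const: "\<exists>C k. \<forall>N. d \<le> C * (N + 1) ^ k" for d :: nat
    by (intro exI[of _ d] exI[of _ 0]) simp
  have lin: "\<exists>C k. \<forall>N::nat. N \<le> C * (N + 1) ^ k"
    by (rule exI[of _ 1], rule exI[of _ "Suc 0"]) simp
  show ?thesis
    by (induction e) (simp only: tb.simps, intro add mult const lin; assumption)+
qed

text \<open>The argument is \<open>Node c (Node a l)\<close>. As \<open>foldr\<close> demands, the
  tail is processed before the element. The body then runs in the environment of the element, the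
  accumulator and \<open>c\<close>, followed by the argument.\<close>

fun loop :: "nat \<Rightarrow> expr \<Rightarrow> expr" where
  "loop k b = Cond (Op1 IsNode (Op1 Right (Op1 Right (Arg 0))))
     (LetIn (Op1 Left (Arg 0))
       (LetIn (Call k (Op2 Pair (Arg 0) (Op2 Pair (Op1 Left (Op1 Right (Arg 1)))
            (Op1 Right (Op1 Right (Op1 Right (Arg 1)))))))
         (LetIn (Op1 Left (Op1 Right (Op1 Right (Arg 2)))) b)))
     (Op1 Left (Op1 Right (Arg 0)))"

declare loop.simps [simp del]

text \<open>Returns an expression and the bodies of the functions it calls, to be placed from
  address \<open>n\<close> on. Only folds create functions; a subroutine is closed and can be
  inlined as a \<open>LetIn\<close>.\<close>

primrec compile :: "lx \<Rightarrow> nat \<Rightarrow> expr \<times> expr list" where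
  "compile (VA i) = (\<lambda>n. (Arg i, []))"
| "compile VE = (\<lambda>n. (EmptyTree, []))"
| "compile (VL z) = (\<lambda>n. (Literal z, []))"
| "compile (V1 f a) = (\<lambda>n. let (a', fa) = compile a n in (Op1 f a', fa))"
| "compile (V2 f a b) = (\<lambda>n. let (a', fa) = compile a n; (b', fb) = compile b (n + length fa) in
     (Op2 f a' b', fa @ fb))"
| "compile (VC c a b) = (\<lambda>n. let (c', fc) = compile c n; (a', fa) = compile a (n + length fc);
     (b', fb) = compile b (n + length fc + length fa) in (Cond c' a' b', fc @ fa @ fb))"
| "compile (VLet a b) = (\<lambda>n. let (a', fa) = compile a n; (b', fb) = compile b (n + length fa) in
     (LetIn a' b', fa @ fb))"
| "compile (VS a b) = (\<lambda>n. let (a', fa) = compile a n; (b', fb) = compile b (n + length fa) in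
     (LetIn a' b', fa @ fb))"
| "compile (VQ a) = (\<lambda>n. let (a', fa) = compile a n in (Query a', fa))"
| "compile (VF c xs a b) = (\<lambda>n. let (c', fc) = compile c n; (xs', fx) = compile xs (n + length fc);
     (a', fa) = compile a (n + length fc + length fx);
     (b', fb) = compile b (n + length fc + length fx + length fa);
     k = n + length fc + length fx + length fa + length fb in
     (Call k (Op2 Pair c' (Op2 Pair a' xs')), fc @ fx @ fa @ fb @ [loop k b']))"

definition has_code :: "expr list \<Rightarrow> nat \<Rightarrow> expr list \<Rightarrow> bool" where
  "has_code P n fs \<longleftrightarrow> (\<exists>as bs. P = as @ fs @ bs \<and> length as = n)"

lemma has_code_append: "has_code P n (fs @ gs) \<longleftrightarrow> has_code P n fs \<and> has_code P (n + length fs) gs"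
proof
  assume "has_code P n (fs @ gs)"
  then obtain as bs where *: "P = as @ (fs @ gs) @ bs" "length as = n" by (auto simp: has_code_def)
  have "P = as @ fs @ (gs @ bs)" "P = (as @ fs) @ gs @ bs" using * by simp_all
  with *(2) show "has_code P n fs \<and> has_code P (n + length fs) gs"
    unfolding has_code_def by (metis length_append)
next
  assume c: "has_code P n fs \<and> has_code P (n + length fs) gs"
  obtain as bs where 1: "P = as @ fs @ bs" "length as = n" using c unfolding has_code_def by blast
  obtain as' bs' where 2: "P = as' @ gs @ bs'" "length as' = n + length fs" using c unfolding has_code_def by blast
  note * = 1 2
  have "as' = as @ fs" using * by (metis append.assoc append_eq_append_conv length_append)
  then show "has_code P n (fs @ gs)" using * unfolding has_code_def by (metis append.assoc)
qed

lemma has_code_single: "has_code P n [f] \<longleftrightarrow> n < length P \<and> P ! n = f"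
proof
  assume "n < length P \<and> P ! n = f"
  then have "P = take n P @ [f] @ drop (Suc n) P" "length (take n P) = n"
    using id_take_nth_drop[of n P] by auto
  then show "has_code P n [f]" unfolding has_code_def by blast
qed (auto simp: has_code_def)

lemma loop_nil:
  assumes code: "P ! k = loop k b'" and l: "apply1 IsNode l = Leaf"
  shows "eval P orc [Node c (Node a l)] (P ! k) a 8"
proof -
  let ?v = "Node c (Node a l)"
  have e0: "eval P orc [?v] (Op1 IsNode (Op1 Right (Op1 Right (Arg 0)))) Leaf (1 + 1 + 1 + 1)"
    using eval.Op1[OF eval.Op1[OF eval.Op1[OF eval.Arg[of 0 "[?v]" P orc], of Right], of Right], of IsNode] l by simp
  have e1: "eval P orc [?v] (Op1 Left (Op1 Right (Arg 0))) a (1 + 1 + 1)"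
    using eval.Op1[OF eval.Op1[OF eval.Arg[of 0 "[?v]" P orc], of Right], of Left] by simp
  from eval.CondF[OF e0 e1] show ?thesis unfolding code loop.simps by (simp add: eval_nat_numeral)
qed

lemma loop_correct:
  assumes code: "k < length P" "P ! k = loop k b'"
    and body: "\<And>x acc \<rho>. bnd orc N b [x, acc, c] \<Longrightarrow>
      \<exists>t\<le>tb N b. eval P orc ([x, acc, c] @ \<rho>) b' (den orc b [x, acc, c]) t"
    and bd: "\<And>ys x zs. dl l = ys @ x # zs \<Longrightarrow>
      bnd orc N b [x, foldr (\<lambda>x acc. den orc b [x, acc, c]) zs a, c]"
  shows "\<exists>t\<le>(length (dl l) + 1) * (tb N b + 40). eval P orc [Node c (Node a l)] (P ! k)
    (foldr (\<lambda>x acc. den orc b [x, acc, c]) (dl l) a) t"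
  using bd
proof (induction l)
  case (Node x l)
  let ?g = "\<lambda>x acc. den orc b [x, acc, c]"
  let ?acc = "foldr ?g (dl l) a" let ?v = "Node c (Node a (Node x l))"
  have "\<exists>t\<le>(length (dl l) + 1) * (tb N b + 40). eval P orc [Node c (Node a l)] (P ! k) ?acc t"
  proof (rule Node.IH(2))
    fix ys x' zs assume "dl l = ys @ x' # zs"
    then show "bnd orc N b [x', foldr ?g zs a, c]" by (intro Node.prems[of "x # ys"]) simp
  qed
  then obtain t1 where t1: "t1 \<le> (length (dl l) + 1) * (tb N b + 40)"
    "eval P orc [Node c (Node a l)] (P ! k) ?acc t1" by blast
  have "bnd orc N b [x, ?acc, c]" by (rule Node.prems[of "[]"]) simp
  from body[OF this] obtain t2 where t2: "t2 \<le> tb N b"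
    "eval P orc ([x, ?acc, c] @ [?v]) b' (?g x ?acc) t2" by blast
  have e0: "eval P orc [?v] (Op1 IsNode (Op1 Right (Op1 Right (Arg 0)))) (truth True) (1 + 1 + 1 + 1)"
    using eval.Op1[OF eval.Op1[OF eval.Op1[OF eval.Arg[of 0 "[?v]" P orc], of Right], of Right], of IsNode] by simp
  have e1: "eval P orc [?v] (Op1 Left (Arg 0)) c (1 + 1)"
    using eval.Op1[OF eval.Arg[of 0 "[?v]" P orc], of Left] by simp
  have e2: "eval P orc [c, ?v] (Op1 Left (Op1 Right (Arg 1))) a (1 + 1 + 1)"
    using eval.Op1[OF eval.Op1[OF eval.Arg[of 1 "[c, ?v]" P orc], of Right], of Left] by simp
  have e3: "eval P orc [c, ?v] (Op1 Right (Op1 Right (Op1 Right (Arg 1)))) l (1 + 1 + 1 + 1)"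
    using eval.Op1[OF eval.Op1[OF eval.Op1[OF eval.Arg[of 1 "[c, ?v]" P orc], of Right], of Right], of Right] by simp
  have e4: "eval P orc [c, ?v] (Arg 0) c 1"
    using eval.Arg[of 0 "[c, ?v]" P orc] by simp
  have e5: "eval P orc [c, ?v] (Op2 Pair (Arg 0) (Op2 Pair (Op1 Left (Op1 Right (Arg 1)))
      (Op1 Right (Op1 Right (Op1 Right (Arg 1)))))) (Node c (Node a l)) 10"
    using eval.Op2[OF e4 eval.Op2[OF e2 e3, of Pair], of Pair] by (simp add: eval_nat_numeral)
  note e6 = eval.Call[OF e5 code(1) t1(2)]
  have e7: "eval P orc [?acc, c, ?v] (Op1 Left (Op1 Right (Op1 Right (Arg 2)))) x (1 + 1 + 1 + 1)"
    using eval.Op1[OF eval.Op1[OF eval.Op1[OF eval.Arg[of 2 "[?acc, c, ?v]" P orc], of Right], of Right], of Left] by simp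
  have t2': "eval P orc (x # [?acc, c, ?v]) b' (?g x ?acc) t2" using t2(2) by simp
  note e8 = eval.LetIn[OF e1 eval.LetIn[OF e6 eval.LetIn[OF e7 t2']]]
  have ne: "truth True \<noteq> Leaf" by (simp add: truth_def)
  have "eval P orc [?v] (P ! k) (?g x ?acc) (1 + 1 + 1 + 1 + (1 + 1 + (10 + t1 + 1 + (1 + 1 + 1 + 1 + t2 + 1) + 1) + 1) + 1)"
    unfolding code(2) loop.simps by (rule eval.CondT[OF e0 ne e8])
  moreover have "1 + 1 + 1 + 1 + (1 + 1 + (10 + t1 + 1 + (1 + 1 + 1 + 1 + t2 + 1) + 1) + 1) + 1
      \<le> (length (dl (Node x l)) + 1) * (tb N b + 40)"
    using t1(1) t2(1) by (simp add: algebra_simps)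
  ultimately show ?case by (intro exI conjI) (assumption, simp)
next
  case Leaf then show ?case using loop_nil[OF code(2), of Leaf] by (intro exI[of _ 8]) simp
next
  case (Vtx x) then show ?case using loop_nil[OF code(2), of "Vtx x"] by (intro exI[of _ 8]) simp
next
  case (Edg x) then show ?case using loop_nil[OF code(2), of "Edg x"] by (intro exI[of _ 8]) simp
next
  case (Num x) then show ?case using loop_nil[OF code(2), of "Num x"] by (intro exI[of _ 8]) simp
qed

text \<open>The suffix \<open>\<rho>\<close> stands for whatever lies in the environment below the
  variables of \<open>e\<close>. It is what allows closed bodies to be executed in larger
  environments.\<close>

theorem compile_correct:
  assumes "compile e n = (ex, fs)" "has_code P n fs" "wfx (length \<sigma>) e" "bnd orc N e \<sigma>"
  shows "\<exists>t\<le>tb N e. eval P orc (\<sigma> @ \<rho>) ex (den orc e \<sigma>) t"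
  using assms
proof (induction e arbitrary: n ex fs \<sigma> \<rho>)
  case (VA i)
  then have "eval P orc (\<sigma> @ \<rho>) (Arg i) ((\<sigma> @ \<rho>) ! i) 1" by (intro eval.Arg) simp
  then show ?case using VA by (auto simp: nth_append)
next
  case VE then show ?case by (auto intro!: exI[of _ "Suc 0"] eval.EmptyTree[simplified])
next
  case (VL z) then show ?case by (auto intro!: exI[of _ "Suc 0"] eval.Literal[simplified])
next
  case (V1 f a)
  obtain a' fa where a: "compile a n = (a', fa)" by fastforce
  have c: "ex = Op1 f a'" "has_code P n fa" using V1.prems a by auto
  obtain t where "t \<le> tb N a" "eval P orc (\<sigma> @ \<rho>) a' (den orc a \<sigma>) t"
    using V1.IH[OF a c(2)] V1.prems by (auto simp del: length_0_conv)
  then show ?case unfolding c(1) by (intro exI[of _ "t + 1"] conjI) (auto intro: eval.Op1[simplified])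
next
  case (V2 f a b)
  obtain a' fa where a: "compile a n = (a', fa)" by fastforce
  obtain b' fb where b: "compile b (n + length fa) = (b', fb)" by fastforce
  have c: "ex = Op2 f a' b'" "has_code P n fa" "has_code P (n + length fa) fb"
    using V2.prems a b by (auto simp: has_code_append)
  obtain t1 where t1: "t1 \<le> tb N a" "eval P orc (\<sigma> @ \<rho>) a' (den orc a \<sigma>) t1"
    using V2.IH(1)[OF a c(2)] V2.prems by auto
  obtain t2 where t2: "t2 \<le> tb N b" "eval P orc (\<sigma> @ \<rho>) b' (den orc b \<sigma>) t2"
    using V2.IH(2)[OF b c(3)] V2.prems by auto
  have "eval P orc (\<sigma> @ \<rho>) ex (den orc (V2 f a b) \<sigma>) (t1 + t2 + 1)"
    unfolding c(1) den.simps by (rule eval.Op2[OF t1(2) t2(2)])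
  then show ?case using t1(1) t2(1) by (intro exI[of _ "t1 + t2 + 1"]) simp
next
  case (VC d a b)
  obtain d' fd where d: "compile d n = (d', fd)" by fastforce
  obtain a' fa where a: "compile a (n + length fd) = (a', fa)" by fastforce
  obtain b' fb where b: "compile b (n + length fd + length fa) = (b', fb)" by fastforce
  have c: "ex = Cond d' a' b'" "has_code P n fd" "has_code P (n + length fd) fa"
    "has_code P (n + length fd + length fa) fb"
    using VC.prems d a b by (auto simp: has_code_append)
  obtain t1 where t1: "t1 \<le> tb N d" "eval P orc (\<sigma> @ \<rho>) d' (den orc d \<sigma>) t1"
    using VC.IH(1)[OF d c(2)] VC.prems by auto
  show ?case
  proof (cases "den orc d \<sigma> = Leaf")
    case True
    obtain t2 where t2: "t2 \<le> tb N b" "eval P orc (\<sigma> @ \<rho>) b' (den orc b \<sigma>) t2"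
      using VC.IH(3)[OF b c(4)] VC.prems True by auto
    have "eval P orc (\<sigma> @ \<rho>) ex (den orc (VC d a b) \<sigma>) (t1 + t2 + 1)"
      unfolding c(1) using eval.CondF[OF t1(2)[unfolded True] t2(2)] True by simp
    then show ?thesis using t1(1) t2(1) by (intro exI[of _ "t1 + t2 + 1"]) simp
  next
    case False
    obtain t2 where t2: "t2 \<le> tb N a" "eval P orc (\<sigma> @ \<rho>) a' (den orc a \<sigma>) t2"
      using VC.IH(2)[OF a c(3)] VC.prems False by auto
    have "eval P orc (\<sigma> @ \<rho>) ex (den orc (VC d a b) \<sigma>) (t1 + t2 + 1)"
      unfolding c(1) using eval.CondT[OF t1(2) False t2(2)] False by simp
    then show ?thesis using t1(1) t2(1) by (intro exI[of _ "t1 + t2 + 1"]) simp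
  qed
next
  case (VLet a b)
  obtain a' fa where a: "compile a n = (a', fa)" by fastforce
  obtain b' fb where b: "compile b (n + length fa) = (b', fb)" by fastforce
  have c: "ex = LetIn a' b'" "has_code P n fa" "has_code P (n + length fa) fb"
    using VLet.prems a b by (auto simp: has_code_append)
  obtain t1 where t1: "t1 \<le> tb N a" "eval P orc (\<sigma> @ \<rho>) a' (den orc a \<sigma>) t1"
    using VLet.IH(1)[OF a c(2)] VLet.prems by auto
  obtain t2 where t2: "t2 \<le> tb N b"
    "eval P orc ((den orc a \<sigma> # \<sigma>) @ \<rho>) b' (den orc b (den orc a \<sigma> # \<sigma>)) t2"
    using VLet.IH(2)[OF b c(3), of "den orc a \<sigma> # \<sigma>"] VLet.prems by auto
  have "eval P orc (\<sigma> @ \<rho>) ex (den orc (VLet a b) \<sigma>) (t1 + t2 + 1)"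
    unfolding c(1) using eval.LetIn[OF t1(2)] t2(2) by simp
  then show ?case using t1(1) t2(1) by (intro exI[of _ "t1 + t2 + 1"]) simp
next
  case (VS a b)
  obtain a' fa where a: "compile a n = (a', fa)" by fastforce
  obtain b' fb where b: "compile b (n + length fa) = (b', fb)" by fastforce
  have c: "ex = LetIn a' b'" "has_code P n fa" "has_code P (n + length fa) fb"
    using VS.prems a b by (auto simp: has_code_append)
  obtain t1 where t1: "t1 \<le> tb N a" "eval P orc (\<sigma> @ \<rho>) a' (den orc a \<sigma>) t1"
    using VS.IH(1)[OF a c(2)] VS.prems by auto
  obtain t2 where t2: "t2 \<le> tb N b"
    "eval P orc ([den orc a \<sigma>] @ (\<sigma> @ \<rho>)) b' (den orc b [den orc a \<sigma>]) t2"
    using VS.IH(2)[OF b c(3), of "[den orc a \<sigma>]"] VS.prems by auto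
  have "eval P orc (\<sigma> @ \<rho>) ex (den orc (VS a b) \<sigma>) (t1 + t2 + 1)"
    unfolding c(1) using eval.LetIn[OF t1(2)] t2(2) by simp
  then show ?case using t1(1) t2(1) by (intro exI[of _ "t1 + t2 + 1"]) simp
next
  case (VQ a)
  obtain a' fa where a: "compile a n = (a', fa)" by fastforce
  have c: "ex = Query a'" "has_code P n fa" using VQ.prems a by auto
  obtain t where t: "t \<le> tb N a" "eval P orc (\<sigma> @ \<rho>) a' (den orc a \<sigma>) t"
    using VQ.IH[OF a c(2)] VQ.prems by auto
  have "eval P orc (\<sigma> @ \<rho>) ex (den orc (VQ a) \<sigma>) (t + snd (orc (den orc a \<sigma>)) + 1)"
    unfolding c(1) den.simps by (rule eval.Query[OF t(2)])
  then show ?case using t(1) VQ.prems(4) by (intro exI[of _ "t + snd (orc (den orc a \<sigma>)) + 1"]) simp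
next
  case (VF d xs a b)
  obtain d' fd where d: "compile d n = (d', fd)" by fastforce
  obtain x' fx where x: "compile xs (n + length fd) = (x', fx)" by fastforce
  obtain a' fa where a: "compile a (n + length fd + length fx) = (a', fa)" by fastforce
  obtain b' fb where b: "compile b (n + length fd + length fx + length fa) = (b', fb)" by fastforce
  let ?k = "n + length fd + length fx + length fa + length fb"
  have c: "ex = Call ?k (Op2 Pair d' (Op2 Pair a' x'))" "has_code P n fd" "has_code P (n + length fd) fx"
    "has_code P (n + length fd + length fx) fa" "has_code P (n + length fd + length fx + length fa) fb"
    "has_code P ?k [loop ?k b']"
    using VF.prems d x a b by (auto simp: has_code_append Let_def add.assoc)
  have k: "?k < length P" "P ! ?k = loop ?k b'" using c(6) unfolding has_code_single by blast+
  have wf: "wfx (length \<sigma>) d" "wfx (length \<sigma>) xs" "wfx (length \<sigma>) a" "wfx 3 b"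
    and bn: "bnd orc N d \<sigma>" "bnd orc N xs \<sigma>" "bnd orc N a \<sigma>"
    using VF.prems(3,4) by simp_all
  obtain t1 where t1: "t1 \<le> tb N d" "eval P orc (\<sigma> @ \<rho>) d' (den orc d \<sigma>) t1"
    using VF.IH(1)[OF d c(2) wf(1) bn(1)] by blast
  obtain t2 where t2: "t2 \<le> tb N xs" "eval P orc (\<sigma> @ \<rho>) x' (den orc xs \<sigma>) t2"
    using VF.IH(2)[OF x c(3) wf(2) bn(2)] by blast
  obtain t3 where t3: "t3 \<le> tb N a" "eval P orc (\<sigma> @ \<rho>) a' (den orc a \<sigma>) t3"
    using VF.IH(3)[OF a c(4) wf(3) bn(3)] by blast
  have body: "\<exists>t\<le>tb N b. eval P orc ([u, v, w] @ \<rho>') b' (den orc b [u, v, w]) t"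
    if "bnd orc N b [u, v, w]" for u v w \<rho>'
    using VF.IH(4)[OF b c(5) _ that, of \<rho>'] wf(4) by (simp add: numeral_3_eq_3)
  have len: "length (dl (den orc xs \<sigma>)) \<le> N" using VF.prems(4) by simp
  have bd: "bnd orc N b [u, foldr (\<lambda>x acc. den orc b [x, acc, den orc d \<sigma>]) zs (den orc a \<sigma>), den orc d \<sigma>]"
    if "dl (den orc xs \<sigma>) = ys @ u # zs" for ys u zs
    using VF.prems(4) that by simp
  obtain t4 where t4: "t4 \<le> (length (dl (den orc xs \<sigma>)) + 1) * (tb N b + 40)"
    "eval P orc [Node (den orc d \<sigma>) (Node (den orc a \<sigma>) (den orc xs \<sigma>))] (P ! ?k) (den orc (VF d xs a b) \<sigma>) t4"
  proof -
    have "\<exists>t\<le>(length (dl (den orc xs \<sigma>)) + 1) * (tb N b + 40).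
      eval P orc [Node (den orc d \<sigma>) (Node (den orc a \<sigma>) (den orc xs \<sigma>))] (P ! ?k) (den orc (VF d xs a b) \<sigma>) t"
      unfolding den.simps by (rule loop_correct[OF k body bd])
    then show ?thesis using that by blast
  qed
  have "eval P orc (\<sigma> @ \<rho>) (Op2 Pair d' (Op2 Pair a' x'))
      (Node (den orc d \<sigma>) (Node (den orc a \<sigma>) (den orc xs \<sigma>))) (t1 + (t3 + t2 + 1) + 1)"
    using eval.Op2[OF t1(2) eval.Op2[OF t3(2) t2(2), of Pair], of Pair] by simp
  from eval.Call[OF this k(1) t4(2)]
  have "eval P orc (\<sigma> @ \<rho>) ex (den orc (VF d xs a b) \<sigma>) (t1 + (t3 + t2 + 1) + 1 + t4 + 1)"
    unfolding c(1) .
  moreover have "t4 \<le> (N + 1) * (tb N b + 40)"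
    using t4(1) mult_le_mono1[of "length (dl (den orc xs \<sigma>)) + 1" "N + 1" "tb N b + 40"] len by linarith
  ultimately show ?case using t1(1) t2(1) t3(1)
    by (intro exI[of _ "t1 + (t3 + t2 + 1) + 1 + t4 + 1"]) simp
qed

section \<open>Derived loops and their meaning\<close>

abbreviation (input) "Lf a \<equiv> V1 Left a"
abbreviation (input) "Rt a \<equiv> V1 Right a"
abbreviation (input) "Pr a b \<equiv> V2 Pair a b"
abbreviation (input) "xT \<equiv> V2 Pair VE VE"
abbreviation (input) "A0 \<equiv> VA 0"

text \<open>In the following loops the body \<open>p\<close> is a subroutine applied to the pair of the element and
  the context \<open>c\<close>.\<close>

definition xEx :: "lx \<Rightarrow> lx \<Rightarrow> lx \<Rightarrow> lx" where
  "xEx c xs p = VF c xs VE (VC (VS (Pr (VA 0) (VA 2)) p) xT (VA 1))"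
definition xAll :: "lx \<Rightarrow> lx \<Rightarrow> lx \<Rightarrow> lx" where
  "xAll c xs p = VF c xs xT (VC (VS (Pr (VA 0) (VA 2)) p) (VA 1) VE)"
definition xFil :: "lx \<Rightarrow> lx \<Rightarrow> lx \<Rightarrow> lx" where
  "xFil c xs p = VF c xs VE (VC (VS (Pr (VA 0) (VA 2)) p) (Pr (VA 0) (VA 1)) (VA 1))"
definition xMap :: "lx \<Rightarrow> lx \<Rightarrow> lx \<Rightarrow> lx" where
  "xMap c xs p = VF c xs VE (Pr (VS (Pr (VA 0) (VA 2)) p) (VA 1))"
definition xSum :: "lx \<Rightarrow> lx \<Rightarrow> lx \<Rightarrow> lx" where
  "xSum c xs p = VF c xs (VL 0) (V2 Add (VS (Pr (VA 0) (VA 2)) p) (VA 1))"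
definition xFold :: "lx \<Rightarrow> lx \<Rightarrow> lx \<Rightarrow> lx \<Rightarrow> lx" where
  "xFold c xs a p = VF c xs a (VS (Pr (VA 0) (Pr (VA 1) (VA 2))) p)"
definition xNot :: "lx \<Rightarrow> lx" where "xNot a = VC a VE xT"
definition xAnd :: "lx \<Rightarrow> lx \<Rightarrow> lx" where "xAnd a b = VC a b VE"

fun num :: "('v,'e) data \<Rightarrow> real" where "num (Num r) = r" | "num _ = 0"

lemma truth_simps [simp]: "truth True = Node Leaf Leaf" "truth False = Leaf" "truth b = Leaf \<longleftrightarrow> \<not> b"
  by (simp_all add: truth_def)

lemma den_xEx [simp]: "den orc (xEx c xs p) \<sigma> =
    truth (\<exists>x\<in>set (dl (den orc xs \<sigma>)). den orc p [Node x (den orc c \<sigma>)] \<noteq> Leaf)"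
proof -
  have "foldr (\<lambda>x acc. if Q x then Node Leaf Leaf else acc) l Leaf = truth (\<exists>x\<in>set l. Q x)" for Q l
    by (induction l) auto
  from this[of "\<lambda>x. den orc p [Node x (den orc c \<sigma>)] \<noteq> Leaf"] show ?thesis by (simp add: xEx_def numeral_2_eq_2 cong: if_cong)
qed

lemma den_xAll [simp]: "den orc (xAll c xs p) \<sigma> =
    truth (\<forall>x\<in>set (dl (den orc xs \<sigma>)). den orc p [Node x (den orc c \<sigma>)] \<noteq> Leaf)"
proof -
  have "foldr (\<lambda>x acc. if Q x then acc else Leaf) l (Node Leaf Leaf) = truth (\<forall>x\<in>set l. Q x)" for Q l
    by (induction l) auto
  from this[of "\<lambda>x. den orc p [Node x (den orc c \<sigma>)] \<noteq> Leaf"] show ?thesis by (simp add: xAll_def numeral_2_eq_2 cong: if_cong)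
qed

lemma den_xFil [simp]: "den orc (xFil c xs p) \<sigma> =
    list_data (filter (\<lambda>x. den orc p [Node x (den orc c \<sigma>)] \<noteq> Leaf) (dl (den orc xs \<sigma>)))"
proof -
  have "foldr (\<lambda>x acc. if Q x then Node x acc else acc) l Leaf = list_data (filter Q l)" for Q l
    by (induction l) auto
  from this[of "\<lambda>x. den orc p [Node x (den orc c \<sigma>)] \<noteq> Leaf"] show ?thesis by (simp add: xFil_def numeral_2_eq_2 cong: if_cong)
qed

lemma den_xMap [simp]: "den orc (xMap c xs p) \<sigma> =
    list_data (map (\<lambda>x. den orc p [Node x (den orc c \<sigma>)]) (dl (den orc xs \<sigma>)))"
proof -
  have "foldr (\<lambda>x acc. Node (f x) acc) l Leaf = list_data (map f l)" for f l
    by (induction l) auto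
  from this[of "\<lambda>x. den orc p [Node x (den orc c \<sigma>)]"] show ?thesis by (simp add: xMap_def numeral_2_eq_2)
qed

text \<open>Conditional, because adding anything other than two numbers yields \<open>Leaf\<close>;
  every summand has to be known to be a number.\<close>

lemma den_xSum:
  assumes "\<And>x. x \<in> set (dl (den orc xs \<sigma>)) \<Longrightarrow> den orc p [Node x (den orc c \<sigma>)] = Num (f x)"
  shows "den orc (xSum c xs p) \<sigma> = Num (\<Sum>x\<leftarrow>dl (den orc xs \<sigma>). f x)"
proof -
  have "foldr (\<lambda>x acc. apply2 Add (g x) acc) l (Num 0) = Num (\<Sum>x\<leftarrow>l. f x)"
    if "\<And>x. x \<in> set l \<Longrightarrow> g x = Num (f x)" for g l
    using that by (induction l) auto
  from this[of "dl (den orc xs \<sigma>)" "\<lambda>x. den orc p [Node x (den orc c \<sigma>)]"] assms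
  show ?thesis by (simp add: xSum_def numeral_2_eq_2)
qed

lemma den_xFold [simp]: "den orc (xFold c xs a p) \<sigma> =
    foldr (\<lambda>x acc. den orc p [Node x (Node acc (den orc c \<sigma>))]) (dl (den orc xs \<sigma>)) (den orc a \<sigma>)"
  by (simp add: xFold_def numeral_2_eq_2)

lemma den_xNot [simp]: "den orc (xNot a) \<sigma> = truth (den orc a \<sigma> = Leaf)"
  by (simp add: xNot_def)
lemma den_xAnd [simp]: "den orc (xAnd a b) \<sigma> = (if den orc a \<sigma> \<noteq> Leaf then den orc b \<sigma> else Leaf)"
  by (simp add: xAnd_def)

text \<open>For a body that does not look at the accumulator, the condition that \<open>bnd\<close>
  imposes on every position becomes one on every element.\<close>

lemma split_all: "(\<forall>ys x zs. l = ys @ x # zs \<longrightarrow> Q x) \<longleftrightarrow> (\<forall>x\<in>set l. Q x)"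
  "(\<forall>ys x. (\<exists>zs. l = ys @ x # zs) \<longrightarrow> Q x) \<longleftrightarrow> (\<forall>x\<in>set l. Q x)"
  by (metis in_set_conv_decomp)+

lemma bnd_loops [simp]:
  "bnd orc N (xEx c xs p) \<sigma> \<longleftrightarrow> bnd orc N c \<sigma> \<and> bnd orc N xs \<sigma> \<and> length (dl (den orc xs \<sigma>)) \<le> N \<and>
     (\<forall>x\<in>set (dl (den orc xs \<sigma>)). bnd orc N p [Node x (den orc c \<sigma>)])"
  "bnd orc N (xAll c xs p) \<sigma> \<longleftrightarrow> bnd orc N c \<sigma> \<and> bnd orc N xs \<sigma> \<and> length (dl (den orc xs \<sigma>)) \<le> N \<and>
     (\<forall>x\<in>set (dl (den orc xs \<sigma>)). bnd orc N p [Node x (den orc c \<sigma>)])"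
  "bnd orc N (xFil c xs p) \<sigma> \<longleftrightarrow> bnd orc N c \<sigma> \<and> bnd orc N xs \<sigma> \<and> length (dl (den orc xs \<sigma>)) \<le> N \<and>
     (\<forall>x\<in>set (dl (den orc xs \<sigma>)). bnd orc N p [Node x (den orc c \<sigma>)])"
  "bnd orc N (xMap c xs p) \<sigma> \<longleftrightarrow> bnd orc N c \<sigma> \<and> bnd orc N xs \<sigma> \<and> length (dl (den orc xs \<sigma>)) \<le> N \<and>
     (\<forall>x\<in>set (dl (den orc xs \<sigma>)). bnd orc N p [Node x (den orc c \<sigma>)])"
  "bnd orc N (xSum c xs p) \<sigma> \<longleftrightarrow> bnd orc N c \<sigma> \<and> bnd orc N xs \<sigma> \<and> length (dl (den orc xs \<sigma>)) \<le> N \<and>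
     (\<forall>x\<in>set (dl (den orc xs \<sigma>)). bnd orc N p [Node x (den orc c \<sigma>)])"
  by (simp_all add: xEx_def xAll_def xFil_def xMap_def xSum_def numeral_2_eq_2 split_all cong: if_cong split del: if_split)

lemma bnd_xFold [simp]:
  "bnd orc N (xFold c xs a p) \<sigma> \<longleftrightarrow> bnd orc N c \<sigma> \<and> bnd orc N xs \<sigma> \<and> bnd orc N a \<sigma> \<and>
     length (dl (den orc xs \<sigma>)) \<le> N \<and>
     (\<forall>ys x zs. dl (den orc xs \<sigma>) = ys @ x # zs \<longrightarrow>
       bnd orc N p [Node x (Node (foldr (\<lambda>x acc. den orc p [Node x (Node acc (den orc c \<sigma>))]) zs (den orc a \<sigma>))
         (den orc c \<sigma>))])"
  by (simp add: xFold_def numeral_2_eq_2)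

lemma bnd_bool [simp]:
  "bnd orc N (xNot a) \<sigma> \<longleftrightarrow> bnd orc N a \<sigma>"
  "bnd orc N (xAnd a b) \<sigma> \<longleftrightarrow> bnd orc N a \<sigma> \<and> (den orc a \<sigma> \<noteq> Leaf \<longrightarrow> bnd orc N b \<sigma>)"
  by (auto simp: xNot_def xAnd_def)

lemma wfx_loops [simp]:
  "wfx k (xEx c xs p) \<longleftrightarrow> wfx k c \<and> wfx k xs \<and> wfx 1 p"
  "wfx k (xAll c xs p) \<longleftrightarrow> wfx k c \<and> wfx k xs \<and> wfx 1 p"
  "wfx k (xFil c xs p) \<longleftrightarrow> wfx k c \<and> wfx k xs \<and> wfx 1 p"
  "wfx k (xMap c xs p) \<longleftrightarrow> wfx k c \<and> wfx k xs \<and> wfx 1 p"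
  "wfx k (xSum c xs p) \<longleftrightarrow> wfx k c \<and> wfx k xs \<and> wfx 1 p"
  "wfx k (xFold c xs a p) \<longleftrightarrow> wfx k c \<and> wfx k xs \<and> wfx k a \<and> wfx 1 p"
  "wfx k (xNot a) \<longleftrightarrow> wfx k a" "wfx k (xAnd a b) \<longleftrightarrow> wfx k a \<and> wfx k b"
  by (auto simp: xEx_def xAll_def xFil_def xMap_def xSum_def xFold_def xNot_def xAnd_def)

subsection \<open>Data representation of pieces\<close>

text \<open>Entries are pairs of a vertex and a payload: the cost in the pieces described by
  \<open>okX\<close>, empty in the list of the two ends of an edge.\<close>

definition vX :: "('v,'e) data \<Rightarrow> 'v set" where
  "vX d = {v. \<exists>k. Node (Vtx v) k \<in> set (dl d)}"

definition okW :: "('v,'e) data \<Rightarrow> bool" where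
  "okW d \<longleftrightarrow> (\<forall>x\<in>set (dl d). \<exists>v k. x = Node (Vtx v) k)"

definition decM :: "('v,'e) data \<Rightarrow> 'e multiset" where
  "decM d = (THE M. enc_edges d M)"

definition dec :: "('v,'e) data \<Rightarrow> ('v,'e) piece" where
  "dec p = Piece (vX (apply1 Left p)) (decM (apply1 Left (apply1 Right p)))
     (num (apply1 Left (apply1 Right (apply1 Right p)))) (apply1 Right (apply1 Right (apply1 Right p)) \<noteq> Leaf)"

abbreviation decL :: "('v,'e) data \<Rightarrow> ('v,'e) piece list" where
  "decL ds \<equiv> map dec (dl ds)"

lemma enc_edges_unique:
  fixes d :: "('v,'e) data"
  assumes "enc_edges d M" "enc_edges d M'"
  shows "M = M'"
proof -
  obtain es where es: "set es = set_mset M" "d = list_data (map (\<lambda>e. Node (Edg e) (Num (of_nat (count M e)))) es)"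
    using assms(1) by (auto simp: enc_edges_def)
  obtain es' where es': "set es' = set_mset M'" "d = list_data (map (\<lambda>e. Node (Edg e) (Num (of_nat (count M' e)))) es')"
    using assms(2) by (auto simp: enc_edges_def)
  have m: "map (\<lambda>e. Node (Edg e) (Num (of_nat (count M e))) :: ('v,'e) data) es = map (\<lambda>e. Node (Edg e) (Num (of_nat (count M' e)))) es'"
    using arg_cong[OF trans[OF es(2)[symmetric] es'(2)], of dl] by simp
  from arg_cong[OF m, of "map (apply1 Left)"] have "map (Edg :: 'e \<Rightarrow> ('v,'e) data) es = map Edg es'" by (simp add: comp_def)
  then have e: "es = es'" by (simp add: inj_on_def flip: map_map)
  show ?thesis
  proof (rule multiset_eqI)
    fix e
    show "count M e = count M' e"
    proof (cases "e \<in> set es")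
      case True
      then show ?thesis using m unfolding e[symmetric] map_eq_conv by simp
    next
      case False
      then have "e \<notin># M" "e \<notin># M'" using es(1) es'(1) e by auto
      then show ?thesis by (simp add: not_in_iff)
    qed
  qed
qed

lemma decM_eq: "enc_edges d M \<Longrightarrow> decM d = M"
  unfolding decM_def by (blast intro: the_equality enc_edges_unique)

definition s_mem :: lx where
  "s_mem = xEx (Lf A0) (Rt A0) (V2 Same (Lf (Lf A0)) (Lf (Rt A0)))"

lemma wf_s_mem [simp]: "wfx (Suc 0) s_mem" by (simp add: s_mem_def)

lemma den_s_mem: "okW ys \<Longrightarrow> den orc s_mem [Node (Node (Vtx v) k) ys] = truth (v \<in> vX ys)"
  by (auto simp: s_mem_def vX_def okW_def intro!: arg_cong[of _ _ truth]; force)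

lemma bnd_s_mem: "length (dl ys) \<le> N \<Longrightarrow> bnd orc N s_mem [Node x ys]"
  by (simp add: s_mem_def)

definition s_touch :: lx where "s_touch = xEx (Rt A0) (Lf A0) s_mem"
definition s_sub :: lx where "s_sub = xAll (Rt A0) (Lf A0) s_mem"

lemma wf_s_touch [simp]: "wfx (Suc 0) s_touch" "wfx (Suc 0) s_sub" by (simp_all add: s_touch_def s_sub_def)

lemma den_s_touch:
  assumes "okW xs" "okW ys"
  shows "den orc s_touch [Node xs ys] = truth (vX xs \<inter> vX ys \<noteq> {})"
    "den orc s_sub [Node xs ys] = truth (vX xs \<subseteq> vX ys)"
proof -
  have 1: "den orc s_mem [Node x ys] \<noteq> Leaf \<longleftrightarrow> (\<exists>v k. x = Node (Vtx v) k \<and> v \<in> vX ys)" if "x \<in> set (dl xs)" for x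
    using assms that den_s_mem[OF assms(2)] by (fastforce simp: okW_def)
  show "den orc s_touch [Node xs ys] = truth (vX xs \<inter> vX ys \<noteq> {})"
    using 1 by (auto simp: s_touch_def vX_def[of xs] intro!: arg_cong[of _ _ truth])
  show "den orc s_sub [Node xs ys] = truth (vX xs \<subseteq> vX ys)"
  proof -
    have "(\<forall>x\<in>set (dl xs). den orc s_mem [Node x ys] \<noteq> Leaf) \<longleftrightarrow> vX xs \<subseteq> vX ys"
    proof
      assume a: "\<forall>x\<in>set (dl xs). den orc s_mem [Node x ys] \<noteq> Leaf"
      show "vX xs \<subseteq> vX ys" using a 1 by (fastforce simp: vX_def[of xs])
    next
      assume a: "vX xs \<subseteq> vX ys"
      show "\<forall>x\<in>set (dl xs). den orc s_mem [Node x ys] \<noteq> Leaf"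
      proof
        fix x assume x: "x \<in> set (dl xs)"
        then obtain v k where v: "x = Node (Vtx v) k" using assms(1) by (auto simp: okW_def)
        then have "v \<in> vX ys" using a x by (auto simp: vX_def[of xs])
        then show "den orc s_mem [Node x ys] \<noteq> Leaf" using 1[OF x] v by simp
      qed
    qed
    then show ?thesis by (simp add: s_sub_def)
  qed
qed

lemma bnd_s_touch: "length (dl xs) \<le> N \<Longrightarrow> length (dl ys) \<le> N \<Longrightarrow> bnd orc N s_touch [Node xs ys]"
    "length (dl xs) \<le> N \<Longrightarrow> length (dl ys) \<le> N \<Longrightarrow> bnd orc N s_sub [Node xs ys]"
  by (simp_all add: s_touch_def s_sub_def bnd_s_mem)

definition s_app :: lx where
  "s_app = VF VE (Lf A0) (Rt A0) (Pr (VA 0) (VA 1))"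

lemma wf_s_app [simp]: "wfx (Suc 0) s_app" by (simp add: s_app_def)

lemma den_s_app: "den orc s_app [Node a b] = foldr Node (dl a) b"
  by (simp add: s_app_def)

lemma dl_foldr_Node [simp]: "dl (foldr Node xs b) = xs @ dl b"
  by (induction xs) auto

lemma bnd_s_app: "length (dl a) \<le> N \<Longrightarrow> bnd orc N s_app [Node a b]"
  by (simp add: s_app_def)

definition s_cnt :: lx where
  "s_cnt = xSum (Lf A0) (Rt A0) (VC (V2 Same (Lf (Lf A0)) (Rt A0)) (Rt (Lf A0)) (VL 0))"

lemma wf_s_cnt [simp]: "wfx (Suc 0) s_cnt" by (simp add: s_cnt_def)

lemma den_s_cnt:
  assumes "enc_edges m M"
  shows "den orc s_cnt [Node (Edg e) m] = Num (of_nat (count M e))"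
proof -
  obtain es where es: "distinct es" "set es = set_mset M"
    "m = list_data (map (\<lambda>e. Node (Edg e) (Num (of_nat (count M e)))) es)"
    using assms by (auto simp: enc_edges_def)
  have "den orc s_cnt [Node (Edg e) m] =
      Num (\<Sum>x\<leftarrow>dl (den orc (Rt A0) [Node (Edg e) m]). if apply1 Left x = Edg e then num (apply1 Right x) else 0)"
    unfolding s_cnt_def by (rule den_xSum) (auto simp: es(3))
  also have "(\<Sum>x\<leftarrow>dl (den orc (Rt A0) [Node (Edg e) m]). if apply1 Left x = Edg e then num (apply1 Right x) else 0)
      = (\<Sum>e'\<leftarrow>es. if e' = e then real (count M e) else 0)"
    unfolding es(3) by (simp add: comp_def) (rule arg_cong[of _ _ sum_list], auto)
  also have "\<dots> = (\<Sum>e'\<in>set es. if e' = e then real (count M e) else 0)"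
    by (rule sum_list_distinct_conv_sum_set[OF es(1)])
  also have "\<dots> = of_nat (count M e)" using es(2) by (simp add: count_eq_zero_iff)
  finally show ?thesis .
qed

lemma bnd_s_cnt: "length (dl m) \<le> N \<Longrightarrow> bnd orc N s_cnt [Node e m]"
  by (simp add: s_cnt_def)

text \<open>The sum is rebuilt along the list of all edges instead of concatenating, because an
  encoding lists each edge once. Edges of multiplicity zero are skipped.\<close>

definition s_addm :: lx where
  "s_addm = VF (Rt A0) (Lf A0) VE
     (VLet (V2 Add (VS (Pr (Lf (VA 0)) (Lf (VA 2))) s_cnt) (VS (Pr (Lf (VA 0)) (Rt (VA 2))) s_cnt))
       (VC (V2 Leq (VA 0) (VL 0)) (VA 2) (Pr (Pr (Lf (VA 1)) (VA 0)) (VA 2))))"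

lemma wf_s_addm [simp]: "wfx (Suc 0) s_addm" by (simp add: s_addm_def)

definition okA :: "('v,'e) pre_digraph \<Rightarrow> ('v,'e) data \<Rightarrow> bool" where
  "okA G A \<longleftrightarrow> (\<exists>es x. distinct es \<and> set es = arcs G \<and>
     A = list_data (map (\<lambda>e. list_data [Edg e, Vtx (tail G e), Vtx (head G e), Num (x e)]) es))"

lemma enc_edges_filterI:
  assumes "distinct es" "set_mset M \<subseteq> set es"
  shows "enc_edges (list_data (map (\<lambda>e. Node (Edg e) (Num (of_nat (count M e)))) (filter (\<lambda>e. e \<in># M) es))) M"
  unfolding enc_edges_def using assms by (intro exI[of _ "filter (\<lambda>e. e \<in># M) es"]) auto

lemma den_s_addm:
  assumes A: "okA G A" and m: "enc_edges a M" "enc_edges b M'" "set_mset M \<subseteq> arcs G" "set_mset M' \<subseteq> arcs G"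
  shows "enc_edges (den orc s_addm [Node A (Node a b)]) (M + M')"
proof -
  obtain es x where es: "distinct es" "set es = arcs G"
    "A = list_data (map (\<lambda>e. list_data [Edg e, Vtx (tail G e), Vtx (head G e), Num (x e)]) es)"
    using A by (auto simp: okA_def)
  let ?f = "\<lambda>e. Node (Edg e) (Num (of_nat (count (M + M') e)))"
  have "den orc s_addm [Node A (Node a b)] = foldr (\<lambda>e acc. if e \<in># M + M' then Node (?f e) acc else acc) es Leaf"
    unfolding s_addm_def es(3)
    by (simp add: foldr_map comp_def den_s_cnt[OF m(1)] den_s_cnt[OF m(2)] numeral_2_eq_2 cong: if_cong)
      (rule foldr_cong, simp_all add: fun_eq_iff not_in_iff den_s_cnt[OF m(1)] den_s_cnt[OF m(2)] flip: count_greater_zero_iff)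
  also have "\<dots> = list_data (map ?f (filter (\<lambda>e. e \<in># M + M') es))"
    by (induction es) auto
  finally show ?thesis using enc_edges_filterI[OF es(1), of "M + M'"] m(3,4) es(2) by simp
qed

lemma bnd_s_addm: "length (dl A) \<le> N \<Longrightarrow> length (dl a) \<le> N \<Longrightarrow> length (dl b) \<le> N \<Longrightarrow> bnd orc N s_addm [Node A (Node a b)]"
  by (simp add: s_addm_def bnd_s_cnt numeral_2_eq_2 split_all)

text \<open>The number \<open>N\<close> is to bound all lists that are folded over;
  \<open>2 \<le> N\<close> covers the list of the two ends of an edge.\<close>

locale data_setting =
  fixes G :: "('v,'e) pre_digraph" and c :: "'v \<Rightarrow> real" and N :: nat and orc :: "('v,'e) orc"
    and A :: "('v,'e) data"
  assumes finG: "fin_digraph G" and NV: "card (verts G) \<le> N" and NA: "card (arcs G) \<le> N" and N2: "2 \<le> N"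
    and A: "okA G A"
begin

text \<open>Costs travel with the vertices, so that the cost of a piece is a sum over its own list
  without any lookup.\<close>

definition okX :: "('v,'e) data \<Rightarrow> bool" where
  "okX d \<longleftrightarrow> (\<exists>us. distinct us \<and> set us \<subseteq> verts G \<and> d = list_data (map (\<lambda>v. Node (Vtx v) (Num (c v))) us))"

definition okM :: "('v,'e) data \<Rightarrow> bool" where
  "okM d \<longleftrightarrow> (\<exists>M. enc_edges d M \<and> set_mset M \<subseteq> arcs G)"

definition okP :: "('v,'e) data \<Rightarrow> bool" where
  "okP p \<longleftrightarrow> (\<exists>xs m l s. p = Node xs (Node m (Node (Num l) s)) \<and> okX xs \<and> okM m)"

definition okL :: "('v,'e) data \<Rightarrow> bool" where
  "okL ds \<longleftrightarrow> (\<forall>p\<in>set (dl ds). okP p) \<and> length (dl ds) \<le> N"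

lemma finite_verts [simp]: "finite (verts G)" and finite_arcs [simp]: "finite (arcs G)"
  using finG by (simp_all add: fin_digraph.finite_verts fin_digraph.finite_arcs)

lemma okX_D:
  assumes "okX d"
  shows "okW d" "length (dl d) \<le> N" "vX d \<subseteq> verts G" "finite (vX d)"
proof -
  obtain us where us: "distinct us" "set us \<subseteq> verts G" "d = list_data (map (\<lambda>v. Node (Vtx v) (Num (c v))) us)"
    using assms by (auto simp: okX_def)
  show "okW d" by (auto simp: us(3) okW_def)
  have "vX d = set us" by (auto simp: us(3) vX_def)
  then show "vX d \<subseteq> verts G" "finite (vX d)" using us(2) by auto
  have "length us \<le> card (verts G)" using distinct_card[OF us(1)] card_mono[OF finite_verts us(2)] by simp
  then show "length (dl d) \<le> N" using NV by (simp add: us(3))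
qed

lemma okX_app:
  assumes "okX d" "okX d'" "vX d \<inter> vX d' = {}"
  shows "okX (foldr Node (dl d) d')" "vX (foldr Node (dl d) d') = vX d \<union> vX d'"
proof -
  obtain us where us: "distinct us" "set us \<subseteq> verts G" "d = list_data (map (\<lambda>v. Node (Vtx v) (Num (c v))) us)"
    using assms by (auto simp: okX_def)
  obtain us' where us': "distinct us'" "set us' \<subseteq> verts G" "d' = list_data (map (\<lambda>v. Node (Vtx v) (Num (c v))) us')"
    using assms by (auto simp: okX_def)
  have v: "vX d = set us" "vX d' = set us'" by (auto simp: us(3) us'(3) vX_def)
  have "foldr Node xs (list_data ys) = list_data (xs @ ys)" for xs ys :: "('v,'e) data list"
    by (induction xs) auto
  then have "foldr Node (dl d) d' = list_data (map (\<lambda>v. Node (Vtx v) (Num (c v))) (us @ us'))"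
    by (simp add: us(3) us'(3))
  moreover have "distinct (us @ us')" "set (us @ us') \<subseteq> verts G" using us us' assms(3) v by auto
  ultimately show "okX (foldr Node (dl d) d')" unfolding okX_def by blast
  show "vX (foldr Node (dl d) d') = vX d \<union> vX d'" by (auto simp: vX_def)
qed

lemma okX_Leaf [simp]: "okX Leaf" "vX Leaf = {}"
  by (auto simp: okX_def vX_def intro!: exI[of _ "[]"])

lemma okM_D:
  assumes "okM d"
  shows "enc_edges d (decM d)" "set_mset (decM d) \<subseteq> arcs G" "length (dl d) \<le> N"
proof -
  obtain M where M: "enc_edges d M" "set_mset M \<subseteq> arcs G" using assms by (auto simp: okM_def)
  then show e: "enc_edges d (decM d)" and s: "set_mset (decM d) \<subseteq> arcs G" by (simp_all add: decM_eq)
  obtain es where es: "distinct es" "set es = set_mset (decM d)"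
      "d = list_data (map (\<lambda>e. Node (Edg e) (Num (of_nat (count (decM d) e)))) es)"
    using e by (auto simp: enc_edges_def)
  have "length es \<le> card (arcs G)" using distinct_card[OF es(1)] card_mono[OF finite_arcs s] es(2) by simp
  moreover have "length (dl d) = length es" by (subst es(3)) simp
  ultimately show "length (dl d) \<le> N" using NA by simp
qed

lemma okM_I: "enc_edges d M \<Longrightarrow> set_mset M \<subseteq> arcs G \<Longrightarrow> okM d \<and> decM d = M"
  by (auto simp: okM_def decM_eq)

lemma enc_edges_Leaf: "enc_edges Leaf {#}"
  by (simp add: enc_edges_def)

lemma okM_Leaf [simp]: "okM Leaf" "decM (Leaf :: ('v,'e) data) = {#}"
  using okM_I[OF enc_edges_Leaf] by auto

lemma okA_len: "length (dl A) \<le> N"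
proof -
  obtain es x where es: "distinct es" "set es = arcs G"
    "A = list_data (map (\<lambda>e. list_data [Edg e, Vtx (tail G e), Vtx (head G e), Num (x e)]) es)"
    using A by (auto simp: okA_def)
  have "length (dl A) = length es" unfolding es(3) by simp
  also have "\<dots> = card (arcs G)" using distinct_card[OF es(1)] es(2) by simp
  finally show ?thesis using NA by simp
qed

lemma addm:
  assumes "okM a" "okM b"
  shows "okM (den orc s_addm [Node A (Node a b)])" "decM (den orc s_addm [Node A (Node a b)]) = decM a + decM b"
    "bnd orc N s_addm [Node A (Node a b)]"
proof -
  have "enc_edges (den orc s_addm [Node A (Node a b)]) (decM a + decM b)"
    using okM_D[OF assms(1)] okM_D[OF assms(2)] by (intro den_s_addm[OF A]) auto
  from okM_I[OF this] show "okM (den orc s_addm [Node A (Node a b)])"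
    "decM (den orc s_addm [Node A (Node a b)]) = decM a + decM b"
    using okM_D(2)[OF assms(1)] okM_D(2)[OF assms(2)] by auto
  show "bnd orc N s_addm [Node A (Node a b)]"
    using okM_D(3) assms okA_len by (intro bnd_s_addm) auto
qed

lemma okP_D:
  assumes "okP p"
  obtains xs m l s where "p = Node xs (Node m (Node (Num l) s))" "okX xs" "okM m"
    "dec p = Piece (vX xs) (decM m) l (s \<noteq> Leaf)"
  using assms by (auto simp: okP_def dec_def)

lemma okP_X: "okP p \<Longrightarrow> okX (apply1 Left p)" "okP p \<Longrightarrow> pX (dec p) = vX (apply1 Left p)"
  "okP p \<Longrightarrow> pX (dec p) \<subseteq> verts G" "okP p \<Longrightarrow> apply1 Left (apply1 Right (apply1 Right p)) = Num (pl (dec p))"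
  "okP p \<Longrightarrow> okM (apply1 Left (apply1 Right p))" "okP p \<Longrightarrow> pM (dec p) = decM (apply1 Left (apply1 Right p))"
  "okP p \<Longrightarrow> (apply1 Right (apply1 Right (apply1 Right p)) \<noteq> Leaf) = ps (dec p)"
  by (auto elim!: okP_D dest: okX_D(3)[THEN subsetD])

subsection \<open>Basic operations on pieces\<close>

definition s_csum :: lx where "s_csum = xSum VE A0 (Rt (Lf A0))"

lemma wf_s_csum [simp]: "wfx (Suc 0) s_csum" by (simp add: s_csum_def)

lemma s_csum:
  assumes "okX d"
  shows "den orc s_csum [d] = Num (sum c (vX d))" "bnd orc N s_csum [d]"
proof -
  obtain us where us: "distinct us" "set us \<subseteq> verts G" "d = list_data (map (\<lambda>v. Node (Vtx v) (Num (c v))) us)"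
    using assms by (auto simp: okX_def)
  have "vX d = set us" by (auto simp: us(3) vX_def)
  moreover have "den orc s_csum [d] = Num (\<Sum>x\<leftarrow>dl (den orc A0 [d]). num (apply1 Right x))"
    unfolding s_csum_def by (rule den_xSum) (auto simp: us(3))
  ultimately show "den orc s_csum [d] = Num (sum c (vX d))"
    by (simp add: us comp_def sum_list_distinct_conv_sum_set)
  show "bnd orc N s_csum [d]" using okX_D(2)[OF assms] by (simp add: s_csum_def)
qed

definition s_tch :: lx where "s_tch = VS (Pr (Lf (Lf A0)) (Lf (Rt A0))) s_touch"
definition s_crs :: lx where
  "s_crs = xAnd s_tch (xNot (VS (Pr (Lf (Lf A0)) (Lf (Rt A0))) s_sub))"

lemma wf_s_tch [simp]: "wfx (Suc 0) s_tch" "wfx (Suc 0) s_crs" by (simp_all add: s_tch_def s_crs_def)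

lemma s_tch [simp]:
  assumes "okP p" "okP q"
  shows "den orc s_tch [Node p q] = truth (touch (dec p) (dec q))" "bnd orc N s_tch [Node p q]"
    "den orc s_crs [Node p q] = truth (crossP (dec p) (dec q))" "bnd orc N s_crs [Node p q]"
proof -
  note o = okP_X(1)[OF assms(1)] okP_X(1)[OF assms(2)]
  note X = okP_X(2)[OF assms(1)] okP_X(2)[OF assms(2)]
  show t: "den orc s_tch [Node p q] = truth (touch (dec p) (dec q))"
    using den_s_touch(1)[OF okX_D(1)[OF o(1)] okX_D(1)[OF o(2)]] X by (simp add: s_tch_def touch_def)
  show b: "bnd orc N s_tch [Node p q]"
    using bnd_s_touch(1)[OF okX_D(2)[OF o(1)] okX_D(2)[OF o(2)]] by (simp add: s_tch_def)
  show "den orc s_crs [Node p q] = truth (crossP (dec p) (dec q))"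
    using den_s_touch(2)[OF okX_D(1)[OF o(1)] okX_D(1)[OF o(2)]] X t by (simp add: s_crs_def crossP_def)
  show "bnd orc N s_crs [Node p q]"
    using bnd_s_touch(2)[OF okX_D(2)[OF o(1)] okX_D(2)[OF o(2)]] b by (simp add: s_crs_def)
qed

definition s_join :: lx where
  "s_join = (let q = Lf (Rt A0); cur = Rt (Rt A0) in
     Pr (VS (Pr (Lf q) (Lf cur)) s_app)
       (Pr (VS (Pr (Lf A0) (Pr (Lf (Rt q)) (Lf (Rt cur)))) s_addm)
         (Pr (VC (V2 Leq (Lf (Rt (Rt q))) (Lf (Rt (Rt cur)))) (Lf (Rt (Rt cur))) (Lf (Rt (Rt q)))) VE)))"

lemma wf_s_join [simp]: "wfx (Suc 0) s_join" by (simp add: s_join_def Let_def)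

lemma s_join:
  assumes "okP q" "okP cur" "pX (dec q) \<inter> pX (dec cur) = {}"
  shows "okP (den orc s_join [Node A (Node q cur)])"
    "dec (den orc s_join [Node A (Node q cur)]) =
      Piece (pX (dec q) \<union> pX (dec cur)) (pM (dec q) + pM (dec cur)) (max (pl (dec q)) (pl (dec cur))) False"
    "bnd orc N s_join [Node A (Node q cur)]"
proof -
  obtain xs m l s where q: "q = Node xs (Node m (Node (Num l) s))" "okX xs" "okM m"
    "dec q = Piece (vX xs) (decM m) l (s \<noteq> Leaf)" using okP_D[OF assms(1)] .
  obtain xs' m' l' s' where u: "cur = Node xs' (Node m' (Node (Num l') s'))" "okX xs'" "okM m'"
    "dec cur = Piece (vX xs') (decM m') l' (s' \<noteq> Leaf)" using okP_D[OF assms(2)] .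
  have d: "vX xs \<inter> vX xs' = {}" using assms(3) q(4) u(4) by simp
  have e: "den orc s_join [Node A (Node q cur)] =
      Node (foldr Node (dl xs) xs') (Node (den orc s_addm [Node A (Node m m')]) (Node (Num (max l l')) Leaf))"
    by (simp add: s_join_def Let_def q(1) u(1) den_s_app max_def)
  show "okP (den orc s_join [Node A (Node q cur)])"
    unfolding e okP_def using okX_app(1)[OF q(2) u(2) d] addm(1)[OF q(3) u(3)] by blast
  show "dec (den orc s_join [Node A (Node q cur)]) =
      Piece (pX (dec q) \<union> pX (dec cur)) (pM (dec q) + pM (dec cur)) (max (pl (dec q)) (pl (dec cur))) False"
    unfolding e q(4) u(4) by (simp add: dec_def okX_app(2)[OF q(2) u(2) d] addm(2)[OF q(3) u(3)])
  show "bnd orc N s_join [Node A (Node q cur)]"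
    by (simp add: s_join_def Let_def q(1) u(1) addm(3)[OF q(3) u(3)] bnd_s_app[OF okX_D(2)[OF q(2)]])
qed

text \<open>A single pass: the accumulator holds the joined piece so far and the untouched pieces.
  Touching is tested against the absorbed piece itself, not against the growing one.\<close>

definition s_abs :: lx where
  "s_abs = VF (Lf A0) (Rt A0) (Pr (Pr VE (Pr (Lf (Rt (Rt (Lf A0)))) (Pr (VL 0) VE))) VE)
     (VC (VS (Pr (Lf (Rt (VA 2))) (Lf (VA 0))) s_touch)
        (Pr (VS (Pr (Lf (VA 2)) (Pr (VA 0) (Lf (VA 1)))) s_join) (Rt (VA 1)))
        (Pr (Lf (VA 1)) (Pr (VA 0) (Rt (VA 1)))))"

lemma wf_s_abs [simp]: "wfx (Suc 0) s_abs" by (simp add: s_abs_def)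

text \<open>The absorbed piece \<open>p\<close> may list a vertex twice (the two ends of a loop).\<close>

lemma s_abs:
  assumes ds: "okL ds" "djl (decL ds)" and p: "p = Node xs (Node m z)" "okW xs" "length (dl xs) \<le> N" "okM m"
    and p': "pX p' = vX xs" "pM p' = decM m"
  shows "\<forall>q\<in>set (dl (den orc s_abs [Node (Node A p) ds])). okP q"
    "decL (den orc s_abs [Node (Node A p) ds]) = absorb p' (decL ds)"
    "bnd orc N s_abs [Node (Node A p) ds]"
proof -
  define body where "body = (\<lambda>q acc. if den orc s_touch [Node xs (apply1 Left q)] \<noteq> Leaf
     then Node (den orc s_join [Node A (Node q (apply1 Left acc))]) (apply1 Right acc)
     else Node (apply1 Left acc) (Node q (apply1 Right acc)))"
  let ?init = "Node (Node Leaf (Node m (Node (Num 0) Leaf))) Leaf"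
  have tch: "den orc s_touch [Node xs (apply1 Left q)] = truth (touch p' (dec q))" if "okP q" for q
    using den_s_touch(1)[OF p(2) okX_D(1)[OF okP_X(1)[OF that]]] okP_X(2)[OF that] p' by (simp add: touch_def)
  have inv: "\<exists>cur rest. foldr body qs ?init = Node cur rest \<and> okP cur \<and>
      dec cur = joined p' (filter (touch p') (map dec qs)) \<and>
      dl rest = filter (\<lambda>q. \<not> touch p' (dec q)) qs"
    if "\<forall>q\<in>set qs. okP q" "djl (map dec qs)" for qs
    using that
  proof (induction qs)
    case Nil
    then show ?case using p p' by (auto simp: okP_def dec_def joined_def)
  next
    case (Cons q qs)
    then obtain cur rest where IH: "foldr body qs ?init = Node cur rest" "okP cur"
      "dec cur = joined p' (filter (touch p') (map dec qs))" "dl rest = filter (\<lambda>q. \<not> touch p' (dec q)) qs"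
      by auto
    have q: "okP q" using Cons.prems by simp
    have st: "foldr body (q # qs) ?init = body q (Node cur rest)" by (simp add: IH(1))
    show ?case
    proof (cases "touch p' (dec q)")
      case True
      have "pX (dec q) \<inter> pX (dec cur) = {}" using Cons.prems(2) IH(3) by auto
      note j = s_join[OF q IH(2) this]
      have "foldr body (q # qs) ?init = Node (den orc s_join [Node A (Node q cur)]) rest"
        unfolding st using True by (simp add: body_def tch[OF q])
      moreover have "dec (den orc s_join [Node A (Node q cur)]) = joined p' (filter (touch p') (map dec (q # qs)))"
        unfolding j(2) IH(3) using True by (simp add: joined_def ac_simps)
      ultimately show ?thesis using True j(1) IH(4) by simp
    next
      case False
      have "foldr body (q # qs) ?init = Node cur (Node q rest)"
        unfolding st using False by (simp add: body_def tch[OF q])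
      then show ?thesis using False IH by simp
    qed
  qed
  have ok: "\<forall>q\<in>set (dl ds). okP q" "length (dl ds) \<le> N" using ds(1) by (auto simp: okL_def)
  have e: "den orc s_abs [Node (Node A p) ds] = foldr body (dl ds) ?init"
    by (simp add: s_abs_def p(1) body_def numeral_2_eq_2 cong: if_cong)
  obtain cur rest where r: "foldr body (dl ds) ?init = Node cur rest" "okP cur"
      "dec cur = joined p' (filter (touch p') (decL ds))" "dl rest = filter (\<lambda>q. \<not> touch p' (dec q)) (dl ds)"
    using inv[OF ok(1) ds(2)] by blast
  show "\<forall>q\<in>set (dl (den orc s_abs [Node (Node A p) ds])). okP q"
    using ok(1) r unfolding e by auto
  show "decL (den orc s_abs [Node (Node A p) ds]) = absorb p' (decL ds)"
    unfolding e r(1) by (simp add: r(3,4) absorb_def filter_map comp_def)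
  have "bnd orc N s_touch [Node xs (apply1 Left x)] \<and>
     (den orc s_touch [Node xs (apply1 Left x)] \<noteq> Leaf \<longrightarrow>
       bnd orc N s_join [Node A (Node x (apply1 Left (foldr body zs ?init)))])"
    if s: "dl ds = ys @ x # zs" for ys x zs
  proof -
    have x: "okP x" and zs: "\<forall>q\<in>set zs. okP q" using ok(1) s by auto
    have dj: "djl (map dec (x # zs))" using ds(2) s by (simp add: djl_append)
    then obtain cur rest where z: "foldr body zs ?init = Node cur rest" "okP cur"
      "dec cur = joined p' (filter (touch p') (map dec zs))" using inv[OF zs] by auto
    have "pX (dec x) \<inter> pX (dec cur) = {}" using dj z(3) by auto
    from s_join(3)[OF x z(2) this] show ?thesis
      using z(1) bnd_s_touch(1)[OF p(3) okX_D(2)[OF okP_X(1)[OF x]]] by simp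
  qed
  then show "bnd orc N s_abs [Node (Node A p) ds]"
    using ok(2) by (simp add: s_abs_def p(1) body_def[symmetric] numeral_2_eq_2 cong: if_cong)
qed

end

abbreviation (input) "xLab a \<equiv> V1 Left (V1 Right (V1 Right a))"

section \<open>Programs for components, unions and packing\<close>

context data_setting begin

lemma okL_filter: "okL ds \<Longrightarrow> okL (list_data (filter P (dl ds)))"
  by (auto simp: okL_def intro: order_trans[OF length_filter_le])

lemma decL_filter:
  assumes "\<And>x. x \<in> set (dl ds) \<Longrightarrow> P x = P' (dec x)"
  shows "decL (list_data (filter P (dl ds))) = filter P' (decL ds)"
  using assms by (simp add: filter_map) (rule arg_cong[of _ _ "map dec"], auto intro: filter_cong)

lemma okL_P: "okL ds \<Longrightarrow> p \<in> set (dl ds) \<Longrightarrow> okP p"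
  and okL_len: "okL ds \<Longrightarrow> length (dl ds) \<le> N"
  by (auto simp: okL_def)

lemma okL_part: "\<forall>q\<in>set (dl ds). okP q \<Longrightarrow> part (verts G) (decL ds) \<Longrightarrow> okL ds"
  using part_length[of "verts G" "decL ds"] NV by (simp add: okL_def)

definition s_singles :: lx where
  "s_singles = xMap VE A0 (Pr (Pr (Lf A0) VE) (Pr VE (Pr (Rt (Lf A0)) VE)))"

lemma wf_s_singles [simp]: "wfx (Suc 0) s_singles" by (simp add: s_singles_def)

lemma s_singles:
  assumes "okX xs"
  obtains us where "distinct us" "set us = vX xs" "decL (den orc s_singles [xs]) = singles c us"
    "okL (den orc s_singles [xs])" "bnd orc N s_singles [xs]"
proof -
  obtain us where us: "distinct us" "set us \<subseteq> verts G" "xs = list_data (map (\<lambda>v. Node (Vtx v) (Num (c v))) us)"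
    using assms by (auto simp: okX_def)
  have l: "length us \<le> N" using okX_D(2)[OF assms] by (simp add: us(3))
  have okv: "okX (Node (Node (Vtx v) (Num (c v))) Leaf)" if "v \<in> set us" for v
    using that us(2) unfolding okX_def by (intro exI[of _ "[v]"]) auto
  have e: "den orc s_singles [xs] = list_data (map (\<lambda>v. Node (Node (Node (Vtx v) (Num (c v))) Leaf)
      (Node Leaf (Node (Num (c v)) Leaf))) us)"
    by (simp add: s_singles_def us(3) comp_def)
  have "vX (Node (Node (Vtx v) (Num (c v))) Leaf :: ('v,'e) data) = {v}" for v by (auto simp: vX_def)
  then have "decL (den orc s_singles [xs]) = singles c us" unfolding e by (simp add: singles_def comp_def dec_def)
  moreover have "okL (den orc s_singles [xs])" unfolding e using okv l by (auto simp: okL_def okP_def)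
  moreover have "bnd orc N s_singles [xs]" using l by (simp add: s_singles_def us(3))
  moreover have "set us = vX xs" by (auto simp: us(3) vX_def)
  ultimately show ?thesis using that us(1) by blast
qed

definition s_ends :: lx where
  "s_ends = VLet (Lf (xFil (Lf A0) (Rt A0) (V2 Same (Lf (Lf A0)) (Rt A0))))
     (Pr (Pr (Lf (Rt (VA 0))) VE) (Pr (Pr (Lf (Rt (Rt (VA 0)))) VE) VE))"

lemma wf_s_ends [simp]: "wfx (Suc 0) s_ends" by (simp add: s_ends_def)

lemma s_ends:
  assumes "e \<in> arcs G"
  shows "den orc s_ends [Node (Edg e) A] = Node (Node (Vtx (tail G e)) Leaf) (Node (Node (Vtx (head G e)) Leaf) Leaf)"
    "bnd orc N s_ends [Node (Edg e) A]"
proof -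
  obtain es x where es: "distinct es" "set es = arcs G"
    "A = list_data (map (\<lambda>e. list_data [Edg e, Vtx (tail G e), Vtx (head G e), Num (x e)]) es)"
    using A by (auto simp: okA_def)
  have "distinct l \<Longrightarrow> e \<in> set l \<Longrightarrow> filter (\<lambda>e'. e' = e) l = [e]" for l
    by (induction l) (auto simp: filter_empty_conv)
  from this[OF es(1)] have "filter (\<lambda>e'. e' = e) es = [e]" using assms es(2) by simp
  then show "den orc s_ends [Node (Edg e) A] = Node (Node (Vtx (tail G e)) Leaf) (Node (Node (Vtx (head G e)) Leaf) Leaf)"
    by (simp add: s_ends_def es(3) filter_map comp_def)
  show "bnd orc N s_ends [Node (Edg e) A]" using okA_len by (simp add: s_ends_def)
qed

text \<open>Each edge becomes a piece whose vertices are looked up in the list of arcs; its entry in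
  the encoding of the multiset, put into a list of length one, encodes all its copies.\<close>

definition s_comps :: lx where
  "s_comps = xFold (Lf (Rt (Lf A0))) (Rt A0) (VS (Lf (Lf A0)) s_singles)
     (VS (Pr (Pr (Rt (Rt A0)) (Pr (VS (Pr (Lf (Lf A0)) (Rt (Rt A0))) s_ends) (Pr (Pr (Lf A0) VE) VE)))
       (Lf (Rt A0))) s_abs)"

lemma wf_s_comps [simp]: "wfx (Suc 0) s_comps" by (simp add: s_comps_def)

lemma s_comps:
  assumes Vs: "okX Vs" "vX Vs = verts G" and d: "okM d"
  shows "okL (den orc s_comps [Node (Node Vs (Node A z)) d])"
    "comps_of G (decM d) (decL (den orc s_comps [Node (Node Vs (Node A z)) d]))"
    "bnd orc N s_comps [Node (Node Vs (Node A z)) d]"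
proof -
  let ?F = "decM d"
  obtain us where us: "distinct us" "set us = vX Vs" "decL (den orc s_singles [Vs]) = singles c us"
    "okL (den orc s_singles [Vs])" "bnd orc N s_singles [Vs]" using s_singles[OF Vs(1)] .
  obtain es where es: "distinct es" "set es = set_mset ?F"
    "d = list_data (map (\<lambda>e. Node (Edg e) (Num (of_nat (count ?F e)))) es)"
    using okM_D(1)[OF d] by (auto simp: enc_edges_def)
  have FA: "set_mset ?F \<subseteq> arcs G" by (rule okM_D(2)[OF d])
  let ?en = "\<lambda>e. Node (Edg e) (Num (of_nat (count ?F e))) :: ('v,'e) data"
  define arg where "arg = (\<lambda>x acc. Node (Node A (Node (den orc s_ends [Node (apply1 Left x) A]) (Node (Node x Leaf) Leaf))) acc)"
  define body where "body = (\<lambda>x acc. den orc s_abs [arg x acc])"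
  have step: "okP' \<and> decL (body (?en q) acc) = absorb (edge_piece G ?F q) (decL acc) \<and>
      part (verts G) (absorb (edge_piece G ?F q) (decL acc)) \<and> bnd orc N s_abs [arg (?en q) acc]"
    if q: "q \<in> set es" and acc: "\<forall>p\<in>set (dl acc). okP p" "part (verts G) (decL acc)"
      and okP': "okP' = (\<forall>p\<in>set (dl (body (?en q) acc)). okP p)" for q acc okP'
  proof -
    have qA: "q \<in> arcs G" using q es(2) FA by blast
    let ?ends = "Node (Node (Vtx (tail G q)) Leaf) (Node (Node (Vtx (head G q)) Leaf) Leaf)"
    let ?m = "Node (?en q) Leaf"
    have arg: "arg (?en q) acc = Node (Node A (Node ?ends (Node ?m Leaf))) acc"
      by (simp add: arg_def s_ends(1)[OF qA])
    have m: "enc_edges ?m (replicate_mset (count ?F q) q)"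
      unfolding enc_edges_def using q es(2) by (intro exI[of _ "[q]"]) (auto simp: count_eq_zero_iff)
    have "set_mset (replicate_mset (count ?F q) q) \<subseteq> arcs G" using qA by auto
    from okM_I[OF m this] have m': "okM ?m" "decM ?m = replicate_mset (count ?F q) q" by auto
    have w: "okW ?ends" "length (dl ?ends) \<le> N" using N2 by (auto simp: okW_def)
    have e: "pX (edge_piece G ?F q) = vX ?ends" "pM (edge_piece G ?F q) = decM ?m"
      using m'(2) by (auto simp: edge_piece_def vX_def)
    have dj: "djl (decL acc)" using acc(2) by (simp add: part_def)
    note ab = s_abs[OF okL_part[OF acc] dj refl w m'(1) e, of Leaf, folded arg]
    have "pX (edge_piece G ?F q) \<subseteq> verts G" "pX (edge_piece G ?F q) \<noteq> {}"
      using qA finG by (auto simp: edge_piece_def fin_digraph_def wf_digraph_def)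
    then have "part (verts G) (absorb (edge_piece G ?F q) (decL acc))" by (rule part_absorb[OF acc(2)])
    then show ?thesis using ab okP' by (simp add: body_def)
  qed
have inv: "(\<forall>q\<in>set (dl (foldr body (map ?en qs) (den orc s_singles [Vs]))). okP q) \<and>
      decL (foldr body (map ?en qs) (den orc s_singles [Vs])) = foldr (\<lambda>e. absorb (edge_piece G ?F e)) qs (singles c us) \<and>
      part (verts G) (foldr (\<lambda>e. absorb (edge_piece G ?F e)) qs (singles c us))" if "set qs \<subseteq> set es" for qs
    using that
  proof (induction qs)
    case Nil
    then show ?case using us part_singles[OF us(1), of c] Vs(2) by (simp add: okL_def)
  next
    case (Cons q qs)
    then have IH: "\<forall>p\<in>set (dl (foldr body (map ?en qs) (den orc s_singles [Vs]))). okP p"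
      "decL (foldr body (map ?en qs) (den orc s_singles [Vs])) = foldr (\<lambda>e. absorb (edge_piece G ?F e)) qs (singles c us)"
      "part (verts G) (decL (foldr body (map ?en qs) (den orc s_singles [Vs])))" and q: "q \<in> set es" by simp_all
    from step[OF q IH(1,3) refl] show ?case unfolding IH(2) by simp
  qed
  have bn: "bnd orc N s_ends [Node (Edg q) A] \<and>
      bnd orc N s_abs [arg (?en q) (foldr body (map ?en qs) (den orc s_singles [Vs]))]" if q: "set (q # qs) \<subseteq> set es" for q qs
  proof -
    have i: "\<forall>p\<in>set (dl (foldr body (map ?en qs) (den orc s_singles [Vs]))). okP p"
      "part (verts G) (decL (foldr body (map ?en qs) (den orc s_singles [Vs])))"
      using inv[of qs] q by auto
    have "q \<in> set es" "q \<in> arcs G" using q es(2) FA by auto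
    then show ?thesis using step[OF _ i refl] s_ends(2) by blast
  qed
  have e: "den orc s_comps [Node (Node Vs (Node A z)) d] = foldr body (map ?en es) (den orc s_singles [Vs])"
    unfolding s_comps_def body_def arg_def by (subst es(3)) simp
  note i = inv[OF order_refl]
  show "okL (den orc s_comps [Node (Node Vs (Node A z)) d])" unfolding e using i by (intro okL_part) auto
  show "comps_of G (decM d) (decL (den orc s_comps [Node (Node Vs (Node A z)) d]))" unfolding e
    using i comps_of_fold[OF finG FA us(1) _ es(1,2), of c] us(2) Vs(2) by simp
  have "bnd orc N s_ends [Node (apply1 Left x) A] \<and> bnd orc N s_abs [arg x (foldr body zs (den orc s_singles [Vs]))]"
    if "dl d = ys @ x # zs" for ys x zs
  proof -
    have "map ?en es = ys @ x # zs" using that by (subst (asm) es(3)) simp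
    then obtain es1 q es2 where "es = es1 @ q # es2" "x = ?en q" "zs = map ?en es2"
      by (auto simp: map_eq_append_conv map_eq_Cons_conv)
    then show ?thesis using bn[of q es2] by auto
  qed
  then show "bnd orc N s_comps [Node (Node Vs (Node A z)) d]"
    using okM_D(3)[OF d] us(5) unfolding arg_def body_def by (simp add: s_comps_def)
qed

definition s_union :: lx where
  "s_union = xFold (Lf A0) (Rt A0) (Pr VE (Pr VE (Pr (VL 0) VE)))
     (VS (Pr (Rt (Rt A0)) (Pr (Lf A0) (Lf (Rt A0)))) s_join)"

lemma wf_s_union [simp]: "wfx (Suc 0) s_union" by (simp add: s_union_def)

lemma s_union:
  assumes Ts: "okL Ts" "djl (decL Ts)"
  shows "okP (den orc s_union [Node A Ts])"
    "pX (dec (den orc s_union [Node A Ts])) = pX (unionP (decL Ts))"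
    "pM (dec (den orc s_union [Node A Ts])) = pM (unionP (decL Ts))"
    "bnd orc N s_union [Node A Ts]"
proof -
  define body where "body = (\<lambda>x acc. den orc s_join [Node A (Node x acc)])"
  let ?init = "Node Leaf (Node Leaf (Node (Num 0) Leaf))"
  have inv: "okP (foldr body qs ?init) \<and> pX (dec (foldr body qs ?init)) = (\<Union>q\<in>set qs. pX (dec q)) \<and>
     pM (dec (foldr body qs ?init)) = sum_list (map (\<lambda>q. pM (dec q)) qs)"
    if "\<forall>q\<in>set qs. okP q" "djl (map dec qs)" for qs
    using that
  proof (induction qs)
    case Nil then show ?case by (auto simp: okP_def dec_def)
  next
    case (Cons q qs)
    then have q: "okP q" and IH: "okP (foldr body qs ?init)"
      "pX (dec (foldr body qs ?init)) = (\<Union>q\<in>set qs. pX (dec q))"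
      "pM (dec (foldr body qs ?init)) = sum_list (map (\<lambda>q. pM (dec q)) qs)" by auto
    have "pX (dec q) \<inter> pX (dec (foldr body qs ?init)) = {}" using Cons.prems(2) IH(2) by auto
    from s_join(1,2)[OF q IH(1) this] show ?case by (simp add: body_def[symmetric] IH) (simp add: body_def IH)
  qed
  have e: "den orc s_union [Node A Ts] = foldr body (dl Ts) ?init"
    by (simp add: s_union_def body_def)
  have ok: "\<forall>q\<in>set (dl Ts). okP q" using Ts(1) by (simp add: okL_def)
  note i = inv[OF ok Ts(2)]
  show "okP (den orc s_union [Node A Ts])"
    "pX (dec (den orc s_union [Node A Ts])) = pX (unionP (decL Ts))"
    "pM (dec (den orc s_union [Node A Ts])) = pM (unionP (decL Ts))"
    unfolding e using i by (simp_all add: comp_def)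
  have "bnd orc N s_join [Node A (Node x (foldr body zs ?init))]" if s: "dl Ts = ys @ x # zs" for ys x zs
  proof -
    have x: "okP x" and zs: "\<forall>q\<in>set zs. okP q" using ok s by auto
    have dj: "djl (map dec (x # zs))" using Ts(2) s by (simp add: djl_append)
    then have j: "okP (foldr body zs ?init)" "pX (dec (foldr body zs ?init)) = (\<Union>q\<in>set zs. pX (dec q))"
      using inv[OF zs] by auto
    show ?thesis by (rule s_join(3)[OF x j(1)]) (use dj j(2) in auto)
  qed
  then show "bnd orc N s_union [Node A Ts]"
    using okL_len[OF Ts(1)] by (simp add: s_union_def body_def[symmetric])
qed

definition s_tq :: lx where
  "s_tq = xSum (Lf (Rt A0)) (Lf (Lf A0)) (VC s_mem (Rt (Lf A0)) (VL 0))"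

lemma wf_s_tq [simp]: "wfx (Suc 0) s_tq" by (simp add: s_tq_def)

lemma s_tq:
  assumes "okP q" "okP u"
  shows "den orc s_tq [Node q u] = Num (sum c (pX (dec q) \<inter> pX (dec u)))" "bnd orc N s_tq [Node q u]"
proof -
  obtain us where us: "distinct us" "set us \<subseteq> verts G" "apply1 Left q = list_data (map (\<lambda>v. Node (Vtx v) (Num (c v))) us)"
    using okP_X(1)[OF assms(1)] by (auto simp: okX_def)
  have vq: "pX (dec q) = set us" using okP_X(2)[OF assms(1)] by (auto simp: us(3) vX_def)
  note W = okX_D(1,2)[OF okP_X(1)[OF assms(2)]]
  have m: "den orc s_mem [Node (Node (Vtx v) k) (apply1 Left u)] = truth (v \<in> pX (dec u))" for v k
    using den_s_mem[OF W(1)] okP_X(2)[OF assms(2)] by simp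
  have "den orc s_tq [Node q u] = Num (\<Sum>x\<leftarrow>dl (den orc (Lf (Lf A0)) [Node q u]).
      if den orc s_mem [Node x (apply1 Left u)] \<noteq> Leaf then num (apply1 Right x) else 0)"
    unfolding s_tq_def by (rule den_xSum) (auto simp: us(3))
  also have "\<dots> = Num (\<Sum>v\<leftarrow>us. if v \<in> pX (dec u) then c v else 0)"
    by (simp add: us(3) comp_def m cong: if_cong)
  also have "(\<Sum>v\<leftarrow>us. if v \<in> pX (dec u) then c v else 0) = sum c (pX (dec q) \<inter> pX (dec u))"
    unfolding vq using sum_list_distinct_conv_sum_set[OF us(1)] by (simp add: sum.inter_restrict)
  finally show "den orc s_tq [Node q u] = Num (sum c (pX (dec q) \<inter> pX (dec u)))" .
  show "bnd orc N s_tq [Node q u]"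
    using okX_D(2)[OF okP_X(1)[OF assms(1)]] W(2) by (simp add: s_tq_def bnd_s_mem)
qed

definition s_pack :: lx where
  "s_pack = xFold (Rt (Rt A0)) (Lf (Rt A0)) (Pr (Lf A0) (Pr VE VE))
     (let q = Lf A0; acc = Lf (Rt A0); q' = Lf (VA 1); acc' = Lf (Rt (VA 1)) in
      VLet (V2 Add (Lf acc) (VS (Pr q (Rt (Rt (Rt A0)))) s_tq))
       (VC (V2 Leq (V2 Mul (VL 3) (VA 0)) (V2 Mul (VL 2) (Lf (Rt (Rt (VA 1))))))
         (Pr (VA 0) (Pr (Pr q' (Lf (Rt acc'))) (Rt (Rt acc'))))
         (Pr (Lf acc') (Pr (Lf (Rt acc')) (Pr q' (Rt (Rt acc')))))))"

lemma wf_s_pack [simp]: "wfx (Suc 0) s_pack" by (simp add: s_pack_def Let_def)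

lemma s_pack:
  assumes ds: "okL ds" and u: "okP u"
  defines "tq \<equiv> \<lambda>q. sum c (pX (dec q) \<inter> pX (dec u))"
  shows "den orc s_pack [Node (Num t0) (Node ds (Node (Num L) u))] =
     (case pack tq L t0 (dl ds) of (t, As, Rs) \<Rightarrow> Node (Num t) (Node (list_data As) (list_data Rs)))"
    "bnd orc N s_pack [Node (Num t0) (Node ds (Node (Num L) u))]"
proof -
  define body where "body = (\<lambda>q acc. if apply2 Leq (apply2 Mul (Num 3) (apply2 Add (apply1 Left acc) (den orc s_tq [Node q u])))
       (apply2 Mul (Num 2) (Num L)) \<noteq> Leaf
     then Node (apply2 Add (apply1 Left acc) (den orc s_tq [Node q u])) (Node (Node q (apply1 Left (apply1 Right acc))) (apply1 Right (apply1 Right acc)))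
     else Node (apply1 Left acc) (Node (apply1 Left (apply1 Right acc)) (Node q (apply1 Right (apply1 Right acc)))))"
  have t: "den orc s_tq [Node q u] = Num (tq q)" "bnd orc N s_tq [Node q u]" if "okP q" for q
    using s_tq[OF that u] by (simp_all add: tq_def)
  have ok: "\<forall>q\<in>set (dl ds). okP q" using ds by (simp add: okL_def)
  have inv: "foldr body qs (Node (Num t0) (Node Leaf Leaf)) =
     (case pack tq L t0 qs of (t, As, Rs) \<Rightarrow> Node (Num t) (Node (list_data As) (list_data Rs)))"
    if "\<forall>q\<in>set qs. okP q" for qs
    using that
  proof (induction qs)
    case (Cons q qs)
    then show ?case by (cases "pack tq L t0 qs") (simp add: body_def t pack_def)
  qed (simp add: pack_def)
  have e: "den orc s_pack [Node (Num t0) (Node ds (Node (Num L) u))] = foldr body (dl ds) (Node (Num t0) (Node Leaf Leaf))"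
    by (simp add: s_pack_def Let_def body_def cong: if_cong)
  show "den orc s_pack [Node (Num t0) (Node ds (Node (Num L) u))] =
     (case pack tq L t0 (dl ds) of (t, As, Rs) \<Rightarrow> Node (Num t) (Node (list_data As) (list_data Rs)))"
    unfolding e by (rule inv[OF ok])
  show "bnd orc N s_pack [Node (Num t0) (Node ds (Node (Num L) u))]"
    using okL_len[OF ds] t(2) ok by (auto simp: s_pack_def Let_def)
qed

end

subsection \<open>One step of the local search as a loop program\<close>

locale alg_setting = light_setting I B c \<alpha> \<beta> 3 3 3 Alg \<alpha>' + data_setting "gr I" c N orc A
  for I :: "('v,'e) inst" and B c \<alpha> \<beta> Alg \<alpha>' N orc A
begin

definition s_grp :: lx where
  "s_grp = xAnd (VS (Pr (Lf A0) (Lf (Rt A0))) s_tch)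
     (xAll (Pr (Lf A0) (Lf (Rt A0))) (Rt (Rt A0))
       (VC (VS (Pr (Lf (Rt A0)) (Lf A0)) s_tch) (V2 Leq (xLab (Lf A0)) (xLab (Rt (Rt A0)))) xT))"

lemma wf_s_grp [simp]: "wfx (Suc 0) s_grp" by (simp add: s_grp_def)

lemma s_grp:
  assumes "okP T" "okP p" "okL H"
  shows "den orc s_grp [Node T (Node p H)] = truth (grp (decL H) (dec p) (dec T))"
    "bnd orc N s_grp [Node T (Node p H)]"
proof -
  have ok: "okP q" if "q \<in> set (dl H)" for q using okL_P[OF assms(3) that] .
  have q: "(if den orc s_tch [Node T q] \<noteq> Leaf
        then apply2 Leq (apply1 Left (apply1 Right (apply1 Right q))) (apply1 Left (apply1 Right (apply1 Right p)))
        else Node Leaf Leaf) \<noteq> Leaf \<longleftrightarrow> (touch (dec T) (dec q) \<longrightarrow> pl (dec q) \<le> pl (dec p))" if "q \<in> set (dl H)" for q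
    using okP_X(4)[OF ok[OF that]] okP_X(4)[OF assms(2)] s_tch(1)[OF assms(1) ok[OF that]] by simp
  show "den orc s_grp [Node T (Node p H)] = truth (grp (decL H) (dec p) (dec T))"
    using q by (simp add: s_grp_def grp_def assms(1,2) cong: if_cong)
  show "bnd orc N s_grp [Node T (Node p H)]"
    using okL_len[OF assms(3)] ok by (simp add: s_grp_def assms(1,2) cong: if_cong)
qed

definition s_group :: lx where "s_group = xFil (Pr (Lf A0) (Rt (Rt A0))) (Lf (Rt A0)) s_grp"

lemma wf_s_group [simp]: "wfx (Suc 0) s_group" by (simp add: s_group_def)

lemma s_group:
  assumes "okP p" "okL Tf" "okL H"
  shows "okL (den orc s_group [Node p (Node Tf H)])"
    "decL (den orc s_group [Node p (Node Tf H)]) = filter (grp (decL H) (dec p)) (decL Tf)"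
    "bnd orc N s_group [Node p (Node Tf H)]"
proof -
  have e: "den orc s_group [Node p (Node Tf H)] =
      list_data (filter (\<lambda>T. den orc s_grp [Node T (Node p H)] \<noteq> Leaf) (dl Tf))"
    by (simp add: s_group_def)
  show "okL (den orc s_group [Node p (Node Tf H)])" unfolding e by (rule okL_filter[OF assms(2)])
  show "decL (den orc s_group [Node p (Node Tf H)]) = filter (grp (decL H) (dec p)) (decL Tf)"
    unfolding e using s_grp(1)[OF okL_P[OF assms(2)] assms(1,3)] by (intro decL_filter) simp
  show "bnd orc N s_group [Node p (Node Tf H)]"
    using okL_len[OF assms(2)] s_grp(2)[OF okL_P[OF assms(2)] assms(1,3)] by (simp add: s_group_def)
qed

definition s_csums :: lx where "s_csums = xSum VE A0 (VS (Lf (Lf A0)) s_csum)"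

lemma wf_s_csums [simp]: "wfx (Suc 0) s_csums" by (simp add: s_csums_def)

lemma csumP:
  assumes "okP p"
  shows "den orc s_csum [apply1 Left p] = Num (cX (dec p))" "bnd orc N s_csum [apply1 Left p]"
  using s_csum[OF okP_X(1)[OF assms]] okP_X(2)[OF assms] by simp_all

lemma s_csums:
  assumes "okL Ts"
  shows "den orc s_csums [Ts] = Num (\<Sum>T\<leftarrow>decL Ts. cX T)" "bnd orc N s_csums [Ts]"
proof -
  have "den orc s_csums [Ts] = Num (\<Sum>x\<leftarrow>dl (den orc A0 [Ts]). cX (dec x))"
    unfolding s_csums_def by (rule den_xSum) (simp add: csumP okL_P[OF assms])
  then show "den orc s_csums [Ts] = Num (\<Sum>T\<leftarrow>decL Ts. cX T)" by (simp add: comp_def)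
  show "bnd orc N s_csums [Ts]"
    using okL_len[OF assms] by (simp add: s_csums_def csumP okL_P[OF assms])
qed

definition s_viol :: lx where
  "s_viol = xFil A0 (Rt A0) (xNot (V2 Leq (VS (VS A0 s_group) s_csums) (V2 Mul (VL 3) (xLab (Lf A0)))))"

lemma wf_s_viol [simp]: "wfx (Suc 0) s_viol" by (simp add: s_viol_def)

text \<open>Only the bound on groups is tested. As \<open>K\<close> and \<open>f\<close> are both 3
  here, the bound on single subtours follows: a member of a group costs at most as much as the
  group.\<close>

definition violP :: "('v,'e) piece list \<Rightarrow> ('v,'e) piece list \<Rightarrow> ('v,'e) piece \<Rightarrow> bool" where
  "violP H Tf p \<longleftrightarrow> 3 * pl p < (\<Sum>T\<leftarrow>filter (grp H p) Tf. cX T)"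

lemma s_viol:
  assumes "okL Tf" "okL H"
  shows "den orc s_viol [Node Tf H] = list_data (filter (\<lambda>p. violP (decL H) (decL Tf) (dec p)) (dl H))"
    "bnd orc N s_viol [Node Tf H]"
proof -
  have p: "apply2 Leq (den orc s_csums [den orc s_group [Node p (Node Tf H)]])
      (apply2 Mul (Num 3) (apply1 Left (apply1 Right (apply1 Right p)))) = truth (\<not> violP (decL H) (decL Tf) (dec p))"
    "bnd orc N s_csums [den orc s_group [Node p (Node Tf H)]]" "bnd orc N s_group [Node p (Node Tf H)]"
    if "p \<in> set (dl H)" for p
    using s_group[OF okL_P[OF assms(2) that] assms] s_csums[OF s_group(1)[OF okL_P[OF assms(2) that] assms]]
      okP_X(4)[OF okL_P[OF assms(2) that]] by (simp_all add: violP_def not_less)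
  show "den orc s_viol [Node Tf H] = list_data (filter (\<lambda>p. violP (decL H) (decL Tf) (dec p)) (dl H))"
    using p(1) by (simp add: s_viol_def cong: filter_cong)
  show "bnd orc N s_viol [Node Tf H]"
    using p(2,3) okL_len[OF assms(2)] by (simp add: s_viol_def)
qed

definition s_crossing :: lx where
  "s_crossing = xFil (Lf A0) (Rt A0) (xEx (Lf A0) (Rt A0) (VS (Pr (Rt A0) (Lf A0)) s_crs))"

lemma wf_s_crossing [simp]: "wfx (Suc 0) s_crossing" by (simp add: s_crossing_def)

lemma s_crossing:
  assumes "okL E" "okL Ts"
  shows "okL (den orc s_crossing [Node E Ts])" "decL (den orc s_crossing [Node E Ts]) = crossing (decL E) (decL Ts)"
    "bnd orc N s_crossing [Node E Ts]"
proof -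
  have e: "den orc s_crossing [Node E Ts] =
      list_data (filter (\<lambda>T. \<exists>Y\<in>set (dl E). den orc s_crs [Node T Y] \<noteq> Leaf) (dl Ts))"
    by (simp add: s_crossing_def)
  show "okL (den orc s_crossing [Node E Ts])" unfolding e by (rule okL_filter[OF assms(2)])
  show "decL (den orc s_crossing [Node E Ts]) = crossing (decL E) (decL Ts)"
    unfolding e crossing_def by (intro decL_filter) (simp add: okL_P[OF assms(1)] okL_P[OF assms(2)])
  show "bnd orc N s_crossing [Node E Ts]"
    using okL_len[OF assms(1)] okL_len[OF assms(2)]
    by (simp add: s_crossing_def okL_P[OF assms(1)] okL_P[OF assms(2)])
qed

definition s_freeL :: lx where "s_freeL = xFil (Lf A0) (Rt A0) (xNot s_tch)"

lemma wf_s_freeL [simp]: "wfx (Suc 0) s_freeL" by (simp add: s_freeL_def)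

lemma s_freeL:
  assumes "okP b" "okL Ts"
  shows "okL (den orc s_freeL [Node b Ts])"
    "decL (den orc s_freeL [Node b Ts]) = filter (\<lambda>T. \<not> touch T (dec b)) (decL Ts)"
    "bnd orc N s_freeL [Node b Ts]"
proof -
  have e: "den orc s_freeL [Node b Ts] = list_data (filter (\<lambda>T. den orc s_tch [Node T b] = Leaf) (dl Ts))"
    by (simp add: s_freeL_def)
  show "okL (den orc s_freeL [Node b Ts])" unfolding e by (rule okL_filter[OF assms(2)])
  show "decL (den orc s_freeL [Node b Ts]) = filter (\<lambda>T. \<not> touch T (dec b)) (decL Ts)"
    unfolding e by (intro decL_filter) (simp add: okL_P[OF assms(2)] assms(1))
  show "bnd orc N s_freeL [Node b Ts]"
    using okL_len[OF assms(2)] by (simp add: s_freeL_def okL_P[OF assms(2)] assms(1))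
qed

definition s_pool :: lx where
  "s_pool = xFil (Lf A0) (Rt A0) (xEx (Lf A0) (Rt A0)
     (xAnd (Rt (Rt (Rt (Lf A0)))) (xAnd (VS (Pr (Rt A0) (Lf A0)) s_crs)
       (V2 Leq (VS (Lf (Rt A0)) s_csum) (V2 Mul (VL 3) (xLab (Lf A0)))))))"

lemma wf_s_pool [simp]: "wfx (Suc 0) s_pool" by (simp add: s_pool_def)

definition poolP :: "('v,'e) piece list \<Rightarrow> ('v,'e) piece \<Rightarrow> bool" where
  "poolP E T \<longleftrightarrow> (\<exists>Y\<in>set E. ps Y \<and> crossP T Y \<and> cX T \<le> 3 * pl Y)"

lemma s_pool:
  assumes "okL E" "okL Tf"
  shows "den orc s_pool [Node E Tf] = list_data (filter (\<lambda>T. poolP (decL E) (dec T)) (dl Tf))"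
    "bnd orc N s_pool [Node E Tf]"
proof -
  have Y: "okP Y" "apply1 Left (apply1 Right (apply1 Right Y)) = Num (pl (dec Y))"
    "(apply1 Right (apply1 Right (apply1 Right Y)) \<noteq> Leaf) = ps (dec Y)" if "Y \<in> set (dl E)" for Y
    using okL_P[OF assms(1) that] okP_X(4,7) by auto
  have "(\<exists>Y\<in>set (dl E). apply1 Right (apply1 Right (apply1 Right Y)) \<noteq> Leaf \<and>
     den orc s_crs [Node T Y] \<noteq> Leaf \<and> apply2 Leq (den orc s_csum [apply1 Left T])
       (apply2 Mul (Num 3) (apply1 Left (apply1 Right (apply1 Right Y)))) \<noteq> Leaf) \<longleftrightarrow> poolP (decL E) (dec T)"
    if "T \<in> set (dl Tf)" for T
    using okL_P[OF assms(2) that] csumP[OF okL_P[OF assms(2) that]] Y by (simp add: poolP_def)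
  moreover have a: "(if x \<noteq> Leaf then if y \<noteq> Leaf then z else Leaf else Leaf) \<noteq> Leaf \<longleftrightarrow> x \<noteq> Leaf \<and> y \<noteq> Leaf \<and> z \<noteq> Leaf"
    for x y z :: "('v,'e) data" by simp
  ultimately show "den orc s_pool [Node E Tf] = list_data (filter (\<lambda>T. poolP (decL E) (dec T)) (dl Tf))"
    by (simp add: s_pool_def a cong: filter_cong if_cong del: if_split)
  show "bnd orc N s_pool [Node E Tf]"
    using okL_len[OF assms(1)] okL_len[OF assms(2)]
    by (simp add: s_pool_def Y csumP okL_P[OF assms(2)] cong: if_cong)
qed

definition s_min :: lx where
  "s_min = Lf (xFil A0 A0 (xAll (Lf A0) (Rt A0) (V2 Leq (xLab (Rt A0)) (xLab (Lf A0)))))"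

lemma wf_s_min [simp]: "wfx (Suc 0) s_min" by (simp add: s_min_def)

lemma s_min:
  assumes "okL D" "dl D \<noteq> []"
  shows "okP (den orc s_min [D])" "dec (den orc s_min [D]) = minp (decL D)" "bnd orc N s_min [D]"
proof -
  let ?P = "\<lambda>g. \<forall>q\<in>set (dl D). pl (dec g) \<le> pl (dec q)"
  have lab: "apply1 Left (apply1 Right (apply1 Right q)) = Num (pl (dec q))" if "q \<in> set (dl D)" for q
    using okP_X(4)[OF okL_P[OF assms(1) that]] .
  have e: "den orc s_min [D] = apply1 Left (list_data (filter ?P (dl D)))"
    using lab by (simp add: s_min_def cong: filter_cong)
  have m: "decL (list_data (filter ?P (dl D))) = filter (\<lambda>g. \<forall>q\<in>set (decL D). pl g \<le> pl q) (decL D)"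
    by (intro decL_filter) simp
  have "minp (decL D) \<in> set (decL D)" "\<And>q. q \<in> set (decL D) \<Longrightarrow> pl (minp (decL D)) \<le> pl q"
    using minp[of "decL D"] assms(2) by simp_all
  then have "minp (decL D) \<in> set (decL (list_data (filter ?P (dl D))))" unfolding m by simp
  then obtain g gs where g: "filter ?P (dl D) = g # gs" by (cases "filter ?P (dl D)") (simp, blast)
  have "g \<in> set (filter ?P (dl D))" unfolding g by simp
  then have "g \<in> set (dl D)" by simp
  then show "okP (den orc s_min [D])" unfolding e g using okL_P[OF assms(1)] by simp
  show "dec (den orc s_min [D]) = minp (decL D)"
    unfolding minp_def m[symmetric] e g by simp
  show "bnd orc N s_min [D]" using okL_len[OF assms(1)] by (simp add: s_min_def)
qed

definition s_xstep :: lx where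
  "s_xstep = (let A' = Lf (VA 1); Q = Lf (Rt (VA 1)); D = Rt (Rt (VA 1)) in
     VLet (VS (Rt (Rt A0)) s_min)
       (VLet (xFil A0 Q (xAnd s_crs (V2 Leq (VS (Lf (Lf A0)) s_csum) (V2 Mul (VL 3) (xLab (Rt A0))))))
         (VC A0 (VS (Pr (Pr (Lf (VA 2)) (Lf A0)) (Rt (Rt (VA 2)))) s_abs) (Rt (Rt (VA 2))))))"

lemma wf_s_xstep [simp]: "wfx (Suc 0) s_xstep" by (simp add: s_xstep_def Let_def)

lemma absP:
  assumes "okL D" "djl (decL D)" "okP p"
  shows "\<forall>q\<in>set (dl (den orc s_abs [Node (Node A p) D])). okP q"
    "decL (den orc s_abs [Node (Node A p) D]) = absorb (dec p) (decL D)"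
    "bnd orc N s_abs [Node (Node A p) D]"
proof -
  obtain xs m l s where p: "p = Node xs (Node m (Node (Num l) s))" "okX xs" "okM m"
    "dec p = Piece (vX xs) (decM m) l (s \<noteq> Leaf)" using okP_D[OF assms(3)] .
  note a = s_abs[OF assms(1,2) p(1) okX_D(1,2)[OF p(2)] p(3), of "dec p"]
  show "\<forall>q\<in>set (dl (den orc s_abs [Node (Node A p) D])). okP q"
    "decL (den orc s_abs [Node (Node A p) D]) = absorb (dec p) (decL D)"
    "bnd orc N s_abs [Node (Node A p) D]"
    using a p(4) by simp_all
qed

lemma part_ne: "part V D \<Longrightarrow> D \<noteq> []"
  using b0 VB_sub by (auto simp: part_def)

lemma s_xstep:
  assumes D: "okL D" "part V (decL D)" and Q: "okL Q" "\<And>C. C \<in> set (decL Q) \<Longrightarrow> cyc C"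
  shows "okL (den orc s_xstep [Node A (Node Q D)])"
    "decL (den orc s_xstep [Node A (Node Q D)]) = xstep (decL Q) (decL D)"
    "part V (xstep (decL Q) (decL D))"
    "bnd orc N s_xstep [Node A (Node Q D)]"
proof -
  have dj: "djl (decL D)" using D(2) by (simp add: part_def)
  have "dl D \<noteq> []" using part_ne[OF D(2)] by simp
  note g = s_min[OF D(1) this]
  let ?g = "den orc s_min [D]"
  let ?cs = "filter (\<lambda>C. crossP (dec C) (dec ?g) \<and> cX (dec C) \<le> 3 * pl (dec ?g)) (dl Q)"
  have C: "(if den orc s_crs [Node C ?g] \<noteq> Leaf then
      apply2 Leq (den orc s_csum [apply1 Left C]) (apply2 Mul (Num 3) (apply1 Left (apply1 Right (apply1 Right ?g)))) else Leaf) \<noteq> Leaf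
      \<longleftrightarrow> crossP (dec C) (dec ?g) \<and> cX (dec C) \<le> 3 * pl (dec ?g)" if "C \<in> set (dl Q)" for C
    using okL_P[OF Q(1) that] g(1) csumP(1)[OF okL_P[OF Q(1) that]] okP_X(4)[OF g(1)] by simp
  have cs: "map dec ?cs = cheap (decL Q) (decL D)"
    unfolding cheap_def using decL_filter[of Q _ "\<lambda>C. crossP C (dec ?g) \<and> cX C \<le> 3 * pl (dec ?g)"] g(2) by simp
  have fl: "filter (\<lambda>C. (if den orc s_crs [Node C ?g] \<noteq> Leaf then
      apply2 Leq (den orc s_csum [apply1 Left C]) (apply2 Mul (Num 3) (apply1 Left (apply1 Right (apply1 Right ?g)))) else Leaf) \<noteq> Leaf) (dl Q) = ?cs"
    using C by (intro filter_cong) auto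
  have e: "den orc s_xstep [Node A (Node Q D)] = (if list_data ?cs \<noteq> Leaf
      then den orc s_abs [Node (Node A (apply1 Left (list_data ?cs))) D] else D)"
    unfolding s_xstep_def Let_def by (simp add: numeral_2_eq_2 fl del: if_split cong: if_cong)
  have *: "okL (den orc s_xstep [Node A (Node Q D)]) \<and>
    decL (den orc s_xstep [Node A (Node Q D)]) = xstep (decL Q) (decL D) \<and>
    part V (xstep (decL Q) (decL D)) \<and>
    (list_data ?cs \<noteq> Leaf \<longrightarrow> bnd orc N s_abs [Node (Node A (apply1 Left (list_data ?cs))) D])"
  proof (cases ?cs)
    case Nil
    then show ?thesis using D cs e by (simp add: xstep_def)
  next
    case (Cons C Cs)
    have "C \<in> set ?cs" unfolding Cons by simp
    then have CQ: "C \<in> set (dl Q)" by simp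
    then have cC: "cyc (dec C)" using Q(2) by simp
    note a = absP[OF D(1) dj okL_P[OF Q(1) CQ]]
    have x: "xstep (decL Q) (decL D) = absorb (dec C) (decL D)"
      unfolding xstep_def cs[symmetric] Cons by simp
    have "pX (dec C) \<noteq> {}" using cC by (simp add: cyc_def lconn_def)
    then have pt: "part V (absorb (dec C) (decL D))" by (rule part_absorb[OF D(2) cycD(1)[OF cC]])
    have e': "den orc s_xstep [Node A (Node Q D)] = den orc s_abs [Node (Node A C) D]" unfolding e Cons by simp
    have "okL (den orc s_xstep [Node A (Node Q D)])"
      unfolding e' by (rule okL_part[OF a(1)]) (simp only: a(2) pt)
    then show ?thesis using a pt x e' Cons by simp
  qed
  then show "okL (den orc s_xstep [Node A (Node Q D)])"
    "decL (den orc s_xstep [Node A (Node Q D)]) = xstep (decL Q) (decL D)"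
    "part V (xstep (decL Q) (decL D))" by blast+
  note ab = conjunct2[OF conjunct2[OF conjunct2[OF *]]]
  show "bnd orc N s_xstep [Node A (Node Q D)]"
    unfolding s_xstep_def Let_def using ab g okL_len[OF Q(1)]
    by (simp add: numeral_2_eq_2 fl csumP okL_P[OF Q(1)] del: if_split cong: if_cong)
qed

text \<open>The list of vertices serves as a counter: its elements are ignored and
  \<open>xstep\<close> is applied \<open>card V\<close> times, which suffices because a partition of
  \<open>V\<close> has at most that many pieces.\<close>

definition s_loop :: lx where
  "s_loop = xFold (Pr (Lf A0) (Lf (Rt A0))) (Rt (Rt (Rt A0))) (Lf (Rt (Rt A0)))
     (VS (Pr (Lf (Rt (Rt A0))) (Pr (Rt (Rt (Rt A0))) (Lf (Rt A0)))) s_xstep)"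

lemma wf_s_loop [simp]: "wfx (Suc 0) s_loop" by (simp add: s_loop_def)

lemma s_loop:
  assumes D: "okL D" "part V (decL D)" and Q: "okL Q" "\<And>C. C \<in> set (decL Q) \<Longrightarrow> cyc C" and Vs: "length (dl Vs) \<le> N"
  shows "okL (den orc s_loop [Node A (Node Q (Node D Vs))])"
    "decL (den orc s_loop [Node A (Node Q (Node D Vs))]) = (xstep (decL Q) ^^ length (dl Vs)) (decL D)"
    "bnd orc N s_loop [Node A (Node Q (Node D Vs))]"
proof -
  define body where "body = (\<lambda>(x :: ('v,'e) data) acc. den orc s_xstep [Node A (Node Q acc)])"
  have inv: "okL (foldr body xs D) \<and> decL (foldr body xs D) = (xstep (decL Q) ^^ length xs) (decL D) \<and>
     part V (decL (foldr body xs D))" for xs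
  proof (induction xs)
    case Nil then show ?case using D by simp
  next
    case (Cons x xs)
    then have IH: "okL (foldr body xs D)" "decL (foldr body xs D) = (xstep (decL Q) ^^ length xs) (decL D)"
      "part V (decL (foldr body xs D))" by blast+
    have st: "foldr body (x # xs) D = den orc s_xstep [Node A (Node Q (foldr body xs D))]"
      by (simp only: body_def foldr.simps comp_apply)
    show ?case unfolding st using s_xstep(1-3)[OF IH(1,3) Q] IH(2) by simp
  qed
  have e: "den orc s_loop [Node A (Node Q (Node D Vs))] = foldr body (dl Vs) D"
    by (simp add: s_loop_def body_def)
  show "okL (den orc s_loop [Node A (Node Q (Node D Vs))])"
    "decL (den orc s_loop [Node A (Node Q (Node D Vs))]) = (xstep (decL Q) ^^ length (dl Vs)) (decL D)"
    unfolding e using inv by blast+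
  have "bnd orc N s_xstep [Node A (Node Q (foldr body zs D))]" for zs
    using inv[of zs] by (intro s_xstep(4)[OF _ _ Q]) auto
  then show "bnd orc N s_loop [Node A (Node Q (Node D Vs))]"
    using Vs by (simp add: s_loop_def body_def[symmetric])
qed

definition s_mergeD :: lx where
  "s_mergeD = xFold (Lf A0) (Lf (Rt A0)) (Rt (Rt A0)) (VS (Pr (Pr (Rt (Rt A0)) (Lf A0)) (Lf (Rt A0))) s_abs)"

lemma wf_s_mergeD [simp]: "wfx (Suc 0) s_mergeD" by (simp add: s_mergeD_def)

lemma s_mergeD:
  assumes E: "okL E" "part V (decL E)" and Ts: "okL Ts" "\<And>T. T \<in> set (decL Ts) \<Longrightarrow> pX T \<noteq> {}"
  shows "okL (den orc s_mergeD [Node A (Node Ts E)])"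
    "decL (den orc s_mergeD [Node A (Node Ts E)]) = foldr absorb (decL Ts) (decL E)"
    "part V (foldr absorb (decL Ts) (decL E))"
    "bnd orc N s_mergeD [Node A (Node Ts E)]"
proof -
  define body where "body = (\<lambda>x acc. den orc s_abs [Node (Node A x) acc])"
  have inv: "okL (foldr body xs E) \<and> decL (foldr body xs E) = foldr absorb (map dec xs) (decL E) \<and>
     part V (foldr absorb (map dec xs) (decL E))" if "set xs \<subseteq> set (dl Ts)" for xs
    using that
  proof (induction xs)
    case Nil then show ?case using E by simp
  next
    case (Cons x xs)
    then have IH: "okL (foldr body xs E)" "decL (foldr body xs E) = foldr absorb (map dec xs) (decL E)"
      "part V (foldr absorb (map dec xs) (decL E))" and x: "x \<in> set (dl Ts)" by auto
    have ox: "okP x" by (rule okL_P[OF Ts(1) x])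
    have "pX (dec x) \<noteq> {}" using Ts(2) x by simp
    then have pt: "part V (absorb (dec x) (foldr absorb (map dec xs) (decL E)))"
      by (rule part_absorb[OF IH(3) okP_X(3)[OF ox]])
    have "djl (decL (foldr body xs E))" using IH(2,3) by (simp add: part_def)
    note a = absP[OF IH(1) this ox]
    have "okL (den orc s_abs [Node (Node A x) (foldr body xs E)])"
      by (rule okL_part[OF a(1)]) (simp only: a(2) IH(2) pt)
    then show ?case using a(2) IH(2) pt by (simp add: body_def)
  qed
  have e: "den orc s_mergeD [Node A (Node Ts E)] = foldr body (dl Ts) E"
    by (simp add: s_mergeD_def body_def)
  show "okL (den orc s_mergeD [Node A (Node Ts E)])"
    "decL (den orc s_mergeD [Node A (Node Ts E)]) = foldr absorb (decL Ts) (decL E)"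
    "part V (foldr absorb (decL Ts) (decL E))"
    unfolding e using inv[OF order_refl] by blast+
  have "bnd orc N s_abs [Node (Node A x) (foldr body zs E)]" if "dl Ts = ys @ x # zs" for ys x zs
  proof -
    have s: "set zs \<subseteq> set (dl Ts)" and x: "okP x" using that okL_P[OF Ts(1)] by auto
    have "djl (decL (foldr body zs E))" using inv[OF s] by (simp add: part_def)
    then show ?thesis using inv[OF s] by (intro absP(3)[OF _ _ x]) auto
  qed
  then show "bnd orc N s_mergeD [Node A (Node Ts E)]"
    using okL_len[OF Ts(1)] by (simp add: s_mergeD_def body_def[symmetric])
qed

end

section \<open>Programs for dropping pieces and improving \<open>H\<close>\<close>

context alg_setting begin

lemma list_data_app: "foldr Node xs (list_data ys) = list_data (xs @ ys)"
  by (induction xs) auto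

definition s_lsum :: lx where "s_lsum = xSum VE A0 (xLab (Lf A0))"

lemma wf_s_lsum [simp]: "wfx (Suc 0) s_lsum" by (simp add: s_lsum_def)

lemma s_lsum:
  assumes "\<forall>p\<in>set xs. okP p" "length xs \<le> N"
  shows "den orc s_lsum [list_data xs] = Num (\<Sum>p\<leftarrow>xs. pl (dec p))" "bnd orc N s_lsum [list_data xs]"
proof -
  have "den orc s_lsum [list_data xs] = Num (\<Sum>p\<leftarrow>dl (den orc A0 [list_data xs]). pl (dec p))"
    unfolding s_lsum_def using assms(1) by (intro den_xSum) (simp add: okP_X(4))
  then show "den orc s_lsum [list_data xs] = Num (\<Sum>p\<leftarrow>xs. pl (dec p))" by simp
  show "bnd orc N s_lsum [list_data xs]" using assms(2) by (simp add: s_lsum_def)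
qed

definition s_bins :: lx where
  "s_bins = VLet (VS A0 s_pack) (VLet (VS (Pr (Lf (VA 1)) (Pr (Rt (Rt (VA 0))) (Rt (Rt (VA 1))))) s_pack)
     (let A1 = Lf (Rt (VA 1)); A2 = Lf (Rt (VA 0)); R2 = Rt (Rt (VA 0)) in
      VC (xAnd (V2 Leq (VS A2 s_lsum) (VS A1 s_lsum)) (V2 Leq (VS R2 s_lsum) (VS A1 s_lsum)))
        (VS (Pr A2 R2) s_app)
        (VC (V2 Leq (VS R2 s_lsum) (VS A2 s_lsum)) (VS (Pr A1 R2) s_app) (VS (Pr A1 A2) s_app))))"

lemma wf_s_bins [simp]: "wfx (Suc 0) s_bins" by (simp add: s_bins_def Let_def)

lemma s_bins:
  assumes ds: "\<forall>p\<in>set xs. okP p" "length xs \<le> N" and u: "okP u"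
    and t: "3 * t0 \<le> 2 * L"
  defines "tq \<equiv> \<lambda>q. sum c (pX (dec q) \<inter> pX (dec u))"
  shows "den orc s_bins [Node (Num t0) (Node (list_data xs) (Node (Num L) u))] =
     list_data (bins tq L t0 (\<lambda>p. pl (dec p)) xs)"
    "bnd orc N s_bins [Node (Num t0) (Node (list_data xs) (Node (Num L) u))]"
    "mset (bins tq L t0 (\<lambda>p. pl (dec p)) xs) \<subseteq># mset xs"
proof -
  have tn: "0 \<le> tq q" for q by (simp add: tq_def c_sum_nonneg)
  obtain t1 A1 R1 where p1: "pack tq L t0 xs = (t1, A1, R1)" by (cases "pack tq L t0 xs") auto
  obtain t2 A2 R2 where p2: "pack tq L t0 R1 = (t2, A2, R2)" by (cases "pack tq L t0 R1") auto
  have m1: "mset A1 + mset R1 = mset xs" by (rule pack_spec(3)[OF p1 t tn])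
  have m2: "mset A2 + mset R2 = mset R1" by (rule pack_spec(3)[OF p2 t tn])
  have m: "mset A1 + (mset A2 + mset R2) = mset xs" using m1 m2 by simp
  have ok: "(\<forall>p\<in>set B'. okP p) \<and> length B' \<le> N" if "mset B' \<subseteq># mset xs" for B'
    using that ds set_mset_mono[OF that] size_mset_mono[OF that] by auto
  have s: "mset A1 \<subseteq># mset xs" "mset R1 \<subseteq># mset xs" "mset A2 \<subseteq># mset xs" "mset R2 \<subseteq># mset xs"
    unfolding m1[symmetric] m2[symmetric] by (simp_all add: subset_mset.add_increasing)
  have oL: "okL (list_data xs)" "okL (list_data R1)" using ds ok[OF s(2)] by (simp_all add: okL_def)
  have k1: "den orc s_pack [Node (Num t0) (Node (list_data xs) (Node (Num L) u))] =
      Node (Num t1) (Node (list_data A1) (list_data R1))"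
    using s_pack(1)[OF oL(1) u, of t0 L] p1 by (simp add: tq_def)
  have k2: "den orc s_pack [Node (Num t0) (Node (list_data R1) (Node (Num L) u))] =
      Node (Num t2) (Node (list_data A2) (list_data R2))"
    using s_pack(1)[OF oL(2) u, of t0 L] p2 by (simp add: tq_def)
  note l = s_lsum[of A1] s_lsum[of A2] s_lsum[of R2]
  have o: "\<forall>p\<in>set A1. okP p" "length A1 \<le> N" "\<forall>p\<in>set A2. okP p" "length A2 \<le> N" "\<forall>p\<in>set R2. okP p" "length R2 \<le> N"
    using ok[OF s(1)] ok[OF s(3)] ok[OF s(4)] by simp_all
  have e: "bins tq L t0 (\<lambda>p. pl (dec p)) xs = (let sl = \<lambda>A. (\<Sum>p\<leftarrow>A. pl (dec p)) in
      if sl A2 \<le> sl A1 \<and> sl R2 \<le> sl A1 then A2 @ R2 else if sl R2 \<le> sl A2 then A1 @ R2 else A1 @ A2)"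
    by (simp add: bins_def p1 p2 Let_def)
  show "den orc s_bins [Node (Num t0) (Node (list_data xs) (Node (Num L) u))] =
     list_data (bins tq L t0 (\<lambda>p. pl (dec p)) xs)"
    unfolding e by (simp add: s_bins_def Let_def k1 k2 l o den_s_app list_data_app)
  show "bnd orc N s_bins [Node (Num t0) (Node (list_data xs) (Node (Num L) u))]"
    using s_pack(2)[OF oL(1) u] s_pack(2)[OF oL(2) u]
    by (simp add: s_bins_def Let_def k1 k2 l o bnd_s_app)
  have "mset (A2 @ R2) \<subseteq># mset xs" "mset (A1 @ R2) \<subseteq># mset xs" "mset (A1 @ A2) \<subseteq># mset xs"
    unfolding m[symmetric] by (simp_all add: subset_mset.add_mono subset_mset.add_increasing2 ac_simps)
  then show "mset (bins tq L t0 (\<lambda>p. pl (dec p)) xs) \<subseteq># mset xs" unfolding e Let_def by simp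
qed

text \<open>Packing sees items only through their sizes, so it commutes with decoding; the program
  packs encoded pieces, the specification decoded ones.\<close>

lemma pack_map: "pack t L t0 (map g qs) = (case pack (\<lambda>q. t (g q)) L t0 qs of (s, A, R) \<Rightarrow> (s, map g A, map g R))"
  by (induction qs) (auto simp: pack_def split: prod.splits)

lemma bins_map: "bins t L t0 l (map g qs) = map g (bins (\<lambda>q. t (g q)) L t0 (\<lambda>q. l (g q)) qs)"
  by (auto simp: bins_def pack_map Let_def comp_def split: prod.splits)

definition s_drops :: lx where
  "s_drops = (let j = Lf A0; H = Lf (Rt A0); Ts = Lf (Rt (Rt A0)); U = Rt (Rt (Rt A0)) in
     VS (Pr (VS (Pr j U) s_tq) (Pr (xFil (Pr U j) H
           (xAnd (VS (Pr (Lf (Rt A0)) (Lf A0)) s_tch) (xNot (VS (Pr (Lf A0) (Rt (Rt A0))) s_tch))))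
         (Pr (VS Ts s_csums) U))) s_bins)"

lemma wf_s_drops [simp]: "wfx (Suc 0) s_drops" by (simp add: s_drops_def Let_def)

lemma s_drops:
  assumes j: "okP j" and H: "okL H" and Ts: "okL Ts" and U: "okP U" "pX (dec U) = pX (unionP (decL Ts))"
    and t: "3 * sum c (pX (dec j) \<inter> pX (dec U)) \<le> 2 * (\<Sum>T\<leftarrow>decL Ts. cX T)"
  shows "okL (den orc s_drops [Node j (Node H (Node Ts U))])"
    "decL (den orc s_drops [Node j (Node H (Node Ts U))]) = drops (decL H) (dec j) (decL Ts)"
    "bnd orc N s_drops [Node j (Node H (Node Ts U))]"
proof -
  define F where "F = filter (\<lambda>q. touch (dec U) (dec q) \<and> \<not> touch (dec q) (dec j)) (dl H)"
  have F: "\<forall>p\<in>set F. okP p" "length F \<le> N"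
    using okL_P[OF H] okL_len[OF H] by (auto simp: F_def intro: order_trans[OF length_filter_le])
  have fl: "filter (\<lambda>x. (den orc s_tch [Node U x] \<noteq> Leaf \<longrightarrow> den orc s_tch [Node x j] = Leaf) \<and>
      den orc s_tch [Node U x] \<noteq> Leaf) (dl H) = F"
    unfolding F_def using okL_P[OF H] by (intro filter_cong) (auto simp: U(1) j)
  define Lt where "Lt = (\<Sum>T\<leftarrow>decL Ts. cX T)"
  note b = s_bins[OF F U(1) t[folded Lt_def]]
  note cs = s_csums[OF Ts, folded Lt_def]
  have e: "den orc s_drops [Node j (Node H (Node Ts U))] =
    list_data (bins (\<lambda>q. sum c (pX (dec q) \<inter> pX (dec U))) Lt
      (sum c (pX (dec j) \<inter> pX (dec U))) (\<lambda>p. pl (dec p)) F)"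
    using fl by (simp add: s_drops_def Let_def s_tq[OF j U(1)] cs b(1))
  show "okL (den orc s_drops [Node j (Node H (Node Ts U))])"
    unfolding e okL_def dl_list_data using F set_mset_mono[OF b(3)] size_mset_mono[OF b(3)] by auto
  have "filter (\<lambda>q. touch (unionP (decL Ts)) q \<and> \<not> touch q (dec j)) (decL H) = map dec F"
    using U(2) unfolding F_def by (simp add: filter_map comp_def touch_def)
  then show "decL (den orc s_drops [Node j (Node H (Node Ts U))]) = drops (decL H) (dec j) (decL Ts)"
    unfolding e drops_def U(2)[symmetric] Lt_def by (simp add: bins_map)
  show "bnd orc N s_drops [Node j (Node H (Node Ts U))]"
    using fl okL_len[OF H] okL_P[OF H]
    by (simp add: s_drops_def Let_def s_tq[OF j U(1)] cs b(2) U(1) j)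
qed

definition s_verts :: lx where "s_verts = xFold VE A0 VE (VS (Pr (Lf (Lf A0)) (Lf (Rt A0))) s_app)"
definition s_dissolve :: lx where
  "s_dissolve = VS (Pr (VS (VS (Lf A0) s_verts) s_singles)
     (xFil (Lf A0) (Rt A0) (xAll (Lf A0) (Rt A0) (xNot s_tch)))) s_app"

lemma wf_s_dissolve [simp]: "wfx (Suc 0) s_verts" "wfx (Suc 0) s_dissolve"
  by (simp_all add: s_verts_def s_dissolve_def)

lemma s_verts:
  assumes "okL ds" "djl (decL ds)"
  shows "okX (den orc s_verts [ds])" "vX (den orc s_verts [ds]) = (\<Union>q\<in>set (decL ds). pX q)"
    "bnd orc N s_verts [ds]"
proof -
  have inv: "okX (foldr (\<lambda>x acc. foldr Node (dl (apply1 Left x)) acc) qs Leaf) \<and>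
     vX (foldr (\<lambda>x acc. foldr Node (dl (apply1 Left x)) acc) qs Leaf) = (\<Union>q\<in>set qs. pX (dec q))"
    if "\<forall>q\<in>set qs. okP q" "djl (map dec qs)" for qs
    using that
  proof (induction qs)
    case (Cons q qs)
    let ?r = "foldr (\<lambda>x acc. foldr Node (dl (apply1 Left x)) acc) qs Leaf"
    have IH: "okX ?r" "vX ?r = (\<Union>q\<in>set qs. pX (dec q))" and q: "okP q" using Cons by auto
    have "vX (apply1 Left q) \<inter> vX ?r = {}" using Cons.prems(2) IH(2) okP_X(2)[OF q] by auto
    from okX_app[OF okP_X(1)[OF q] IH(1) this] show ?case using IH(2) okP_X(2)[OF q] by simp
  qed simp
  have e: "den orc s_verts [ds] = foldr (\<lambda>x acc. foldr Node (dl (apply1 Left x)) acc) (dl ds) Leaf"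
    by (simp add: s_verts_def den_s_app)
  have ok: "\<forall>q\<in>set (dl ds). okP q" using okL_P[OF assms(1)] by blast
  show "okX (den orc s_verts [ds])" "vX (den orc s_verts [ds]) = (\<Union>q\<in>set (decL ds). pX q)"
    unfolding e using inv[OF ok assms(2)] by simp_all
  show "bnd orc N s_verts [ds]"
    using okL_len[OF assms(1)] okX_D(2)[OF okP_X(1)] ok by (simp add: s_verts_def bnd_s_app split_all)
qed

lemma s_dissolve:
  assumes drp: "okL drp" "djl (decL drp)" and H: "okL H"
  obtains us where "distinct us" "set us = (\<Union>q\<in>set (decL drp). pX q)"
    "decL (den orc s_dissolve [Node drp H]) = dissolve c us (decL drp) (decL H)"
    "\<forall>q\<in>set (dl (den orc s_dissolve [Node drp H])). okP q"
    "bnd orc N s_dissolve [Node drp H]"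
proof -
  note v = s_verts[OF drp]
  obtain us where us: "distinct us" "set us = vX (den orc s_verts [drp])"
    "decL (den orc s_singles [den orc s_verts [drp]]) = singles c us"
    "okL (den orc s_singles [den orc s_verts [drp]])" "bnd orc N s_singles [den orc s_verts [drp]]"
    using s_singles[OF v(1)] .
  let ?k = "list_data (filter (\<lambda>q. \<forall>r\<in>set (dl drp). den orc s_tch [Node r q] = Leaf) (dl H))"
  have k: "decL ?k = filter (\<lambda>q. \<forall>r\<in>set (decL drp). \<not> touch r q) (decL H)"
    by (rule decL_filter) (simp add: okL_P[OF drp(1)] okL_P[OF H])
  have e: "den orc s_dissolve [Node drp H] = foldr Node (dl (den orc s_singles [den orc s_verts [drp]])) ?k"
    by (simp add: s_dissolve_def den_s_app)
  have "decL (den orc s_dissolve [Node drp H]) = dissolve c us (decL drp) (decL H)"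
    unfolding e dissolve_def k[symmetric] us(3)[symmetric] by simp
  moreover have "\<forall>q\<in>set (dl (den orc s_dissolve [Node drp H])). okP q"
    unfolding e using okL_P[OF us(4)] okL_P[OF H] by auto
  moreover have "bnd orc N s_dissolve [Node drp H]"
    using v(3) us(5) okL_len[OF us(4)] okL_len[OF H] okL_len[OF drp(1)] okL_P[OF H] okL_P[OF drp(1)]
    by (simp add: s_dissolve_def bnd_s_app)
  ultimately show ?thesis using that us(1,2) v(2) by simp
qed

definition s_improve :: lx where
  "s_improve = VLet (VS (Pr (Lf A0) (Rt (Rt (Rt A0)))) s_union)
     (VLet (VS (Pr (VS (Pr (Lf (Rt (VA 1))) (Pr (Lf (Rt (Rt (VA 1)))) (Pr (Rt (Rt (Rt (VA 1)))) (VA 0)))) s_drops)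
          (Lf (Rt (Rt (VA 1))))) s_dissolve)
       (VLet (VS (Pr (Pr (Lf (VA 2)) (VA 1)) (VA 0)) s_abs)
         (Pr (Pr (Lf (Lf A0)) (Pr (Lf (Rt (Lf A0))) (Pr (VS (Lf (Lf A0)) s_csum) VE))) (Rt A0))))"

lemma wf_s_improve [simp]: "wfx (Suc 0) s_improve" by (simp add: s_improve_def)

lemma Hinv_okL:
  assumes "\<forall>q\<in>set (dl ds). okP q" "Hinv (decL ds)"
  shows "okL ds"
  using assms length_Hinv[OF assms(2)] NV by (simp add: okL_def)

lemma s_improve:
  assumes H: "okL H" "Hinv (decL H)" and j: "j \<in> set (dl H)"
    and Ts: "okL Ts" "dl Ts \<noteq> []" "\<And>T. T \<in> set (decL Ts) \<Longrightarrow> cyc T \<and> grp (decL H) (dec j) T" "djl (decL Ts)"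
    and big: "3 * pl (dec j) < (\<Sum>T\<leftarrow>decL Ts. cX T)"
  shows "okL (den orc s_improve [Node A (Node j (Node H Ts))])"
    "Hinv (decL (den orc s_improve [Node A (Node j (Node H Ts))]))"
    "(\<Sum>q\<leftarrow>decL H. (pl q)\<^sup>2) + 5 * (pl (dec j))\<^sup>2
      \<le> (\<Sum>q\<leftarrow>decL (den orc s_improve [Node A (Node j (Node H Ts))]). (pl q)\<^sup>2)"
    "bnd orc N s_improve [Node A (Node j (Node H Ts))]"
proof -
  have jP: "okP j" by (rule okL_P[OF H(1) j])
  have jH: "dec j \<in> set (decL H)" using j by simp
  have P: "part (V - VB) (decL H)" using H(2) by (simp add: Hinv_def)
  note u = s_union[OF Ts(1,4)]
  let ?U = "den orc s_union [Node A Ts]"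
  have plj: "pl (dec j) = cX (dec j)" using H(2) jH unfolding Hinv_def by blast
  have "sum c (pX (dec j) \<inter> pX (dec ?U)) \<le> pl (dec j)"
    unfolding plj using okP_X(3)[OF jP] by (intro c_sum_mono finite_subset[of "pX (dec j)" V]) auto
  moreover have "0 \<le> pl (dec j)" unfolding plj by (rule c_sum_nonneg)
  ultimately have t: "3 * sum c (pX (dec j) \<inter> pX (dec ?U)) \<le> 2 * (\<Sum>T\<leftarrow>decL Ts. cX T)"
    using big by linarith
  note d = s_drops[OF jP H(1) Ts(1) u(1,2) t]
  let ?d = "den orc s_drops [Node j (Node H (Node Ts ?U))]"
  have TsN: "decL Ts \<noteq> []" using Ts(2) by simp
  \<comment> \<open>Being a submultiset of a list without repetitions, the dropped pieces are
    pairwise disjoint, as the program that collects their vertices requires.\<close>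
  have sub: "mset (drops (decL H) (dec j) (decL Ts)) \<subseteq># mset (decL H)"
  proof -
    let ?F = "filter (\<lambda>q. touch (dec ?U) (dec q) \<and> \<not> touch (dec q) (dec j)) (dl H)"
    have F: "\<forall>p\<in>set ?F. okP p" "length ?F \<le> N"
      using okL_P[OF H(1)] okL_len[OF H(1)] by (auto intro: order_trans[OF length_filter_le])
    have "filter (\<lambda>q. touch (unionP (decL Ts)) q \<and> \<not> touch q (dec j)) (decL H) = map dec ?F"
      using u(2) by (simp add: filter_map comp_def touch_def)
    then have "drops (decL H) (dec j) (decL Ts) = map dec (bins (\<lambda>q. sum c (pX (dec q) \<inter> pX (dec ?U)))
        (\<Sum>T\<leftarrow>decL Ts. cX T) (sum c (pX (dec j) \<inter> pX (dec ?U))) (\<lambda>p. pl (dec p)) ?F)"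
      unfolding drops_def u(2)[symmetric] by (simp add: bins_map)
    moreover have "mset (bins (\<lambda>q. sum c (pX (dec q) \<inter> pX (dec ?U)))
        (\<Sum>T\<leftarrow>decL Ts. cX T) (sum c (pX (dec j) \<inter> pX (dec ?U))) (\<lambda>p. pl (dec p)) ?F) \<subseteq># mset (dl H)"
      by (rule subset_mset.order_trans[OF s_bins(3)[OF F u(1) t]]) (simp add: multiset_filter_subset)
    ultimately show ?thesis by (simp add: image_mset_subseteq_mono)
  qed
  have dd: "djl (decL ?d)"
  proof -
    have "djl L" if "distinct L" "set L \<subseteq> set (decL H)" for L
      using that
    proof (induction L)
      case (Cons a L)
      have "pX a \<inter> pX q = {}" if q: "q \<in> set L" for q
      proof (rule ccontr)
        assume "pX a \<inter> pX q \<noteq> {}"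
        then obtain v where "v \<in> pX a" "v \<in> pX q" by blast
        from part_unique[OF P _ _ this] q Cons.prems show False by auto
      qed
      then show ?case using Cons by simp
    qed simp
    moreover have "distinct (drops (decL H) (dec j) (decL Ts))"
    proof -
      obtain R where "mset (decL H) = mset (drops (decL H) (dec j) (decL Ts)) + R"
        using sub unfolding subset_mset.le_iff_add by blast
      moreover obtain zs where "mset zs = R" using ex_mset by blast
      ultimately have "mset (decL H) = mset (drops (decL H) (dec j) (decL Ts) @ zs)" by simp
      then show ?thesis using part_distinct[OF P]
          mset_eq_imp_distinct_iff[of "decL H" "drops (decL H) (dec j) (decL Ts) @ zs"] by simp
    qed
    ultimately show ?thesis unfolding d(2) using set_mset_mono[OF sub] by simp
  qed
  obtain us where us: "distinct us" "set us = (\<Union>q\<in>set (decL ?d). pX q)"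
    "decL (den orc s_dissolve [Node ?d H]) = dissolve c us (decL ?d) (decL H)"
    "\<forall>q\<in>set (dl (den orc s_dissolve [Node ?d H])). okP q"
    "bnd orc N s_dissolve [Node ?d H]" using s_dissolve[OF d(1) dd H(1)] .
  let ?D = "den orc s_dissolve [Node ?d H]"
  note im = improve_local[OF H(2) jH TsN Ts(3,4) refl big us(1) us(2)[unfolded d(2)]]
  have PD: "djl (decL ?D) \<and> length (decL ?D) \<le> card V"
  proof -
    have "part (V - VB) (decL ?D)"
      unfolding us(3) using set_mset_mono[OF sub] by (intro part_dissolve[OF P _ us(1,2)]) (simp add: d(2))
    then show ?thesis using part_length[of "V - VB" "decL ?D"] card_mono[of V "V - VB"] by (simp add: part_def)
  qed
  have D: "okL ?D" using us(4) PD NV by (simp add: okL_def)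
  note a = absP[OF D conjunct1[OF PD] u(1)]
  let ?r = "den orc s_abs [Node (Node A ?U) ?D]"
  have ab: "decL ?r = absorb (unionP (decL Ts)) (dissolve c us (drops (decL H) (dec j) (decL Ts)) (decL H))"
  proof -
    have "touch (dec ?U) = touch (unionP (decL Ts))" by (rule ext) (simp add: touch_def u(2))
    then show ?thesis unfolding a(2) us(3) d(2) by (simp add: absorb_def joined_def u(3))
  qed
  then obtain r1 rs where r: "dl ?r = r1 # rs" by (cases "dl ?r") (simp_all add: absorb_def)
  have r1: "okP r1" using a(1) r by simp
  obtain x y where xy: "?r = Node x y" "x = r1" "dl y = rs" using r by (cases ?r) auto
  let ?h = "Node (apply1 Left r1) (Node (apply1 Left (apply1 Right r1)) (Node (Num (cX (dec r1))) Leaf))"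
  have e: "den orc s_improve [Node A (Node j (Node H Ts))] = Node ?h y"
    by (simp add: s_improve_def numeral_2_eq_2 xy csumP(1)[OF r1])
  have h: "okP ?h" "dec ?h = Piece (pX (dec r1)) (pM (dec r1)) (cX (dec r1)) False"
  proof -
    obtain xs m l s where q: "r1 = Node xs (Node m (Node (Num l) s))" "okX xs" "okM m" using okP_D[OF r1] .
    show "okP ?h" unfolding okP_def using q by (intro exI[of _ xs] exI[of _ m] exI[of _ "cX (dec r1)"] exI[of _ Leaf]) simp
    show "dec ?h = Piece (pX (dec r1)) (pM (dec r1)) (cX (dec r1)) False" unfolding q(1) by (simp add: dec_def)
  qed
  have dec_im: "decL (Node ?h y) = improve c us (drops (decL H) (dec j) (decL Ts)) (decL Ts) (decL H)"
    unfolding improve_def ab[symmetric] using h(2) xy(3) r by (simp add: reset_hd_def)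
  show hi: "Hinv (decL (den orc s_improve [Node A (Node j (Node H Ts))]))"
    unfolding e dec_im by (rule im(1))
  show "(\<Sum>q\<leftarrow>decL H. (pl q)\<^sup>2) + 5 * (pl (dec j))\<^sup>2
      \<le> (\<Sum>q\<leftarrow>decL (den orc s_improve [Node A (Node j (Node H Ts))]). (pl q)\<^sup>2)"
    unfolding e dec_im by (rule im(2))
  show "okL (den orc s_improve [Node A (Node j (Node H Ts))])"
    using hi a(1) r h(1) xy(3) unfolding e by (intro Hinv_okL) auto
  show "bnd orc N s_improve [Node A (Node j (Node H Ts))]"
    using u(4) d(3) us(5) a(3) by (simp add: s_improve_def numeral_2_eq_2 xy csumP(2)[OF r1])
qed

end

text \<open>\<open>N3\<close> will bound the number of remembered subtours via
  \<open>card_bits\<close>. The lower bound \<open>\<delta>\<close> on costs outside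
  \<open>V(B)\<close> gives every improvement a minimum size.\<close>

locale run_setting = alg_setting I B c \<alpha> \<beta> Alg \<alpha>' N orc A
  for I :: "('v,'e) inst" and B c \<alpha> \<beta> Alg \<alpha>' N orc A +
  fixes Vs Bd :: "('v,'e) data" and \<delta> :: real
  assumes N3: "card (verts (gr I)) ^ 3 \<le> N"
    and \<delta>: "0 < \<delta>" "\<And>v. v \<in> verts (gr I) - mverts (gr I) B \<Longrightarrow> \<delta> \<le> c v"
    and impl: "implements orc Alg I B" and time: "time_bounded Alg I B N"
    and Vs: "okX Vs" "vX Vs = verts (gr I)"
    and Bd: "okP Bd" "dec Bd = Bp"
begin

text \<open>The part of the state that never changes: vertices with costs, arcs, and the piece of
  \<open>B\<close>.\<close>

abbreviation "Kc \<equiv> Node Vs (Node A Bd)"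

lemma length_Vs: "length (dl Vs) = card V" "length (dl Vs) \<le> N"
proof -
  obtain us where us: "distinct us" "set us \<subseteq> verts (gr I)" "Vs = list_data (map (\<lambda>v. Node (Vtx v) (Num (c v))) us)"
    using Vs(1) by (auto simp: okX_def)
  have "vX Vs = set us" by (auto simp: us(3) vX_def)
  then show "length (dl Vs) = card V" using Vs(2) distinct_card[OF us(1)] by (simp add: us(3))
  then show "length (dl Vs) \<le> N" using NV by simp
qed

text \<open>The oracle expects bare lists of vertices, so the costs are stripped, and the piece of
  \<open>B\<close> is left out.\<close>

definition s_query :: lx where
  "s_query = VQ (xMap VE (VS A0 s_freeL) (xMap VE (Lf (Lf A0)) (Lf (Lf A0))))"

lemma wf_s_query [simp]: "wfx (Suc 0) s_query" by (simp add: s_query_def)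

lemma s_query:
  assumes E: "okL E" and inv: "Einv H Q (decL E)"
  shows "okM (den orc s_query [Node Bd E])"
    "decM (den orc s_query [Node Bd E]) = fst (Alg I B (query_of (decL E)))"
    "bnd orc N s_query [Node Bd E]"
proof -
  let ?L = "den orc s_freeL [Node Bd E]"
  let ?parts = "\<lambda>ds. list_data (map (\<lambda>Y. list_data (map (apply1 Left) (dl (apply1 Left Y)))) (dl ds)) :: ('v,'e) data"
  note fl = s_freeL[OF Bd(1) E]
  have q: "query_of (decL E) = map pX (decL ?L)" using fl(2) Bd(2) by (simp add: free_def[abs_def])
  have "enc_vset (list_data (map (apply1 Left) (dl (apply1 Left Y)))) (pX (dec Y))" if Y: "okP Y" for Y
  proof -
    obtain us where us: "distinct us" "set us \<subseteq> verts (gr I)" "apply1 Left Y = list_data (map (\<lambda>v. Node (Vtx v) (Num (c v))) us)"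
      using okP_X(1)[OF Y] by (auto simp: okX_def)
    have "pX (dec Y) = set us" unfolding okP_X(2)[OF Y] by (auto simp: us(3) vX_def)
    moreover have "map (apply1 Left) (dl (apply1 Left Y)) = map Vtx us" by (simp add: us(3))
    ultimately show ?thesis using us(1) by (auto simp: enc_vset_def)
  qed
  then have "list_all2 enc_vset (map (\<lambda>Y. list_data (map (apply1 Left) (dl (apply1 Left Y)))) (dl ?L)) (map pX (decL ?L))"
    using okL_P[OF fl(1)] by (auto simp: list_all2_conv_all_nth)
  then have enc: "enc_parts (?parts ?L) (query_of (decL E))" unfolding q enc_parts_def by blast
  note vq = valid_query[OF inv]
  have im: "enc_edges (fst (orc (?parts ?L))) (fst (Alg I B (query_of (decL E))))"
    "snd (orc (?parts ?L)) = snd (Alg I B (query_of (decL E)))"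
    using impl vq enc unfolding implements_def by blast+
  have e: "den orc s_query [Node Bd E] = fst (orc (?parts ?L))" by (simp add: s_query_def)
  have "eulerian (gr I) (fst (Alg I B (query_of (decL E))))"
    using solves vq by (simp add: solves_spc_def spc_solution_def)
  then have "set_mset (fst (Alg I B (query_of (decL E)))) \<subseteq> arcs (gr I)" by (simp add: eulerian_def)
  from okM_I[OF im(1) this] show "okM (den orc s_query [Node Bd E])"
    "decM (den orc s_query [Node Bd E]) = fst (Alg I B (query_of (decL E)))" unfolding e by auto
  have "snd (Alg I B (query_of (decL E))) \<le> N" using time vq unfolding time_bounded_def by blast
  moreover have "length (dl (apply1 Left Y)) \<le> N" if "Y \<in> set (dl ?L)" for Y
    using okX_D(2)[OF okP_X(1)[OF okL_P[OF fl(1) that]]] .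
  ultimately show "bnd orc N s_query [Node Bd E]"
    using im(2) fl(3) okL_len[OF fl(1)] by (simp add: s_query_def)
qed

abbreviation (input) "stK a \<equiv> V1 Left a"
abbreviation (input) "stA a \<equiv> V1 Left (V1 Right (V1 Left a))"
abbreviation (input) "stB a \<equiv> V1 Right (V1 Right (V1 Left a))"
abbreviation (input) "stV a \<equiv> V1 Left (V1 Left a)"
abbreviation (input) "stH a \<equiv> V1 Left (V1 Right a)"
abbreviation (input) "stQ a \<equiv> V1 Left (V1 Right (V1 Right a))"
abbreviation (input) "stE a \<equiv> V1 Right (V1 Right (V1 Right a))"

definition s_front :: lx where
  "s_front = VLet (VS (Pr (stE A0) (VS (Pr (stK A0) (VS (Pr (stB A0) (stE A0)) s_query)) s_comps)) s_crossing)
     (Pr (VA 0) (VS (Pr (stB (VA 1)) (VA 0)) s_freeL))"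

lemma wf_s_front [simp]: "wfx (Suc 0) s_front" by (simp add: s_front_def)

lemma s_front:
  assumes E: "okL E" and inv: "Einv H' Q' (decL E)"
  obtains Ts L1 Lf where "den orc s_front [Node Kc (Node H (Node Q E))] = Node L1 Lf"
    "spc_out (decL E) Ts" "okL L1" "decL L1 = crossing (decL E) Ts" "okL Lf" "decL Lf = filter free (crossing (decL E) Ts)"
    "bnd orc N s_front [Node Kc (Node H (Node Q E))]"
proof -
  note q = s_query[OF E inv]
  let ?F = "den orc s_query [Node Bd E]"
  note cm = s_comps[OF Vs q(1), of Bd]
  let ?T = "den orc s_comps [Node Kc ?F]"
  have out: "spc_out (decL E) (decL ?T)" by (rule spc_out_query[OF inv cm(2)[unfolded q(2)]])
  note cr = s_crossing[OF E cm(1)]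
  let ?L1 = "den orc s_crossing [Node E ?T]"
  note fr = s_freeL[OF Bd(1) cr(1)]
  have "decL (den orc s_freeL [Node Bd ?L1]) = filter free (crossing (decL E) (decL ?T))"
    using fr(2) cr(2) Bd(2) by (simp add: free_def[abs_def])
  moreover have "den orc s_front [Node Kc (Node H (Node Q E))] = Node ?L1 (den orc s_freeL [Node Bd ?L1])"
    by (simp add: s_front_def)
  moreover have "bnd orc N s_front [Node Kc (Node H (Node Q E))]"
    by (simp add: s_front_def q(3) cm(3) cr(3) fr(3))
  ultimately show ?thesis using that[OF _ out cr(1,2) fr(1)] by blast
qed

definition s_commit :: lx where
  "s_commit = Pr (Pr (Lf (Lf A0)) (Pr (Lf (Rt (Lf A0))) (Pr (xLab (Lf A0)) xT)))
     (xFil (Lf A0) (Rt A0) (xNot (VS (Pr (Rt A0) (Lf A0)) s_tch)))"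

lemma wf_s_commit [simp]: "wfx (Suc 0) s_commit" by (simp add: s_commit_def)

lemma s_commit:
  assumes g: "okP g" and E: "okL E"
  shows "\<forall>q\<in>set (dl (den orc s_commit [Node g E])). okP q"
    "decL (den orc s_commit [Node g E]) = seal (dec g) # filter (\<lambda>Y. \<not> touch (dec g) Y) (decL E)"
    "bnd orc N s_commit [Node g E]"
proof -
  obtain xs m l s where q: "g = Node xs (Node m (Node (Num l) s))" "okX xs" "okM m" using okP_D[OF g] .
  let ?h = "Node xs (Node m (Node (Num l) (Node Leaf Leaf)))"
  let ?k = "list_data (filter (\<lambda>Y. den orc s_tch [Node g Y] = Leaf) (dl E))"
  have e: "den orc s_commit [Node g E] = Node ?h ?k" by (simp add: s_commit_def q(1))
  have h: "okP ?h" unfolding okP_def using q(2,3) by blast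
  have dh: "dec ?h = seal (dec g)" by (simp add: q(1) dec_def seal_def)
  have k: "decL ?k = filter (\<lambda>Y. \<not> touch (dec g) Y) (decL E)"
    by (rule decL_filter) (simp add: g okL_P[OF E])
  show "\<forall>q\<in>set (dl (den orc s_commit [Node g E])). okP q" unfolding e using h okL_P[OF E] by auto
  show "decL (den orc s_commit [Node g E]) = seal (dec g) # filter (\<lambda>Y. \<not> touch (dec g) Y) (decL E)"
    unfolding e k[symmetric] dh[symmetric] by simp
  show "bnd orc N s_commit [Node g E]"
    using okL_len[OF E] okL_P[OF E] by (simp add: s_commit_def g)
qed

text \<open>The first component of the result tells whether to go on. Both restarts reset the
  partition to \<open>B\<close> together with \<open>H\<close>. An improvement of \<open>H\<close>
  also empties \<open>Q\<close>, which keeps the length of \<open>Q\<close> below the number of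
  triples for the new \<open>H\<close>.\<close>

definition s_step :: lx where
  "s_step = VLet (VS A0 s_front) (VLet (VS (Pr (Rt (VA 0)) (stH (VA 1))) s_viol)
     (VC (VA 0)
       (VLet (VS (Pr (stA (VA 2)) (Pr (Lf (VA 0)) (Pr (stH (VA 2))
            (VS (Pr (Lf (VA 0)) (Pr (Rt (VA 1)) (stH (VA 2)))) s_group)))) s_improve)
         (Pr xT (Pr (stK (VA 3)) (Pr (VA 0) (Pr VE (Pr (stB (VA 3)) (VA 0)))))))
       (VLet (VS (Pr (stE (VA 2)) (Rt (VA 1))) s_pool)
         (VC (VA 0)
           (Pr xT (Pr (stK (VA 3)) (Pr (stH (VA 3)) (Pr (Pr (Lf (VA 0)) (stQ (VA 3))) (Pr (stB (VA 3)) (stH (VA 3)))))))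
           (VLet (VS (Pr (stA (VA 3)) (Pr (stQ (VA 3))
               (Pr (VS (Pr (stA (VA 3)) (Pr (Lf (VA 2)) (stE (VA 3)))) s_mergeD) (stV (VA 3))))) s_loop)
             (VLet (VS (VA 0) s_min)
               (VC (V1 IsNode (Rt (VA 1)))
                 (Pr xT (Pr (stK (VA 5)) (Pr (stH (VA 5)) (Pr (stQ (VA 5)) (VS (Pr (VA 0) (stE (VA 5))) s_commit)))))
                 (Pr VE (Lf (Rt (VA 0)))))))))))"

lemma wf_s_step [simp]: "wfx (Suc 0) s_step" by (simp add: s_step_def)

text \<open>Each remembered subtour has added a triple to \<open>bits\<close>. The inequality thus
  bounds the length of \<open>Q\<close> by the cube of the number of vertices and keeps the folds
  over \<open>Q\<close> within \<open>N\<close>.\<close>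

definition st_ok :: "('v,'e) data \<Rightarrow> ('v,'e) data \<Rightarrow> ('v,'e) data \<Rightarrow> bool" where
  "st_ok H Q E \<longleftrightarrow> okL H \<and> Hinv (decL H) \<and> okL Q \<and> (\<forall>C\<in>set (decL Q). cyc C) \<and>
     length (decL Q) \<le> card (bits (decL H) (decL Q)) \<and> okL E \<and> Einv (decL H) (decL Q) (decL E)"

text \<open>A bound on the improvements still possible: the sum of squared labels never exceeds the
  squared total cost, and each improvement adds at least
  \<open>5 * \<delta>\<^sup>2\<close>.\<close>

definition pot :: "('v,'e) piece list \<Rightarrow> nat" where
  "pot H = nat \<lfloor>((sum c V)\<^sup>2 - (\<Sum>q\<leftarrow>H. (pl q)\<^sup>2)) / (5 * \<delta>\<^sup>2)\<rfloor>"

text \<open>Encodes the lexicographic order on the potential of \<open>H\<close>, the number of triples missing from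
  \<open>bits H Q\<close>, and the number of pieces in \<open>E\<close>.\<close>

definition msr :: "('v,'e) piece list \<Rightarrow> ('v,'e) piece list \<Rightarrow> ('v,'e) piece list \<Rightarrow> nat" where
  "msr H Q E = (pot H * (card V ^ 3 + 1) + (card V ^ 3 - card (bits H Q))) * (card V + 1) + length E"

lemma sum_squares_le:
  fixes xs :: "real list"
  assumes "\<And>x. x \<in> set xs \<Longrightarrow> 0 \<le> x"
  shows "(\<Sum>x\<leftarrow>xs. x\<^sup>2) \<le> (sum_list xs)\<^sup>2"
  using assms
proof (induction xs)
  case (Cons a xs)
  then have "(\<Sum>x\<leftarrow>xs. x\<^sup>2) \<le> (sum_list xs)\<^sup>2" "0 \<le> a * sum_list xs"
    by (simp, intro mult_nonneg_nonneg sum_list_nonneg) auto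
  then show ?case by (simp add: power2_eq_square algebra_simps)
qed simp

lemma squares_bound:
  assumes "Hinv H"
  shows "(\<Sum>q\<leftarrow>H. (pl q)\<^sup>2) \<le> (sum c V)\<^sup>2"
proof -
  have P: "part (V - VB) H" using assms by (simp add: Hinv_def)
  have pl: "pl q = cX q" if "q \<in> set H" for q using assms that by (simp add: Hinv_def)
  have "(\<Sum>q\<leftarrow>H. (pl q)\<^sup>2) \<le> (\<Sum>q\<leftarrow>H. pl q)\<^sup>2"
  proof -
    have "0 \<le> x" if "x \<in> set (map pl H)" for x using that pl c_sum_nonneg by auto
    from sum_squares_le[of "map pl H", OF this] show ?thesis by (simp add: comp_def)
  qed
  also have "(\<Sum>q\<leftarrow>H. pl q) = (\<Sum>q\<leftarrow>H. cX q)" using pl by (intro arg_cong[of _ _ sum_list] map_cong) auto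
  also have "\<dots> = sum c (V - VB)"
  proof -
    have "finite (pX q)" if "q \<in> set H" for q using part_subset[OF P that] by (rule finite_subset) simp
    then show ?thesis using sum_djl[of H c] P by (simp add: part_def)
  qed
  also have "(sum c (V - VB))\<^sup>2 \<le> (sum c V)\<^sup>2" by (intro power_mono c_sum_mono c_sum_nonneg) auto
  finally show ?thesis .
qed

lemma pot_decreases:
  assumes H': "Hinv H'" and inc: "(\<Sum>q\<leftarrow>H. (pl q)\<^sup>2) + 5 * x\<^sup>2 \<le> (\<Sum>q\<leftarrow>H'. (pl q)\<^sup>2)" and x: "\<delta> \<le> x"
  shows "pot H' < pot H"
proof -
  let ?s = "\<lambda>H. (\<Sum>q\<leftarrow>H. (pl q)\<^sup>2)" let ?S = "(sum c V)\<^sup>2"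
  have d: "0 < 5 * \<delta>\<^sup>2" using \<delta>(1) by simp
  have "\<delta>\<^sup>2 \<le> x\<^sup>2" using \<delta>(1) x by (intro power_mono) auto
  then have "?S - ?s H' + 5 * \<delta>\<^sup>2 \<le> ?S - ?s H" using inc by linarith
  then have "(?S - ?s H' + 5 * \<delta>\<^sup>2) / (5 * \<delta>\<^sup>2) \<le> (?S - ?s H) / (5 * \<delta>\<^sup>2)"
    using d by (intro divide_right_mono) auto
  moreover have "(?S - ?s H' + 5 * \<delta>\<^sup>2) / (5 * \<delta>\<^sup>2) = (?S - ?s H') / (5 * \<delta>\<^sup>2) + 1"
    using d by (simp only: add_divide_distrib) simp
  ultimately have "(?S - ?s H') / (5 * \<delta>\<^sup>2) + 1 \<le> (?S - ?s H) / (5 * \<delta>\<^sup>2)" by simp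
  then have "\<lfloor>(?S - ?s H') / (5 * \<delta>\<^sup>2)\<rfloor> + 1 \<le> \<lfloor>(?S - ?s H) / (5 * \<delta>\<^sup>2)\<rfloor>" by linarith
  moreover have "0 \<le> \<lfloor>(?S - ?s H') / (5 * \<delta>\<^sup>2)\<rfloor>" using squares_bound[OF H'] d by simp
  ultimately show ?thesis unfolding pot_def by linarith
qed

lemma msr_mono:
  fixes p p' b b' n l l' :: nat
  assumes "l' \<le> n" "p' < p \<and> b' \<le> m \<or> p' = p \<and> b' < b"
  shows "(p' * (m + 1) + b') * (n + 1) + l' < (p * (m + 1) + b) * (n + 1) + l"
proof -
  have "p' * (m + 1) + b' < p * (m + 1) + b"
  proof (cases "p' = p")
    case False
    then have "Suc p' \<le> p" "b' \<le> m" using assms(2) by auto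
    then have "Suc p' * (m + 1) \<le> p * (m + 1)" by (intro mult_le_mono1)
    then show ?thesis using \<open>b' \<le> m\<close> by simp
  qed (use assms(2) in auto)
  then have "Suc (p' * (m + 1) + b') * (n + 1) \<le> (p * (m + 1) + b) * (n + 1)" by (intro mult_le_mono1) simp
  then show ?thesis using assms(1) by simp
qed

lemma Bp_H:
  assumes "okL H" "Hinv (decL H)"
  shows "okL (Node Bd H)" "Einv (decL H) Q (decL (Node Bd H))" "length (decL (Node Bd H)) \<le> card V"
proof -
  show e: "Einv (decL H) Q (decL (Node Bd H))" using Einv_init[OF assms(2)] Bd(2) by simp
  then have P: "part V (decL (Node Bd H))" by (simp add: Einv_def)
  then show "length (decL (Node Bd H)) \<le> card V" by (rule part_length) simp
  have "\<forall>q\<in>set (dl (Node Bd H)). okP q" using Bd(1) okL_P[OF assms(1)] by auto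
  then show "okL (Node Bd H)" using P by (rule okL_part)
qed

text \<open>Each way to go on lowers one component of the measure: an improvement lowers
  \<open>pot\<close>, remembering a subtour lowers the number of missing triples, and sealing
  shortens \<open>E\<close>. If the two lists of violations are empty, \<open>quiet\<close> holds
  and \<open>merge_step\<close> applies.\<close>

theorem s_step:
  assumes st: "st_ok H Q E"
  shows "bnd orc N s_step [Node Kc (Node H (Node Q E))] \<and>
    ((\<exists>m M. den orc s_step [Node Kc (Node H (Node Q E))] = Node Leaf m \<and> enc_edges m M \<and> tour (gr I) M \<and>
        wt M \<le> 9 * \<alpha> * sum c V + \<beta> + wt B) \<or>
     (\<exists>H' Q' E'. den orc s_step [Node Kc (Node H (Node Q E))] = Node (Node Leaf Leaf) (Node Kc (Node H' (Node Q' E'))) \<and>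
        st_ok H' Q' E' \<and> msr (decL H') (decL Q') (decL E') < msr (decL H) (decL Q) (decL E)))"
proof -
  let ?s = "Node Kc (Node H (Node Q E))"
  have H: "okL H" "Hinv (decL H)" and Q: "okL Q" "\<And>C. C \<in> set (decL Q) \<Longrightarrow> cyc C"
    "length (decL Q) \<le> card (bits (decL H) (decL Q))" and E: "okL E" "Einv (decL H) (decL Q) (decL E)"
    using st unfolding st_ok_def by blast+
  have PE: "part V (decL E)" using E(2) by (simp add: Einv_def)
  have PH: "part (V - VB) (decL H)" using H(2) by (simp add: Hinv_def)
  have lE: "length (decL E) \<le> card V" by (rule part_length[OF PE]) simp
  obtain Ts L1 Lf where f: "den orc s_front [?s] = Node L1 Lf" "spc_out (decL E) Ts" "okL L1"
    "decL L1 = crossing (decL E) Ts" "okL Lf" "decL Lf = filter free (crossing (decL E) Ts)"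
    "bnd orc N s_front [?s]" using s_front[OF E] .
  note vi = s_viol[OF f(5) H(1)]
  let ?vi = "filter (\<lambda>p. violP (decL H) (decL Lf) (dec p)) (dl H)"
  show ?thesis
  proof (cases ?vi)
    case (Cons j js)
    have "j \<in> set ?vi" unfolding Cons by simp
    then have j: "j \<in> set (dl H)" "violP (decL H) (decL Lf) (dec j)" by auto
    note gr = s_group[OF okL_P[OF H(1) j(1)] f(5) H(1)]
    let ?g = "den orc s_group [Node j (Node Lf H)]"
    have big: "3 * pl (dec j) < (\<Sum>T\<leftarrow>decL ?g. cX T)" using j(2) unfolding violP_def gr(2) .
    have jp: "pl (dec j) = cX (dec j)" "pX (dec j) \<noteq> {}" "pX (dec j) \<subseteq> V - VB"
      using H(2) j(1) part_nonempty[OF PH] part_subset[OF PH] unfolding Hinv_def by auto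
    have ne: "dl ?g \<noteq> []"
    proof
      assume "dl ?g = []"
      then show False using big jp(1) c_sum_nonneg[of "pX (dec j)"] by simp
    qed
    have Tg: "cyc T \<and> grp (decL H) (dec j) T" if "T \<in> set (decL ?g)" for T
      using that crossing_cyc[OF f(2)] unfolding gr(2) f(6) by auto
    have dg: "djl (decL ?g)" unfolding gr(2) f(6) by (rule crossing_djl[OF f(2)])
    let ?H = "den orc s_improve [Node A (Node j (Node H ?g))]"
    have im: "okL ?H" "Hinv (decL ?H)" "(\<Sum>q\<leftarrow>decL H. (pl q)\<^sup>2) + 5 * (pl (dec j))\<^sup>2 \<le> (\<Sum>q\<leftarrow>decL ?H. (pl q)\<^sup>2)"
      "bnd orc N s_improve [Node A (Node j (Node H ?g))]"
      by (rule s_improve[OF H j(1) gr(1) ne Tg dg big], assumption)+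
    have d: "den orc s_step [?s] = Node (Node Leaf Leaf) (Node Kc (Node ?H (Node Leaf (Node Bd ?H))))"
      by (simp add: s_step_def f(1) vi(1) Cons numeral_eq_Suc)
    have b: "bnd orc N s_step [?s]"
      by (simp add: s_step_def f(1,7) vi Cons numeral_eq_Suc gr(3) im(4))
    \<comment> \<open>Each vertex of \<open>j\<close> costs at least \<open>\<delta>\<close>, hence
      so does its label, and the gain in squares is large enough to lower
      \<open>pot\<close>.\<close>
    obtain v where v: "v \<in> pX (dec j)" using jp(2) by blast
    have "\<delta> \<le> c v" using \<delta>(2) v jp(3) by blast
    also have "c v \<le> pl (dec j)" unfolding jp(1) using c_sum_mono[of "{v}" "pX (dec j)"] v
        finite_subset[OF jp(3)] by simp
    finally have "pot (decL ?H) < pot (decL H)" by (rule pot_decreases[OF im(2,3)])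
    then have "msr (decL ?H) (decL Leaf) (decL (Node Bd ?H)) < msr (decL H) (decL Q) (decL E)"
      unfolding msr_def using Bp_H(3)[OF im(1,2)] by (intro msr_mono) auto
    moreover have "st_ok ?H Leaf (Node Bd ?H)"
      using im(1,2) Bp_H[OF im(1,2)] unfolding st_ok_def by (simp add: okL_def[of Leaf])
    ultimately show ?thesis using d b by blast
  next
    case Nil
    note po = s_pool[OF E(1) f(5)]
    let ?po = "filter (\<lambda>T. poolP (decL E) (dec T)) (dl Lf)"
    show ?thesis
    proof (cases ?po)
      case (Cons T Tl)
      have "T \<in> set ?po" unfolding Cons by simp
      then have T: "T \<in> set (dl Lf)" "poolP (decL E) (dec T)" by auto
      then obtain Y where Y: "Y \<in> set (decL E)" "ps Y" "crossP (dec T) Y" "cX (dec T) \<le> 3 * pl Y"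
        unfolding poolP_def by blast
      have cT: "cyc (dec T)" using T(1) crossing_cyc[OF f(2)] f(6)[symmetric] by simp
      have gr: "card (bits (decL H) (decL Q)) < card (bits (decL H) (decL (Node T Q)))"
        using bits_grow[OF E(2) cycD(1)[OF cT] Y] by simp
      have le: "card (bits (decL H) (decL (Node T Q))) \<le> card V ^ 3" by (rule card_bits[OF PH])
      have d: "den orc s_step [?s] = Node (Node Leaf Leaf) (Node Kc (Node H (Node (Node T Q) (Node Bd H))))"
        by (simp add: s_step_def f(1) vi(1) Nil po(1) Cons numeral_eq_Suc)
      have b: "bnd orc N s_step [?s]"
        by (simp add: s_step_def f(1,7) vi Nil po Cons numeral_eq_Suc)
      \<comment> \<open>The list grows by one element and the set of triples by at least one, so the
        inequality in \<open>st_ok\<close> survives.\<close>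
      have len: "length (decL (Node T Q)) \<le> card (bits (decL H) (decL (Node T Q)))" using gr Q(3) by simp
      then have "okL (Node T Q)"
        using okL_P[OF f(5) T(1)] okL_P[OF Q(1)] le N3 by (auto simp: okL_def)
      then have "st_ok H (Node T Q) (Node Bd H)"
        using H len Q(2) cT Bp_H[OF H] unfolding st_ok_def by simp
      moreover have "msr (decL H) (decL (Node T Q)) (decL (Node Bd H)) < msr (decL H) (decL Q) (decL E)"
        unfolding msr_def using Bp_H(3)[OF H] gr le by (intro msr_mono) auto
      ultimately show ?thesis using d b by blast
    next
      case Nil2: Nil
      have qt: "quiet (decL H) (decL E) (filter free (crossing (decL E) Ts))"
        unfolding f(6)[symmetric] quiet_def
      proof (intro conjI ballI impI)
        fix p assume p: "p \<in> set (decL H)"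
        then obtain d where d: "d \<in> set (dl H)" "p = dec d" by auto
        then have "\<not> violP (decL H) (decL Lf) (dec d)" using Nil by (auto simp: filter_empty_conv)
        then show *: "(\<Sum>T\<leftarrow>filter (grp (decL H) p) (decL Lf). cX T) \<le> 3 * pl p"
          unfolding violP_def d(2) by simp
        fix T assume T: "T \<in> set (decL Lf)" "grp (decL H) p T"
        have "cX T \<in> set (map cX (filter (grp (decL H) p) (decL Lf)))" using T by auto
        then have "cX T \<le> (\<Sum>T\<leftarrow>filter (grp (decL H) p) (decL Lf). cX T)"
          by (rule member_le_sum_list) (auto intro: c_sum_nonneg)
        then show "cX T \<le> 3 * pl p" using * by simp
      next
        fix T Y assume T: "T \<in> set (decL Lf)" "Y \<in> set (decL E)" "ps Y \<and> crossP T Y"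
        then obtain d where d: "d \<in> set (dl Lf)" "T = dec d" by auto
        then have "\<not> poolP (decL E) T" using Nil2 by (auto simp: filter_empty_conv)
        then show "3 * pl Y < cX T" using T(2,3) unfolding poolP_def by force
      qed
      have Tne: "pX T \<noteq> {}" if "T \<in> set (decL L1)" for T
        using that f(2) part_nonempty[of V Ts] unfolding f(4) crossing_def spc_out_def by auto
      let ?Da = "den orc s_mergeD [Node A (Node L1 E)]"
      have mD: "okL ?Da" "decL ?Da = foldr absorb (decL L1) (decL E)" "part V (foldr absorb (decL L1) (decL E))"
        "bnd orc N s_mergeD [Node A (Node L1 E)]"
        by (rule s_mergeD[OF E(1) PE f(3) Tne], assumption)+
      have pD: "part V (decL ?Da)" unfolding mD(2) by (rule mD(3))
      let ?D = "den orc s_loop [Node A (Node Q (Node ?Da Vs))]"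
      have lp: "okL ?D" "decL ?D = (xstep (decL Q) ^^ length (dl Vs)) (decL ?Da)"
        "bnd orc N s_loop [Node A (Node Q (Node ?Da Vs))]"
        by (rule s_loop[OF mD(1) pD Q(1,2) length_Vs(2)], assumption)+
      have Deq: "decL ?D = (xstep (decL Q) ^^ card V) (foldr absorb (crossing (decL E) Ts) (decL E))"
        unfolding lp(2) mD(2) length_Vs(1) f(4) ..
      note ms = merge_step[OF H(2) E(2) Q(2) f(2) qt lE, folded Deq]
      have Dne: "dl ?D \<noteq> []"
      proof -
        note bm = bounded_merged[OF H(2) E(2) f(2) qt]
        have "Dinv (decL E) (crossing (decL E) Ts) (decL ?D)"
          unfolding Deq by (rule xloop_inv(1)[OF bm(1) H(2) E(2) Q(2) bm(2) order_trans[OF bm(3) lE]])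
        then have "part V (decL ?D)" by (simp add: Dinv_def)
        then show ?thesis using part_ne by fastforce
      qed
      note g = s_min[OF lp(1) Dne]
      let ?g = "den orc s_min [?D]"
      have one: "apply1 IsNode (apply1 Right ?D) \<noteq> Leaf \<longleftrightarrow> length (decL ?D) \<noteq> 1"
      proof -
        obtain x y where xy: "?D = Node x y" using Dne by (cases ?D) auto
        show ?thesis unfolding xy by (cases y) auto
      qed
      have e: "den orc s_step [?s] = (if apply1 IsNode (apply1 Right ?D) \<noteq> Leaf
          then Node (Node Leaf Leaf) (Node Kc (Node H (Node Q (den orc s_commit [Node ?g E]))))
          else Node Leaf (apply1 Left (apply1 Right ?g)))"
        by (simp add: s_step_def f(1) vi(1) Nil po(1) Nil2 numeral_eq_Suc)
      note co = s_commit[OF g(1) E(1)]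
      have b: "bnd orc N s_step [?s]"
        by (simp add: s_step_def f(1,7) vi Nil po Nil2 numeral_eq_Suc mD(4) lp(3) g(3) co(3))
      show ?thesis
      proof (cases "length (decL ?D) = 1")
        case True
        have t: "tour (gr I) (pM (dec ?g)) \<and> wt (pM (dec ?g)) \<le> (3 + 3 + 3) * \<alpha> * sum c V + \<beta> + wt B"
          unfolding g(2) by (rule ms(1)[OF _ True])
        have "enc_edges (apply1 Left (apply1 Right ?g)) (pM (dec ?g))"
          unfolding okP_X(6)[OF g(1)] by (rule okM_D(1)[OF okP_X(5)[OF g(1)]])
        then show ?thesis using e one True t b by auto
      next
        case False
        let ?E = "den orc s_commit [Node ?g E]"
        have dE: "decL ?E = seal (minp (decL ?D)) # filter (\<lambda>Y. \<not> touch (minp (decL ?D)) Y) (decL E)"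
          unfolding co(2) g(2) ..
        have ei: "Einv (decL H) (decL Q) (decL ?E)" "length (decL ?E) < length (decL E)"
          using ms(2)[OF _ False] unfolding dE by blast+
        have "part V (decL ?E)" using ei(1) by (simp add: Einv_def)
        then have "okL ?E" by (rule okL_part[OF co(1)])
        then have "st_ok H Q ?E" using H Q ei(1) unfolding st_ok_def by blast
        moreover have "msr (decL H) (decL Q) (decL ?E) < msr (decL H) (decL Q) (decL E)"
          unfolding msr_def using ei(2) by simp
        moreover have "den orc s_step [?s] = Node (Node Leaf Leaf) (Node Kc (Node H (Node Q ?E)))"
          unfolding e using one False by simp
        ultimately show ?thesis using b by blast
      qed
    qed
  qed
qed

end

subsection \<open>The initial state\<close>

text \<open>Assign to a set one of its elements and its size. Laminar sets sharing an element are
  nested, and nested sets of equal size coincide, so the assignment is injective.\<close>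

lemma laminar_card:
  assumes L: "laminar L" and V: "finite V" and sub: "\<And>S. S \<in> L \<Longrightarrow> S \<subseteq> V \<and> S \<noteq> {}"
  shows "card L \<le> card V ^ 2"
proof -
  have fin: "finite L" using V sub by (auto intro: finite_subset[of L "Pow V"])
  define u where "u S = (SOME v. v \<in> S)" for S :: "'a set"
  have u: "u S \<in> S" if "S \<in> L" for S using sub[OF that] by (auto simp: u_def intro: someI)
  have "inj_on (\<lambda>S. (u S, card S)) L"
  proof (rule inj_onI)
    fix S T assume *: "S \<in> L" "T \<in> L" "(u S, card S) = (u T, card T)"
    then have "u S \<in> S \<inter> T" using u[of S] u[of T] by simp
    then have "S \<subseteq> T \<or> T \<subseteq> S" using L * unfolding laminar_def by blast
    then show "S = T" using * sub V by (metis card_subset_eq finite_subset prod.inject)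
  qed
  moreover have "(\<lambda>S. (u S, card S)) ` L \<subseteq> V \<times> {1..card V}"
  proof (clarsimp)
    fix S assume S: "S \<in> L"
    then have "finite S" using sub V finite_subset by blast
    then show "u S \<in> V \<and> Suc 0 \<le> card S \<and> card S \<le> card V"
      using S sub[OF S] u[OF S] V by (auto simp: Suc_le_eq card_gt_0_iff intro: card_mono)
  qed
  ultimately have "card L \<le> card (V \<times> {1..card V})" using V by (intro card_inj_on_le) auto
  then show ?thesis by (simp add: card_cartesian_product power2_eq_square)
qed

text \<open>At most \<open>card (verts (gr I))\<close> vertices lie outside \<open>V(B)\<close>, so
  adding the shift to each of them raises the total cost from \<open>lb_compl I B\<close> to at most
  \<open>1 + \<epsilon>\<close> times that value.\<close>

definition shift :: "('v,'e) inst \<Rightarrow> 'e multiset \<Rightarrow> real \<Rightarrow> real" where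
  "shift I B \<epsilon> = \<epsilon> * lb_compl I B / card (verts (gr I))"

text \<open>Making all costs positive guarantees that every improvement has a minimum size.\<close>

definition cost :: "('v,'e) inst \<Rightarrow> 'e multiset \<Rightarrow> real \<Rightarrow> 'v \<Rightarrow> real" where
  "cost I B \<epsilon> v = (if v \<in> mverts (gr I) B then 0 else if lb_compl I B \<le> 0 then 1
     else lb_vert I v + shift I B \<epsilon>)"

locale init_setting = data_setting "gr I" "cost I B \<epsilon>" N orc A
  for I :: "('v,'e) inst" and B \<epsilon> N orc A +
  fixes dV dL dB da :: "('v,'e) data"
  assumes dV: "enc_vset dV (verts (gr I))" and dL: "enc_fam dL I" "finite (fam I)" "card (fam I) \<le> N"
    and dB: "enc_edges dB B" "set_mset B \<subseteq> arcs (gr I)" and VB: "mverts (gr I) B \<subseteq> verts (gr I)"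
begin

definition s_inB :: lx where
  "s_inB = xEx (Pr (Lf A0) (Lf (Rt A0))) (Rt (Rt A0))
     (VS (Pr (Pr (Lf (Rt A0)) VE) (VS (Pr (Lf (Lf A0)) (Rt (Rt A0))) s_ends)) s_mem)"

lemma wf_s_inB [simp]: "wfx (Suc 0) s_inB" by (simp add: s_inB_def)

lemma dB_len: "length (dl dB) \<le> N" and okM_dB: "okM dB" "decM dB = B"
  using okM_I[OF dB] okM_D(3) by auto

lemma s_inB:
  "den orc s_inB [Node (Vtx v) (Node A dB)] = truth (v \<in> mverts (gr I) B)"
  "bnd orc N s_inB [Node (Vtx v) (Node A dB)]"
proof -
  obtain es where es: "set es = set_mset B" "dB = list_data (map (\<lambda>e. Node (Edg e) (Num (of_nat (count B e)))) es)"
    using dB(1) by (auto simp: enc_edges_def)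
  let ?E = "\<lambda>e. Node (Node (Vtx (tail (gr I) e)) Leaf) (Node (Node (Vtx (head (gr I) e)) Leaf) Leaf) :: ('v,'e) data"
  have arc: "e \<in> arcs (gr I)" if "e \<in> set es" for e using that dB(2) es(1) by auto
  have W: "okW (?E e)" "vX (?E e) = {tail (gr I) e, head (gr I) e}" for e
    by (auto simp: okW_def vX_def)
  have m: "den orc s_mem [Node (Node (Vtx v) Leaf) (?E e)] = truth (v \<in> {tail (gr I) e, head (gr I) e})" for e
    using den_s_mem[OF W(1)] unfolding W(2) .
  show "den orc s_inB [Node (Vtx v) (Node A dB)] = truth (v \<in> mverts (gr I) B)"
    using s_ends(1)[OF arc] by (auto simp: s_inB_def es(2) m mverts_def es(1)[symmetric] intro!: arg_cong[of _ _ truth])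
  have "bnd orc N s_mem [Node x (?E e)]" for x e using N2 by (intro bnd_s_mem) simp
  then show "bnd orc N s_inB [Node (Vtx v) (Node A dB)]"
    using s_ends[OF arc] dB_len by (simp add: s_inB_def es(2))
qed

text \<open>A set of the family is \<open>{v}\<close> if its list starts with \<open>v\<close> and
  has no second entry. The value is added to itself for the factor 2 in
  \<open>lb_vert\<close>.\<close>

definition s_lbv :: lx where
  "s_lbv = xSum (Lf A0) (Rt A0)
     (VC (xAnd (V2 Same (Lf (Lf (Lf A0))) (Rt A0)) (xNot (V1 IsNode (Rt (Lf (Lf A0))))))
       (V2 Add (Rt (Lf A0)) (Rt (Lf A0))) (VL 0))"

lemma wf_s_lbv [simp]: "wfx (Suc 0) s_lbv" by (simp add: s_lbv_def)

lemma s_lbv: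
  "den orc s_lbv [Node (Vtx v) dL] = Num (lb_vert I v)"
  "bnd orc N s_lbv [Node (Vtx v) dL]"
proof -
  obtain Ss ds where S: "distinct Ss" "set Ss = fam I" "list_all2 enc_vset ds Ss"
     "dL = list_data (map2 (\<lambda>dS S. Node dS (Num (yval I S))) ds Ss)"
    using dL(1) by (auto simp: enc_fam_def)
  define g where "g = (\<lambda>x :: ('v,'e) data. if apply1 Left (apply1 Left x) = Vtx v \<and> apply1 IsNode (apply1 Right (apply1 Left x)) = Leaf
     then 2 * num (apply1 Right x) else 0)"
  have sing: "apply1 Left d = Vtx v \<and> apply1 IsNode (apply1 Right d) = Leaf \<longleftrightarrow> T = {v}"
    if e: "enc_vset d T" for d :: "('v,'e) data" and T
  proof -
    obtain us where us: "distinct us" "set us = T" "d = list_data (map Vtx us)" using e by (auto simp: enc_vset_def)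
    show ?thesis
    proof (cases us)
      case Nil then show ?thesis using us by auto
    next
      case (Cons a us')
      then show ?thesis using us by (cases us') auto
    qed
  qed
  have same: "apply2 Same d (Vtx v) = truth (d = Vtx v)" for d :: "('v,'e) data" by (cases d) auto
  have "den orc s_lbv [Node (Vtx v) dL] = Num (\<Sum>x\<leftarrow>dl (den orc (Rt A0) [Node (Vtx v) dL]). g x)"
    unfolding s_lbv_def
  proof (rule den_xSum)
    fix x assume "x \<in> set (dl (den orc (Rt A0) [Node (Vtx v) dL]))"
    then obtain d T where x: "x = Node d (Num (yval I T))" by (auto simp: S(4))
    show "den orc (VC (xAnd (V2 Same (Lf (Lf (Lf A0))) (Rt A0)) (xNot (V1 IsNode (Rt (Lf (Lf A0))))))
       (V2 Add (Rt (Lf A0)) (Rt (Lf A0))) (VL 0)) [Node x (den orc (Lf A0) [Node (Vtx v) dL])] = Num (g x)"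
      by (simp add: x g_def same)
  qed
  also have "(\<Sum>x\<leftarrow>dl (den orc (Rt A0) [Node (Vtx v) dL]). g x) = (\<Sum>x\<leftarrow>zip ds Ss. g (case x of (d, T) \<Rightarrow> Node d (Num (yval I T))))"
    by (simp add: S(4) comp_def)
  also have "\<dots> = (\<Sum>T\<leftarrow>Ss. if T = {v} then 2 * yval I T else 0)"
    using S(3) by (induction rule: list_all2_induct) (auto simp: g_def sing)
  also have "\<dots> = (\<Sum>T\<in>fam I. if T = {v} then 2 * yval I T else 0)"
    using sum_list_distinct_conv_sum_set[OF S(1)] S(2) by simp
  also have "\<dots> = lb_vert I v" using dL(2) by (simp add: lb_vert_def sum.delta)
  finally show "den orc s_lbv [Node (Vtx v) dL] = Num (lb_vert I v)" .
  have "length (dl dL) \<le> N"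
    using distinct_card[OF S(1)] S(2) dL(3) list_all2_lengthD[OF S(3)] by (simp add: S(4))
  then show "bnd orc N s_lbv [Node (Vtx v) dL]" by (simp add: s_lbv_def)
qed

text \<open>The shift needs the total lower bound before any cost is known, so the vertices are
  traversed once for the total and again for the costs. The number of vertices is a sum of
  ones.\<close>

definition s_costs :: lx where
  "s_costs = VLet (xSum (Lf (Rt (Rt A0))) (xFil (Pr (Lf (Rt A0)) (Lf (Rt (Rt (Rt A0))))) (Lf A0) (xNot s_inB)) s_lbv)
     (VLet (V2 Div (V2 Mul (Rt (Rt (Rt (Rt (VA 1))))) (VA 0)) (xSum VE (Lf (VA 1)) (VL 1)))
       (xMap (Pr (Pr (Lf (Rt (VA 2))) (Lf (Rt (Rt (Rt (VA 2)))))) (Pr (Lf (Rt (Rt (VA 2)))) (Pr (VA 1) (VA 0)))) (Lf (VA 2))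
         (Pr (Lf A0) (VC (VS (Pr (Lf A0) (Lf (Rt A0))) s_inB) (VL 0)
            (VC (V2 Leq (Lf (Rt (Rt (Rt A0)))) (VL 0)) (VL 1)
               (V2 Add (VS (Pr (Lf A0) (Lf (Rt (Rt A0)))) s_lbv) (Rt (Rt (Rt (Rt A0))))))))))"

lemma wf_s_costs [simp]: "wfx (Suc 0) s_costs" by (simp add: s_costs_def)

lemma s_costs:
  defines "Vs \<equiv> den orc s_costs [Node dV (Node A (Node dL (Node dB (Num \<epsilon>))))]"
  shows "okX Vs" "vX Vs = verts (gr I)" "bnd orc N s_costs [Node dV (Node A (Node dL (Node dB (Num \<epsilon>))))]"
proof -
  let ?st = "Node dV (Node A (Node dL (Node dB (Num \<epsilon>))))"
  obtain us where us: "distinct us" "set us = verts (gr I)" "dV = list_data (map Vtx us)"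
    using dV by (auto simp: enc_vset_def)
  let ?L = "xFil (Pr (Lf (Rt A0)) (Lf (Rt (Rt (Rt A0))))) (Lf A0) (xNot s_inB)"
  let ?vs = "filter (\<lambda>v. v \<notin> mverts (gr I) B) us"
  have L: "den orc ?L [?st] = list_data (map Vtx ?vs)"
    by (simp add: us(3) s_inB filter_map comp_def)
  have n: "den orc (xSum VE (Lf (VA 1)) (VL 1)) [l, ?st] = Num (card (verts (gr I)))" for l
  proof -
    have "den orc (xSum VE (Lf (VA 1)) (VL 1)) [l, ?st] = Num (\<Sum>x\<leftarrow>dl (den orc (Lf (VA 1)) [l, ?st]). 1)"
      by (rule den_xSum) simp
    then show ?thesis using distinct_card[OF us(1)] us(2) by (simp add: us(3) comp_def sum_list_triv)
  qed
  have lb: "den orc (xSum (Lf (Rt (Rt A0))) ?L s_lbv) [?st] = Num (lb_compl I B)"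
  proof -
    have "den orc (xSum (Lf (Rt (Rt A0))) ?L s_lbv) [?st] =
      Num (\<Sum>x\<leftarrow>dl (den orc ?L [?st]). case x of Vtx v \<Rightarrow> lb_vert I v | _ \<Rightarrow> 0)"
      by (rule den_xSum) (unfold L, auto simp: s_lbv(1))
    also have "(\<Sum>x\<leftarrow>dl (den orc ?L [?st]). case x of Vtx v \<Rightarrow> lb_vert I v | _ \<Rightarrow> 0) = (\<Sum>v\<leftarrow>?vs. lb_vert I v)"
      unfolding L by (simp add: comp_def)
    also have "\<dots> = (\<Sum>v\<in>set ?vs. lb_vert I v)"
      by (rule sum_list_distinct_conv_sum_set) (simp add: us(1))
    also have "set ?vs = verts (gr I) - mverts (gr I) B" using us(2) by auto
    finally show ?thesis by (simp add: lb_compl_def lb_def)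
  qed
  have e: "Vs = list_data (map (\<lambda>v. Node (Vtx v) (Num (cost I B \<epsilon> v))) us)"
    unfolding Vs_def s_costs_def den.simps lb
    by (simp only: n nth_Cons_0)
      (simp add: us(3) comp_def s_inB s_lbv cost_def shift_def numeral_2_eq_2 if_distrib[of Num] cong: if_cong)
  show "okX Vs" unfolding okX_def using us e by blast
  show "vX Vs = verts (gr I)" using us(2) by (auto simp: e vX_def)
  have "length us \<le> N" using distinct_card[OF us(1)] us(2) NV by simp
  moreover have "length ?vs \<le> N" by (rule order_trans[OF length_filter_le]) fact
  ultimately show "bnd orc N s_costs [?st]"
    by (auto simp: s_costs_def us(3) filter_map comp_def s_inB s_lbv numeral_2_eq_2)
qed

definition s_init :: lx where
  "s_init = VLet (VS (Pr (Lf (Lf A0)) (Pr (Rt (Lf A0)) (Pr (Lf (Rt A0)) (Pr (Lf (Rt (Rt A0))) (Lf (Rt (Rt (Rt (Rt A0))))))))) s_costs)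
     (VLet (Pr (Rt (Lf (VA 1))) (Lf (Rt (Rt (VA 1)))))
       (VLet (Pr (xFil (VA 0) (VA 1) (VS (Pr (Lf (Lf A0)) (Rt A0)) s_inB))
          (Pr (Rt (VA 0)) (Pr (V2 Add (VS (VA 1) s_csum) (VL 1)) VE)))
         (VLet (VS (xFil (VA 1) (VA 2) (xNot (VS (Pr (Lf (Lf A0)) (Rt A0)) s_inB))) s_singles)
            (Pr (Pr (VA 3) (Pr (Lf (VA 2)) (VA 1))) (Pr (VA 0) (Pr VE (Pr (VA 1) (VA 0))))))))"

lemma wf_s_init [simp]: "wfx (Suc 0) s_init" by (simp add: s_init_def)

lemma okX_filter:
  assumes "okX xs" "\<And>v k. P (Node (Vtx v) k) \<longleftrightarrow> p v"
  shows "okX (list_data (filter P (dl xs)))" "vX (list_data (filter P (dl xs))) = {v \<in> vX xs. p v}"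
proof -
  obtain us where us: "distinct us" "set us \<subseteq> verts (gr I)" "xs = list_data (map (\<lambda>v. Node (Vtx v) (Num (cost I B \<epsilon> v))) us)"
    using assms(1) by (auto simp: okX_def)
  have "list_data (filter P (dl xs)) = list_data (map (\<lambda>v. Node (Vtx v) (Num (cost I B \<epsilon> v))) (filter p us))"
    by (simp add: us(3) filter_map comp_def assms(2))
  then show "okX (list_data (filter P (dl xs)))"
    unfolding okX_def using us by (intro exI[of _ "filter p us"]) auto
  show "vX (list_data (filter P (dl xs))) = {v \<in> vX xs. p v}" by (auto simp: vX_def assms(2))
qed

lemma s_init:
  obtains Vs Bd H us where
    "den orc s_init [list_data [Node dV A, dL, dB, da, Num \<epsilon>]] = Node (Node Vs (Node A Bd)) (Node H (Node Leaf (Node Bd H)))"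
    "okX Vs" "vX Vs = verts (gr I)" "okP Bd"
    "dec Bd = Piece (mverts (gr I) B) B (sum (cost I B \<epsilon>) (verts (gr I)) + 1) False"
    "distinct us" "set us = verts (gr I) - mverts (gr I) B" "okL H" "decL H = singles (cost I B \<epsilon>) us"
    "bnd orc N s_init [list_data [Node dV A, dL, dB, da, Num \<epsilon>]]"
proof -
  let ?Vs = "den orc s_costs [Node dV (Node A (Node dL (Node dB (Num \<epsilon>))))]"
  let ?in = "\<lambda>x. den orc s_inB [Node (apply1 Left x) (Node A dB)]"
  let ?Xb = "list_data (filter (\<lambda>x. ?in x \<noteq> Leaf) (dl ?Vs))"
  let ?Xf = "list_data (filter (\<lambda>x. ?in x = Leaf) (dl ?Vs))"
  let ?Bd = "Node ?Xb (Node dB (Node (Num (sum (cost I B \<epsilon>) (verts (gr I)) + 1)) Leaf))"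
  let ?H = "den orc s_singles [?Xf]"
  note co = s_costs
  have b: "okX ?Xb" "vX ?Xb = mverts (gr I) B"
    using okX_filter[OF co(1), of "\<lambda>x. ?in x \<noteq> Leaf" "\<lambda>v. v \<in> mverts (gr I) B"] VB
    by (auto simp: s_inB(1) co(2))
  have f: "okX ?Xf" "vX ?Xf = verts (gr I) - mverts (gr I) B"
    using okX_filter[OF co(1), of "\<lambda>x. ?in x = Leaf" "\<lambda>v. v \<notin> mverts (gr I) B"]
    by (auto simp: s_inB(1) co(2))
  obtain us where us: "distinct us" "set us = vX ?Xf" "decL ?H = singles (cost I B \<epsilon>) us" "okL ?H"
    "bnd orc N s_singles [?Xf]" using s_singles[OF f(1)] .
  have W: "\<forall>x\<in>set (dl ?Vs). \<exists>v k. x = Node (Vtx v) k" using okX_D(1)[OF co(1)] by (simp add: okW_def)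
  have d: "den orc s_init [list_data [Node dV A, dL, dB, da, Num \<epsilon>]] = Node (Node ?Vs (Node A ?Bd)) (Node ?H (Node Leaf (Node ?Bd ?H)))"
    by (simp add: s_init_def numeral_eq_Suc s_csum(1)[OF co(1), unfolded co(2)])
  have bi: "bnd orc N s_inB [Node (apply1 Left x) (Node A dB)]" if "x \<in> set (dl ?Vs)" for x
    using W that s_inB(2) by fastforce
  have bb: "bnd orc N s_init [list_data [Node dV A, dL, dB, da, Num \<epsilon>]]"
    using us(5) okX_D(2)[OF co(1)] by (simp add: s_init_def numeral_eq_Suc co(3) s_csum(2)[OF co(1)] bi)
  have P: "okP ?Bd" using b(1) okM_dB(1) by (auto simp: okP_def)
  have D: "dec ?Bd = Piece (mverts (gr I) B) B (sum (cost I B \<epsilon>) (verts (gr I)) + 1) False"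
    by (simp add: dec_def b(2) okM_dB(2))
  show ?thesis using that[OF d co(1,2) P D us(1) _ us(4,3) bb] us(2) f(2) by simp
qed

end

subsection \<open>The complete program\<close>

text \<open>The definitions of \<open>s_step\<close> and \<open>s_init\<close> mention no parameter
  of their locales, so each is one program for all instances. Addresses 0 and 1 are reserved for the
  two functions at the front of \<open>prog\<close>.\<close>

abbreviation "step_code \<equiv> compile run_setting.s_step 2"
abbreviation "init_code \<equiv> compile init_setting.s_init (2 + length (snd step_code))"

text \<open>Function 1 performs a step and calls itself as long as the step returns a nonempty tag.
  This is the only recursion that is not a fold, so it alone needs a termination measure.\<close>

definition prog :: "expr list" where
  "prog = [Call 1 (fst init_code),
     LetIn (fst step_code) (Cond (Op1 Left (Arg 0)) (Call 1 (Op1 Right (Arg 0))) (Op1 Right (Arg 0)))]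
     @ snd step_code @ snd init_code"

lemma prog_nth: "2 \<le> length prog" "prog ! 0 = Call 1 (fst init_code)"
  "prog ! 1 = LetIn (fst step_code) (Cond (Op1 Left (Arg 0)) (Call 1 (Op1 Right (Arg 0))) (Op1 Right (Arg 0)))"
  by (simp_all add: prog_def)

lemma prog_code: "has_code prog 2 (snd step_code)" "has_code prog (2 + length (snd step_code)) (snd init_code)"
proof -
  have "has_code prog 2 (snd step_code @ snd init_code)"
    unfolding has_code_def prog_def by (intro exI[of _ "[_, _]"] exI[of _ "[]"]) simp
  then show "has_code prog 2 (snd step_code)" "has_code prog (2 + length (snd step_code)) (snd init_code)"
    by (simp_all add: has_code_append)
qed

section \<open>Running time of the outer loop\<close>

context run_setting begin

text \<open>The summand 7 is what an iteration spends, apart from the step itself, on testing the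
  tag and calling the loop again.\<close>

lemma loop_run:
  assumes "st_ok H Q E" "msr (decL H) (decL Q) (decL E) < m"
  shows "\<exists>out t F. eval prog orc [Node Kc (Node H (Node Q E))] (prog ! 1) out t \<and> enc_edges out F \<and> tour (gr I) F \<and>
    weight I F \<le> 9 * \<alpha> * sum c V + \<beta> + weight I B \<and> t \<le> m * (tb N s_step + 7)"
  using assms
proof (induction m arbitrary: H Q E)
  case (Suc m)
  let ?st = "Node Kc (Node H (Node Q E))"
  note s = s_step[OF Suc.prems(1)]
  obtain t1 where t1: "t1 \<le> tb N s_step" "eval prog orc [?st] (fst step_code) (den orc s_step [?st]) t1"
    using compile_correct[OF prod.collapse[symmetric] prog_code(1), of "[?st]" orc N "[]"] s by auto
  let ?v = "den orc s_step [?st]"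
  have v: "eval prog orc [?v, ?st] (Arg 0) ?v 1" using eval.Arg[of 0 "[?v, ?st]" prog orc] by simp
  note l = eval.Op1[OF v, of Left] and r = eval.Op1[OF v, of Right]
  consider m' M where "?v = Node Leaf m'" "enc_edges m' M" "tour (gr I) M" "wt M \<le> 9 * \<alpha> * sum c V + \<beta> + wt B"
    | H' Q' E' where "?v = Node (Node Leaf Leaf) (Node Kc (Node H' (Node Q' E')))" "st_ok H' Q' E'"
      "msr (decL H') (decL Q') (decL E') < msr (decL H) (decL Q) (decL E)"
    using s by blast
  then show ?case
  proof cases
    case 1
    have "eval prog orc [?v, ?st] (Cond (Op1 Left (Arg 0)) (Call 1 (Op1 Right (Arg 0))) (Op1 Right (Arg 0))) m' (1 + 1 + (1 + 1) + 1)"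
      by (rule eval.CondF) (use l r 1(1) in auto)
    from eval.LetIn[OF t1(2) this] have "eval prog orc [?st] (prog ! 1) m' (t1 + (1 + 1 + (1 + 1) + 1) + 1)"
      unfolding prog_nth .
    moreover have "t1 + (1 + 1 + (1 + 1) + 1) + 1 \<le> Suc m * (tb N s_step + 7)" using t1(1) by simp
    ultimately show ?thesis using 1 unfolding wt_weight by blast
  next
    case 2
    let ?n = "Node Kc (Node H' (Node Q' E'))"
    obtain out t F where t: "eval prog orc [?n] (prog ! 1) out t" "enc_edges out F" "tour (gr I) F"
      "weight I F \<le> 9 * \<alpha> * sum c V + \<beta> + weight I B" "t \<le> m * (tb N s_step + 7)"
      using Suc.IH[OF 2(2)] 2(3) Suc.prems(2) by force
    have "eval prog orc [?v, ?st] (Op1 Right (Arg 0)) ?n (1 + 1)" using r 2(1) by simp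
    from eval.Call[OF this _ t(1)] have c: "eval prog orc [?v, ?st] (Call 1 (Op1 Right (Arg 0))) out (1 + 1 + t + 1)"
      using prog_nth(1) by simp
    have "eval prog orc [?v, ?st] (Cond (Op1 Left (Arg 0)) (Call 1 (Op1 Right (Arg 0))) (Op1 Right (Arg 0))) out (1 + 1 + (1 + 1 + t + 1) + 1)"
      by (rule eval.CondT[OF l _ c]) (simp add: 2(1))
    from eval.LetIn[OF t1(2) this] have "eval prog orc [?st] (prog ! 1) out (t1 + (1 + 1 + (1 + 1 + t + 1) + 1) + 1)"
      unfolding prog_nth .
    moreover have "t1 + (1 + 1 + (1 + 1 + t + 1) + 1) + 1 \<le> Suc m * (tb N s_step + 7)" using t1(1) t(5) by simp
    ultimately show ?thesis using t(2-4) by blast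
  qed
qed simp

lemma Hinv_singles:
  assumes "distinct us" "set us = V - VB"
  shows "Hinv (singles c us)"
  using part_singles[OF assms(1), of c] assms(2) params
  by (auto simp: Hinv_def singles_def lconn_single eulerian_def wt_def intro!: mult_nonneg_nonneg c_nonneg)

text \<open>The bound on \<open>sum c V\<close> makes \<open>\<delta>\<close> cancel:
  \<open>pot\<close> is at most
  \<open>(2 * X\<^sup>2 * \<delta>)\<^sup>2 / (5 * \<delta>\<^sup>2)\<close>, of degree 4 in
  \<open>X\<close>. The triples contribute degree 3 and the pieces degree 1, together 8.\<close>

lemma msr_init:
  assumes H: "Hinv (decL H)" and E: "length E \<le> card V" and X: "real (card V) \<le> X" "1 \<le> X" "sum c V \<le> 2 * X\<^sup>2 * \<delta>"
  shows "real (msr (decL H) Q E + 1) \<le> 20 * X ^ 8"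
proof -
  have s: "0 \<le> sum c V" by (rule c_sum_nonneg)
  have "(\<Sum>q\<leftarrow>decL H. (pl q)\<^sup>2) \<ge> 0" by (intro sum_list_nonneg) auto
  then have "((sum c V)\<^sup>2 - (\<Sum>q\<leftarrow>decL H. (pl q)\<^sup>2)) / (5 * \<delta>\<^sup>2) \<le> (2 * X\<^sup>2 * \<delta>)\<^sup>2 / (5 * \<delta>\<^sup>2)"
    using power_mono[OF X(3) s, of 2] by (intro divide_right_mono) auto
  also have "\<dots> = 4 / 5 * X ^ 4" using \<delta>(1) by (simp add: power_mult_distrib field_simps)
  also have "\<dots> \<le> 4 * X ^ 4" using X(2) by simp
  finally have "real (pot (decL H)) \<le> 4 * X ^ 4"
    using squares_bound[OF H] \<delta>(1) unfolding pot_def by (simp add: of_nat_nat)  (smt (verit) of_int_floor_le)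
  then have p: "real (pot (decL H)) \<le> 4 * X ^ 4" .
  have n3: "real (card V ^ 3) \<le> X ^ 3" using power_mono[OF X(1), of 3] by simp
  have X3: "1 \<le> X ^ 3" and X4: "1 \<le> X ^ 4" "1 \<le> X ^ 7" using X(2) by (simp_all add: one_le_power)
  have "real (pot (decL H) * (card V ^ 3 + 1)) \<le> 4 * X ^ 4 * (2 * X ^ 3)"
    unfolding of_nat_mult using p n3 X3 by (intro mult_mono) auto
  moreover have "real (card V ^ 3 - card (bits (decL H) Q)) \<le> X ^ 7"
  proof -
    have "X ^ 3 \<le> X ^ 7" using X(2) by (intro power_increasing) auto
    then show ?thesis using n3 by (smt (verit) of_nat_mono diff_le_self)
  qed
  ultimately have a: "real (pot (decL H) * (card V ^ 3 + 1) + (card V ^ 3 - card (bits (decL H) Q))) \<le> 9 * X ^ 7"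
    by (simp add: power_add[symmetric])
  have "real ((pot (decL H) * (card V ^ 3 + 1) + (card V ^ 3 - card (bits (decL H) Q))) * (card V + 1)) \<le> 9 * X ^ 7 * (2 * X)"
    unfolding of_nat_mult[of _ "card V + 1"] using a X by (intro mult_mono) auto
  also have "9 * X ^ 7 * (2 * X) = 18 * X ^ 8" by (simp add: power_Suc2[symmetric] del: power_Suc2 power_Suc)
  finally have b: "real ((pot (decL H) * (card V ^ 3 + 1) + (card V ^ 3 - card (bits (decL H) Q))) * (card V + 1)) \<le> 18 * X ^ 8" .
  have "X ^ 1 \<le> X ^ 8" "1 \<le> X ^ 8" using X(2) by (intro power_increasing one_le_power; simp)+
  moreover have "real (length E) \<le> X" using E X(1) by linarith
  ultimately show ?thesis using b unfolding msr_def by simp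
qed

end

section \<open>Perturbed costs and the polynomial time bound\<close>

lemma card_fam:
  assumes "is_instance I"
  shows "finite (fam I)" "card (fam I) \<le> card (verts (gr I)) ^ 2"
proof -
  have V: "finite (verts (gr I))" using is_instance_fin[OF assms] by (simp add: fin_digraph.finite_verts)
  \<comment> \<open>A tight set is nonempty, because no edge leaves the empty set.\<close>
  have s: "S \<subseteq> verts (gr I) \<and> S \<noteq> {}" if "S \<in> fam I" for S
    using assms that by (fastforce simp: is_instance_def cut_out_def)
  show "finite (fam I)" using V s by (auto intro: finite_subset[of "fam I" "Pow (verts (gr I))"])
  show "card (fam I) \<le> card (verts (gr I)) ^ 2"
    by (rule laminar_card[OF _ V s]) (use assms in \<open>simp add: is_instance_def\<close>)
qed

lemma lb_mono:
  assumes "is_instance I" "X \<subseteq> Y" "finite Y"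
  shows "0 \<le> lb I X" "lb I X \<le> lb I Y"
  unfolding lb_def using assms lb_vert_nonneg[OF assms(1)] by (auto intro!: sum_nonneg sum_mono2)

text \<open>The summands of \<open>N\<close> cover the remembered subtours (\<open>n ^ 3\<close>),
  the laminar family (\<open>n ^ 2\<close>), partitions (\<open>n\<close>), lists of edges
  (\<open>m\<close>), oracle calls (\<open>\<tau>\<close>) and the two ends of an edge.\<close>

lemma tour_computed:
  fixes Alg :: "('v,'e) alg"
  assumes I: "is_instance I" and B: "subtour (gr I) B" and \<alpha>: "0 \<le> \<alpha>"
    and Alg: "solves_spc Alg I B" "light Alg \<alpha> \<beta> I B" and \<epsilon>: "0 < \<epsilon>"
    and orc: "time_bounded Alg I B \<tau>" "implements orc Alg I B" and inp: "enc_input inp I B \<alpha> \<epsilon>"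
  defines "n \<equiv> card (verts (gr I))" and "m \<equiv> card (arcs (gr I))"
  defines "N \<equiv> n ^ 3 + n ^ 2 + n + m + \<tau> + 2" and "X \<equiv> real n + real m + 1 / \<epsilon> + real \<tau> + 1"
  shows "\<exists>out t F. runs prog orc inp out t \<and> enc_edges out F \<and> tour (gr I) F \<and>
    weight I F \<le> 9 * (1 + \<epsilon>) * \<alpha> * lb_compl I B + \<beta> + weight I B \<and>
    real t \<le> real (tb N init_setting.s_init) + 20 * X ^ 8 * (real (tb N run_setting.s_step) + 7) + 3"
proof -
  let ?V = "verts (gr I)" and ?VB = "mverts (gr I) B" and ?c = "cost I B \<epsilon>" and ?Lb = "lb_compl I B"
  interpret fin_digraph "gr I" by (rule is_instance_fin[OF I])
  have Bne: "B \<noteq> {#}" by (rule subtour_nonempty[OF I Alg(1)])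
  have Bsub: "set_mset B \<subseteq> arcs (gr I)" using B by (simp add: subtour_def eulerian_def)
  have VBs: "?VB \<subseteq> ?V" using Bsub by (auto simp: mverts_def)
  have VBne: "?VB \<noteq> {}" using Bne by (simp add: mverts_def)
  have n0: "0 < n" unfolding n_def using VBs VBne finite_verts by (auto simp: card_gt_0_iff)
  have Lb: "0 \<le> ?Lb" unfolding lb_compl_def by (rule lb_mono(1)[OF I order_refl]) simp
  have sh: "0 \<le> shift I B \<epsilon>" unfolding shift_def using Lb \<epsilon> by simp
  have c0: "0 \<le> ?c v" for v using lb_vert_nonneg[OF I, of v] sh by (simp add: cost_def)
  \<comment> \<open>If \<open>lb_compl\<close> vanishes, \<open>\<alpha> * lb\<close> is at most 0
    on every set outside \<open>V(B)\<close>. Unit costs with factor 0 then satisfy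
    \<open>lb_le\<close>, still have a positive minimum, and add nothing to the bound on the
    tour.\<close>
  define \<alpha>2 where "\<alpha>2 = (if ?Lb \<le> 0 then 0 else \<alpha>)"
  define \<delta> where "\<delta> = (if ?Lb \<le> 0 then 1 else shift I B \<epsilon>)"
  have X1: "1 \<le> X" "real n \<le> X" "1 / \<epsilon> \<le> X" unfolding X_def using \<epsilon> by simp_all
  have sV: "sum ?c ?V = sum ?c (?V - ?VB)"
    by (rule sum.mono_neutral_right) (auto simp: cost_def)
  have nX: "real n \<le> X\<^sup>2"
  proof -
    have "real n * 1 \<le> X * X" using X1 by (intro mult_mono) auto
    then show ?thesis by (simp add: power2_eq_square)
  qed
  have cd: "real (card (?V - ?VB)) \<le> real n" unfolding n_def by (simp add: card_mono)
  have S: "sum ?c ?V \<le> 2 * X\<^sup>2 * \<delta>" and wb: "9 * \<alpha>2 * sum ?c ?V \<le> 9 * (1 + \<epsilon>) * \<alpha> * ?Lb"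
  proof -
    consider "?Lb = 0" | "0 < ?Lb" using Lb by linarith
    then have "sum ?c ?V \<le> 2 * X\<^sup>2 * \<delta> \<and> 9 * \<alpha>2 * sum ?c ?V \<le> 9 * (1 + \<epsilon>) * \<alpha> * ?Lb"
    proof cases
      case 1
      have "sum ?c (?V - ?VB) = (\<Sum>v\<in>?V - ?VB. 1)" using 1 by (intro sum.cong) (auto simp: cost_def)
      then have "sum ?c ?V \<le> real n" using sV cd by simp
      then show ?thesis using 1 nX by (simp add: \<delta>_def \<alpha>2_def)
    next
      case 2
      have "sum ?c (?V - ?VB) = (\<Sum>v\<in>?V - ?VB. lb_vert I v + shift I B \<epsilon>)"
        using 2 by (intro sum.cong) (auto simp: cost_def)
      also have "\<dots> = ?Lb + real (card (?V - ?VB)) * shift I B \<epsilon>"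
        by (simp add: sum.distrib lb_compl_def lb_def)
      also have "\<dots> \<le> ?Lb + real n * shift I B \<epsilon>" using cd sh by (simp add: mult_right_mono)
      finally have le: "sum ?c ?V \<le> ?Lb + real n * shift I B \<epsilon>" using sV by simp
      have e: "real n * shift I B \<epsilon> = \<epsilon> * ?Lb" unfolding shift_def n_def[symmetric] using n0 by simp
      \<comment> \<open>Both \<open>n\<close> and \<open>1 / \<epsilon>\<close> are at most
        \<open>X\<close>; here the number of improvements comes to depend on
        \<open>1 / \<epsilon>\<close>.\<close>
      have "?Lb = real n * (1 / \<epsilon>) * shift I B \<epsilon>"
        unfolding shift_def n_def[symmetric] using n0 \<epsilon> by simp
      moreover have "real n * (1 / \<epsilon>) * shift I B \<epsilon> \<le> X\<^sup>2 * shift I B \<epsilon>"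
        unfolding power2_eq_square using X1 \<epsilon> sh by (intro mult_right_mono mult_mono) auto
      ultimately have "sum ?c ?V \<le> X\<^sup>2 * shift I B \<epsilon> + X\<^sup>2 * shift I B \<epsilon>"
        using le mult_right_mono[OF nX sh] by linarith
      then have S: "sum ?c ?V \<le> 2 * X\<^sup>2 * \<delta>" using 2 by (simp add: \<delta>_def mult.commute)
      have "9 * \<alpha> * sum ?c ?V \<le> 9 * \<alpha> * ((1 + \<epsilon>) * ?Lb)"
        using le e \<alpha> by (intro mult_left_mono) (auto simp: algebra_simps)
      then show ?thesis using S 2 by (simp add: \<alpha>2_def mult.commute mult.left_commute)
    qed
    then show "sum ?c ?V \<le> 2 * X\<^sup>2 * \<delta>" "9 * \<alpha>2 * sum ?c ?V \<le> 9 * (1 + \<epsilon>) * \<alpha> * ?Lb" by blast+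
  qed
  obtain dV dA dL dB where d: "inp = list_data [Node dV dA, dL, dB, Num \<alpha>, Num \<epsilon>]" "enc_vset dV ?V" "okA (gr I) dA"
    "enc_fam dL I" "enc_edges dB B"
    using inp unfolding enc_input_def enc_graph_def okA_def by blast
  have Nb: "n \<le> N" "m \<le> N" "2 \<le> N" "n ^ 3 \<le> N" "n ^ 2 \<le> N" "\<tau> \<le> N" by (simp_all add: N_def)
  interpret init_setting I B \<epsilon> N orc dA dV dL dB "Num \<alpha>"
  proof
    show "card (fam I) \<le> N" using card_fam(2)[OF I] Nb(5) unfolding n_def by (rule order_trans)
  qed (use d(2-5) Nb card_fam(1)[OF I] Bsub VBs in \<open>simp_all add: n_def m_def\<close>)
  obtain Vs Bd H us where i:
    "den orc s_init [inp] = Node (Node Vs (Node dA Bd)) (Node H (Node Leaf (Node Bd H)))"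
    "okX Vs" "vX Vs = ?V" "okP Bd" "dec Bd = Piece ?VB B (sum ?c ?V + 1) False"
    "distinct us" "set us = ?V - ?VB" "okL H" "decL H = singles ?c us" "bnd orc N s_init [inp]"
    using s_init[where thesis = thesis] unfolding d(1) by blast
  have lt: "light_setting I B ?c \<alpha>2 \<beta> 3 3 3 Alg \<alpha>"
  proof
    show "0 \<le> weight_edge I e" for e by (rule weight_edge_nonneg[OF I])
    show "\<alpha> * lb I Y \<le> \<alpha>2 * sum ?c Y" if Y: "Y \<subseteq> ?V - ?VB" for Y
    proof (cases "?Lb \<le> 0")
      case True
      have "lb I Y \<le> 0" using lb_mono(2)[OF I Y] True by (simp add: lb_compl_def)
      then show ?thesis using \<alpha> True by (simp add: \<alpha>2_def mult_nonneg_nonpos)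
    next
      case False
      have "lb I Y \<le> sum ?c Y" unfolding lb_def
      proof (rule sum_mono)
        fix v assume "v \<in> Y"
        then show "lb_vert I v \<le> ?c v" using Y False sh by (auto simp: cost_def)
      qed
      then show ?thesis using \<alpha> False by (simp add: \<alpha>2_def mult_left_mono)
    qed
  qed (use I B Bne c0 \<alpha> Alg fin_digraph_axioms in \<open>auto simp: cost_def \<alpha>2_def\<close>)
  interpret L: light_setting I B ?c \<alpha>2 \<beta> 3 3 3 Alg \<alpha> by (rule lt)
  interpret R: run_setting I B ?c \<alpha>2 \<beta> Alg \<alpha> N orc dA Vs Bd \<delta>
  proof
    show "card ?V ^ 3 \<le> N" using Nb(4) by (simp add: n_def)
    show "0 < \<delta>" using \<epsilon> n0 by (simp add: \<delta>_def shift_def n_def)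
    show "\<delta> \<le> ?c v" if "v \<in> ?V - ?VB" for v
      using that lb_vert_nonneg[OF I, of v] by (simp add: \<delta>_def cost_def)
    show "implements orc Alg I B" by (rule orc(2))
    show "time_bounded Alg I B N" using orc(1) Nb(6) by (auto simp: time_bounded_def intro: order_trans)
    show "dec Bd = L.Bp" unfolding i(5) L.Bp_def L.big_def by simp
  qed (use i(2-4) in auto)
  have Hi: "L.Hinv (decL H)" unfolding i(9) by (rule R.Hinv_singles[OF i(6,7)])
  note bp = R.Bp_H[OF i(8) Hi]
  have st: "R.st_ok H Leaf (Node Bd H)"
    unfolding R.st_ok_def using i(8) Hi bp by (simp add: okL_def[of Leaf])
  let ?k = "R.msr (decL H) (decL Leaf) (decL (Node Bd H)) + 1"
  have k: "real ?k \<le> 20 * X ^ 8"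
    by (rule R.msr_init[OF Hi bp(3)]) (use X1 S in \<open>simp_all add: n_def\<close>)
  obtain out t F where r: "eval prog orc [den orc s_init [inp]] (prog ! 1) out t" "enc_edges out F" "tour (gr I) F"
    "weight I F \<le> 9 * \<alpha>2 * sum ?c ?V + \<beta> + weight I B" "t \<le> ?k * (tb N R.s_step + 7)"
    using R.loop_run[OF st, of ?k] unfolding i(1) by auto
  obtain t0 where t0: "t0 \<le> tb N s_init" "eval prog orc [inp] (fst init_code) (den orc s_init [inp]) t0"
    using compile_correct[OF prod.collapse[symmetric] prog_code(2), of "[inp]" orc N "[]"] i(10) by auto
  have p: "1 < length prog" "0 < length prog" using prog_nth(1) by linarith+
  have "eval prog orc [inp] (prog ! 0) out (t0 + t + 1)"
    unfolding prog_nth(2) by (rule eval.Call[OF t0(2) p(1) r(1)])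
  from eval.Call[OF _ p(2) this, of "[inp]" "Arg 0" 1] eval.Arg[of 0 "[inp]" prog orc]
  have run: "runs prog orc inp out (1 + (t0 + t + 1) + 1)" unfolding runs_def by simp
  have "real t \<le> real ?k * real (tb N R.s_step + 7)" using r(5) by (metis of_nat_mono of_nat_mult)
  also have "\<dots> \<le> 20 * X ^ 8 * real (tb N R.s_step + 7)" using k by (intro mult_right_mono) auto
  finally have "real (1 + (t0 + t + 1) + 1) \<le> real (tb N s_init) + 20 * X ^ 8 * (real (tb N R.s_step) + 7) + 3"
    using t0(1) by simp
  then show ?thesis using run r(2-4) wb by (intro exI[of _ out] exI[of _ "1 + (t0 + t + 1) + 1"] exI[of _ F]) auto
qed

lemma tour_computed_poly:
  "\<exists>c k. \<forall>(Alg :: ('v,'e) alg) I B \<alpha> \<beta> \<epsilon> \<tau> orc inp.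
     is_instance I \<and> subtour (gr I) B \<and> 0 \<le> \<alpha> \<and> solves_spc Alg I B \<and> light Alg \<alpha> \<beta> I B \<and> 0 < \<epsilon> \<and>
     time_bounded Alg I B \<tau> \<and> implements orc Alg I B \<and> enc_input inp I B \<alpha> \<epsilon> \<longrightarrow>
     (\<exists>out t F. runs prog orc inp out t \<and> enc_edges out F \<and> tour (gr I) F \<and>
        weight I F \<le> 9 * (1 + \<epsilon>) * \<alpha> * lb_compl I B + \<beta> + weight I B \<and>
        real t \<le> real c * (real (card (verts (gr I))) + real (card (arcs (gr I))) + 1 / \<epsilon> + real \<tau> + 1) ^ k)"
proof -
  obtain C1 k1 where 1: "\<And>N. tb N init_setting.s_init \<le> C1 * (N + 1) ^ k1" using tb_poly by blast
  obtain C2 k2 where 2: "\<And>N. tb N run_setting.s_step \<le> C2 * (N + 1) ^ k2" using tb_poly by blast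
  let ?k = "3 * k1 + 3 * k2 + 8" let ?C = "C1 * 5 ^ k1 + 20 * (C2 * 5 ^ k2 + 7) + 3"
  have bound: "real (tb N init_setting.s_init) + 20 * X ^ 8 * (real (tb N run_setting.s_step) + 7) + 3 \<le> real ?C * X ^ ?k"
    if N: "real N + 1 \<le> 5 * X ^ 3" and X: "1 \<le> X" for N :: nat and X :: real
  proof -
    have pw: "real (C * (N + 1) ^ k) \<le> real (C * 5 ^ k) * X ^ (3 * k)" for C k
    proof -
      have "(real N + 1) ^ k \<le> (5 * X ^ 3) ^ k" using N by (intro power_mono) auto
      then have "real C * (real N + 1) ^ k \<le> real C * (5 * X ^ 3) ^ k" by (intro mult_left_mono) auto
      then show ?thesis by (simp add: power_mult_distrib power_mult add.commute)
    qed
    have up: "X ^ i \<le> X ^ ?k" if "i \<le> ?k" for i using X that by (intro power_increasing) auto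
    have a: "real (tb N init_setting.s_init) \<le> real (C1 * 5 ^ k1) * X ^ ?k"
    proof -
      have "real (tb N init_setting.s_init) \<le> real (C1 * 5 ^ k1) * X ^ (3 * k1)"
        using pw[of C1 k1] of_nat_mono[OF 1[of N], where 'a = real] by linarith
      also have "\<dots> \<le> real (C1 * 5 ^ k1) * X ^ ?k" by (intro mult_left_mono up) auto
      finally show ?thesis .
    qed
    have "real (tb N run_setting.s_step) + 7 \<le> real (C2 * 5 ^ k2 + 7) * X ^ (3 * k2)"
    proof -
      have "1 \<le> X ^ (3 * k2)" using X by (rule one_le_power)
      moreover have "real (tb N run_setting.s_step) \<le> real (C2 * 5 ^ k2) * X ^ (3 * k2)"
        using pw[of C2 k2] of_nat_mono[OF 2[of N], where 'a = real] by linarith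
      ultimately show ?thesis by (simp add: algebra_simps)
    qed
    then have "20 * X ^ 8 * (real (tb N run_setting.s_step) + 7) \<le> 20 * X ^ 8 * (real (C2 * 5 ^ k2 + 7) * X ^ (3 * k2))"
      using X by (intro mult_left_mono) auto
    also have "\<dots> = real (20 * (C2 * 5 ^ k2 + 7)) * X ^ (3 * k2 + 8)" by (simp add: power_add algebra_simps)
    also have "\<dots> \<le> real (20 * (C2 * 5 ^ k2 + 7)) * X ^ ?k" by (intro mult_left_mono up) auto
    finally have b: "20 * X ^ 8 * (real (tb N run_setting.s_step) + 7) \<le> real (20 * (C2 * 5 ^ k2 + 7)) * X ^ ?k" .
    have "1 \<le> X ^ ?k" using X by (rule one_le_power)
    then have "3 \<le> 3 * X ^ ?k" by simp
    with a b show ?thesis unfolding of_nat_add[of "_ + _" 3] of_nat_add[of "C1 * 5 ^ k1"] distrib_right by simp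
  qed
  show ?thesis
  proof (rule exI[of _ ?C], rule exI[of _ ?k], intro allI impI, elim conjE)
    fix Alg :: "('v,'e) alg" and I B \<alpha> \<beta> \<epsilon> \<tau> orc inp
    assume h: "is_instance I" "subtour (gr I) B" "0 \<le> \<alpha>" "solves_spc Alg I B" "light Alg \<alpha> \<beta> I B" "0 < \<epsilon>"
      "time_bounded Alg I B \<tau>" "implements orc Alg I B" "enc_input inp I B \<alpha> \<epsilon>"
    let ?n = "card (verts (gr I))" and ?m = "card (arcs (gr I))"
    let ?N = "?n ^ 3 + ?n ^ 2 + ?n + ?m + \<tau> + 2" and ?X = "real ?n + real ?m + 1 / \<epsilon> + real \<tau> + 1"
    have X: "1 \<le> ?X" "real ?n \<le> ?X" using h(6) by simp_all
    have "real ?n ^ 3 \<le> ?X ^ 3" "real ?n ^ 2 \<le> ?X ^ 2" using X(2) by (intro power_mono; simp)+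
    moreover have "?X ^ 2 \<le> ?X ^ 3" "?X ^ 1 \<le> ?X ^ 3" "?X ^ 0 \<le> ?X ^ 3" using X(1) by (intro power_increasing; simp)+
    moreover have "real ?n + real ?m + real \<tau> + 1 \<le> ?X" using h(6) by simp
    \<comment> \<open>Five multiples of \<open>?X ^ 3\<close>: one each for the cube, the square,
      and the linear terms together with 1, and two for the remaining constant 2.\<close>
    moreover have "real ?N + 1 = real ?n ^ 3 + real ?n ^ 2 + real ?n + real ?m + real \<tau> + 3" by simp
    ultimately have N: "real ?N + 1 \<le> 5 * ?X ^ 3" unfolding power_one_right power_0 by linarith
    from tour_computed[OF h] bound[OF N X(1)]
    show "\<exists>out t F. runs prog orc inp out t \<and> enc_edges out F \<and> tour (gr I) F \<and>
        weight I F \<le> 9 * (1 + \<epsilon>) * \<alpha> * lb_compl I B + \<beta> + weight I B \<and> real t \<le> real ?C * ?X ^ ?k"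
      by (meson order_trans)
  qed
qed

lemma card_arcs_nomulti:
  assumes "nomulti_digraph G" "finite (verts G)"
  shows "card (arcs G) \<le> card (verts G) ^ 2"
proof -
  interpret nomulti_digraph G by (rule assms(1))
  have "card (arcs G) \<le> card (verts G \<times> verts G)"
    using inj_on_arc_to_ends assms(2) by (intro card_inj_on_le[of "arc_to_ends G"]) (auto simp: arc_to_ends_def)
  then show ?thesis by (simp add: card_cartesian_product power2_eq_square)
qed

text \<open>With parallel edges the number of edges is not bounded in terms of the number of
  vertices, so the general time bound counts both; the last clause gives the bound in the number of
  vertices for digraphs without parallel edges.\<close>

theorem mainTheorem6:
  shows "(\<forall>(A :: ('v,'e) alg) I B \<alpha> \<beta>.
            is_instance I \<and> subtour (gr I) B \<and> 0 \<le> \<alpha> \<and>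
            solves_spc A I B \<and> light A \<alpha> \<beta> I B \<longrightarrow>
            (\<exists>F. tour (gr I) F \<and>
                 weight I F \<le> 5 * \<alpha> * lb_compl I B + \<beta> + weight I B)) \<and>
         (\<exists>(P :: expr list) (c :: nat) (k :: nat).
            \<forall>(A :: ('v,'e) alg) I B \<alpha> \<beta> \<epsilon> \<tau> orc inp.
              is_instance I \<and> subtour (gr I) B \<and> 0 \<le> \<alpha> \<and>
              solves_spc A I B \<and> light A \<alpha> \<beta> I B \<and> 0 < \<epsilon> \<and>
              time_bounded A I B \<tau> \<and> implements orc A I B \<and> enc_input inp I B \<alpha> \<epsilon> \<longrightarrow>
              (\<exists>out t F.
                 runs P orc inp out t \<and> enc_edges out F \<and> tour (gr I) F \<and>
                 weight I F \<le> 9 * (1 + \<epsilon>) * \<alpha> * lb_compl I B + \<beta> + weight I B \<and>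
                 real t \<le> real c * (real (card (verts (gr I))) + real (card (arcs (gr I)))
                                     + 1 / \<epsilon> + real \<tau> + 1) ^ k \<and>
                 (nomulti_digraph (gr I) \<longrightarrow>
                    real t \<le> real c * (real (card (verts (gr I)))
                                       + 1 / \<epsilon> + real \<tau> + 1) ^ k)))"
proof (rule conjI)
  show "\<forall>(A :: ('v,'e) alg) I B \<alpha> \<beta>.
      is_instance I \<and> subtour (gr I) B \<and> 0 \<le> \<alpha> \<and> solves_spc A I B \<and> light A \<alpha> \<beta> I B \<longrightarrow>
      (\<exists>F. tour (gr I) F \<and> weight I F \<le> 5 * \<alpha> * lb_compl I B + \<beta> + weight I B)"
    using tour_existence by blast
next
  obtain c k where P: "\<And>(A :: ('v,'e) alg) I B \<alpha> \<beta> \<epsilon> \<tau> orc inp.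
     is_instance I \<and> subtour (gr I) B \<and> 0 \<le> \<alpha> \<and> solves_spc A I B \<and> light A \<alpha> \<beta> I B \<and> 0 < \<epsilon> \<and>
     time_bounded A I B \<tau> \<and> implements orc A I B \<and> enc_input inp I B \<alpha> \<epsilon> \<Longrightarrow>
     (\<exists>out t F. runs prog orc inp out t \<and> enc_edges out F \<and> tour (gr I) F \<and>
        weight I F \<le> 9 * (1 + \<epsilon>) * \<alpha> * lb_compl I B + \<beta> + weight I B \<and>
        real t \<le> real c * (real (card (verts (gr I))) + real (card (arcs (gr I))) + 1 / \<epsilon> + real \<tau> + 1) ^ k)"
    using tour_computed_poly by blast
  show "\<exists>(P :: expr list) (c :: nat) (k :: nat). \<forall>(A :: ('v,'e) alg) I B \<alpha> \<beta> \<epsilon> \<tau> orc inp.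
      is_instance I \<and> subtour (gr I) B \<and> 0 \<le> \<alpha> \<and> solves_spc A I B \<and> light A \<alpha> \<beta> I B \<and> 0 < \<epsilon> \<and>
      time_bounded A I B \<tau> \<and> implements orc A I B \<and> enc_input inp I B \<alpha> \<epsilon> \<longrightarrow>
      (\<exists>out t F. runs P orc inp out t \<and> enc_edges out F \<and> tour (gr I) F \<and>
         weight I F \<le> 9 * (1 + \<epsilon>) * \<alpha> * lb_compl I B + \<beta> + weight I B \<and>
         real t \<le> real c * (real (card (verts (gr I))) + real (card (arcs (gr I))) + 1 / \<epsilon> + real \<tau> + 1) ^ k \<and>
         (nomulti_digraph (gr I) \<longrightarrow> real t \<le> real c * (real (card (verts (gr I))) + 1 / \<epsilon> + real \<tau> + 1) ^ k))"
  \<comment> \<open>One pair of constants serves both time bounds. In either case \<open>?X\<close>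
    is at most twice a square, which turns \<open>?X ^ k\<close> into the factor
    \<open>2 ^ k\<close> and the exponent \<open>2 * k\<close>.\<close>
  proof (rule exI[of _ prog], rule exI[of _ "c * 2 ^ k"], rule exI[of _ "2 * k"], intro allI impI)
    fix A :: "('v,'e) alg" and I B \<alpha> \<beta> \<epsilon> \<tau> orc inp
    assume h: "is_instance I \<and> subtour (gr I) B \<and> 0 \<le> \<alpha> \<and> solves_spc A I B \<and> light A \<alpha> \<beta> I B \<and> 0 < \<epsilon> \<and>
      time_bounded A I B \<tau> \<and> implements orc A I B \<and> enc_input inp I B \<alpha> \<epsilon>"
    let ?n = "real (card (verts (gr I)))" and ?m = "real (card (arcs (gr I)))"
    let ?X = "?n + ?m + 1 / \<epsilon> + real \<tau> + 1" and ?Y = "?n + 1 / \<epsilon> + real \<tau> + 1"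
    obtain out t F where r: "runs prog orc inp out t" "enc_edges out F" "tour (gr I) F"
      "weight I F \<le> 9 * (1 + \<epsilon>) * \<alpha> * lb_compl I B + \<beta> + weight I B" "real t \<le> real c * ?X ^ k"
      using P[OF h] by blast
    have XY: "1 \<le> ?X" "1 \<le> ?Y" using h by simp_all
    \<comment> \<open>Applied with \<open>Z = ?X\<close> for the general bound, and with
      \<open>Z = ?Y\<close> without parallel edges, where the number of edges is at most
      \<open>?n ^ 2\<close>.\<close>
    have grow: "real t \<le> real (c * 2 ^ k) * Z ^ (2 * k)" if "?X \<le> 2 * Z ^ 2" for Z
    proof -
      have "?X ^ k \<le> (2 * Z ^ 2) ^ k" using that XY(1) by (intro power_mono) auto
      also have "(2 * Z ^ 2) ^ k = 2 ^ k * Z ^ (2 * k)" by (simp add: power_mult_distrib power_mult)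
      finally have "real c * ?X ^ k \<le> real c * (2 ^ k * Z ^ (2 * k))" by (intro mult_left_mono) auto
      then show ?thesis using r(5) by (simp add: mult.assoc)
    qed
    have "?X ^ 1 \<le> ?X ^ 2" using XY(1) by (intro power_increasing) auto
    then have a: "real t \<le> real (c * 2 ^ k) * ?X ^ (2 * k)" using XY(1) by (intro grow) simp
    have b: "real t \<le> real (c * 2 ^ k) * ?Y ^ (2 * k)" if "nomulti_digraph (gr I)"
    proof (rule grow)
      have "finite (verts (gr I))" using h is_instance_fin fin_digraph.finite_verts by blast
      then have "?m \<le> ?n ^ 2" using card_arcs_nomulti[OF that] by (metis of_nat_mono of_nat_power)
      also have "\<dots> \<le> ?Y ^ 2" using h by (intro power_mono) auto
      finally have m: "?m \<le> ?Y ^ 2" .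
      have "?Y ^ 1 \<le> ?Y ^ 2" using XY(2) by (intro power_increasing) auto
      then show "?X \<le> 2 * ?Y ^ 2" using m by simp
    qed
    show "\<exists>out t F. runs prog orc inp out t \<and> enc_edges out F \<and> tour (gr I) F \<and>
        weight I F \<le> 9 * (1 + \<epsilon>) * \<alpha> * lb_compl I B + \<beta> + weight I B \<and>
        real t \<le> real (c * 2 ^ k) * ?X ^ (2 * k) \<and>
        (nomulti_digraph (gr I) \<longrightarrow> real t \<le> real (c * 2 ^ k) * ?Y ^ (2 * k))"
      using r(1-4) a b by blast
  qed
qed


end
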